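(* Let $\xi$ be a space-time white noise on $(0,\infty)\times\mathbb{R}$, let $\sigma:\mathbb{R}\to\mathbb{R}$ be a nonrandom Lipschitz continuous function, and let $u$ be the (unique, continuous) mild solution of the stochastic wave equation $\partial^2_{tt}u=\partial^2_{xx}u+\sigma(u)\xi$, in the sense described in the context. Fix $t>0$ and $x\in\mathbb{R}$. Then \[ \frac{u(t+\varepsilon,x)-u(t,x)}{\sqrt{\varepsilon}}\xrightarrow{d}\int_{x-t}^{x+t}\sigma(u(t-|x-y|,y))\,W(\mathrm{d}y)\qquad\text{as }\varepsilon\downarrow0, \] where $W$ is a standard two-sided Brownian motion independent of $\mathcal{G}_{t,x}$. Moreover, \[ \limsup_{\varepsilon\downarrow0}\frac{u(t+\varepsilon,x)-u(t,x)}{\sqrt{2\varepsilon\log\log(1/\varepsilon)}}=\sqrt{\int_{x-t}^{x+t}\left[\sigma(u(t-|x-y|,y))\right]^2\mathrm{d}y}\qquad\text{a.s.} \]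
   Context: For $(t,x)\in\mathbb{R}_+\times\mathbb{R}$ let $Q(x,t):=\{(s,y): 0\le s\le t,\ |y-x|\le t-s\}$ denote the backward light cone. A mild solution means: $u$ is predictable with respect to the Brownian filtration generated by the Wiener integrals $\int_{[0,t]\times\mathbb{R}}\phi\,\mathrm{d}\xi$, $\phi\in L^2(\mathbb{R}_+\times\mathbb{R})$, and for every $t\ge0$, $x\in\mathbb{R}$, $u(t,x)=1+\int_{Q(x,t)}\sigma(u(s,y))\,\xi(\mathrm{d}s\,\mathrm{d}y)$ a.s. (Walsh integral). Let $\mathcal{G}^0_{t,x}$ be the $\mathbb{P}$-completion of the $\sigma$-algebra generated by all Wiener integrals $\int\phi\,\mathrm{d}\xi$ with $\phi$ smooth and supported in $Q(x,t)$, and $\mathcal{G}_{t,x}:=\bigcap_{s>t}\mathcal{G}^0_{s,x}$. *)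

theory Defs
  imports "HOL-Probability.Probability"
begin

definition L2_st :: "(real \<times> real \<Rightarrow> real) \<Rightarrow> bool" where
  "L2_st \<phi> \<longleftrightarrow> \<phi> \<in> borel_measurable lborel \<and> integrable lborel (\<lambda>p. (\<phi> p)^2)
     \<and> (\<forall>s y. s < 0 \<longrightarrow> \<phi> (s, y) = 0)"

definition L2_norm_sq :: "(real \<times> real \<Rightarrow> real) \<Rightarrow> real" where
  "L2_norm_sq \<phi> = (\<integral>p. (\<phi> p)^2 \<partial>lborel)"

text \<open>Space-time white noise as an isonormal Gaussian process on L2(R+ x R):
  xi(phi) is centred Gaussian with variance the squared L2 norm, and xi is a.s. linear.\<close>
definition centred_normal :: "'a measure \<Rightarrow> ('a \<Rightarrow> real) \<Rightarrow> real \<Rightarrow> bool" where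
  "centred_normal M X v \<longleftrightarrow> X \<in> borel_measurable M \<and>
     (if v = 0 then (AE \<omega> in M. X \<omega> = 0)
      else distributed M lborel X (normal_density 0 (sqrt v)))"

definition white_noise :: "'a measure \<Rightarrow> ((real \<times> real \<Rightarrow> real) \<Rightarrow> 'a \<Rightarrow> real) \<Rightarrow> bool" where
  "white_noise M \<xi> \<longleftrightarrow> prob_space M \<and>
     (\<forall>\<phi>. L2_st \<phi> \<longrightarrow> centred_normal M (\<xi> \<phi>) (L2_norm_sq \<phi>)) \<and>
     (\<forall>\<phi> \<psi> a b. L2_st \<phi> \<longrightarrow> L2_st \<psi> \<longrightarrow>
        (AE \<omega> in M. \<xi> (\<lambda>p. a * \<phi> p + b * \<psi> p) \<omega> = a * \<xi> \<phi> \<omega> + b * \<xi> \<psi> \<omega>))"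

definition wn_filtration :: "'a measure \<Rightarrow> ((real \<times> real \<Rightarrow> real) \<Rightarrow> 'a \<Rightarrow> real) \<Rightarrow> real \<Rightarrow> 'a set set" where
  "wn_filtration M \<xi> t = sigma_sets (space M)
     ({\<xi> \<phi> -` B \<inter> space M | \<phi> B. L2_st \<phi> \<and> (\<forall>s y. s > t \<longrightarrow> \<phi> (s, y) = 0) \<and> B \<in> sets borel}
      \<union> null_sets M)"

definition predictable_measure :: "'a measure \<Rightarrow> ((real \<times> real \<Rightarrow> real) \<Rightarrow> 'a \<Rightarrow> real) \<Rightarrow> ((real \<times> real) \<times> 'a) measure" where
  "predictable_measure M \<xi> = sigma (({0..} \<times> UNIV) \<times> space M)
     ({({a<..b} \<times> A) \<times> F | a b A F. 0 \<le> a \<and> A \<in> sets lborel \<and> F \<in> wn_filtration M \<xi> a}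
      \<union> {({0} \<times> A) \<times> F | A F. A \<in> sets lborel \<and> F \<in> wn_filtration M \<xi> 0})"

definition predictable :: "'a measure \<Rightarrow> ((real \<times> real \<Rightarrow> real) \<Rightarrow> 'a \<Rightarrow> real) \<Rightarrow> (real \<Rightarrow> real \<Rightarrow> 'a \<Rightarrow> real) \<Rightarrow> bool" where
  "predictable M \<xi> u \<longleftrightarrow> (\<lambda>(p, \<omega>). u (fst p) (snd p) \<omega>) \<in> borel_measurable (predictable_measure M \<xi>)"

text \<open>Elementary predictable processes: finite lists of (c, a, b, A, F) standing for
  sum c * 1_{(a,b] x A}(s,y) * 1_F(\<omega>), with F in F_a and A of finite Lebesgue measure.\<close>
definition elementary :: "'a measure \<Rightarrow> ((real \<times> real \<Rightarrow> real) \<Rightarrow> 'a \<Rightarrow> real)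
    \<Rightarrow> (real \<times> real \<times> real \<times> real set \<times> 'a set) list \<Rightarrow> bool" where
  "elementary M \<xi> es \<longleftrightarrow> (\<forall>(c, a, b, A, F) \<in> set es. 0 \<le> a \<and> a \<le> b \<and> A \<in> sets lborel
      \<and> emeasure lborel A < \<infinity> \<and> F \<in> wn_filtration M \<xi> a)"

definition elem_process :: "(real \<times> real \<times> real \<times> real set \<times> 'a set) list \<Rightarrow> real \<times> real \<Rightarrow> 'a \<Rightarrow> real" where
  "elem_process es p \<omega> = (\<Sum>(c, a, b, A, F) \<leftarrow> es.
      c * indicator ({a<..b} \<times> A) p * indicator F \<omega>)"

definition elem_integral :: "((real \<times> real \<Rightarrow> real) \<Rightarrow> 'a \<Rightarrow> real)
    \<Rightarrow> (real \<times> real \<times> real \<times> real set \<times> 'a set) list \<Rightarrow> 'a \<Rightarrow> real" where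
  "elem_integral \<xi> es \<omega> = (\<Sum>(c, a, b, A, F) \<leftarrow> es.
      c * indicator F \<omega> * \<xi> (indicator ({a<..b} \<times> A)) \<omega>)"

definition walsh_integral :: "'a measure \<Rightarrow> ((real \<times> real \<Rightarrow> real) \<Rightarrow> 'a \<Rightarrow> real)
    \<Rightarrow> (real \<times> real \<Rightarrow> 'a \<Rightarrow> real) \<Rightarrow> ('a \<Rightarrow> real) \<Rightarrow> bool" where
  "walsh_integral M \<xi> X I \<longleftrightarrow> I \<in> borel_measurable M \<and>
     (\<exists>es :: nat \<Rightarrow> (real \<times> real \<times> real \<times> real set \<times> 'a set) list.
        (\<forall>n. elementary M \<xi> (es n)) \<and>
        ((\<lambda>n. \<integral>\<^sup>+\<omega>. (\<integral>\<^sup>+p. ennreal ((elem_process (es n) p \<omega> - X p \<omega>)^2) \<partial>lborel) \<partial>M) \<longlonglongrightarrow> 0) \<and>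
        ((\<lambda>n. \<integral>\<^sup>+\<omega>. ennreal ((elem_integral \<xi> (es n) \<omega> - I \<omega>)^2) \<partial>M) \<longlonglongrightarrow> 0))"

definition light_cone :: "real \<Rightarrow> real \<Rightarrow> (real \<times> real) set" where
  "light_cone x t = {(s, y). 0 \<le> s \<and> s \<le> t \<and> \<bar>y - x\<bar> \<le> t - s}"

definition mild_solution :: "'a measure \<Rightarrow> ((real \<times> real \<Rightarrow> real) \<Rightarrow> 'a \<Rightarrow> real)
    \<Rightarrow> (real \<Rightarrow> real) \<Rightarrow> (real \<Rightarrow> real \<Rightarrow> 'a \<Rightarrow> real) \<Rightarrow> bool" where
  "mild_solution M \<xi> \<sigma> u \<longleftrightarrow> predictable M \<xi> u \<and>
     (\<forall>t x. 0 \<le> t \<longrightarrow> (\<exists>I. walsh_integral M \<xi>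
         (\<lambda>p \<omega>. indicator (light_cone x t) p * \<sigma> (u (fst p) (snd p) \<omega>)) I
       \<and> (AE \<omega> in M. u t x \<omega> = 1 + I \<omega>)))"

primrec dir_deriv :: "(real \<times> real) list \<Rightarrow> (real \<times> real \<Rightarrow> real) \<Rightarrow> real \<times> real \<Rightarrow> real" where
  "dir_deriv [] f = f"
| "dir_deriv (v # vs) f = (\<lambda>p. frechet_derivative (dir_deriv vs f) (at p) v)"

definition smooth_fun :: "(real \<times> real \<Rightarrow> real) \<Rightarrow> bool" where
  "smooth_fun f \<longleftrightarrow> (\<forall>vs p. dir_deriv vs f differentiable (at p))"

definition G0 :: "'a measure \<Rightarrow> ((real \<times> real \<Rightarrow> real) \<Rightarrow> 'a \<Rightarrow> real) \<Rightarrow> real \<Rightarrow> real \<Rightarrow> 'a set set" where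
  "G0 M \<xi> t x = sigma_sets (space M)
     ({\<xi> \<phi> -` B \<inter> space M | \<phi> B. smooth_fun \<phi> \<and> (\<forall>p. p \<notin> light_cone x t \<longrightarrow> \<phi> p = 0)
        \<and> B \<in> sets borel} \<union> null_sets M)"

definition G :: "'a measure \<Rightarrow> ((real \<times> real \<Rightarrow> real) \<Rightarrow> 'a \<Rightarrow> real) \<Rightarrow> real \<Rightarrow> real \<Rightarrow> 'a set set" where
  "G M \<xi> t x = (\<Inter>s\<in>{t<..}. G0 M \<xi> s x)"

definition two_sided_BM :: "'a measure \<Rightarrow> (real \<Rightarrow> 'a \<Rightarrow> real) \<Rightarrow> bool" where
  "two_sided_BM M W \<longleftrightarrow>
     (\<forall>y. W y \<in> borel_measurable M) \<and>
     (\<forall>\<omega>\<in>space M. W 0 \<omega> = 0 \<and> continuous_on UNIV (\<lambda>y. W y \<omega>)) \<and>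
     (\<forall>a b. a < b \<longrightarrow> distributed M lborel (\<lambda>\<omega>. W b \<omega> - W a \<omega>) (normal_density 0 (sqrt (b - a)))) \<and>
     (\<forall>ys :: real list. sorted ys \<longrightarrow> prob_space.indep_vars M (\<lambda>_. borel)
        (\<lambda>i \<omega>. W (ys ! Suc i) \<omega> - W (ys ! i) \<omega>) {..<length ys - 1})"

definition sigma_of_process :: "'a measure \<Rightarrow> (real \<Rightarrow> 'a \<Rightarrow> real) \<Rightarrow> 'a set set" where
  "sigma_of_process M W = sigma_sets (space M) {W y -` B \<inter> space M | y B. B \<in> sets borel}"

text \<open>Stochastic integral of a continuous integrand V (independent of W) against W over [a,b]:
  the limit in probability of left-point Riemann sums over uniform partitions.\<close>
definition riemann_sum :: "(real \<Rightarrow> 'a \<Rightarrow> real) \<Rightarrow> (real \<Rightarrow> 'a \<Rightarrow> real) \<Rightarrow> real \<Rightarrow> real \<Rightarrow> nat \<Rightarrow> 'a \<Rightarrow> real" where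
  "riemann_sum V W a b n \<omega> = (\<Sum>k<n. V (a + real k * (b - a) / real n) \<omega> *
      (W (a + real (Suc k) * (b - a) / real n) \<omega> - W (a + real k * (b - a) / real n) \<omega>))"

definition stoch_integral :: "'a measure \<Rightarrow> (real \<Rightarrow> 'a \<Rightarrow> real) \<Rightarrow> (real \<Rightarrow> 'a \<Rightarrow> real)
    \<Rightarrow> real \<Rightarrow> real \<Rightarrow> ('a \<Rightarrow> real) \<Rightarrow> bool" where
  "stoch_integral M V W a b Z \<longleftrightarrow> Z \<in> borel_measurable M \<and>
     (\<forall>e > 0. (\<lambda>n. measure M {\<omega> \<in> space M. \<bar>riemann_sum V W a b n \<omega> - Z \<omega>\<bar> > e}) \<longlonglongrightarrow> 0)"

end

theory Submission
  imports Defs "HOL-Computational_Algebra.Polynomial"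
begin

text \<open>
  The increment \<open>u(t + \<epsilon>, x) - u(t, x)\<close> is the integral of \<open>\<sigma>(u)\<close> against the noise in the
  thin strip between the cones at \<open>(t, x)\<close> and \<open>(t + \<epsilon>, x)\<close>. Split the strip into cells over short
  intervals of the space variable and replace \<open>\<sigma>(u)\<close> on each cell by its value at a point of the
  boundary of the cone at \<open>(t, x)\<close>; the error is of smaller order than \<open>\<surd>\<epsilon>\<close> in mean square.

  Finite speed of propagation (conditional expectation given the noise in a cone, together with a
  Gronwall iteration) shows that \<open>u\<close> in the cone at \<open>(t, x)\<close> is determined by the noise in this cone.
  The frozen sums are therefore Gaussian conditionally on that noise, with variance
  \<open>\<epsilon> \<Sum>\<^sub>j \<sigma>(u(t\<^sub>j, y\<^sub>j))\<^sup>2 \<Delta>y\<close>, a Riemann sum of the integral in the claim. The limit law follows by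
  characteristic functions. After normalisation the frozen sums have independent centred Gaussian
  increments in \<open>\<epsilon>\<close>, so the law of the iterated logarithm follows along \<open>\<epsilon>\<^sub>k = w\<^sup>4\<^sup>k\<close> from
  maximal inequalities of Levy and Kolmogorov type and the Borel--Cantelli argument.
\<close>

section \<open>White noise\<close>

text \<open>The points \<open>(t - \<bar>x - y\<bar>, y)\<close> at which the integrand is frozen
  lie at different times, and cells over different \<open>y\<close> overlap in time. The time
  filtration thus offers no moment at which all frozen values are known and no cell has begun. The
  obstacle is that the Walsh integral is built from integrands adapted in time, whose coefficients
  may see noise far outside the cone. Cone measurability of \<open>u\<close> comes from projecting
  these coefficients on the noise in the cone; the projection stays adapted because the noise after
  time \<open>a\<close> is independent of all that precedes it. The noise is linear only almost
  surely, so every sigma-algebra contains the null sets. Maximal inequalities run on finite grids,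
  since only the increment of \<open>u\<close> itself is continuous.\<close>

definition sqint :: "'b measure \<Rightarrow> ('b \<Rightarrow> real) \<Rightarrow> bool" where
  "sqint N f \<longleftrightarrow> f \<in> borel_measurable N \<and> integrable N (\<lambda>x. (f x)^2)"

lemma sqint_measurable [measurable_dest]: "sqint N f \<Longrightarrow> f \<in> borel_measurable N"
  by (simp add: sqint_def)

lemma sqint_mult_integrable:
  assumes "sqint N f" "sqint N g" shows "integrable N (\<lambda>x. f x * g x)"
proof (rule Bochner_Integration.integrable_bound)
  show "integrable N (\<lambda>x. (f x)^2 + (g x)^2)" using assms by (auto simp: sqint_def)
  show "(\<lambda>x. f x * g x) \<in> borel_measurable N" using assms by (auto simp: sqint_def)
  have "\<bar>a * b\<bar> \<le> a\<^sup>2 + b\<^sup>2" for a b :: real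
  proof -
    have "0 \<le> (\<bar>a\<bar> - \<bar>b\<bar>)\<^sup>2" by simp
    then have "2 * (\<bar>a\<bar> * \<bar>b\<bar>) \<le> a\<^sup>2 + b\<^sup>2" by (simp add: power2_diff)
    moreover have "0 \<le> \<bar>a\<bar> * \<bar>b\<bar>" by simp
    ultimately show ?thesis unfolding abs_mult by linarith
  qed
  then show "AE x in N. norm (f x * g x) \<le> norm ((f x)^2 + (g x)^2)" by (auto)
qed

lemma sqint_cmult: "sqint N f \<Longrightarrow> sqint N (\<lambda>x. c * f x)"
  by (auto simp: sqint_def power_mult_distrib)

lemma sqint_add: assumes "sqint N f" "sqint N g" shows "sqint N (\<lambda>x. f x + g x)"
  using assms sqint_mult_integrable[OF assms] by (auto simp: sqint_def power2_sum mult.assoc)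

lemma sqint_diff: "sqint N f \<Longrightarrow> sqint N g \<Longrightarrow> sqint N (\<lambda>x. f x - g x)"
  using sqint_add[of N f "\<lambda>x. (-1) * g x"] sqint_cmult[of N g "-1"] by simp

lemma sqint_sum: "finite I \<Longrightarrow> (\<And>i. i \<in> I \<Longrightarrow> sqint N (f i)) \<Longrightarrow> sqint N (\<lambda>x. \<Sum>i\<in>I. f i x)"
  by (induction I rule: finite_induct) (auto intro!: sqint_add, auto simp: sqint_def)

lemma sqint_bounded_mult:
  assumes "sqint N f" and [measurable]: "g \<in> borel_measurable N" and b: "\<And>x. \<bar>g x\<bar> \<le> c"
  shows "sqint N (\<lambda>x. g x * f x)"
  unfolding sqint_def
proof
  show [measurable]: "(\<lambda>x. g x * f x) \<in> borel_measurable N" using assms by (auto simp: sqint_def)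
  have "(g x)\<^sup>2 \<le> c\<^sup>2" for x using b[of x] by (simp add: abs_le_square_iff[symmetric])
  then have *: "(g x)\<^sup>2 * (f x)\<^sup>2 \<le> c\<^sup>2 * (f x)\<^sup>2" for x by (simp add: mult_right_mono)
  show "integrable N (\<lambda>x. (g x * f x)\<^sup>2)"
    by (rule Bochner_Integration.integrable_bound[where f="\<lambda>x. c^2 * (f x)^2"])
      (use assms * in \<open>auto simp: sqint_def power_mult_distrib\<close>)
qed

lemma sqint_indicator_mult: "sqint N f \<Longrightarrow> A \<in> sets N \<Longrightarrow> sqint N (\<lambda>x. indicator A x * f x)"
  by (rule sqint_bounded_mult[where c=1]) (auto simp: indicator_def)

lemma (in finite_measure) sqint_const: "sqint M (\<lambda>x. c)" by (simp add: sqint_def)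

lemma (in finite_measure) sqint_bounded:
  "f \<in> borel_measurable M \<Longrightarrow> (\<And>x. \<bar>f x\<bar> \<le> c) \<Longrightarrow> sqint M f"
  using sqint_bounded_mult[OF sqint_const[of 1], of f c] by simp

lemma (in finite_measure) sqint_integrable: "sqint M f \<Longrightarrow> integrable M f"
  using sqint_mult_integrable[of M f "\<lambda>_. 1"] sqint_const[of 1] by simp

lemma square_sum_le: "(a + b)\<^sup>2 \<le> 2 * a\<^sup>2 + 2 * (b::real)\<^sup>2"
  using zero_le_power2[of "a - b"] by (simp add: power2_diff power2_sum)

section \<open>Test functions of the noise and normal characteristic functions\<close>

lemma L2_st_sqint: "L2_st \<phi> \<Longrightarrow> sqint lborel \<phi>" by (simp add: L2_st_def sqint_def)

lemma L2_st_iff: "L2_st \<phi> \<longleftrightarrow> sqint lborel \<phi> \<and> (\<forall>s y. s < 0 \<longrightarrow> \<phi> (s, y) = 0)"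
  by (auto simp: L2_st_def sqint_def)

lemma L2_st_lin: "L2_st \<phi> \<Longrightarrow> L2_st \<psi> \<Longrightarrow> L2_st (\<lambda>p. a * \<phi> p + b * \<psi> p)"
  by (auto simp: L2_st_iff intro!: sqint_add sqint_cmult)

lemma L2_st_cmult: "L2_st \<phi> \<Longrightarrow> L2_st (\<lambda>p. a * \<phi> p)"
  by (auto simp: L2_st_iff intro!: sqint_cmult)

lemma L2_st_zero: "L2_st (\<lambda>p. 0)" by (simp add: L2_st_def)

lemma L2_st_sum: "finite I \<Longrightarrow> (\<And>i. i \<in> I \<Longrightarrow> L2_st (f i)) \<Longrightarrow> L2_st (\<lambda>x. \<Sum>i\<in>I. f i x)"
  by (auto simp: L2_st_iff intro!: sqint_sum sum.neutral)

lemma L2_st_indicator_mult: "L2_st \<phi> \<Longrightarrow> D \<in> sets borel \<Longrightarrow> L2_st (\<lambda>p. indicator D p * \<phi> p)"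
  by (auto simp: L2_st_iff intro!: sqint_indicator_mult)

lemma L2_st_indicator:
  assumes "R \<in> sets borel" "emeasure lborel R < \<infinity>" "R \<subseteq> {0..} \<times> UNIV"
  shows "L2_st (indicator R :: real \<times> real \<Rightarrow> real)"
proof -
  have "(\<lambda>p. (indicator R p :: real)\<^sup>2) = indicator R" by (auto simp: indicator_def)
  then show ?thesis using assms by (auto simp: L2_st_def split: split_indicator)
qed

definition ip :: "(real \<times> real \<Rightarrow> real) \<Rightarrow> (real \<times> real \<Rightarrow> real) \<Rightarrow> real" where
  "ip \<phi> \<psi> = (\<integral>p. \<phi> p * \<psi> p \<partial>lborel)"

lemma L2_norm_sq_nonneg: "0 \<le> L2_norm_sq \<phi>" by (simp add: L2_norm_sq_def)

lemma L2_norm_sq_lin: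
  assumes "L2_st \<phi>" "L2_st \<psi>"
  shows "L2_norm_sq (\<lambda>p. a * \<phi> p + b * \<psi> p) = a^2 * L2_norm_sq \<phi> + 2 * a * b * ip \<phi> \<psi> + b^2 * L2_norm_sq \<psi>"
proof -
  note i = sqint_mult_integrable[OF L2_st_sqint[OF assms(1)] L2_st_sqint[OF assms(2)]]
    and [simp] = assms[unfolded L2_st_def]
  have "(\<lambda>p. (a * \<phi> p + b * \<psi> p)\<^sup>2) = (\<lambda>p. a^2 * (\<phi> p)^2 + 2 * a * b * (\<phi> p * \<psi> p) + b^2 * (\<psi> p)^2)"
    by (auto simp: power2_sum power_mult_distrib)
  then show ?thesis using i by (simp add: L2_norm_sq_def ip_def)
qed

lemma ip_disjoint: "(\<And>p. p \<notin> D \<Longrightarrow> \<phi> p = 0) \<Longrightarrow> (\<And>p. p \<in> D \<Longrightarrow> \<psi> p = 0) \<Longrightarrow> ip \<phi> \<psi> = 0"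
  unfolding ip_def by (metis (mono_tags, lifting) integral_zero mult_eq_0_iff Bochner_Integration.integral_cong)

lemma (in prob_space) normal_iexp:
  assumes d: "distributed M lborel X (normal_density 0 v)" and v: "v > 0"
  shows "(CLINT \<omega>|M. iexp (c * X \<omega>)) = complex_of_real (exp (- (c\<^sup>2 * v\<^sup>2) / 2))"
proof -
  have "distributed M lborel (\<lambda>\<omega>. (X \<omega> - 0) / v) std_normal_density"
    using d normal_standard_normal_convert[OF v, of X 0] by simp
  then have e: "distr M lborel (\<lambda>\<omega>. X \<omega> / v) = std_normal_distribution" by (simp add: distributed_def)
  have X[measurable]: "X \<in> borel_measurable M" using d by (auto simp: distributed_def)
  have "char std_normal_distribution (c * v) = (CLINT \<omega>|M. iexp ((c * v) * (X \<omega> / v)))"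
    unfolding char_def e[symmetric] by (subst integral_distr) auto
  then show ?thesis using v by (simp add: char_std_normal_distribution power_mult_distrib)
qed

lemma (in prob_space) normal_cos_sin:
  assumes d: "distributed M lborel X (normal_density 0 v)" and v: "v > 0"
  shows "(\<integral>\<omega>. cos (X \<omega>) \<partial>M) = exp (- (v\<^sup>2) / 2)" "(\<integral>\<omega>. sin (X \<omega>) \<partial>M) = 0"
proof -
  have X[measurable]: "X \<in> borel_measurable M" using d by (auto simp: distributed_def)
  have *: "(CLINT \<omega>|M. iexp (X \<omega>)) = exp (- (v\<^sup>2) / 2)" using normal_iexp[OF d v, of 1] by simp
  have i: "complex_integrable M (\<lambda>\<omega>. iexp (X \<omega>))" by (rule integrable_iexp) auto
  have "(\<integral>\<omega>. Re (iexp (X \<omega>)) \<partial>M) = Re (CLINT \<omega>|M. iexp (X \<omega>))"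
    "(\<integral>\<omega>. Im (iexp (X \<omega>)) \<partial>M) = Im (CLINT \<omega>|M. iexp (X \<omega>))"
    using i by (auto intro: integral_Re integral_Im)
  then show "(\<integral>\<omega>. cos (X \<omega>) \<partial>M) = exp (- (v\<^sup>2) / 2)" "(\<integral>\<omega>. sin (X \<omega>) \<partial>M) = 0"
    unfolding * by (simp_all add: Re_exp Im_exp)
qed

text \<open>The sets on which \<open>f\<close> and \<open>g\<close> lead to different preimages are
  null sets of \<open>M\<close>, hence belong to \<open>N\<close>. This transfers measurability
  along identities between Wiener integrals, which hold only almost surely.\<close>

lemma (in prob_space) complete_AE_cong:
  assumes N: "subalgebra M N" "null_sets M \<subseteq> sets N" and f: "f \<in> borel_measurable N" and [measurable]: "g \<in> borel_measurable M"
    and ae: "AE \<omega> in M. f \<omega> = (g \<omega> :: real)"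
  shows "g \<in> borel_measurable N"
proof (rule measurableI)
  have sp: "space N = space M" using N by (simp add: subalgebra_def)
  have [measurable]: "f \<in> borel_measurable M" using measurable_from_subalg[OF N(1) f] .
  fix B :: "real set" assume B[measurable]: "B \<in> sets borel"
  have "(g -` B \<inter> space M) - (f -` B \<inter> space M) \<in> null_sets M"
    "(f -` B \<inter> space M) - (g -` B \<inter> space M) \<in> null_sets M"
    using ae by (auto intro!: AE_iff_null_sets[THEN iffD2] elim!: eventually_mono)
  then have *: "(g -` B \<inter> space M) - (f -` B \<inter> space M) \<in> sets N"
    "(f -` B \<inter> space M) - (g -` B \<inter> space M) \<in> sets N" using N by auto
  have "f -` B \<inter> space M \<in> sets N" using measurable_sets[OF f B] sp by simp
  then have "((f -` B \<inter> space M) - ((f -` B \<inter> space M) - (g -` B \<inter> space M))) \<union>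
     ((g -` B \<inter> space M) - (f -` B \<inter> space M)) \<in> sets N" using * by auto
  also have "((f -` B \<inter> space M) - ((f -` B \<inter> space M) - (g -` B \<inter> space M))) \<union>
     ((g -` B \<inter> space M) - (f -` B \<inter> space M)) = g -` B \<inter> space M" by auto
  finally show "g -` B \<inter> space N \<in> sets N" using sp by simp
qed auto

text \<open>A subsequence converges almost surely; its pointwise limit is
  \<open>N\<close>-measurable and differs from \<open>g\<close> on a null set only.\<close>

lemma (in prob_space) complete_L2_limit:
  assumes N: "subalgebra M N" "null_sets M \<subseteq> sets N"
    and f: "\<And>n. f n \<in> borel_measurable N" and g[measurable]: "g \<in> borel_measurable M"
    and i: "\<And>n. integrable M (\<lambda>\<omega>. (f n \<omega> - g \<omega>)\<^sup>2)"
    and l: "(\<lambda>n. \<integral>\<omega>. (f n \<omega> - g \<omega>)\<^sup>2 \<partial>M) \<longlonglongrightarrow> (0::real)"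
  shows "g \<in> borel_measurable N"
proof -
  obtain r :: "nat \<Rightarrow> nat" where r: "AE x in M. (\<lambda>n. (f (r n) x - g x)\<^sup>2) \<longlonglongrightarrow> 0"
    using tendsto_L1_AE_subseq[of M "\<lambda>n \<omega>. (f n \<omega> - g \<omega>)\<^sup>2"] i l by auto
  have "AE x in M. (\<lambda>n. f (r n) x) \<longlonglongrightarrow> g x"
    using r
  proof eventually_elim
    case (elim x)
    then have "(\<lambda>n. sqrt ((f (r n) x - g x)\<^sup>2)) \<longlonglongrightarrow> sqrt 0" by (intro tendsto_real_sqrt)
    then show ?case by (simp add: tendsto_rabs_zero_iff LIM_zero_iff)
  qed
  then have ae: "AE x in M. lim (\<lambda>n. f (r n) x) = g x" by (auto simp: limI)
  show ?thesis
    by (rule complete_AE_cong[OF N _ g ae]) (intro borel_measurable_lim_metric f)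
qed

section \<open>Linearity and moments of the noise, and the sigma-algebras of regions\<close>

locale white_noise_space = prob_space M for M :: "'a measure" +
  fixes \<xi> :: "(real \<times> real \<Rightarrow> real) \<Rightarrow> 'a \<Rightarrow> real"
  assumes wn: "white_noise M \<xi>"
begin

lemma xi_measurable [measurable]: "L2_st \<phi> \<Longrightarrow> \<xi> \<phi> \<in> borel_measurable M"
  using wn by (auto simp: white_noise_def centred_normal_def)

lemma xi_lin: "L2_st \<phi> \<Longrightarrow> L2_st \<psi> \<Longrightarrow> AE \<omega> in M. \<xi> (\<lambda>p. a * \<phi> p + b * \<psi> p) \<omega> = a * \<xi> \<phi> \<omega> + b * \<xi> \<psi> \<omega>"
  using wn by (auto simp: white_noise_def)

lemma xi_cases:
  assumes "L2_st \<phi>"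
  obtains "L2_norm_sq \<phi> = 0" "AE \<omega> in M. \<xi> \<phi> \<omega> = 0"
  | "L2_norm_sq \<phi> > 0" "distributed M lborel (\<xi> \<phi>) (normal_density 0 (sqrt (L2_norm_sq \<phi>)))"
  using wn assms L2_norm_sq_nonneg[of \<phi>]
  by (auto simp: white_noise_def centred_normal_def split: if_splits) (metis order_le_less)

lemma xi_cos_sin:
  assumes "L2_st \<phi>"
  shows "(\<integral>\<omega>. cos (\<xi> \<phi> \<omega>) \<partial>M) = exp (- L2_norm_sq \<phi> / 2)" "(\<integral>\<omega>. sin (\<xi> \<phi> \<omega>) \<partial>M) = 0"
proof -
  note [measurable] = xi_measurable[OF assms]
  have "(\<integral>\<omega>. cos (\<xi> \<phi> \<omega>) \<partial>M) = exp (- L2_norm_sq \<phi> / 2) \<and> (\<integral>\<omega>. sin (\<xi> \<phi> \<omega>) \<partial>M) = 0"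
  proof (rule xi_cases[OF assms])
    assume z: "L2_norm_sq \<phi> = 0" "AE \<omega> in M. \<xi> \<phi> \<omega> = 0"
    have "(\<integral>\<omega>. cos (\<xi> \<phi> \<omega>) \<partial>M) = (\<integral>\<omega>. 1 \<partial>M)" by (rule integral_cong_AE) (use z in auto)
    moreover have "(\<integral>\<omega>. sin (\<xi> \<phi> \<omega>) \<partial>M) = (\<integral>\<omega>. 0 \<partial>M)" by (rule integral_cong_AE) (use z in auto)
    ultimately show ?thesis using z by (simp add: prob_space)
  next
    assume z: "L2_norm_sq \<phi> > 0" "distributed M lborel (\<xi> \<phi>) (normal_density 0 (sqrt (L2_norm_sq \<phi>)))"
    show ?thesis using normal_cos_sin[OF z(2)] z(1) by simp
  qed
  then show "(\<integral>\<omega>. cos (\<xi> \<phi> \<omega>) \<partial>M) = exp (- L2_norm_sq \<phi> / 2)" "(\<integral>\<omega>. sin (\<xi> \<phi> \<omega>) \<partial>M) = 0" by auto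
qed

lemma xi_moments:
  assumes "L2_st \<phi>"
  shows "sqint M (\<xi> \<phi>)" "(\<integral>\<omega>. \<xi> \<phi> \<omega> \<partial>M) = 0" "(\<integral>\<omega>. (\<xi> \<phi> \<omega>)\<^sup>2 \<partial>M) = L2_norm_sq \<phi>"
proof -
  note [measurable] = xi_measurable[OF assms]
  have "sqint M (\<xi> \<phi>) \<and> (\<integral>\<omega>. \<xi> \<phi> \<omega> \<partial>M) = 0 \<and> (\<integral>\<omega>. (\<xi> \<phi> \<omega>)\<^sup>2 \<partial>M) = L2_norm_sq \<phi>"
  proof (rule xi_cases[OF assms])
    assume z: "L2_norm_sq \<phi> = 0" "AE \<omega> in M. \<xi> \<phi> \<omega> = 0"
    have "(\<integral>\<omega>. \<xi> \<phi> \<omega> \<partial>M) = (\<integral>\<omega>. 0 \<partial>M)" by (rule integral_cong_AE) (use z in auto)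
    moreover have "(\<integral>\<omega>. (\<xi> \<phi> \<omega>)\<^sup>2 \<partial>M) = (\<integral>\<omega>. 0 \<partial>M)" by (rule integral_cong_AE) (use z in auto)
    moreover have "integrable M (\<lambda>\<omega>. (\<xi> \<phi> \<omega>)\<^sup>2) \<longleftrightarrow> integrable M (\<lambda>\<omega>. 0 :: real)"
      by (rule integrable_cong_AE) (use z in auto)
    ultimately show ?thesis using z by (simp add: sqint_def)
  next
    assume z: "L2_norm_sq \<phi> > 0" "distributed M lborel (\<xi> \<phi>) (normal_density 0 (sqrt (L2_norm_sq \<phi>)))"
    have s: "sqrt (L2_norm_sq \<phi>) > 0" using z by simp
    have e: "(\<integral>\<omega>. \<xi> \<phi> \<omega> \<partial>M) = 0" using normal_distributed_expectation[OF s z(2)] .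
    have "variance (\<xi> \<phi>) = (sqrt (L2_norm_sq \<phi>))\<^sup>2" using normal_distributed_variance[OF s z(2)] .
    then have v: "(\<integral>\<omega>. (\<xi> \<phi> \<omega>)\<^sup>2 \<partial>M) = L2_norm_sq \<phi>" using e z by simp
    then have "integrable M (\<lambda>\<omega>. (\<xi> \<phi> \<omega>)\<^sup>2)" using z(1) not_integrable_integral_eq by force
    then show ?thesis using e v by (simp add: sqint_def)
  qed
  then show "sqint M (\<xi> \<phi>)" "(\<integral>\<omega>. \<xi> \<phi> \<omega> \<partial>M) = 0" "(\<integral>\<omega>. (\<xi> \<phi> \<omega>)\<^sup>2 \<partial>M) = L2_norm_sq \<phi>" by auto
qed

lemma xi_null: "L2_st \<phi> \<Longrightarrow> L2_norm_sq \<phi> = 0 \<Longrightarrow> AE \<omega> in M. \<xi> \<phi> \<omega> = 0"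
  by (rule xi_cases) auto

lemma xi_cmult: assumes "L2_st \<phi>" shows "AE \<omega> in M. \<xi> (\<lambda>p. a * \<phi> p) \<omega> = a * \<xi> \<phi> \<omega>"
  using xi_lin[OF assms assms, of a 0] by simp

lemma xi_add: "L2_st \<phi> \<Longrightarrow> L2_st \<psi> \<Longrightarrow> AE \<omega> in M. \<xi> (\<lambda>p. \<phi> p + \<psi> p) \<omega> = \<xi> \<phi> \<omega> + \<xi> \<psi> \<omega>"
  using xi_lin[of \<phi> \<psi> 1 1] by simp

lemma xi_diff: "L2_st \<phi> \<Longrightarrow> L2_st \<psi> \<Longrightarrow> AE \<omega> in M. \<xi> (\<lambda>p. \<phi> p - \<psi> p) \<omega> = \<xi> \<phi> \<omega> - \<xi> \<psi> \<omega>"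
  using xi_lin[of \<phi> \<psi> 1 "-1"] by simp

lemma xi_zero: "AE \<omega> in M. \<xi> (\<lambda>p. 0) \<omega> = 0"
  using xi_null[OF L2_st_zero] by (simp add: L2_norm_sq_def)

lemma xi_sum:
  assumes "finite I" "\<And>i. i \<in> I \<Longrightarrow> L2_st (f i)"
  shows "AE \<omega> in M. \<xi> (\<lambda>p. \<Sum>i\<in>I. c i * f i p) \<omega> = (\<Sum>i\<in>I. c i * \<xi> (f i) \<omega>)"
  using assms
proof (induction I rule: finite_induct)
  case empty then show ?case using xi_zero by simp
next
  case (insert j I)
  have L: "L2_st (\<lambda>p. \<Sum>i\<in>I. c i * f i p)" using insert by (intro L2_st_sum L2_st_cmult) auto
  have "AE \<omega> in M. \<xi> (\<lambda>p. c j * f j p + (\<Sum>i\<in>I. c i * f i p)) \<omega> = c j * \<xi> (f j) \<omega> + \<xi> (\<lambda>p. \<Sum>i\<in>I. c i * f i p) \<omega>"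
    using xi_lin[OF insert.prems[of j] L, of "c j" 1] by simp
  moreover have "AE \<omega> in M. \<xi> (\<lambda>p. \<Sum>i\<in>I. c i * f i p) \<omega> = (\<Sum>i\<in>I. c i * \<xi> (f i) \<omega>)" using insert by auto
  ultimately show ?case unfolding sum.insert[OF insert.hyps] by eventually_elim simp
qed

lemma xi_cong_AE:
  assumes "L2_st \<phi>" "L2_st \<psi>" "AE p in lborel. \<phi> p = \<psi> p"
  shows "AE \<omega> in M. \<xi> \<phi> \<omega> = \<xi> \<psi> \<omega>"
proof -
  have [measurable]: "\<phi> \<in> borel_measurable borel" "\<psi> \<in> borel_measurable borel" using assms by (auto simp: L2_st_def)
  have d: "L2_st (\<lambda>p. \<phi> p - \<psi> p)" using L2_st_lin[OF assms(1,2), of 1 "-1"] by simp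
  have "L2_norm_sq (\<lambda>p. \<phi> p - \<psi> p) = (\<integral>p. 0 \<partial>(lborel :: (real\<times>real) measure))"
    unfolding L2_norm_sq_def by (rule integral_cong_AE) (use assms(3) in auto)
  with xi_null[OF d] xi_diff[OF assms(1,2)] show ?thesis by fastforce
qed

lemma xi_dist: "L2_st \<phi> \<Longrightarrow> L2_st \<psi> \<Longrightarrow> (\<integral>\<omega>. (\<xi> \<phi> \<omega> - \<xi> \<psi> \<omega>)\<^sup>2 \<partial>M) = L2_norm_sq (\<lambda>p. \<phi> p - \<psi> p)"
proof -
  assume a: "L2_st \<phi>" "L2_st \<psi>"
  note [measurable] = xi_measurable[OF a(1)] xi_measurable[OF a(2)]
  have d: "L2_st (\<lambda>p. \<phi> p - \<psi> p)" using L2_st_lin[OF a, of 1 "-1"] by simp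
  note [measurable] = xi_measurable[OF d]
  have "(\<integral>\<omega>. (\<xi> \<phi> \<omega> - \<xi> \<psi> \<omega>)\<^sup>2 \<partial>M) = (\<integral>\<omega>. (\<xi> (\<lambda>p. \<phi> p - \<psi> p) \<omega>)\<^sup>2 \<partial>M)"
    by (rule integral_cong_AE) (use xi_diff[OF a] in auto)
  then show ?thesis using xi_moments(3)[OF d] by simp
qed

definition noise_gen :: "(real \<times> real) set \<Rightarrow> 'a set set" where
  "noise_gen D = {\<xi> \<phi> -` B \<inter> space M | \<phi> B. L2_st \<phi> \<and> (\<forall>p. p \<notin> D \<longrightarrow> \<phi> p = 0) \<and> B \<in> sets borel}"

text \<open>One notion covers the filtration in time (\<open>D = past a\<close>) and the noise in a
  cone. The null sets are adjoined so that almost sure identities do not lead out of the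
  sigma-algebra.\<close>

definition noise :: "(real \<times> real) set \<Rightarrow> 'a measure" where
  "noise D = sigma (space M) (noise_gen D \<union> null_sets M)"

lemma noise_gen_sub: "noise_gen D \<subseteq> sets M"
  by (auto simp: noise_gen_def intro!: measurable_sets[OF xi_measurable])

lemma space_noise [simp]: "space (noise D) = space M"
  unfolding noise_def by (rule space_measure_of_conv)

lemma sets_noise: "sets (noise D) = sigma_sets (space M) (noise_gen D \<union> null_sets M)"
  unfolding noise_def using noise_gen_sub[of D] sets.sets_into_space[of _ M]
  by (intro sets_measure_of) (auto simp: null_sets_def)

lemma sets_noise_sub: "sets (noise D) \<subseteq> sets M"
  unfolding sets_noise using noise_gen_sub[of D] by (intro sets.sigma_sets_subset) auto

lemma subalgebra_noise: "subalgebra M (noise D)"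
  using sets_noise_sub by (auto simp: subalgebra_def)

lemma noise_measurable_M: "f \<in> borel_measurable (noise D) \<Longrightarrow> f \<in> borel_measurable M"
  using measurable_from_subalg[OF subalgebra_noise] .

lemma noise_mono: "D \<subseteq> E \<Longrightarrow> sets (noise D) \<subseteq> sets (noise E)"
  unfolding sets_noise by (intro sigma_sets_mono') (unfold noise_gen_def, blast)

lemma noise_measurable_mono: "f \<in> borel_measurable (noise D) \<Longrightarrow> D \<subseteq> E \<Longrightarrow> f \<in> borel_measurable (noise E)"
  using measurable_mono[OF order_refl refl noise_mono[of D E]] by auto

lemma null_sets_noise: "null_sets M \<subseteq> sets (noise D)"
  unfolding sets_noise by auto

lemma xi_noise: "L2_st \<phi> \<Longrightarrow> (\<And>p. p \<notin> D \<Longrightarrow> \<phi> p = 0) \<Longrightarrow> \<xi> \<phi> \<in> borel_measurable (noise D)"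
  by (rule measurableI) (auto simp: sets_noise noise_gen_def intro!: sigma_sets.Basic)

end

section \<open>Independence of the noise in disjoint regions\<close>

text \<open>Uniqueness of characteristic functions for a signed weight. After rescaling,
  \<open>1 + K / d\<close> is a probability density, and the hypotheses say that \<open>X\<close>
  has the same characteristic function under the tilted measure as under \<open>M\<close>. Levy's
  theorem then makes the two laws equal, so the contribution of \<open>K\<close> vanishes on every
  event of \<open>X\<close>.\<close>

lemma (in prob_space) weighted_cos_sin_zero:
  fixes K X :: "'a \<Rightarrow> real"
  assumes [measurable]: "K \<in> borel_measurable M" "X \<in> borel_measurable M" "B \<in> sets borel"
    and b: "\<And>\<omega>. \<bar>K \<omega>\<bar> \<le> c"
    and z: "\<And>l. (\<integral>\<omega>. K \<omega> * cos (l * X \<omega>) \<partial>M) = 0" "\<And>l. (\<integral>\<omega>. K \<omega> * sin (l * X \<omega>) \<partial>M) = 0"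
  shows "(\<integral>\<omega>. K \<omega> * indicator B (X \<omega>) \<partial>M) = 0"
proof -
  \<comment> \<open>The summand 1 keeps \<open>d\<close> positive. Nonnegativity of the density
    follows from \<open>\<bar>K \<omega>\<bar> \<le> d\<close>, and its total mass is 1 by the
    cosine hypothesis at \<open>l = 0\<close>.\<close>
  define d where "d = \<bar>c\<bar> + 1"
  have d: "d > 0" "\<And>\<omega>. \<bar>K \<omega>\<bar> \<le> d" using b unfolding d_def by (auto intro: order_trans[of _ c])
  define w where "w = (\<lambda>\<omega>. 1 + K \<omega> / d)"
  have w[simp]: "0 \<le> w \<omega>" for \<omega> using d(1) d(2)[of \<omega>] by (auto simp: w_def field_simps)
  have wm[measurable]: "w \<in> borel_measurable M" unfolding w_def by measurable
  have iK: "integrable M (\<lambda>\<omega>. K \<omega> * g \<omega>)" if [measurable]: "g \<in> borel_measurable M" and "\<And>\<omega>. \<bar>g \<omega>\<bar> \<le> 1" for g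
  proof (rule integrable_const_bound[where B=d])
    have "\<bar>K \<omega>\<bar> * \<bar>g \<omega>\<bar> \<le> d * 1" for \<omega> using d that by (intro mult_mono) auto
    then show "AE \<omega> in M. norm (K \<omega> * g \<omega>) \<le> d" by (auto simp: abs_mult)
  qed measurable
  have iw: "(\<integral>\<omega>. w \<omega> \<partial>M) = 1"
    using z(1)[of 0] iK[of "\<lambda>_. 1"] by (simp add: w_def prob_space)
  define P where "P = density M (\<lambda>\<omega>. ennreal (w \<omega>))"
  have "emeasure P (space P) = (\<integral>\<^sup>+\<omega>. ennreal (w \<omega>) \<partial>M)"
    unfolding P_def by (subst emeasure_density) (auto intro!: nn_integral_cong)
  also have "\<dots> = 1" using iK[of "\<lambda>_. 1"] by (subst nn_integral_eq_integral) (use w iw in \<open>simp_all add: w_def\<close>)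
  finally interpret P: prob_space P by (rule prob_spaceI)
  have [measurable]: "X \<in> borel_measurable P" unfolding P_def by simp
  have "char (distr P borel X) t = char (distr M borel X) t" for t
  proof -
    have c1: "complex_integrable M (\<lambda>\<omega>. iexp (t * X \<omega>))" by (rule integrable_iexp) auto
    have c2: "complex_integrable M (\<lambda>\<omega>. (K \<omega> / d) *\<^sub>R iexp (t * X \<omega>))"
      by (rule integrable_const_bound[where B=1]) (use d in \<open>auto simp: field_simps\<close>)
    have "(\<integral>\<omega>. Re ((K \<omega> / d) *\<^sub>R iexp (t * X \<omega>)) \<partial>M) = Re (CLINT \<omega>|M. (K \<omega> / d) *\<^sub>R iexp (t * X \<omega>))"
      "(\<integral>\<omega>. Im ((K \<omega> / d) *\<^sub>R iexp (t * X \<omega>)) \<partial>M) = Im (CLINT \<omega>|M. (K \<omega> / d) *\<^sub>R iexp (t * X \<omega>))"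
      using c2 by (intro integral_Re integral_Im; simp)+
    moreover have "Re ((K \<omega> / d) *\<^sub>R iexp (t * X \<omega>)) = (K \<omega> * cos (t * X \<omega>)) / d"
      "Im ((K \<omega> / d) *\<^sub>R iexp (t * X \<omega>)) = (K \<omega> * sin (t * X \<omega>)) / d" for \<omega>
      by (simp_all add: Re_exp Im_exp)
    ultimately have z0: "(CLINT \<omega>|M. (K \<omega> / d) *\<^sub>R iexp (t * X \<omega>)) = 0"
      using z[of t] by (intro complex_eqI) (simp_all only: integral_divide_zero, simp_all)
    have "char (distr P borel X) t = (CLINT \<omega>|P. iexp (t * X \<omega>))"
      unfolding char_def by (subst integral_distr) auto
    also have "\<dots> = (CLINT \<omega>|M. w \<omega> *\<^sub>R iexp (t * X \<omega>))"
      unfolding P_def by (subst integral_density) auto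
    also have "\<dots> = (CLINT \<omega>|M. iexp (t * X \<omega>) + (K \<omega> / d) *\<^sub>R iexp (t * X \<omega>))"
      by (simp add: w_def scaleR_add_left)
    also have "\<dots> = (CLINT \<omega>|M. iexp (t * X \<omega>))"
      using z0 by (subst Bochner_Integration.integral_add[OF c1 c2]) simp
    also have "\<dots> = char (distr M borel X) t" unfolding char_def by (subst integral_distr) auto
    finally show ?thesis .
  qed
  then have eq: "distr P borel X = distr M borel X"
    by (intro Levy_uniqueness P.real_distribution_distr real_distribution_distr ext) auto
  have "(\<integral>\<omega>. w \<omega> * indicator B (X \<omega>) \<partial>M) = (\<integral>\<omega>. indicator B (X \<omega>) \<partial>P)"
    unfolding P_def by (subst integral_density) auto
  also have "\<dots> = (\<integral>x. indicator B x \<partial>distr P borel X)" by (subst integral_distr) auto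
  also have "\<dots> = (\<integral>\<omega>. indicator B (X \<omega>) \<partial>M)" unfolding eq by (subst integral_distr) auto
  finally have "(\<integral>\<omega>. indicator B (X \<omega>) + K \<omega> * indicator B (X \<omega>) / d \<partial>M) = (\<integral>\<omega>. indicator B (X \<omega>) \<partial>M)"
    by (simp add: w_def algebra_simps)
  moreover have "integrable M (\<lambda>\<omega>. indicator B (X \<omega>) :: real)"
    by (rule integrable_const_bound[where B=1]) auto
  moreover have "integrable M (\<lambda>\<omega>. K \<omega> * indicator B (X \<omega>))"
    by (rule iK) (auto simp: indicator_def)
  ultimately show ?thesis using d by simp
qed

text \<open>Passing from constant to random parameters: an identity that holds for every constant
  parameter on every event of \<open>H\<close> survives the insertion of an \<open>H\<close>-measurable parameter.\<close>

lemma (in prob_space) random_parameter: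
  fixes F F' :: "real \<Rightarrow> 'a \<Rightarrow> complex"
  assumes sub: "subalgebra M H"
    and [measurable]: "\<And>l. F l \<in> borel_measurable M" "\<And>l. F' l \<in> borel_measurable M"
    and b: "\<And>l \<omega>. cmod (F l \<omega>) \<le> 1" "\<And>l \<omega>. cmod (F' l \<omega>) \<le> 1"
    and c: "\<And>\<omega>. continuous_on UNIV (\<lambda>l. F l \<omega>)" "\<And>\<omega>. continuous_on UNIV (\<lambda>l. F' l \<omega>)"
    and eq: "\<And>l A. A \<in> sets H \<Longrightarrow> (CLINT \<omega>|M. indicator A \<omega> *\<^sub>R F l \<omega>) = (CLINT \<omega>|M. indicator A \<omega> *\<^sub>R F' l \<omega>)"
    and a: "a \<in> borel_measurable H" and A: "A \<in> sets H"
  shows "(CLINT \<omega>|M. indicator A \<omega> *\<^sub>R F (a \<omega>) \<omega>) = (CLINT \<omega>|M. indicator A \<omega> *\<^sub>R F' (a \<omega>) \<omega>)"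
    and "(\<lambda>\<omega>. F (a \<omega>) \<omega>) \<in> borel_measurable M" "(\<lambda>\<omega>. F' (a \<omega>) \<omega>) \<in> borel_measurable M"
proof -
  have HM: "sets H \<subseteq> sets M" "space H = space M" using sub by (auto simp: subalgebra_def)
  obtain s where s: "\<And>i. simple_function H (s i)" "\<And>\<omega>. \<omega> \<in> space H \<Longrightarrow> (\<lambda>i. s i \<omega>) \<longlonglongrightarrow> a \<omega>"
    using borel_measurable_implies_sequence_metric[OF a, of 0] by metis
  have fin: "finite (s i ` space M)" for i using s(1)[of i] HM by (simp add: simple_function_def)
  have lev: "s i -` {v} \<inter> space M \<in> sets H" for i v
    using s(1)[of i] HM by (metis simple_functionD(2))
  have lm[measurable]: "s i -` {v} \<inter> space M \<in> sets M" for i v using lev HM by auto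
  have Am[measurable]: "A \<in> sets M" using A HM by auto
  have dec: "E (s i \<omega>) \<omega> = (\<Sum>v\<in>s i ` space M. indicator (s i -` {v} \<inter> space M) \<omega> *\<^sub>R E v \<omega>)"
    if "\<omega> \<in> space M" for i \<omega> and E :: "real \<Rightarrow> 'a \<Rightarrow> complex"
  proof -
    have "(\<Sum>v\<in>s i ` space M. indicator (s i -` {v} \<inter> space M) \<omega> *\<^sub>R E v \<omega>) = (\<Sum>v\<in>s i ` space M. if v = s i \<omega> then E v \<omega> else 0)"
      using that by (intro sum.cong) auto
    then show ?thesis using that fin by simp
  qed
  have meas: "(\<lambda>\<omega>. E (s i \<omega>) \<omega>) \<in> borel_measurable M" if [measurable]: "\<And>l. E l \<in> borel_measurable M"
    for i and E :: "real \<Rightarrow> 'a \<Rightarrow> complex"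
    by (subst measurable_cong[OF dec], assumption) measurable
  have lim: "(\<lambda>i. E (s i \<omega>) \<omega>) \<longlonglongrightarrow> E (a \<omega>) \<omega>" if "continuous_on UNIV (\<lambda>l. E l \<omega>)" "\<omega> \<in> space M"
    for \<omega> and E :: "real \<Rightarrow> 'a \<Rightarrow> complex"
    by (rule continuous_on_tendsto_compose[OF that(1) s(2)]) (use that HM in auto)
  have int: "integrable M (\<lambda>\<omega>. indicator C \<omega> *\<^sub>R E l \<omega>)"
    if [measurable]: "\<And>l. E l \<in> borel_measurable M" "C \<in> sets M" and b: "\<And>l \<omega>. cmod (E l \<omega>) \<le> 1" for E l C
    by (rule integrable_const_bound[where B=1]) (use b in \<open>auto simp: indicator_def\<close>)
  have simp: "(CLINT \<omega>|M. indicator A \<omega> *\<^sub>R E (s i \<omega>) \<omega>) =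
    (\<Sum>v\<in>s i ` space M. CLINT \<omega>|M. indicator (A \<inter> (s i -` {v} \<inter> space M)) \<omega> *\<^sub>R E v \<omega>)"
    if [measurable]: "\<And>l. E l \<in> borel_measurable M" and b: "\<And>l \<omega>. cmod (E l \<omega>) \<le> 1" for i E
  proof -
    have "(CLINT \<omega>|M. indicator A \<omega> *\<^sub>R E (s i \<omega>) \<omega>) =
      (CLINT \<omega>|M. \<Sum>v\<in>s i ` space M. indicator (A \<inter> (s i -` {v} \<inter> space M)) \<omega> *\<^sub>R E v \<omega>)"
    proof (rule Bochner_Integration.integral_cong[OF refl])
      fix \<omega> assume "\<omega> \<in> space M"
      then show "indicator A \<omega> *\<^sub>R E (s i \<omega>) \<omega> = (\<Sum>v\<in>s i ` space M. indicator (A \<inter> (s i -` {v} \<inter> space M)) \<omega> *\<^sub>R E v \<omega>)"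
        using dec[of \<omega> E i] by (simp add: scaleR_sum_right indicator_inter_arith)
    qed
    also have "\<dots> = (\<Sum>v\<in>s i ` space M. CLINT \<omega>|M. indicator (A \<inter> (s i -` {v} \<inter> space M)) \<omega> *\<^sub>R E v \<omega>)"
      by (rule Bochner_Integration.integral_sum) (rule int, use b in auto)
    finally show ?thesis .
  qed
  have main: "(\<lambda>i. CLINT \<omega>|M. indicator A \<omega> *\<^sub>R E (s i \<omega>) \<omega>) \<longlonglongrightarrow> (CLINT \<omega>|M. indicator A \<omega> *\<^sub>R E (a \<omega>) \<omega>) \<and>
    (\<lambda>\<omega>. E (a \<omega>) \<omega>) \<in> borel_measurable M"
    if m: "\<And>l. E l \<in> borel_measurable M" and b: "\<And>l \<omega>. cmod (E l \<omega>) \<le> 1"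
      and c: "\<And>\<omega>. continuous_on UNIV (\<lambda>l. E l \<omega>)" for E
  proof
    show [measurable]: "(\<lambda>\<omega>. E (a \<omega>) \<omega>) \<in> borel_measurable M"
      by (rule borel_measurable_LIMSEQ_metric[where f="\<lambda>i \<omega>. E (s i \<omega>) \<omega>"]) (use meas[of E] m lim[of E] c in auto)
    note [measurable] = meas[OF m]
    show "(\<lambda>i. CLINT \<omega>|M. indicator A \<omega> *\<^sub>R E (s i \<omega>) \<omega>) \<longlonglongrightarrow> (CLINT \<omega>|M. indicator A \<omega> *\<^sub>R E (a \<omega>) \<omega>)"
      by (rule integral_dominated_convergence[where w="\<lambda>_. 1"])
        (use b in \<open>auto intro!: AE_I2 tendsto_scaleR lim[OF c] simp: indicator_def\<close>)
  qed
  have "(CLINT \<omega>|M. indicator A \<omega> *\<^sub>R F (s i \<omega>) \<omega>) = (CLINT \<omega>|M. indicator A \<omega> *\<^sub>R F' (s i \<omega>) \<omega>)" for i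
    by (subst (1 2) simp) (use b A lev in \<open>auto intro!: sum.cong eq\<close>)
  then show "(CLINT \<omega>|M. indicator A \<omega> *\<^sub>R F (a \<omega>) \<omega>) = (CLINT \<omega>|M. indicator A \<omega> *\<^sub>R F' (a \<omega>) \<omega>)"
    using main[of F] main[of F'] b c by (auto intro: LIMSEQ_unique)
  show "(\<lambda>\<omega>. F (a \<omega>) \<omega>) \<in> borel_measurable M" "(\<lambda>\<omega>. F' (a \<omega>) \<omega>) \<in> borel_measurable M"
    using main[of F] main[of F'] b c by auto
qed

text \<open>The hypothesis \<open>gauss\<close> says that, given \<open>H\<close>, the
  \<open>X k\<close> are independent centred Gaussians with variances \<open>v k\<close>, but tests
  this with constant coefficients only. Random coefficients are inserted one at a time by
  \<open>random_parameter\<close>; \<open>c m\<close> is the hybrid whose first \<open>m\<close>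
  coefficients are already random.\<close>

lemma (in prob_space) conditional_gaussian:
  fixes X :: "nat \<Rightarrow> 'a \<Rightarrow> real"
  assumes sub: "subalgebra M H"
    and Xm[measurable]: "\<And>k. k < n \<Longrightarrow> X k \<in> borel_measurable M"
    and v: "\<And>k. k < n \<Longrightarrow> v k \<ge> 0"
    and gauss: "\<And>\<alpha> A. A \<in> sets H \<Longrightarrow> (CLINT \<omega>|M. indicator A \<omega> *\<^sub>R iexp (\<Sum>k<n. \<alpha> k * X k \<omega>)) =
       complex_of_real (prob A * exp (- (\<Sum>k<n. (\<alpha> k)\<^sup>2 * v k) / 2))"
    and a: "\<And>k. k < n \<Longrightarrow> a k \<in> borel_measurable H" and A: "A \<in> sets H"
  shows "(CLINT \<omega>|M. indicator A \<omega> *\<^sub>R iexp (\<Sum>k<n. a k \<omega> * X k \<omega>)) =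
    complex_of_real (\<integral>\<omega>. indicator A \<omega> * exp (- (\<Sum>k<n. (a k \<omega>)\<^sup>2 * v k) / 2) \<partial>M)"
proof -
  define c where "c m \<alpha> k \<omega> = (if k < m then a k \<omega> else \<alpha> k)" for m \<alpha> k \<omega>
  have aM: "\<And>k. k < n \<Longrightarrow> a k \<in> borel_measurable M" using a measurable_from_subalg[OF sub] by blast
  have "m \<le> n \<Longrightarrow> \<forall>\<alpha>. \<forall>A\<in>sets H. (CLINT \<omega>|M. indicator A \<omega> *\<^sub>R iexp (\<Sum>k<n. c m \<alpha> k \<omega> * X k \<omega>)) =
     (CLINT \<omega>|M. indicator A \<omega> *\<^sub>R complex_of_real (exp (- (\<Sum>k<n. (c m \<alpha> k \<omega>)\<^sup>2 * v k) / 2)))" for m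
  proof (induction m)
    case 0
    show ?case
    proof (intro allI ballI)
      fix \<alpha> A assume A: "A \<in> sets H"
      then have "A \<in> sets M" using sub by (auto simp: subalgebra_def)
      then show "(CLINT \<omega>|M. indicator A \<omega> *\<^sub>R iexp (\<Sum>k<n. c 0 \<alpha> k \<omega> * X k \<omega>)) =
         (CLINT \<omega>|M. indicator A \<omega> *\<^sub>R complex_of_real (exp (- (\<Sum>k<n. (c 0 \<alpha> k \<omega>)\<^sup>2 * v k) / 2)))"
        using gauss[OF A, of \<alpha>] sets.sets_into_space[of A M] by (simp add: c_def scaleR_conv_of_real Int_absorb2)
    qed
  next
    case (Suc m)
    show ?case
    proof (intro allI ballI)
      fix \<alpha> A assume A: "A \<in> sets H"
      define b where "b l k \<omega> = c m (\<alpha>(m := l)) k \<omega>" for l k \<omega>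
      have bS: "b (a m \<omega>) k \<omega> = c (Suc m) \<alpha> k \<omega>" for k \<omega> by (auto simp: b_def c_def less_Suc_eq)
      have bm[measurable]: "b l k \<in> borel_measurable M" if "k < n" for l k
      proof -
        have "b l k = (if k < m then a k else (\<lambda>_. (\<alpha>(m := l)) k))" by (auto simp: b_def c_def fun_eq_iff)
        then show ?thesis using aM[OF that] by (cases "k < m") simp_all
      qed
      have bc: "continuous_on UNIV (\<lambda>l. b l k \<omega>)" for k \<omega>
        by (cases "k < m"; cases "k = m") (auto simp: b_def c_def intro!: continuous_intros)
      have "(CLINT \<omega>|M. indicator A \<omega> *\<^sub>R iexp (\<Sum>k<n. b (a m \<omega>) k \<omega> * X k \<omega>)) =
        (CLINT \<omega>|M. indicator A \<omega> *\<^sub>R complex_of_real (exp (- (\<Sum>k<n. (b (a m \<omega>) k \<omega>)\<^sup>2 * v k) / 2)))"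
      proof (rule random_parameter(1)[OF sub, where F="\<lambda>l \<omega>. iexp (\<Sum>k<n. b l k \<omega> * X k \<omega>)"
          and F'="\<lambda>l \<omega>. complex_of_real (exp (- (\<Sum>k<n. (b l k \<omega>)\<^sup>2 * v k) / 2))"])
        show "a m \<in> borel_measurable H" using a Suc.prems by auto
        show "A \<in> sets H" by fact
        show "(CLINT \<omega>|M. indicator A \<omega> *\<^sub>R iexp (\<Sum>k<n. b l k \<omega> * X k \<omega>)) =
          (CLINT \<omega>|M. indicator A \<omega> *\<^sub>R complex_of_real (exp (- (\<Sum>k<n. (b l k \<omega>)\<^sup>2 * v k) / 2)))" if "A \<in> sets H" for l A
          using Suc that unfolding b_def by auto
        show "continuous_on UNIV (\<lambda>l. iexp (\<Sum>k<n. b l k \<omega> * X k \<omega>))"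
          "continuous_on UNIV (\<lambda>l. complex_of_real (exp (- (\<Sum>k<n. (b l k \<omega>)\<^sup>2 * v k) / 2)))" for \<omega>
          by (intro continuous_intros bc)+ auto
        show "cmod (complex_of_real (exp (- (\<Sum>k<n. (b l k \<omega>)\<^sup>2 * v k) / 2))) \<le> 1" for l \<omega>
          using v by (auto intro!: sum_nonneg)
        show "(\<lambda>\<omega>. iexp (\<Sum>k<n. b l k \<omega> * X k \<omega>)) \<in> borel_measurable M"
          "(\<lambda>\<omega>. complex_of_real (exp (- (\<Sum>k<n. (b l k \<omega>)\<^sup>2 * v k) / 2))) \<in> borel_measurable M" for l
        proof -
          have [measurable]: "(\<lambda>\<omega>. \<Sum>k<n. b l k \<omega> * X k \<omega>) \<in> borel_measurable M"
            "(\<lambda>\<omega>. \<Sum>k<n. (b l k \<omega>)\<^sup>2 * v k) \<in> borel_measurable M"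
            by (rule borel_measurable_sum; use Xm bm in measurable)+
          show "(\<lambda>\<omega>. iexp (\<Sum>k<n. b l k \<omega> * X k \<omega>)) \<in> borel_measurable M"
            "(\<lambda>\<omega>. complex_of_real (exp (- (\<Sum>k<n. (b l k \<omega>)\<^sup>2 * v k) / 2))) \<in> borel_measurable M"
            by measurable
        qed
      qed auto
      then show "(CLINT \<omega>|M. indicator A \<omega> *\<^sub>R iexp (\<Sum>k<n. c (Suc m) \<alpha> k \<omega> * X k \<omega>)) =
         (CLINT \<omega>|M. indicator A \<omega> *\<^sub>R complex_of_real (exp (- (\<Sum>k<n. (c (Suc m) \<alpha> k \<omega>)\<^sup>2 * v k) / 2)))"
        unfolding bS .
    qed
  qed
  from this[of n] have "(CLINT \<omega>|M. indicator A \<omega> *\<^sub>R iexp (\<Sum>k<n. a k \<omega> * X k \<omega>)) =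
     (CLINT \<omega>|M. indicator A \<omega> *\<^sub>R complex_of_real (exp (- (\<Sum>k<n. (a k \<omega>)\<^sup>2 * v k) / 2)))"
    using A by (simp add: c_def)
  also have "\<dots> = (CLINT \<omega>|M. complex_of_real (indicator A \<omega> * exp (- (\<Sum>k<n. (a k \<omega>)\<^sup>2 * v k) / 2)))"
    by (simp add: scaleR_conv_of_real)
  also have "\<dots> = complex_of_real (\<integral>\<omega>. indicator A \<omega> * exp (- (\<Sum>k<n. (a k \<omega>)\<^sup>2 * v k) / 2) \<partial>M)"
    by (rule integral_complex_of_real)
  finally show ?thesis .
qed

section \<open>Conditional laws of the noise outside a region\<close>

context white_noise_space
begin

text \<open>Cosines and sines of Wiener integrals supported in \<open>D\<close> are total for the
  sigma-algebra that these integrals generate. The weight \<open>K * indicator A\<close> inherits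
  the hypothesis when \<open>A\<close> is cut with one more generator; hence finite intersections of
  generators are reached by induction, and they form a pi-system.\<close>

lemma noise_total:
  assumes K[measurable]: "K \<in> borel_measurable M" and b: "\<And>\<omega>. \<bar>K \<omega>\<bar> \<le> c"
    and z: "\<And>\<phi>. L2_st \<phi> \<Longrightarrow> (\<And>p. p \<notin> D \<Longrightarrow> \<phi> p = 0) \<Longrightarrow>
      (\<integral>\<omega>. K \<omega> * cos (\<xi> \<phi> \<omega>) \<partial>M) = 0 \<and> (\<integral>\<omega>. K \<omega> * sin (\<xi> \<phi> \<omega>) \<partial>M) = 0"
    and A: "A \<in> sets (noise D)"
  shows "(\<integral>\<omega>. K \<omega> * indicator A \<omega> \<partial>M) = 0"
proof -
  define T where "T = {\<phi>. L2_st \<phi> \<and> (\<forall>p. p \<notin> D \<longrightarrow> \<phi> p = 0)}"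
  have Tm[measurable]: "\<xi> \<phi> \<in> borel_measurable M" if "\<phi> \<in> T" for \<phi> using that xi_measurable by (auto simp: T_def)
  \<comment> \<open>Testing against all cosines and sines, and not against constants alone, is what
    makes the property stable under intersection with a further generator.\<close>
  define P where "P A \<longleftrightarrow> A \<in> sets M \<and> (\<forall>\<phi>\<in>T. (\<integral>\<omega>. K \<omega> * indicator A \<omega> * cos (\<xi> \<phi> \<omega>) \<partial>M) = 0 \<and>
      (\<integral>\<omega>. K \<omega> * indicator A \<omega> * sin (\<xi> \<phi> \<omega>) \<partial>M) = 0)" for A
  define E where "E = noise_gen D \<union> null_sets M"
  have EM: "E \<subseteq> sets M" using noise_gen_sub by (auto simp: E_def)
  have bint: "integrable M (\<lambda>\<omega>. K \<omega> * indicator A \<omega> * g \<omega>)" if [measurable]: "A \<in> sets M" "g \<in> borel_measurable M" and "\<And>\<omega>. \<bar>g \<omega>\<bar> \<le> 1" for A and g :: "_ \<Rightarrow> real"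
  proof (rule integrable_const_bound[where B=c])
    have "\<bar>K \<omega>\<bar> * (\<bar>indicator A \<omega>\<bar> * \<bar>g \<omega>\<bar>) \<le> c * 1" for \<omega>
      using b[of \<omega>] that(3)[of \<omega>] by (intro mult_mono mult_le_one) (auto simp: indicator_def)
    then show "AE x in M. norm (K x * indicator A x * g x) \<le> c" by (auto simp: abs_mult mult.assoc)
  qed measurable
  have step: "P (A \<inter> g)" if PA: "P A" and g: "g \<in> E" for A g
  proof -
    have [measurable]: "A \<in> sets M" "g \<in> sets M" using that EM by (auto simp: P_def)
    show ?thesis
    proof (cases "g \<in> null_sets M")
      case True
      then have ae: "AE \<omega> in M. \<omega> \<notin> A \<inter> g" using AE_not_in[OF True] by auto
      have "(\<integral>\<omega>. K \<omega> * indicator (A \<inter> g) \<omega> * f \<omega> \<partial>M) = (\<integral>\<omega>. 0 \<partial>M)" if [measurable]: "f \<in> borel_measurable M" for f :: "_ \<Rightarrow> real"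
        by (rule integral_cong_AE) (use ae in \<open>auto elim!: eventually_mono\<close>)
      then show ?thesis unfolding P_def by auto
    next
      case False
      then obtain \<psi> B where \<psi>: "\<psi> \<in> T" and B[measurable]: "B \<in> sets borel" and g_eq: "g = \<xi> \<psi> -` B \<inter> space M"
        using g by (auto simp: E_def noise_gen_def T_def)
      have ind: "K \<omega> * indicator (A \<inter> g) \<omega> * f = (K \<omega> * indicator A \<omega> * f) * indicator B (\<xi> \<psi> \<omega>)" if "\<omega> \<in> space M" for \<omega> f
        using that by (auto simp: g_eq indicator_def)
      note [measurable] = Tm[OF \<psi>]
      have "(\<integral>\<omega>. K \<omega> * indicator (A \<inter> g) \<omega> * cos (\<xi> \<phi> \<omega>) \<partial>M) = 0 \<and> (\<integral>\<omega>. K \<omega> * indicator (A \<inter> g) \<omega> * sin (\<xi> \<phi> \<omega>) \<partial>M) = 0"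
        if \<phi>: "\<phi> \<in> T" for \<phi>
      proof -
        note [measurable] = Tm[OF \<phi>]
        have lin: "(\<lambda>p. \<phi> p + l * \<psi> p) \<in> T" for l
          using \<phi> \<psi> L2_st_lin[of \<phi> \<psi> 1 l] by (auto simp: T_def)
        have linm[measurable]: "\<xi> (\<lambda>p. \<phi> p + l * \<psi> p) \<in> borel_measurable M" for l using Tm[OF lin] .
        have linae: "AE \<omega> in M. \<xi> (\<lambda>p. \<phi> p + l * \<psi> p) \<omega> = \<xi> \<phi> \<omega> + l * \<xi> \<psi> \<omega>" for l
          using xi_lin[of \<phi> \<psi> 1 l] \<phi> \<psi> by (auto simp: T_def)
        have z1: "(\<integral>\<omega>. K \<omega> * indicator A \<omega> * cos (\<xi> \<phi> \<omega> + l * \<xi> \<psi> \<omega>) \<partial>M) = 0"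
          "(\<integral>\<omega>. K \<omega> * indicator A \<omega> * sin (\<xi> \<phi> \<omega> + l * \<xi> \<psi> \<omega>) \<partial>M) = 0" for l
        proof -
          have "(\<integral>\<omega>. K \<omega> * indicator A \<omega> * cos (\<xi> \<phi> \<omega> + l * \<xi> \<psi> \<omega>) \<partial>M) = (\<integral>\<omega>. K \<omega> * indicator A \<omega> * cos (\<xi> (\<lambda>p. \<phi> p + l * \<psi> p) \<omega>) \<partial>M)"
            "(\<integral>\<omega>. K \<omega> * indicator A \<omega> * sin (\<xi> \<phi> \<omega> + l * \<xi> \<psi> \<omega>) \<partial>M) = (\<integral>\<omega>. K \<omega> * indicator A \<omega> * sin (\<xi> (\<lambda>p. \<phi> p + l * \<psi> p) \<omega>) \<partial>M)"
            by (intro integral_cong_AE; use linae[of l] in \<open>auto elim!: eventually_mono\<close>)+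
          then show "(\<integral>\<omega>. K \<omega> * indicator A \<omega> * cos (\<xi> \<phi> \<omega> + l * \<xi> \<psi> \<omega>) \<partial>M) = 0"
            "(\<integral>\<omega>. K \<omega> * indicator A \<omega> * sin (\<xi> \<phi> \<omega> + l * \<xi> \<psi> \<omega>) \<partial>M) = 0" using PA lin by (auto simp: P_def)
        qed
        have i1: "integrable M (\<lambda>\<omega>. K \<omega> * indicator A \<omega> * cos (\<xi> \<phi> \<omega> + l * \<xi> \<psi> \<omega>))"
          "integrable M (\<lambda>\<omega>. K \<omega> * indicator A \<omega> * sin (\<xi> \<phi> \<omega> + l * \<xi> \<psi> \<omega>))" for l
          by (intro bint; simp)+
        \<comment> \<open>These formulas turn a product of functions of \<open>\<xi> \<phi>\<close>
          and \<open>l * \<xi> \<psi>\<close> into functions of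
          \<open>\<xi> \<phi> + l * \<xi> \<psi>\<close> and
          \<open>\<xi> \<phi> - l * \<xi> \<psi>\<close>, which by linearity are again Wiener
          integrals supported in \<open>D\<close>.\<close>
        have cc: "cos a * cos y = (cos (a + (-1) * y) + cos (a + y)) / 2" "cos a * sin y = (sin (a + y) - sin (a + (-1) * y)) / 2"
          "sin a * cos y = (sin (a + y) + sin (a + (-1) * y)) / 2" "sin a * sin y = (cos (a + (-1) * y) - cos (a + y)) / 2" for a y :: real
          by (simp_all add: cos_add sin_add cos_diff sin_diff)
        have t1: "(\<integral>\<omega>. K \<omega> * indicator A \<omega> * (cos (\<xi> \<phi> \<omega>) * cos (l * \<xi> \<psi> \<omega>)) \<partial>M) = 0" for l
          using z1[of l] z1[of "-l"] i1[of l] i1[of "-l"] unfolding cc by (simp add: ring_distribs)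
        have t2: "(\<integral>\<omega>. K \<omega> * indicator A \<omega> * (cos (\<xi> \<phi> \<omega>) * sin (l * \<xi> \<psi> \<omega>)) \<partial>M) = 0" for l
          using z1[of l] z1[of "-l"] i1[of l] i1[of "-l"] unfolding cc by (simp add: ring_distribs)
        have t3: "(\<integral>\<omega>. K \<omega> * indicator A \<omega> * (sin (\<xi> \<phi> \<omega>) * cos (l * \<xi> \<psi> \<omega>)) \<partial>M) = 0" for l
          using z1[of l] z1[of "-l"] i1[of l] i1[of "-l"] unfolding cc by (simp add: ring_distribs)
        have t4: "(\<integral>\<omega>. K \<omega> * indicator A \<omega> * (sin (\<xi> \<phi> \<omega>) * sin (l * \<xi> \<psi> \<omega>)) \<partial>M) = 0" for l
          using z1[of l] z1[of "-l"] i1[of l] i1[of "-l"] unfolding cc by (simp add: ring_distribs)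
        have bd: "\<bar>K \<omega> * indicator A \<omega> * f\<bar> \<le> c" if "\<bar>f\<bar> \<le> 1" for \<omega> and f :: real
        proof -
          have "\<bar>K \<omega>\<bar> * (\<bar>indicator A \<omega>\<bar> * \<bar>f\<bar>) \<le> c * 1"
            using b[of \<omega>] that by (intro mult_mono mult_le_one) (auto simp: indicator_def)
          then show ?thesis by (auto simp: abs_mult mult.assoc)
        qed
        have "(\<integral>\<omega>. (K \<omega> * indicator A \<omega> * cos (\<xi> \<phi> \<omega>)) * indicator B (\<xi> \<psi> \<omega>) \<partial>M) = 0"
          by (rule weighted_cos_sin_zero[where c=c]) (use t1 t2 bd in \<open>auto simp: mult.assoc\<close>)
        moreover have "(\<integral>\<omega>. (K \<omega> * indicator A \<omega> * sin (\<xi> \<phi> \<omega>)) * indicator B (\<xi> \<psi> \<omega>) \<partial>M) = 0"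
          by (rule weighted_cos_sin_zero[where c=c]) (use t3 t4 bd in \<open>auto simp: mult.assoc\<close>)
        ultimately show ?thesis
          by (simp add: ind cong: Bochner_Integration.integral_cong)
      qed
      then show ?thesis unfolding P_def by auto
    qed
  qed
  \<comment> \<open>Cutting with \<open>space M\<close> lets the empty family stand for the whole
    space, which the complement step below uses.\<close>
  define Q where "Q = {space M \<inter> \<Inter>F | F. finite F \<and> F \<subseteq> E}"
  have PQ: "P q" if "q \<in> Q" for q
  proof -
    from that have "\<exists>F. q = space M \<inter> \<Inter>F \<and> finite F \<and> F \<subseteq> E" by (simp add: Q_def)
    then obtain F where F: "finite F" "F \<subseteq> E" and q: "q = space M \<inter> \<Inter>F" by (elim exE conjE)
    from F have "P (space M \<inter> \<Inter>F)"
    proof (induction F rule: finite_induct)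
      case empty
      have "(\<integral>\<omega>. K \<omega> * indicator (space M) \<omega> * f \<omega> \<partial>M) = (\<integral>\<omega>. K \<omega> * f \<omega> \<partial>M)" for f
        by (rule Bochner_Integration.integral_cong) auto
      then show ?case using z by (auto simp: P_def T_def)
    next
      case (insert g F)
      then have "P (space M \<inter> \<Inter>F \<inter> g)" using step by auto
      then show ?case by (simp add: Int_ac)
    qed
    then show ?thesis using q by simp
  qed
  have "Int_stable Q"
  proof (rule Int_stableI)
    fix a b assume "a \<in> Q" "b \<in> Q"
    then obtain F F' where "finite F" "F \<subseteq> E" "a = space M \<inter> \<Inter>F" "finite F'" "F' \<subseteq> E" "b = space M \<inter> \<Inter>F'"
      by (auto simp: Q_def)
    then show "a \<inter> b \<in> Q" unfolding Q_def by (intro CollectI exI[of _ "F \<union> F'"]) auto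
  qed
  moreover have QP: "Q \<subseteq> Pow (space M)" by (auto simp: Q_def)
  moreover have "E \<subseteq> Q"
  proof
    fix g assume g: "g \<in> E"
    then have "g \<subseteq> space M" using EM sets.sets_into_space by auto
    then have "g = space M \<inter> \<Inter>{g}" by auto
    then show "g \<in> Q" unfolding Q_def using g by (intro CollectI exI[of _ "{g}"]) auto
  qed
  then have "A \<in> sigma_sets (space M) Q" using A sigma_sets_mono'[of E Q] unfolding sets_noise E_def by auto
  ultimately have "A \<in> sets M \<and> (LINT \<omega>:A|M. K \<omega>) = 0"
  proof (induction rule: sigma_sets_induct_disjoint)
    case (basic A)
    \<comment> \<open>The zero test function has cosine 1 almost surely and so recovers the plain
      integral of \<open>K\<close> over \<open>A\<close>.\<close>
    have "(\<lambda>p. 0) \<in> T" using L2_st_zero by (auto simp: T_def)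
    note [measurable] = Tm[OF this]
    have A[measurable]: "A \<in> sets M" using PQ[OF basic] by (simp add: P_def)
    have "(LINT \<omega>:A|M. K \<omega>) = (\<integral>\<omega>. K \<omega> * indicator A \<omega> * cos (\<xi> (\<lambda>p. 0) \<omega>) \<partial>M)"
      unfolding set_lebesgue_integral_def by (rule integral_cong_AE) (use xi_zero in \<open>auto elim!: eventually_mono\<close>)
    then show ?case using PQ[OF basic] \<open>(\<lambda>p. 0) \<in> T\<close> by (auto simp: P_def)
  next
    case empty then show ?case by (simp add: set_lebesgue_integral_def)
  next
    case (compl A)
    have "space M \<in> Q" unfolding Q_def by (intro CollectI exI[of _ "{}"]) auto
    have i: "integrable M K" by (rule integrable_const_bound[where B=c]) (use b in auto)
    have "(\<lambda>p. 0) \<in> T" using L2_st_zero by (auto simp: T_def)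
    note [measurable] = Tm[OF this]
    have "(\<integral>\<omega>. K \<omega> \<partial>M) = (\<integral>\<omega>. K \<omega> * indicator (space M) \<omega> * cos (\<xi> (\<lambda>p. 0) \<omega>) \<partial>M)"
      by (rule integral_cong_AE) (use xi_zero in \<open>auto elim!: eventually_mono\<close>)
    then have K0: "(\<integral>\<omega>. K \<omega> \<partial>M) = 0" using PQ[OF \<open>space M \<in> Q\<close>] \<open>(\<lambda>p. 0) \<in> T\<close> by (auto simp: P_def)
    have Am[measurable]: "A \<in> sets M" using compl by auto
    have "(LINT \<omega>:(space M - A)|M. K \<omega>) = (\<integral>\<omega>. K \<omega> - indicator A \<omega> *\<^sub>R K \<omega> \<partial>M)"
      unfolding set_lebesgue_integral_def by (rule Bochner_Integration.integral_cong) (auto simp: indicator_def)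
    also have "\<dots> = (\<integral>\<omega>. K \<omega> \<partial>M) - (LINT \<omega>:A|M. K \<omega>)" unfolding set_lebesgue_integral_def
      by (rule Bochner_Integration.integral_diff[OF i]) (rule integrable_mult_indicator[OF Am i])
    finally show ?case using K0 compl by auto
  next
    case (union A)
    have i: "integrable M K" by (rule integrable_const_bound[where B=c]) (use b in auto)
    have U: "(\<Union>i. A i) \<in> sets M" using union by auto
    have "(LINT \<omega>:(\<Union>i. A i)|M. K \<omega>) = (\<Sum>i. LINT \<omega>:A i|M. K \<omega>)"
    proof (rule lebesgue_integral_countable_add)
      show "set_integrable M (\<Union>i. A i) K" unfolding set_integrable_def by (rule integrable_mult_indicator[OF U i])
    qed (use union in \<open>auto simp: disjoint_family_on_def\<close>)
    then show ?case using union U by auto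
  qed
  then show ?thesis by (simp add: set_lebesgue_integral_def mult.commute)
qed

lemma trig_products:
  fixes a b :: real
  shows "cos a * cos b = (cos (a - b) + cos (a + b)) / 2" "cos a * sin b = (sin (a + b) - sin (a - b)) / 2"
    "sin a * cos b = (sin (a + b) + sin (a - b)) / 2" "sin a * sin b = (cos (a - b) - cos (a + b)) / 2"
  by (simp_all add: cos_add sin_add cos_diff sin_diff)

lemma trig_integrable:
  assumes [measurable]: "X \<in> borel_measurable M"
  shows "integrable M (\<lambda>\<omega>. cos (X \<omega> :: real))" "integrable M (\<lambda>\<omega>. sin (X \<omega>))"
  by (rule integrable_const_bound[where B=1]; simp)+

lemma integrable_ind: "A \<in> sets M \<Longrightarrow> integrable M (indicator A :: _ \<Rightarrow> real)"
  by (rule integrable_const_bound[where B=1]) auto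

text \<open>A test function \<open>\<phi>\<close> supported in \<open>D\<close> is orthogonal to
  \<open>\<psi>\<close>, so \<open>\<xi> \<psi> + \<xi> \<phi>\<close> and
  \<open>\<xi> \<psi> - \<xi> \<phi>\<close> have the same variance. By the product formulas the
  centred cosine and the sine of \<open>\<xi> \<psi>\<close> are then orthogonal to all cosines and
  sines of \<open>\<xi> \<phi>\<close>, and \<open>noise_total\<close> passes from these to the
  events of \<open>noise D\<close>.\<close>

lemma noise_trig:
  assumes \<psi>: "L2_st \<psi>" "\<And>p. p \<in> D \<Longrightarrow> \<psi> p = 0" and A: "A \<in> sets (noise D)"
  shows "(\<integral>\<omega>. cos (\<xi> \<psi> \<omega>) * indicator A \<omega> \<partial>M) = exp (- L2_norm_sq \<psi> / 2) * prob A"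
    "(\<integral>\<omega>. sin (\<xi> \<psi> \<omega>) * indicator A \<omega> \<partial>M) = 0"
proof -
  note [measurable] = xi_measurable[OF \<psi>(1)]
  have AM[measurable]: "A \<in> sets M" using A sets_noise_sub by auto
  have vals: "(\<integral>\<omega>. cos (\<xi> \<psi> \<omega> + \<xi> \<phi> \<omega>) \<partial>M) = exp (- (L2_norm_sq \<psi> + L2_norm_sq \<phi>) / 2)"
    "(\<integral>\<omega>. cos (\<xi> \<psi> \<omega> - \<xi> \<phi> \<omega>) \<partial>M) = exp (- (L2_norm_sq \<psi> + L2_norm_sq \<phi>) / 2)"
    "(\<integral>\<omega>. sin (\<xi> \<psi> \<omega> + \<xi> \<phi> \<omega>) \<partial>M) = 0" "(\<integral>\<omega>. sin (\<xi> \<psi> \<omega> - \<xi> \<phi> \<omega>) \<partial>M) = 0"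
    if \<phi>: "L2_st \<phi>" "\<And>p. p \<notin> D \<Longrightarrow> \<phi> p = 0" for \<phi>
  proof -
    have ip: "ip \<psi> \<phi> = 0" by (rule ip_disjoint[of "-D"]) (use \<phi> \<psi> in auto)
    have s: "L2_st (\<lambda>p. \<psi> p + \<phi> p)" "L2_st (\<lambda>p. \<psi> p - \<phi> p)"
      using L2_st_lin[OF \<psi>(1) \<phi>(1), of 1 1] L2_st_lin[OF \<psi>(1) \<phi>(1), of 1 "-1"] by auto
    have n: "L2_norm_sq (\<lambda>p. \<psi> p + \<phi> p) = L2_norm_sq \<psi> + L2_norm_sq \<phi>" "L2_norm_sq (\<lambda>p. \<psi> p - \<phi> p) = L2_norm_sq \<psi> + L2_norm_sq \<phi>"
      using L2_norm_sq_lin[OF \<psi>(1) \<phi>(1), of 1 1] L2_norm_sq_lin[OF \<psi>(1) \<phi>(1), of 1 "-1"] ip by auto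
    note [measurable] = xi_measurable[OF \<phi>(1)] xi_measurable[OF s(1)] xi_measurable[OF s(2)]
    have "(\<integral>\<omega>. f (\<xi> \<psi> \<omega> + \<xi> \<phi> \<omega>) \<partial>M) = (\<integral>\<omega>. f (\<xi> (\<lambda>p. \<psi> p + \<phi> p) \<omega>) \<partial>M)"
      "(\<integral>\<omega>. f (\<xi> \<psi> \<omega> - \<xi> \<phi> \<omega>) \<partial>M) = (\<integral>\<omega>. f (\<xi> (\<lambda>p. \<psi> p - \<phi> p) \<omega>) \<partial>M)"
      if [measurable]: "f \<in> borel_measurable borel" for f :: "real \<Rightarrow> real"
      by (intro integral_cong_AE eventually_mono[OF xi_add[OF \<psi>(1) \<phi>(1)]] eventually_mono[OF xi_diff[OF \<psi>(1) \<phi>(1)]]; simp)+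
    then show "(\<integral>\<omega>. cos (\<xi> \<psi> \<omega> + \<xi> \<phi> \<omega>) \<partial>M) = exp (- (L2_norm_sq \<psi> + L2_norm_sq \<phi>) / 2)"
      "(\<integral>\<omega>. cos (\<xi> \<psi> \<omega> - \<xi> \<phi> \<omega>) \<partial>M) = exp (- (L2_norm_sq \<psi> + L2_norm_sq \<phi>) / 2)"
      "(\<integral>\<omega>. sin (\<xi> \<psi> \<omega> + \<xi> \<phi> \<omega>) \<partial>M) = 0" "(\<integral>\<omega>. sin (\<xi> \<psi> \<omega> - \<xi> \<phi> \<omega>) \<partial>M) = 0"
      using xi_cos_sin[OF s(1)] xi_cos_sin[OF s(2)] n by auto
  qed
  let ?e = "exp (- L2_norm_sq \<psi> / 2)"
  have "(\<integral>\<omega>. (cos (\<xi> \<psi> \<omega>) - ?e) * indicator A \<omega> \<partial>M) = 0"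
  proof (rule noise_total[OF _ _ _ A, where c="1 + ?e"])
    show "\<bar>cos (\<xi> \<psi> \<omega>) - ?e\<bar> \<le> 1 + ?e" for \<omega>
      by (rule order_trans[OF abs_triangle_ineq4]) auto
    fix \<phi> assume \<phi>: "L2_st \<phi>" "\<And>p. p \<notin> D \<Longrightarrow> \<phi> p = 0"
    note [measurable] = xi_measurable[OF \<phi>(1)]
    have e: "exp (- (L2_norm_sq \<psi> + L2_norm_sq \<phi>) / 2) = ?e * exp (- L2_norm_sq \<phi> / 2)"
      by (simp add: exp_add[symmetric] add_divide_distrib)
    show "(\<integral>\<omega>. (cos (\<xi> \<psi> \<omega>) - ?e) * cos (\<xi> \<phi> \<omega>) \<partial>M) = 0 \<and> (\<integral>\<omega>. (cos (\<xi> \<psi> \<omega>) - ?e) * sin (\<xi> \<phi> \<omega>) \<partial>M) = 0"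
      using vals[OF \<phi>] xi_cos_sin[OF \<phi>(1)] e
      by (simp add: left_diff_distrib trig_products trig_integrable)
  qed measurable
  moreover have "integrable M (\<lambda>\<omega>. cos (\<xi> \<psi> \<omega>) * indicator A \<omega>)"
    by (rule integrable_const_bound[where B=1]) (auto simp: indicator_def)
  ultimately show "(\<integral>\<omega>. cos (\<xi> \<psi> \<omega>) * indicator A \<omega> \<partial>M) = exp (- L2_norm_sq \<psi> / 2) * prob A"
    using sets.sets_into_space[OF AM] integrable_ind[OF AM] by (simp add: left_diff_distrib Int_absorb2)
  show "(\<integral>\<omega>. sin (\<xi> \<psi> \<omega>) * indicator A \<omega> \<partial>M) = 0"
  proof (rule noise_total[OF _ _ _ A, where c="1"])
    fix \<phi> assume \<phi>: "L2_st \<phi>" "\<And>p. p \<notin> D \<Longrightarrow> \<phi> p = 0"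
    note [measurable] = xi_measurable[OF \<phi>(1)]
    show "(\<integral>\<omega>. sin (\<xi> \<psi> \<omega>) * cos (\<xi> \<phi> \<omega>) \<partial>M) = 0 \<and> (\<integral>\<omega>. sin (\<xi> \<psi> \<omega>) * sin (\<xi> \<phi> \<omega>) \<partial>M) = 0"
      using vals[OF \<phi>] by (simp add: trig_products trig_integrable)
  qed auto
qed

lemma noise_char:
  assumes \<psi>: "L2_st \<psi>" "\<And>p. p \<in> D \<Longrightarrow> \<psi> p = 0" and A: "A \<in> sets (noise D)"
  shows "(CLINT \<omega>|M. indicator A \<omega> *\<^sub>R iexp (\<xi> \<psi> \<omega>)) = complex_of_real (prob A * exp (- L2_norm_sq \<psi> / 2))"
proof -
  note [measurable] = xi_measurable[OF \<psi>(1)]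
  have AM[measurable]: "A \<in> sets M" using A sets_noise_sub by auto
  have i: "complex_integrable M (\<lambda>\<omega>. indicator A \<omega> *\<^sub>R iexp (\<xi> \<psi> \<omega>))"
    by (rule integrable_const_bound[where B=1]) (auto simp: indicator_def)
  have "Re (CLINT \<omega>|M. indicator A \<omega> *\<^sub>R iexp (\<xi> \<psi> \<omega>)) = prob A * exp (- L2_norm_sq \<psi> / 2)"
    "Im (CLINT \<omega>|M. indicator A \<omega> *\<^sub>R iexp (\<xi> \<psi> \<omega>)) = 0"
    using noise_trig[OF assms] by (simp_all add: integral_Re[OF i, symmetric] integral_Im[OF i, symmetric] Re_exp Im_exp mult.commute)
  then show ?thesis by (intro complex_eqI) auto
qed

text \<open>By \<open>noise_trig\<close> the weight \<open>indicator A - prob A\<close> integrates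
  to zero against every cosine and sine of multiples of \<open>\<xi> \<psi>\<close>, hence against
  every event of \<open>\<xi> \<psi>\<close>.\<close>

lemma noise_indep_prob:
  assumes \<psi>: "L2_st \<psi>" "\<And>p. p \<in> D \<Longrightarrow> \<psi> p = 0" and A: "A \<in> sets (noise D)" and B[measurable]: "B \<in> sets borel"
  shows "prob (A \<inter> (\<xi> \<psi> -` B \<inter> space M)) = prob A * prob (\<xi> \<psi> -` B \<inter> space M)"
proof -
  have AM[measurable]: "A \<in> sets M" using A sets_noise_sub by auto
  note [measurable] = xi_measurable[OF \<psi>(1)]
  have "(\<integral>\<omega>. (indicator A \<omega> - prob A) * indicator B (\<xi> \<psi> \<omega>) \<partial>M) = 0"
  proof (rule weighted_cos_sin_zero[where c=1])
    show "\<bar>indicator A \<omega> - prob A\<bar> \<le> 1" for \<omega> by (auto simp: indicator_def)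
    fix l :: real
    have L: "L2_st (\<lambda>p. l * \<psi> p)" "\<And>p. p \<in> D \<Longrightarrow> l * \<psi> p = 0" using \<psi> L2_st_cmult by auto
    note [measurable] = xi_measurable[OF L(1)]
    have sp: "space M \<in> sets (noise D)" using sets.top[of "noise D"] by simp
    have z: "(\<integral>\<omega>. cos (\<xi> (\<lambda>p. l * \<psi> p) \<omega>) * indicator A \<omega> - prob A * cos (\<xi> (\<lambda>p. l * \<psi> p) \<omega>) \<partial>M) = 0"
      "(\<integral>\<omega>. sin (\<xi> (\<lambda>p. l * \<psi> p) \<omega>) * indicator A \<omega> - prob A * sin (\<xi> (\<lambda>p. l * \<psi> p) \<omega>) \<partial>M) = 0"
    proof -
      have "integrable M (\<lambda>\<omega>. cos (\<xi> (\<lambda>p. l * \<psi> p) \<omega>) * indicator A \<omega>)" "integrable M (\<lambda>\<omega>. sin (\<xi> (\<lambda>p. l * \<psi> p) \<omega>) * indicator A \<omega>)"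
        by (rule integrable_const_bound[where B=1]; auto simp: indicator_def)+
      then show "(\<integral>\<omega>. cos (\<xi> (\<lambda>p. l * \<psi> p) \<omega>) * indicator A \<omega> - prob A * cos (\<xi> (\<lambda>p. l * \<psi> p) \<omega>) \<partial>M) = 0"
        "(\<integral>\<omega>. sin (\<xi> (\<lambda>p. l * \<psi> p) \<omega>) * indicator A \<omega> - prob A * sin (\<xi> (\<lambda>p. l * \<psi> p) \<omega>) \<partial>M) = 0"
        using noise_trig[OF L A] xi_cos_sin[OF L(1)] by (simp_all add: trig_integrable)
    qed
    have "(\<integral>\<omega>. (indicator A \<omega> - prob A) * cos (l * \<xi> \<psi> \<omega>) \<partial>M) = (\<integral>\<omega>. cos (\<xi> (\<lambda>p. l * \<psi> p) \<omega>) * indicator A \<omega> - prob A * cos (\<xi> (\<lambda>p. l * \<psi> p) \<omega>) \<partial>M)"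
      "(\<integral>\<omega>. (indicator A \<omega> - prob A) * sin (l * \<xi> \<psi> \<omega>) \<partial>M) = (\<integral>\<omega>. sin (\<xi> (\<lambda>p. l * \<psi> p) \<omega>) * indicator A \<omega> - prob A * sin (\<xi> (\<lambda>p. l * \<psi> p) \<omega>) \<partial>M)"
      by (intro integral_cong_AE; use xi_cmult[OF \<psi>(1), of l] in \<open>auto elim!: eventually_mono simp: algebra_simps\<close>)+
    then show "(\<integral>\<omega>. (indicator A \<omega> - prob A) * cos (l * \<xi> \<psi> \<omega>) \<partial>M) = 0"
      "(\<integral>\<omega>. (indicator A \<omega> - prob A) * sin (l * \<xi> \<psi> \<omega>) \<partial>M) = 0" using z by auto
  qed measurable
  moreover have "(\<integral>\<omega>. (indicator A \<omega> - prob A) * indicator B (\<xi> \<psi> \<omega>) \<partial>M) =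
    (\<integral>\<omega>. indicator (A \<inter> (\<xi> \<psi> -` B \<inter> space M)) \<omega> - prob A * indicator (\<xi> \<psi> -` B \<inter> space M) \<omega> \<partial>M)"
    by (rule Bochner_Integration.integral_cong) (auto simp: indicator_def)
  moreover have "\<dots> = prob (A \<inter> (\<xi> \<psi> -` B \<inter> space M)) - prob A * prob (\<xi> \<psi> -` B \<inter> space M)"
    by (subst Bochner_Integration.integral_diff) (auto simp: Int_assoc intro!: integrable_ind)
  ultimately show ?thesis by simp
qed

lemma Int_stable_vimages: "Int_stable {f -` A \<inter> S |A. A \<in> sets N}"
proof (rule Int_stableI)
  fix a b assume "a \<in> {f -` A \<inter> S |A. A \<in> sets N}" "b \<in> {f -` A \<inter> S |A. A \<in> sets N}"
  then obtain A B where "A \<in> sets N" "B \<in> sets N" and ab: "a = f -` A \<inter> S" "b = f -` B \<inter> S" by auto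
  then have "A \<inter> B \<in> sets N" by auto
  moreover have "a \<inter> b = f -` (A \<inter> B) \<inter> S" using ab by auto
  ultimately show "a \<inter> b \<in> {f -` A \<inter> S |A. A \<in> sets N}" by blast
qed

lemma noise_indep_var:
  assumes \<psi>: "L2_st \<psi>" "\<And>p. p \<in> D \<Longrightarrow> \<psi> p = 0" and Y: "Y \<in> borel_measurable (noise D)"
  shows "indep_var borel Y borel (\<xi> \<psi>)"
proof -
  note [measurable] = xi_measurable[OF \<psi>(1)] noise_measurable_M[OF Y]
  have "indep_set {Y -` A \<inter> space M |A. A \<in> sets borel} {\<xi> \<psi> -` A \<inter> space M |A. A \<in> sets borel}"
  proof (rule indep_setI)
    fix a b assume "a \<in> {Y -` A \<inter> space M |A. A \<in> sets borel}" "b \<in> {\<xi> \<psi> -` A \<inter> space M |A. A \<in> sets borel}"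
    then show "prob (a \<inter> b) = prob a * prob b"
      using noise_indep_prob[OF \<psi>] measurable_sets[OF Y] by auto
  qed auto
  then have "indep_set (sigma_sets (space M) {Y -` A \<inter> space M |A. A \<in> sets borel})
    (sigma_sets (space M) {\<xi> \<psi> -` A \<inter> space M |A. A \<in> sets borel})"
    by (intro indep_set_sigma_sets Int_stable_vimages)
  then show ?thesis unfolding indep_var_eq by auto
qed

lemma noise_xi_mult:
  assumes \<psi>: "L2_st \<psi>" "\<And>p. p \<in> D \<Longrightarrow> \<psi> p = 0" and Y: "Y \<in> borel_measurable (noise D)" "integrable M Y"
  shows "integrable M (\<lambda>\<omega>. Y \<omega> * \<xi> \<psi> \<omega>)" "(\<integral>\<omega>. Y \<omega> * \<xi> \<psi> \<omega> \<partial>M) = (0::real)"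
    "integrable M (\<lambda>\<omega>. Y \<omega> * (\<xi> \<psi> \<omega>)\<^sup>2)" "(\<integral>\<omega>. Y \<omega> * (\<xi> \<psi> \<omega>)\<^sup>2 \<partial>M) = (\<integral>\<omega>. Y \<omega> \<partial>M) * L2_norm_sq \<psi>"
proof -
  have i: "indep_var borel Y borel (\<xi> \<psi>)" by (rule noise_indep_var) (use assms in auto)
  have i2: "indep_var borel ((\<lambda>x. x) \<circ> Y) borel ((\<lambda>x. x\<^sup>2) \<circ> \<xi> \<psi>)" by (rule indep_var_compose[OF i]) auto
  note m = xi_moments[OF \<psi>(1)]
  show "integrable M (\<lambda>\<omega>. Y \<omega> * \<xi> \<psi> \<omega>)" "(\<integral>\<omega>. Y \<omega> * \<xi> \<psi> \<omega> \<partial>M) = 0"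
    using indep_var_integrable[OF i Y(2) sqint_integrable[OF m(1)]] indep_var_lebesgue_integral[OF i Y(2) sqint_integrable[OF m(1)]] m by auto
  have i2': "integrable M ((\<lambda>x. x\<^sup>2) \<circ> \<xi> \<psi>)" using m(1) by (simp add: sqint_def comp_def)
  show "integrable M (\<lambda>\<omega>. Y \<omega> * (\<xi> \<psi> \<omega>)\<^sup>2)" "(\<integral>\<omega>. Y \<omega> * (\<xi> \<psi> \<omega>)\<^sup>2 \<partial>M) = (\<integral>\<omega>. Y \<omega> \<partial>M) * L2_norm_sq \<psi>"
    using indep_var_integrable[OF i2 _ i2'] indep_var_lebesgue_integral[OF i2 _ i2'] m Y(2) by (auto simp: comp_def)
qed

text \<open>Polarisation of the quadratic case, applied to \<open>\<psi> + \<psi>'\<close> and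
  \<open>\<psi> - \<psi>'\<close>.\<close>

lemma noise_xi_mult2:
  assumes \<psi>: "L2_st \<psi>" "\<And>p. p \<in> D \<Longrightarrow> \<psi> p = 0" and \<psi>': "L2_st \<psi>'" "\<And>p. p \<in> D \<Longrightarrow> \<psi>' p = 0"
    and Y: "Y \<in> borel_measurable (noise D)" "integrable M Y"
  shows "integrable M (\<lambda>\<omega>. Y \<omega> * (\<xi> \<psi> \<omega> * \<xi> \<psi>' \<omega>))"
    "(\<integral>\<omega>. Y \<omega> * (\<xi> \<psi> \<omega> * \<xi> \<psi>' \<omega>) \<partial>M) = (\<integral>\<omega>. Y \<omega> \<partial>M) * ip \<psi> \<psi>'"
proof -
  note [measurable] = xi_measurable[OF \<psi>(1)] xi_measurable[OF \<psi>'(1)] noise_measurable_M[OF Y(1)]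
  have s: "L2_st (\<lambda>p. \<psi> p + \<psi>' p)" "L2_st (\<lambda>p. \<psi> p - \<psi>' p)"
    using L2_st_lin[OF \<psi>(1) \<psi>'(1), of 1 1] L2_st_lin[OF \<psi>(1) \<psi>'(1), of 1 "-1"] by auto
  note [measurable] = xi_measurable[OF s(1)] xi_measurable[OF s(2)]
  have z: "\<And>p. p \<in> D \<Longrightarrow> \<psi> p + \<psi>' p = 0" "\<And>p. p \<in> D \<Longrightarrow> \<psi> p - \<psi>' p = 0" using \<psi> \<psi>' by auto
  note a = noise_xi_mult(3,4)[OF s(1) z(1) Y] noise_xi_mult(3,4)[OF s(2) z(2) Y]
  have e: "AE \<omega> in M. Y \<omega> * (\<xi> \<psi> \<omega> * \<xi> \<psi>' \<omega>) =
      (Y \<omega> * (\<xi> (\<lambda>p. \<psi> p + \<psi>' p) \<omega>)\<^sup>2 - Y \<omega> * (\<xi> (\<lambda>p. \<psi> p - \<psi>' p) \<omega>)\<^sup>2) / 4"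
    using xi_add[OF \<psi>(1) \<psi>'(1)] xi_diff[OF \<psi>(1) \<psi>'(1)]
    proof eventually_elim
    case (elim \<omega>)
    show ?case unfolding elim by (simp add: power2_eq_square field_simps)
  qed
  show "integrable M (\<lambda>\<omega>. Y \<omega> * (\<xi> \<psi> \<omega> * \<xi> \<psi>' \<omega>))"
    by (rule integrable_cong_AE[THEN iffD2, OF _ _ e]) (use a in auto)
  have "(\<integral>\<omega>. Y \<omega> * (\<xi> \<psi> \<omega> * \<xi> \<psi>' \<omega>) \<partial>M) =
      (\<integral>\<omega>. (Y \<omega> * (\<xi> (\<lambda>p. \<psi> p + \<psi>' p) \<omega>)\<^sup>2 - Y \<omega> * (\<xi> (\<lambda>p. \<psi> p - \<psi>' p) \<omega>)\<^sup>2) / 4 \<partial>M)"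
    by (rule integral_cong_AE[OF _ _ e]) auto
  also have "\<dots> = (\<integral>\<omega>. Y \<omega> \<partial>M) * (L2_norm_sq (\<lambda>p. \<psi> p + \<psi>' p) - L2_norm_sq (\<lambda>p. \<psi> p - \<psi>' p)) / 4"
    using a by (simp add: right_diff_distrib)
  also have "L2_norm_sq (\<lambda>p. \<psi> p + \<psi>' p) - L2_norm_sq (\<lambda>p. \<psi> p - \<psi>' p) = 4 * ip \<psi> \<psi>'"
    using L2_norm_sq_lin[OF \<psi>(1) \<psi>'(1), of 1 1] L2_norm_sq_lin[OF \<psi>(1) \<psi>'(1), of 1 "-1"] by simp
  finally show "(\<integral>\<omega>. Y \<omega> * (\<xi> \<psi> \<omega> * \<xi> \<psi>' \<omega>) \<partial>M) = (\<integral>\<omega>. Y \<omega> \<partial>M) * ip \<psi> \<psi>'" by simp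
qed

end

section \<open>Stochastic integrals\<close>

text \<open>The squared norm with values in the extended half line: limits and isometries can be
  stated before square integrability is known, which is then read off from finiteness
  (\<open>sqnorm_finite\<close>).\<close>

definition sqnorm :: "'b measure \<Rightarrow> ('b \<Rightarrow> real) \<Rightarrow> ennreal" where
  "sqnorm N f = (\<integral>\<^sup>+x. ennreal ((f x)\<^sup>2) \<partial>N)"

lemma sqnorm_sqint: "sqint N f \<Longrightarrow> sqnorm N f = ennreal (\<integral>x. (f x)\<^sup>2 \<partial>N)"
  unfolding sqnorm_def sqint_def by (intro nn_integral_eq_integral) auto

lemma sqnorm_finite: "f \<in> borel_measurable N \<Longrightarrow> sqnorm N f < \<infinity> \<longleftrightarrow> sqint N f"
  unfolding sqnorm_def sqint_def by (subst integrable_iff_bounded) auto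

lemma sqnorm_mono: "(\<And>x. x \<in> space N \<Longrightarrow> \<bar>f x\<bar> \<le> \<bar>g x\<bar>) \<Longrightarrow> sqnorm N f \<le> sqnorm N g"
  unfolding sqnorm_def by (intro nn_integral_mono ennreal_leI) (simp add: abs_le_square_iff)

lemma sqnorm_cong: "(\<And>x. x \<in> space N \<Longrightarrow> f x = g x) \<Longrightarrow> sqnorm N f = sqnorm N g"
  unfolding sqnorm_def by (rule nn_integral_cong) auto

lemma sqnorm_cong_AE: "AE x in N. f x = g x \<Longrightarrow> sqnorm N f = sqnorm N g"
  unfolding sqnorm_def by (rule nn_integral_cong_AE) (auto elim: eventually_mono)

lemma sqnorm_cmult: "f \<in> borel_measurable N \<Longrightarrow> sqnorm N (\<lambda>x. c * f x) = ennreal (c\<^sup>2) * sqnorm N f"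
  unfolding sqnorm_def by (simp add: power_mult_distrib ennreal_mult nn_integral_cmult)

text \<open>The crude factor 2 stands in for the triangle inequality and avoids square roots. It is
  the source of most numerical constants in the estimates below.\<close>

lemma sqnorm_add_le:
  assumes [measurable]: "f \<in> borel_measurable N" "g \<in> borel_measurable N"
  shows "sqnorm N (\<lambda>x. f x + g x) \<le> 2 * sqnorm N f + 2 * sqnorm N g"
proof -
  have "sqnorm N (\<lambda>x. f x + g x) \<le> (\<integral>\<^sup>+x. 2 * ennreal ((f x)\<^sup>2) + 2 * ennreal ((g x)\<^sup>2) \<partial>N)"
    unfolding sqnorm_def
  proof (rule nn_integral_mono)
    fix x
    have "ennreal ((f x + g x)\<^sup>2) \<le> ennreal (2 * (f x)\<^sup>2 + 2 * (g x)\<^sup>2)" by (rule ennreal_leI[OF square_sum_le])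
    then show "ennreal ((f x + g x)\<^sup>2) \<le> 2 * ennreal ((f x)\<^sup>2) + 2 * ennreal ((g x)\<^sup>2)"
      by (simp add: ennreal_mult)
  qed
  also have "\<dots> = 2 * sqnorm N f + 2 * sqnorm N g" unfolding sqnorm_def by (subst nn_integral_add) (auto simp: nn_integral_cmult)
  finally show ?thesis .
qed

lemma sqnorm_minus: "sqnorm N (\<lambda>x. - f x) = sqnorm N f" by (simp add: sqnorm_def)

lemma sqnorm_commute: "sqnorm N (\<lambda>x. f x - g x) = sqnorm N (\<lambda>x. g x - f x)"
  by (simp add: sqnorm_def power2_commute)

lemma sqnorm_diff_le:
  assumes [measurable]: "f \<in> borel_measurable N" "g \<in> borel_measurable N"
  shows "sqnorm N (\<lambda>x. f x - g x) \<le> 2 * sqnorm N f + 2 * sqnorm N g"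
  using sqnorm_add_le[of f N "\<lambda>x. - g x"] sqnorm_minus[of N g] by simp

lemma sqnorm_triangle:
  assumes [measurable]: "f \<in> borel_measurable N" "g \<in> borel_measurable N" "h \<in> borel_measurable N"
  shows "sqnorm N (\<lambda>x. f x - h x) \<le> 2 * sqnorm N (\<lambda>x. f x - g x) + 2 * sqnorm N (\<lambda>x. g x - h x)"
  using sqnorm_add_le[of "\<lambda>x. f x - g x" N "\<lambda>x. g x - h x"] by simp

lemma sqint_Cauchy_Schwarz:
  assumes "sqint N f" "sqint N g"
  shows "(\<integral>x. f x * g x \<partial>N)\<^sup>2 \<le> (\<integral>x. (f x)\<^sup>2 \<partial>N) * (\<integral>x. (g x)\<^sup>2 \<partial>N)"
proof -
  let ?A = "\<integral>x. (f x)\<^sup>2 \<partial>N" and ?B = "\<integral>x. (g x)\<^sup>2 \<partial>N" and ?C = "\<integral>x. f x * g x \<partial>N"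
  note [simp] = sqint_mult_integrable[OF assms] and i = assms[unfolded sqint_def]
  have q: "0 \<le> a\<^sup>2 * ?A + 2 * a * b * ?C + b\<^sup>2 * ?B" for a b
  proof -
    have "0 \<le> (\<integral>x. (a * f x + b * g x)\<^sup>2 \<partial>N)" by simp
    also have "(\<lambda>x. (a * f x + b * g x)\<^sup>2) = (\<lambda>x. a\<^sup>2 * (f x)\<^sup>2 + 2 * a * b * (f x * g x) + b\<^sup>2 * (g x)\<^sup>2)"
      by (auto simp: power2_sum power_mult_distrib)
    finally show ?thesis using i by simp
  qed
  have "0 \<le> ?A" "0 \<le> ?B" by simp_all
  show ?thesis
  proof (cases "?B = 0")
    case True
    have "?C = 0"
    proof (rule ccontr)
      assume "?C \<noteq> 0"
      \<comment> \<open>With \<open>?B = 0\<close> the quadratic form at \<open>a = 1\<close> is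
        affine in \<open>b\<close>; this \<open>b\<close> gives it the value -1.\<close>
      then show False using q[of 1 "- (?A + 1) / (2 * ?C)"] True by (simp add: field_simps)
    qed
    then show ?thesis using True by simp
  next
    case False
    have B: "?B > 0" by (rule le_neq_trans[OF \<open>0 \<le> ?B\<close> False[symmetric]])
    have "0 \<le> ?B * (?A * ?B - ?C\<^sup>2)" using q[of ?B "- ?C"] by (simp add: power2_eq_square algebra_simps)
    then show ?thesis using B by (simp add: zero_le_mult_iff)
  qed
qed

lemma tendsto_ennreal_squeeze_0:
  fixes f g :: "nat \<Rightarrow> ennreal"
  assumes "\<And>n. f n \<le> g n" "g \<longlonglongrightarrow> 0" shows "f \<longlonglongrightarrow> 0"
  by (rule tendsto_sandwich[OF _ _ tendsto_const assms(2)]) (use assms(1) in auto)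

lemma tendsto_ennreal_lin_0:
  fixes f g :: "nat \<Rightarrow> ennreal"
  assumes "f \<longlonglongrightarrow> 0" "g \<longlonglongrightarrow> 0" "c < \<infinity>" "d < \<infinity>" shows "(\<lambda>n. c * f n + d * g n) \<longlonglongrightarrow> 0"
proof -
  have "(\<lambda>n. c * f n + d * g n) \<longlonglongrightarrow> c * 0 + d * 0"
    using assms by (intro tendsto_add ennreal_tendsto_cmult) auto
  then show ?thesis by simp
qed

definition past :: "real \<Rightarrow> (real \<times> real) set" where "past a = {p. fst p \<le> a}"

lemma past_borel [measurable]: "past a \<in> sets borel"
proof -
  have "past a = {..a} \<times> UNIV" by (auto simp: past_def)
  then show ?thesis by (simp add: borel_closed closed_Times)
qed

lemma past_mono: "a \<le> b \<Longrightarrow> past a \<subseteq> past b" by (auto simp: past_def)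

text \<open>Simple integrands, coded as lists of triples \<open>(h, a, \<phi>)\<close> standing for \<open>h \<cdot> \<phi>\<close>, where the random
  factor \<open>h\<close> depends only on the noise up to time \<open>a\<close> and \<open>\<phi>\<close> lives after time \<open>a\<close>.\<close>

type_synonym 'a integrand = "(('a \<Rightarrow> real) \<times> real \<times> (real \<times> real \<Rightarrow> real)) list"

definition sproc :: "'a integrand \<Rightarrow> (real \<times> real) \<times> 'a \<Rightarrow> real" where
  "sproc l z = (\<Sum>(h, a, \<phi>)\<leftarrow>l. h (snd z) * \<phi> (fst z))"

lemma sproc_simps [simp]:
  "sproc [] z = 0" "sproc ((h, a, \<phi>) # l) z = h (snd z) * \<phi> (fst z) + sproc l z" "sproc (l @ l') z = sproc l z + sproc l' z"
  by (simp_all add: sproc_def)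

definition restr :: "(real \<times> real) set \<Rightarrow> 'a integrand \<Rightarrow> 'a integrand" where
  "restr D l = map (\<lambda>(h, a, \<phi>). (h, a, \<lambda>p. indicator D p * \<phi> p)) l"

lemma sproc_restr: "sproc (restr D l) z = indicator D (fst z) * sproc l z"
  by (induction l) (auto simp: restr_def algebra_simps)

definition negl :: "'a integrand \<Rightarrow> 'a integrand" where
  "negl l = map (\<lambda>(h, a, \<phi>). (\<lambda>\<omega>. - h \<omega>, a, \<phi>)) l"

lemma sproc_negl [simp]: "sproc (negl l) z = - sproc l z"
  by (induction l) (auto simp: negl_def)

context white_noise_space
begin

abbreviation PM :: "((real \<times> real) \<times> 'a) measure" where "PM \<equiv> lborel \<Otimes>\<^sub>M M"

lemma wn_filtration_noise: "wn_filtration M \<xi> a = sets (noise (past a))"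
proof -
  have "noise_gen (past a) = {\<xi> \<phi> -` B \<inter> space M | \<phi> B. L2_st \<phi> \<and> (\<forall>s y. s > a \<longrightarrow> \<phi> (s, y) = 0) \<and> B \<in> sets borel}"
    unfolding noise_gen_def past_def by (simp add: split_paired_all not_le)
  then show ?thesis unfolding wn_filtration_def sets_noise by simp
qed

definition sint :: "'a integrand \<Rightarrow> 'a \<Rightarrow> real" where
  "sint l \<omega> = (\<Sum>(h, a, \<phi>)\<leftarrow>l. h \<omega> * \<xi> \<phi> \<omega>)"

lemma sint_simps [simp]:
  "sint [] \<omega> = 0" "sint ((h, a, \<phi>) # l) \<omega> = h \<omega> * \<xi> \<phi> \<omega> + sint l \<omega>" "sint (l @ l') \<omega> = sint l \<omega> + sint l' \<omega>"
  by (simp_all add: sint_def)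

lemma sint_negl [simp]: "sint (negl l) \<omega> = - sint l \<omega>"
  by (induction l) (auto simp: negl_def)

fun sterm :: "('a \<Rightarrow> real) \<times> real \<times> (real \<times> real \<Rightarrow> real) \<Rightarrow> bool" where
  "sterm (h, a, \<phi>) \<longleftrightarrow> h \<in> borel_measurable (noise (past a)) \<and> sqint M h \<and> L2_st \<phi> \<and> (\<forall>p\<in>past a. \<phi> p = 0)"

abbreviation simple :: "'a integrand \<Rightarrow> bool" where
  "simple l \<equiv> list_all sterm l"

lemma simple_negl: "simple l \<Longrightarrow> simple (negl l)"
  using sqint_cmult[where c="-1"] by (induction l) (auto simp: negl_def)

lemma simple_restr: "simple l \<Longrightarrow> D \<in> sets borel \<Longrightarrow> simple (restr D l)"
  by (induction l) (auto simp: restr_def intro: L2_st_indicator_mult)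

lemma sproc_measurable: "simple l \<Longrightarrow> sproc l \<in> borel_measurable PM"
proof (induction l)
  case (Cons x l)
  obtain h a \<phi> where x: "x = (h, a, \<phi>)" by (cases x)
  have [measurable]: "h \<in> borel_measurable M" "\<phi> \<in> borel_measurable lborel" "sproc l \<in> borel_measurable PM"
    using Cons by (auto simp: x sqint_def L2_st_def)
  have "(\<lambda>z. h (snd z) * \<phi> (fst z) + sproc l z) \<in> borel_measurable PM" by measurable
  then show ?case by (simp add: x cong: measurable_cong)
qed (simp add: sproc_def[abs_def])

lemma sproc_sqint: "simple l \<Longrightarrow> sqint M (\<lambda>\<omega>. sproc l (p, \<omega>))"
proof (induction l)
  case Nil then show ?case using sqint_const[of 0] by simp
next
  case (Cons x l)
  obtain h a \<phi> where x: "x = (h, a, \<phi>)" by (cases x)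
  have "sqint M (\<lambda>\<omega>. \<phi> p * h \<omega> + sproc l (p, \<omega>))" using Cons by (intro sqint_add sqint_cmult) (auto simp: x)
  then show ?case by (simp add: x mult.commute)
qed

lemma sterm_sqint: assumes "sterm (h, a, \<phi>)" shows "sqint M (\<lambda>\<omega>. h \<omega> * \<xi> \<phi> \<omega>)"
proof -
  have m: "(\<lambda>\<omega>. (h \<omega>)\<^sup>2) \<in> borel_measurable (noise (past a))" "integrable M (\<lambda>\<omega>. (h \<omega>)\<^sup>2)" using assms by (auto simp: sqint_def)
  have "integrable M (\<lambda>\<omega>. (h \<omega>)\<^sup>2 * (\<xi> \<phi> \<omega>)\<^sup>2)" using assms by (intro noise_xi_mult(3)[OF _ _ m]) auto
  moreover have "h \<in> borel_measurable M" "\<xi> \<phi> \<in> borel_measurable M" using assms xi_measurable by (auto simp: sqint_def)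
  ultimately show ?thesis by (simp add: sqint_def power_mult_distrib)
qed

lemma sint_sqint: "simple l \<Longrightarrow> sqint M (sint l)"
proof (induction l)
  case Nil then show ?case using sqint_const[of 0] by (simp add: sint_def[abs_def])
next
  case (Cons x l)
  obtain h a \<phi> where x: "x = (h, a, \<phi>)" by (cases x)
  have "sqint M (\<lambda>\<omega>. h \<omega> * \<xi> \<phi> \<omega> + sint l \<omega>)" using Cons sterm_sqint by (intro sqint_add) (auto simp: x)
  moreover have "sint (x # l) = (\<lambda>\<omega>. h \<omega> * \<xi> \<phi> \<omega> + sint l \<omega>)" by (simp add: x fun_eq_iff)
  ultimately show ?case by simp
qed

text \<open>The earlier term is split at the later time \<open>b\<close>. The part of
  \<open>\<phi>\<close> up to \<open>b\<close> is known at time \<open>b\<close> and meets the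
  centred factor \<open>\<xi> \<psi>\<close>, so it contributes nothing. The part after
  \<open>b\<close> and \<open>\<psi>\<close> are both independent of \<open>h\<close> and
  \<open>k\<close>, and \<open>\<psi>\<close> sees only that part of \<open>\<phi>\<close>.\<close>

lemma sterm_isometry_le:
  assumes 1: "sterm (h, a, \<phi>)" and 2: "sterm (k, b, \<psi>)" and ab: "a \<le> b"
  shows "(\<integral>\<omega>. (h \<omega> * \<xi> \<phi> \<omega>) * (k \<omega> * \<xi> \<psi> \<omega>) \<partial>M) = (\<integral>\<omega>. h \<omega> * k \<omega> \<partial>M) * ip \<phi> \<psi>"
proof -
  note pb[measurable] = past_borel[of b]
  define \<phi>1 where "\<phi>1 = (\<lambda>p. indicator (past b) p * \<phi> p)"
  define \<phi>2 where "\<phi>2 = (\<lambda>p. indicator (- past b) p * \<phi> p)"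
  have \<phi>: "L2_st \<phi>" and \<psi>: "L2_st \<psi>" using 1 2 by auto
  have L: "L2_st \<phi>1" "L2_st \<phi>2" unfolding \<phi>1_def \<phi>2_def by (intro L2_st_indicator_mult \<phi>; measurable)+
  have "(\<lambda>p. \<phi>1 p + \<phi>2 p) = \<phi>" by (auto simp: \<phi>1_def \<phi>2_def indicator_def)
  then have ae: "AE \<omega> in M. \<xi> \<phi> \<omega> = \<xi> \<phi>1 \<omega> + \<xi> \<phi>2 \<omega>" using xi_add[OF L] by simp
  note [measurable] = xi_measurable[OF \<phi>] xi_measurable[OF \<psi>] xi_measurable[OF L(1)] xi_measurable[OF L(2)]
  have [measurable]: "h \<in> borel_measurable M" "k \<in> borel_measurable M" using 1 2 by (auto simp: sqint_def)
  have hm[measurable]: "h \<in> borel_measurable (noise (past b))"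
    by (rule noise_measurable_mono[OF _ past_mono[OF ab]]) (use 1 in simp)
  have km[measurable]: "k \<in> borel_measurable (noise (past b))" using 2 by simp
  have [measurable]: "\<xi> \<phi>1 \<in> borel_measurable (noise (past b))" by (rule xi_noise[OF L(1)]) (auto simp: \<phi>1_def)
  have t1: "sterm (h, a, \<phi>1)" using 1 L by (auto simp: \<phi>1_def)
  have hk: "integrable M (\<lambda>\<omega>. h \<omega> * k \<omega>)" using 1 2 by (intro sqint_mult_integrable) auto
  have A: "integrable M (\<lambda>\<omega>. (h \<omega> * \<xi> \<phi>1 \<omega> * k \<omega>) * \<xi> \<psi> \<omega>)" "(\<integral>\<omega>. (h \<omega> * \<xi> \<phi>1 \<omega> * k \<omega>) * \<xi> \<psi> \<omega> \<partial>M) = 0"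
    using 2 sqint_mult_integrable[OF sterm_sqint[OF t1], of k] by (intro noise_xi_mult(1,2)[OF \<psi>, of "past b"]; auto)+
  have B: "integrable M (\<lambda>\<omega>. (h \<omega> * k \<omega>) * (\<xi> \<phi>2 \<omega> * \<xi> \<psi> \<omega>))" "(\<integral>\<omega>. (h \<omega> * k \<omega>) * (\<xi> \<phi>2 \<omega> * \<xi> \<psi> \<omega>) \<partial>M) = (\<integral>\<omega>. h \<omega> * k \<omega> \<partial>M) * ip \<phi>2 \<psi>"
    using 2 hk by (intro noise_xi_mult2[OF L(2) _ \<psi>, of "past b"]; auto simp: \<phi>2_def)+
  have "(\<integral>\<omega>. (h \<omega> * \<xi> \<phi> \<omega>) * (k \<omega> * \<xi> \<psi> \<omega>) \<partial>M) = (\<integral>\<omega>. (h \<omega> * \<xi> \<phi>1 \<omega> * k \<omega>) * \<xi> \<psi> \<omega> + (h \<omega> * k \<omega>) * (\<xi> \<phi>2 \<omega> * \<xi> \<psi> \<omega>) \<partial>M)"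
    by (rule integral_cong_AE) (use ae in \<open>auto elim!: eventually_mono simp: algebra_simps\<close>)
  also have "\<dots> = (\<integral>\<omega>. h \<omega> * k \<omega> \<partial>M) * ip \<phi>2 \<psi>" using A B by simp
  also have "ip \<phi>2 \<psi> = ip \<phi> \<psi>"
    unfolding ip_def by (rule Bochner_Integration.integral_cong) (use 2 in \<open>auto simp: \<phi>2_def indicator_def\<close>)
  finally show ?thesis .
qed

lemma sterm_isometry:
  assumes "sterm (h, a, \<phi>)" "sterm (k, b, \<psi>)"
  shows "(\<integral>\<omega>. (h \<omega> * \<xi> \<phi> \<omega>) * (k \<omega> * \<xi> \<psi> \<omega>) \<partial>M) = (\<integral>\<omega>. h \<omega> * k \<omega> \<partial>M) * ip \<phi> \<psi>"
proof (cases "a \<le> b")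
  case False
  then show ?thesis using sterm_isometry_le[OF assms(2,1)] by (simp add: mult.commute ip_def)
qed (rule sterm_isometry_le[OF assms])

text \<open>Integrability of the expectation over space-time is carried through the induction,
  because additivity of the outer Bochner integral depends on it.\<close>

lemma sint_isometry1:
  assumes 1: "sterm (h, a, \<phi>)" and "simple l"
  shows "integrable lborel (\<lambda>p. \<integral>\<omega>. (h \<omega> * \<phi> p) * sproc l (p, \<omega>) \<partial>M) \<and>
    (\<integral>\<omega>. (h \<omega> * \<xi> \<phi> \<omega>) * sint l \<omega> \<partial>M) = (\<integral>p. \<integral>\<omega>. (h \<omega> * \<phi> p) * sproc l (p, \<omega>) \<partial>M \<partial>lborel)"
  using assms(2)
proof (induction l)
  case (Cons x l)
  obtain k b \<psi> where x: "x = (k, b, \<psi>)" by (cases x)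
  have t: "sterm (k, b, \<psi>)" and l: "simple l" using Cons by (auto simp: x)
  have i: "integrable M (\<lambda>\<omega>. h \<omega> * k \<omega>)" using 1 t by (intro sqint_mult_integrable) auto
  have j: "integrable M (\<lambda>\<omega>. (h \<omega> * \<phi> p) * sproc l (p, \<omega>))" for p
    using sqint_mult_integrable[OF _ sproc_sqint[OF l], of "\<lambda>\<omega>. h \<omega> * \<phi> p" p] sqint_cmult[of M h "\<phi> p"] 1 by (simp add: mult.commute)
  have "(\<lambda>p. \<integral>\<omega>. (h \<omega> * \<phi> p) * sproc (x # l) (p, \<omega>) \<partial>M) =
      (\<lambda>p. (\<integral>\<omega>. h \<omega> * k \<omega> \<partial>M) * (\<phi> p * \<psi> p) + (\<integral>\<omega>. (h \<omega> * \<phi> p) * sproc l (p, \<omega>) \<partial>M))"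
  proof
    fix p
    have "(\<integral>\<omega>. (h \<omega> * \<phi> p) * sproc (x # l) (p, \<omega>) \<partial>M) = (\<integral>\<omega>. (h \<omega> * k \<omega>) * (\<phi> p * \<psi> p) + (h \<omega> * \<phi> p) * sproc l (p, \<omega>) \<partial>M)"
      by (simp add: x algebra_simps)
    also have "\<dots> = (\<integral>\<omega>. h \<omega> * k \<omega> \<partial>M) * (\<phi> p * \<psi> p) + (\<integral>\<omega>. (h \<omega> * \<phi> p) * sproc l (p, \<omega>) \<partial>M)"
      using i j by simp
    finally show "(\<integral>\<omega>. (h \<omega> * \<phi> p) * sproc (x # l) (p, \<omega>) \<partial>M) = \<dots>" .
  qed
  moreover have "integrable lborel (\<lambda>p. \<phi> p * \<psi> p)" using 1 t by (intro sqint_mult_integrable L2_st_sqint) auto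
  moreover have "(\<integral>\<omega>. (h \<omega> * \<xi> \<phi> \<omega>) * sint (x # l) \<omega> \<partial>M) = (\<integral>\<omega>. (h \<omega> * \<xi> \<phi> \<omega>) * (k \<omega> * \<xi> \<psi> \<omega>) \<partial>M) + (\<integral>\<omega>. (h \<omega> * \<xi> \<phi> \<omega>) * sint l \<omega> \<partial>M)"
    using sqint_mult_integrable[OF sterm_sqint[OF 1] sterm_sqint[OF t]] sqint_mult_integrable[OF sterm_sqint[OF 1] sint_sqint[OF l]]
    by (simp add: x distrib_left)
  ultimately show ?case using Cons.IH[OF l] sterm_isometry[OF 1 t] by (simp add: ip_def)
qed simp

lemma sint_isometry2:
  assumes "simple l" and m: "simple m"
  shows "integrable lborel (\<lambda>p. \<integral>\<omega>. sproc l (p, \<omega>) * sproc m (p, \<omega>) \<partial>M) \<and>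
    (\<integral>\<omega>. sint l \<omega> * sint m \<omega> \<partial>M) = (\<integral>p. \<integral>\<omega>. sproc l (p, \<omega>) * sproc m (p, \<omega>) \<partial>M \<partial>lborel)"
  using assms(1)
proof (induction l)
  case (Cons x l)
  obtain k b \<psi> where x: "x = (k, b, \<psi>)" by (cases x)
  have t: "sterm (k, b, \<psi>)" and l: "simple l" using Cons by (auto simp: x)
  have j: "integrable M (\<lambda>\<omega>. (k \<omega> * \<psi> p) * sproc m (p, \<omega>))" for p
    using sqint_mult_integrable[OF _ sproc_sqint[OF m], of "\<lambda>\<omega>. k \<omega> * \<psi> p" p] sqint_cmult[of M k "\<psi> p"] t by (simp add: mult.commute)
  have e: "(\<lambda>p. \<integral>\<omega>. sproc (x # l) (p, \<omega>) * sproc m (p, \<omega>) \<partial>M) =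
      (\<lambda>p. (\<integral>\<omega>. (k \<omega> * \<psi> p) * sproc m (p, \<omega>) \<partial>M) + (\<integral>\<omega>. sproc l (p, \<omega>) * sproc m (p, \<omega>) \<partial>M))"
    using j sqint_mult_integrable[OF sproc_sqint[OF l] sproc_sqint[OF m]] by (simp add: x distrib_right)
  have f: "(\<integral>\<omega>. sint (x # l) \<omega> * sint m \<omega> \<partial>M) = (\<integral>\<omega>. (k \<omega> * \<xi> \<psi> \<omega>) * sint m \<omega> \<partial>M) + (\<integral>\<omega>. sint l \<omega> * sint m \<omega> \<partial>M)"
    using sqint_mult_integrable[OF sterm_sqint[OF t] sint_sqint[OF m]] sqint_mult_integrable[OF sint_sqint[OF l] sint_sqint[OF m]]
    by (simp add: x distrib_right)
  show ?case unfolding e f using Cons.IH[OF l] sint_isometry1[OF t m] by simp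
qed simp

lemma sqnorm_PM: "f \<in> borel_measurable PM \<Longrightarrow> sqnorm PM f = (\<integral>\<^sup>+p. sqnorm M (\<lambda>\<omega>. f (p, \<omega>)) \<partial>lborel)"
  unfolding sqnorm_def by (subst nn_integral_fst[symmetric]) auto

lemma sint_isometry:
  assumes "simple l" shows "sqnorm M (sint l) = sqnorm PM (sproc l)"
proof -
  have "sqnorm PM (sproc l) = (\<integral>\<^sup>+p. ennreal (\<integral>\<omega>. sproc l (p, \<omega>) * sproc l (p, \<omega>) \<partial>M) \<partial>lborel)"
    using sqnorm_PM[OF sproc_measurable[OF assms]] by (simp add: sqnorm_sqint sproc_sqint[OF assms] power2_eq_square)
  also have "\<dots> = ennreal (\<integral>p. \<integral>\<omega>. sproc l (p, \<omega>) * sproc l (p, \<omega>) \<partial>M \<partial>lborel)"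
    using sint_isometry2[OF assms assms] by (intro nn_integral_eq_integral) auto
  also have "\<dots> = sqnorm M (sint l)"
    using sint_isometry2[OF assms assms] by (simp add: sqnorm_sqint sint_sqint[OF assms] power2_eq_square)
  finally show ?thesis by simp
qed

text \<open>For each term, \<open>h\<close> and \<open>Y\<close> are both functions of the noise in
  \<open>past a \<union> D\<close>, on which \<open>\<phi>\<close> vanishes. The union is the point:
  \<open>Y\<close> may depend on noise in \<open>D\<close> that comes later than \<open>a\<close>,
  so the time filtration alone would not do.\<close>

lemma sint_orthogonal:
  assumes "simple l" and z: "\<And>h a \<phi> p. (h, a, \<phi>) \<in> set l \<Longrightarrow> p \<in> D \<Longrightarrow> \<phi> p = 0"
    and Y: "Y \<in> borel_measurable (noise D)" "sqint M Y"
  shows "(\<integral>\<omega>. sint l \<omega> * Y \<omega> \<partial>M) = 0"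
  using assms(1,2)
proof (induction l)
  case (Cons x l)
  obtain h a \<phi> where x: "x = (h, a, \<phi>)" by (cases x)
  have t: "sterm (h, a, \<phi>)" and l: "simple l" using Cons by (auto simp: x)
  have [measurable]: "h \<in> borel_measurable (noise (past a \<union> D))"
    by (rule noise_measurable_mono[OF _ Un_upper1]) (use t in simp)
  have [measurable]: "Y \<in> borel_measurable (noise (past a \<union> D))" by (rule noise_measurable_mono[OF Y(1) Un_upper2])
  have "(\<integral>\<omega>. (h \<omega> * Y \<omega>) * \<xi> \<phi> \<omega> \<partial>M) = 0"
    by (rule noise_xi_mult(2)[where D="past a \<union> D"])
      (use t Y Cons.prems(2)[of h a \<phi>] in \<open>auto simp: x intro!: sqint_mult_integrable\<close>)
  then have 0: "(\<integral>\<omega>. (h \<omega> * \<xi> \<phi> \<omega>) * Y \<omega> \<partial>M) = 0" by (simp add: mult_ac)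
  have "(\<integral>\<omega>. sint (x # l) \<omega> * Y \<omega> \<partial>M) = (\<integral>\<omega>. (h \<omega> * \<xi> \<phi> \<omega>) * Y \<omega> \<partial>M) + (\<integral>\<omega>. sint l \<omega> * Y \<omega> \<partial>M)"
    using sqint_mult_integrable[OF sterm_sqint[OF t] Y(2)] sqint_mult_integrable[OF sint_sqint[OF l] Y(2)]
    by (simp add: x distrib_right)
  moreover have "(\<integral>\<omega>. sint l \<omega> * Y \<omega> \<partial>M) = 0" by (rule Cons.IH[OF l]) (metis Cons.prems(2) list.set_intros(2))
  ultimately show ?case using 0 by simp
qed simp

lemma sint_restr_split:
  assumes "simple l" and D: "D \<in> sets borel"
  shows "AE \<omega> in M. sint l \<omega> = sint (restr D l) \<omega> + sint (restr (- D) l) \<omega>"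
  using assms(1)
proof (induction l)
  case (Cons x l)
  obtain h a \<phi> where x: "x = (h, a, \<phi>)" by (cases x)
  have t: "L2_st \<phi>" and l: "simple l" using Cons by (auto simp: x)
  have "(\<lambda>p. indicator D p * \<phi> p + indicator (- D) p * \<phi> p) = \<phi>" by (auto simp: indicator_def)
  then have "AE \<omega> in M. \<xi> \<phi> \<omega> = \<xi> (\<lambda>p. indicator D p * \<phi> p) \<omega> + \<xi> (\<lambda>p. indicator (- D) p * \<phi> p) \<omega>"
    using xi_add[OF L2_st_indicator_mult[OF t D] L2_st_indicator_mult[OF t, of "- D"]] D by simp
  with Cons.IH[OF l] show ?case
    by eventually_elim (simp add: x restr_def algebra_simps)
qed (simp add: restr_def)

text \<open>A relation and not an operator, since the integral is determined up to null sets only.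
  Joint measurability of \<open>X\<close> lets errors be measured over the product measure. The
  approximants come from the larger class of simple integrands, so that frozen sums are themselves
  Walsh integrals.\<close>

definition walsh :: "((real \<times> real) \<times> 'a \<Rightarrow> real) \<Rightarrow> ('a \<Rightarrow> real) \<Rightarrow> bool" where
  "walsh X I \<longleftrightarrow> X \<in> borel_measurable PM \<and> I \<in> borel_measurable M \<and>
    (\<exists>l. (\<forall>n. simple (l n)) \<and> (\<lambda>n. sqnorm PM (\<lambda>z. sproc (l n) z - X z)) \<longlonglongrightarrow> 0 \<and> (\<lambda>n. sqnorm M (\<lambda>\<omega>. sint (l n) \<omega> - I \<omega>)) \<longlonglongrightarrow> 0)"

lemma walsh_simple: "simple l \<Longrightarrow> walsh (sproc l) (sint l)"
  unfolding walsh_def using sproc_measurable[of l] sint_sqint[of l]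
  by (auto simp: sqint_def sqnorm_def intro!: exI[of _ "\<lambda>_. l"])

lemma walsh_diff:
  assumes "walsh X I" "walsh Y J" shows "walsh (\<lambda>z. X z - Y z) (\<lambda>\<omega>. I \<omega> - J \<omega>)"
proof -
  have [measurable]: "X \<in> borel_measurable PM" "Y \<in> borel_measurable PM" "I \<in> borel_measurable M" "J \<in> borel_measurable M"
    using assms by (auto simp: walsh_def)
  obtain l where l: "\<And>n. simple (l n)" "(\<lambda>n. sqnorm PM (\<lambda>z. sproc (l n) z - X z)) \<longlonglongrightarrow> 0" "(\<lambda>n. sqnorm M (\<lambda>\<omega>. sint (l n) \<omega> - I \<omega>)) \<longlonglongrightarrow> 0"
    using assms by (auto simp: walsh_def)
  obtain m where m: "\<And>n. simple (m n)" "(\<lambda>n. sqnorm PM (\<lambda>z. sproc (m n) z - Y z)) \<longlonglongrightarrow> 0" "(\<lambda>n. sqnorm M (\<lambda>\<omega>. sint (m n) \<omega> - J \<omega>)) \<longlonglongrightarrow> 0"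
    using assms by (auto simp: walsh_def)
  note [measurable] = sproc_measurable[OF l(1)] sproc_measurable[OF m(1)] sint_sqint[OF l(1)] sint_sqint[OF m(1)]
  have [measurable]: "\<And>n. sint (l n) \<in> borel_measurable M" "\<And>n. sint (m n) \<in> borel_measurable M"
    using sint_sqint[OF l(1)] sint_sqint[OF m(1)] by (auto simp: sqint_def)
  show ?thesis unfolding walsh_def
  proof (intro conjI exI[of _ "\<lambda>n. l n @ negl (m n)"] allI)
    show "simple (l n @ negl (m n))" for n using l m simple_negl by simp
    have "sqnorm PM (\<lambda>z. sproc (l n @ negl (m n)) z - (X z - Y z)) \<le> 2 * sqnorm PM (\<lambda>z. sproc (l n) z - X z) + 2 * sqnorm PM (\<lambda>z. sproc (m n) z - Y z)" for n
    proof -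
      have "sqnorm PM (\<lambda>z. sproc (l n @ negl (m n)) z - (X z - Y z)) = sqnorm PM (\<lambda>z. (sproc (l n) z - X z) - (sproc (m n) z - Y z))"
        by (rule sqnorm_cong) simp
      also have "\<dots> \<le> 2 * sqnorm PM (\<lambda>z. sproc (l n) z - X z) + 2 * sqnorm PM (\<lambda>z. sproc (m n) z - Y z)"
        by (rule sqnorm_diff_le) measurable
      finally show ?thesis .
    qed
    then show "(\<lambda>n. sqnorm PM (\<lambda>z. sproc (l n @ negl (m n)) z - (X z - Y z))) \<longlonglongrightarrow> 0"
      by (rule tendsto_ennreal_squeeze_0) (rule tendsto_ennreal_lin_0; use l m in simp)
    have "sqnorm M (\<lambda>z. sint (l n @ negl (m n)) z - (I z - J z)) \<le> 2 * sqnorm M (\<lambda>z. sint (l n) z - I z) + 2 * sqnorm M (\<lambda>z. sint (m n) z - J z)" for n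
    proof -
      have "sqnorm M (\<lambda>z. sint (l n @ negl (m n)) z - (I z - J z)) = sqnorm M (\<lambda>z. (sint (l n) z - I z) - (sint (m n) z - J z))"
        by (rule sqnorm_cong) simp
      also have "\<dots> \<le> 2 * sqnorm M (\<lambda>z. sint (l n) z - I z) + 2 * sqnorm M (\<lambda>z. sint (m n) z - J z)"
        by (rule sqnorm_diff_le) measurable
      finally show ?thesis .
    qed
    then show "(\<lambda>n. sqnorm M (\<lambda>z. sint (l n @ negl (m n)) z - (I z - J z))) \<longlonglongrightarrow> 0"
      by (rule tendsto_ennreal_squeeze_0) (rule tendsto_ennreal_lin_0; use l m in simp)
  qed measurable
qed

text \<open>The isometry for simple integrands passes to the limit; two uses of the factor 2 in
  \<open>sqnorm_add_le\<close> produce the 4.\<close>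

lemma walsh_bound:
  assumes "walsh X I" shows "sqnorm M I \<le> 4 * sqnorm PM X" "sqint M I"
proof -
  have [measurable]: "X \<in> borel_measurable PM" "I \<in> borel_measurable M" using assms by (auto simp: walsh_def)
  obtain l where l: "\<And>n. simple (l n)" "(\<lambda>n. sqnorm PM (\<lambda>z. sproc (l n) z - X z)) \<longlonglongrightarrow> 0" "(\<lambda>n. sqnorm M (\<lambda>\<omega>. sint (l n) \<omega> - I \<omega>)) \<longlonglongrightarrow> 0"
    using assms by (auto simp: walsh_def)
  note [measurable] = sproc_measurable[OF l(1)]
  have [measurable]: "\<And>n. sint (l n) \<in> borel_measurable M" using sint_sqint[OF l(1)] by (auto simp: sqint_def)
  have b1: "sqnorm M I \<le> 2 * sqnorm M (\<lambda>\<omega>. sint (l n) \<omega> - I \<omega>) + 2 * sqnorm M (sint (l n))" for n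
    using sqnorm_diff_le[of "\<lambda>\<omega>. sint (l n) \<omega>" M "\<lambda>\<omega>. sint (l n) \<omega> - I \<omega>"] by (simp add: add.commute)
  have b2: "sqnorm M (sint (l n)) \<le> 2 * sqnorm PM (\<lambda>z. sproc (l n) z - X z) + 2 * sqnorm PM X" for n
    unfolding sint_isometry[OF l(1)] using sqnorm_add_le[of "\<lambda>z. sproc (l n) z - X z" PM X] by simp
  have b: "sqnorm M I \<le> (2 * sqnorm M (\<lambda>\<omega>. sint (l n) \<omega> - I \<omega>) + 4 * sqnorm PM (\<lambda>z. sproc (l n) z - X z)) + 4 * sqnorm PM X" for n
  proof -
    have "2 * sqnorm M (sint (l n)) \<le> 2 * (2 * sqnorm PM (\<lambda>z. sproc (l n) z - X z) + 2 * sqnorm PM X)" by (rule mult_left_mono[OF b2]) simp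
    also have "\<dots> = 4 * sqnorm PM (\<lambda>z. sproc (l n) z - X z) + 4 * sqnorm PM X" by (simp add: distrib_left mult.assoc[symmetric])
    finally show ?thesis using order_trans[OF b1[of n] add_left_mono] by (simp add: add.assoc)
  qed
  have "(\<lambda>n. (2 * sqnorm M (\<lambda>\<omega>. sint (l n) \<omega> - I \<omega>) + 4 * sqnorm PM (\<lambda>z. sproc (l n) z - X z)) + 4 * sqnorm PM X) \<longlonglongrightarrow> 0 + 4 * sqnorm PM X"
    by (intro tendsto_add tendsto_const tendsto_ennreal_lin_0 l) auto
  from LIMSEQ_le_const[OF this, of "sqnorm M I"] b show "sqnorm M I \<le> 4 * sqnorm PM X" by simp
  have "eventually (\<lambda>n. sqnorm M (\<lambda>\<omega>. sint (l n) \<omega> - I \<omega>) < 1) sequentially" by (rule order_tendstoD(2)[OF l(3)]) simp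
  then obtain n where "sqnorm M (\<lambda>\<omega>. sint (l n) \<omega> - I \<omega>) < 1" by (auto simp: eventually_sequentially)
  then have "sqnorm M (\<lambda>\<omega>. sint (l n) \<omega> - I \<omega>) < \<infinity>" by (rule less_trans) simp
  then have "sqint M (\<lambda>\<omega>. sint (l n) \<omega> - I \<omega>)" by (subst (asm) sqnorm_finite) auto
  from sqint_diff[OF sint_sqint[OF l(1)[of n]] this] show "sqint M I" by simp
qed

text \<open>Since \<open>X\<close> vanishes on \<open>D\<close>, removing the part of an approximant
  that lives on \<open>D\<close> costs no more than its distance to \<open>X\<close>. What remains
  is supported off \<open>D\<close>, and \<open>sint_orthogonal\<close> applies to it.\<close>

lemma walsh_orthogonal:
  assumes "walsh X I" and D: "D \<in> sets borel" and X0: "\<And>p \<omega>. p \<in> D \<Longrightarrow> \<omega> \<in> space M \<Longrightarrow> X (p, \<omega>) = 0"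
    and Y: "Y \<in> borel_measurable (noise D)" "sqint M Y"
  shows "(\<integral>\<omega>. I \<omega> * Y \<omega> \<partial>M) = 0"
proof -
  have [measurable]: "X \<in> borel_measurable PM" "I \<in> borel_measurable M" "Y \<in> borel_measurable M" using assms by (auto simp: walsh_def sqint_def)
  obtain l where l: "\<And>n. simple (l n)" "(\<lambda>n. sqnorm PM (\<lambda>z. sproc (l n) z - X z)) \<longlonglongrightarrow> 0" "(\<lambda>n. sqnorm M (\<lambda>\<omega>. sint (l n) \<omega> - I \<omega>)) \<longlonglongrightarrow> 0"
    using assms by (auto simp: walsh_def)
  have lD: "simple (restr D (l n))" "simple (restr (- D) (l n))" for n using l(1) D by (auto intro!: simple_restr)
  note [measurable] = sproc_measurable[OF l(1)]
  have sm[measurable]: "\<And>n. sint (l n) \<in> borel_measurable M" "\<And>n. sint (restr D (l n)) \<in> borel_measurable M" "\<And>n. sint (restr (- D) (l n)) \<in> borel_measurable M"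
    using sint_sqint[OF l(1)] sint_sqint[OF lD(1)] sint_sqint[OF lD(2)] by (auto simp: sqint_def)
  \<comment> \<open>Almost surely the distance of \<open>I\<close> from the part of the approximant
    outside \<open>D\<close>: \<open>sint (restr (- D) (l n)) - I\<close>.\<close>
  define E where "E n \<omega> = (sint (l n) \<omega> - I \<omega>) - sint (restr D (l n)) \<omega>" for n \<omega>
  have I: "sqint M I" by (rule walsh_bound(2)[OF assms(1)])
  have Es: "sqint M (E n)" for n unfolding E_def by (intro sqint_diff sint_sqint l lD I)
  have EY: "(\<integral>\<omega>. I \<omega> * Y \<omega> \<partial>M) = - (\<integral>\<omega>. E n \<omega> * Y \<omega> \<partial>M)" for n
  proof -
    have "(\<integral>\<omega>. I \<omega> * Y \<omega> \<partial>M) = (\<integral>\<omega>. sint (restr (- D) (l n)) \<omega> * Y \<omega> - E n \<omega> * Y \<omega> \<partial>M)"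
      by (rule integral_cong_AE) (use sint_restr_split[OF l(1)[of n] D] Es in \<open>auto elim!: eventually_mono simp: E_def sqint_def algebra_simps\<close>)
    also have "\<dots> = (\<integral>\<omega>. sint (restr (- D) (l n)) \<omega> * Y \<omega> \<partial>M) - (\<integral>\<omega>. E n \<omega> * Y \<omega> \<partial>M)"
      by (intro Bochner_Integration.integral_diff sqint_mult_integrable sint_sqint lD Es Y)
    also have "(\<integral>\<omega>. sint (restr (- D) (l n)) \<omega> * Y \<omega> \<partial>M) = 0"
      by (rule sint_orthogonal[OF lD(2) _ Y]) (auto simp: restr_def)
    finally show ?thesis by simp
  qed
  have "sqnorm M (E n) \<le> 2 * sqnorm M (\<lambda>\<omega>. sint (l n) \<omega> - I \<omega>) + 2 * sqnorm PM (\<lambda>z. sproc (l n) z - X z)" for n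
  proof -
    have "sqnorm M (E n) \<le> 2 * sqnorm M (\<lambda>\<omega>. sint (l n) \<omega> - I \<omega>) + 2 * sqnorm M (sint (restr D (l n)))"
      unfolding E_def by (rule sqnorm_diff_le) measurable
    also have "sqnorm M (sint (restr D (l n))) = sqnorm PM (sproc (restr D (l n)))" by (rule sint_isometry[OF lD(1)])
    also have "\<dots> \<le> sqnorm PM (\<lambda>z. sproc (l n) z - X z)"
      by (rule sqnorm_mono) (auto simp: sproc_restr X0 indicator_def space_pair_measure)
    finally show ?thesis by (simp add: add_left_mono mult_left_mono)
  qed
  then have "(\<lambda>n. sqnorm M (E n)) \<longlonglongrightarrow> 0"
    by (rule tendsto_ennreal_squeeze_0) (rule tendsto_ennreal_lin_0; use l in simp)
  then have "(\<lambda>n. \<integral>\<omega>. (E n \<omega>)\<^sup>2 \<partial>M) \<longlonglongrightarrow> 0"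
    unfolding sqnorm_sqint[OF Es] by (simp add: tendsto_ennreal_iff flip: ennreal_0)
  then have "(\<lambda>n. (\<integral>\<omega>. (E n \<omega>)\<^sup>2 \<partial>M) * (\<integral>\<omega>. (Y \<omega>)\<^sup>2 \<partial>M)) \<longlonglongrightarrow> 0 * (\<integral>\<omega>. (Y \<omega>)\<^sup>2 \<partial>M)" by (intro tendsto_mult tendsto_const)
  moreover have "(\<integral>\<omega>. I \<omega> * Y \<omega> \<partial>M)\<^sup>2 \<le> (\<integral>\<omega>. (E n \<omega>)\<^sup>2 \<partial>M) * (\<integral>\<omega>. (Y \<omega>)\<^sup>2 \<partial>M)" for n
    using sqint_Cauchy_Schwarz[OF Es Y(2), of n] EY[of n] by simp
  ultimately have "(\<integral>\<omega>. I \<omega> * Y \<omega> \<partial>M)\<^sup>2 \<le> 0" using LIMSEQ_le_const by fastforce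
  then show ?thesis by simp
qed

end

section \<open>Area and nesting of backward light cones\<close>

lemma light_cone_borel [measurable]: "light_cone x t \<in> sets borel"
proof -
  have "light_cone x t = {p. 0 \<le> fst p \<and> fst p \<le> t \<and> \<bar>snd p - x\<bar> \<le> t - fst p}" by (auto simp: light_cone_def)
  moreover have "closed {p::real\<times>real. 0 \<le> fst p \<and> fst p \<le> t \<and> \<bar>snd p - x\<bar> \<le> t - fst p}"
    by (intro closed_Collect_conj closed_Collect_le continuous_intros)
  ultimately show ?thesis by (metis borel_closed)
qed

lemma light_cone_mono: "(s, y) \<in> light_cone x t \<Longrightarrow> light_cone y s \<subseteq> light_cone x t"
  by (auto simp: light_cone_def)

lemma light_cone_mono': "t \<le> t' \<Longrightarrow> light_cone x t \<subseteq> light_cone x t'"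
  by (auto simp: light_cone_def)

lemma emeasure_light_cone:
  assumes "0 \<le> t" shows "emeasure lborel (light_cone x t) = ennreal (t\<^sup>2)"
proof -
  have sec: "Pair s -` light_cone x t = (if 0 \<le> s \<and> s \<le> t then {x - (t - s)..x + (t - s)} else {})" for s
    by (auto simp: light_cone_def)
  have "emeasure lborel (light_cone x t) = (\<integral>\<^sup>+s. emeasure lborel (Pair s -` light_cone x t) \<partial>lborel)"
    unfolding lborel_prod[symmetric] by (rule lborel.emeasure_pair_measure_alt) (simp only: sets_lborel lborel_prod light_cone_borel)
  also have "\<dots> = (\<integral>\<^sup>+s. ennreal (2 * (t - s)) * indicator {0..t} s \<partial>lborel)"
    unfolding sec by (intro nn_integral_cong) (auto simp: indicator_def)
  also have "\<dots> = ennreal ((2 * t * t - t\<^sup>2) - (2 * t * 0 - 0\<^sup>2))"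
    by (rule nn_integral_FTC_Icc) (use assms in \<open>auto intro!: derivative_eq_intros\<close>)
  finally show ?thesis by (simp add: power2_eq_square)
qed

lemma emeasure_light_cone_diff:
  assumes "0 \<le> s'" "(s', y') \<in> light_cone y s"
  shows "emeasure lborel (light_cone y s - light_cone y' s') = ennreal (s\<^sup>2 - s'\<^sup>2)"
proof -
  have "s' \<le> s" using assms by (auto simp: light_cone_def)
  then show ?thesis using assms light_cone_mono[OF assms(2)]
    by (subst emeasure_Diff) (auto simp: emeasure_light_cone ennreal_minus)
qed

section \<open>From elementary processes to simple integrands\<close>

context white_noise_space
begin

sublocale PM: pair_sigma_finite lborel M ..

definition conv :: "real \<times> real \<times> real \<times> real set \<times> 'a set \<Rightarrow> ('a \<Rightarrow> real) \<times> real \<times> (real \<times> real \<Rightarrow> real)" where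
  "conv = (\<lambda>(c, a, b, A, F). (\<lambda>\<omega>. c * indicator F \<omega>, a, indicator ({a<..b} \<times> A)))"

lemma elem_process_sproc: "elem_process es p \<omega> = sproc (map conv es) (p, \<omega>)"
  unfolding elem_process_def sproc_def by (induction es) (auto simp: conv_def)

lemma elem_integral_sint: "elem_integral \<xi> es \<omega> = sint (map conv es) \<omega>"
  unfolding elem_integral_def sint_def by (induction es) (auto simp: conv_def)

lemma conv_sterm:
  assumes "0 \<le> a" "a \<le> b" and A[measurable]: "A \<in> sets lborel" and Af: "emeasure lborel A < \<infinity>" and F: "F \<in> wn_filtration M \<xi> a"
  shows "sterm (conv (c, a, b, A, F))"
proof -
  have Fn[measurable]: "F \<in> sets (noise (past a))" using F by (simp add: wn_filtration_noise)
  then have FM[measurable]: "F \<in> sets M" using subsetD[OF sets_noise_sub] by blast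
  have 1: "(\<lambda>\<omega>. c * indicator F \<omega>) \<in> borel_measurable (noise (past a))" by measurable
  have 2: "sqint M (\<lambda>\<omega>. c * indicator F \<omega>)" by (intro sqint_cmult sqint_bounded[where c=1]) (auto simp: indicator_def)
  have "emeasure lborel ({a<..b} \<times> A) = emeasure lborel {a<..b} * emeasure lborel A"
    unfolding lborel_prod[symmetric] by (rule lborel.emeasure_pair_measure_Times) (use A in auto)
  also have "\<dots> < \<infinity>" using Af assms(2) by (auto simp: ennreal_mult_less_top)
  finally have f: "emeasure lborel ({a<..b} \<times> A) < \<infinity>" .
  have "{a<..b} \<times> A \<in> sets (lborel \<Otimes>\<^sub>M lborel)" by (rule pair_measureI) (use A in auto)
  then have "{a<..b} \<times> A \<in> sets borel" by (simp only: lborel_prod sets_lborel)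
  then have 3: "L2_st (indicator ({a<..b} \<times> A))" using f assms by (intro L2_st_indicator) auto
  show ?thesis using 1 2 3 by (simp add: conv_def past_def)
qed

lemma elementary_simple: assumes "elementary M \<xi> es" shows "simple (map conv es)"
  unfolding list_all_iff
proof
  fix x assume "x \<in> set (map conv es)"
  then obtain e where e: "e \<in> set es" "x = conv e" by auto
  obtain c a b A F where e': "e = (c, a, b, A, F)" by (cases e)
  have "0 \<le> a \<and> a \<le> b \<and> A \<in> sets lborel \<and> emeasure lborel A < \<infinity> \<and> F \<in> wn_filtration M \<xi> a"
    using bspec[OF assms[unfolded elementary_def] e(1)] by (simp add: e')
  then show "sterm x" unfolding e(2) e' by (elim conjE) (rule conv_sterm)
qed

text \<open>Approximants taken from elementary processes have bounded random factors, and
  \<open>noise_projection\<close> works with a bounded factor; \<open>sterm\<close> alone guarantees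
  only square integrability.\<close>

fun bterm :: "('a \<Rightarrow> real) \<times> real \<times> (real \<times> real \<Rightarrow> real) \<Rightarrow> bool" where
  "bterm (h, a, \<phi>) \<longleftrightarrow> (\<exists>c. \<forall>\<omega>. \<bar>h \<omega>\<bar> \<le> c)"

lemma bterm_conv: "bterm (conv e)"
proof -
  obtain c a b A F where e: "e = (c, a, b, A, F)" by (cases e)
  have "\<bar>c * indicator F \<omega>\<bar> \<le> \<bar>c\<bar>" for \<omega> by (simp add: indicator_def)
  then show ?thesis unfolding e conv_def by auto
qed

lemma walsh_approx:
  assumes w: "walsh_integral M \<xi> X I" and X[measurable]: "(\<lambda>z. X (fst z) (snd z)) \<in> borel_measurable PM"
    and [measurable]: "J \<in> borel_measurable M" and ae: "AE \<omega> in M. J \<omega> = I \<omega>"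
  obtains l where "\<And>n. simple (l n)" "\<And>n. list_all bterm (l n)"
    "(\<lambda>n. sqnorm PM (\<lambda>z. sproc (l n) z - X (fst z) (snd z))) \<longlonglongrightarrow> 0" "(\<lambda>n. sqnorm M (\<lambda>\<omega>. sint (l n) \<omega> - J \<omega>)) \<longlonglongrightarrow> 0"
proof -
  obtain es where es: "\<And>n. elementary M \<xi> (es n)"
    "(\<lambda>n. \<integral>\<^sup>+\<omega>. (\<integral>\<^sup>+p. ennreal ((elem_process (es n) p \<omega> - X p \<omega>)^2) \<partial>lborel) \<partial>M) \<longlonglongrightarrow> 0"
    "(\<lambda>n. \<integral>\<^sup>+\<omega>. ennreal ((elem_integral \<xi> (es n) \<omega> - I \<omega>)^2) \<partial>M) \<longlonglongrightarrow> 0"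
    using w unfolding walsh_integral_def by blast
  have s: "simple (map conv (es n))" for n by (rule elementary_simple[OF es(1)])
  note [measurable] = sproc_measurable[OF s]
  have "(\<integral>\<^sup>+\<omega>. (\<integral>\<^sup>+p. ennreal ((elem_process (es n) p \<omega> - X p \<omega>)^2) \<partial>lborel) \<partial>M) =
      sqnorm PM (\<lambda>z. sproc (map conv (es n)) z - X (fst z) (snd z))" for n
    unfolding sqnorm_def elem_process_sproc by (subst PM.nn_integral_snd[symmetric]) auto
  moreover have "(\<integral>\<^sup>+\<omega>. ennreal ((elem_integral \<xi> (es n) \<omega> - I \<omega>)^2) \<partial>M) = sqnorm M (\<lambda>\<omega>. sint (map conv (es n)) \<omega> - J \<omega>)" for n
    unfolding sqnorm_def elem_integral_sint by (rule nn_integral_cong_AE) (use ae in \<open>auto elim!: eventually_mono\<close>)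
  moreover have "list_all bterm (map conv (es n))" for n by (simp add: list_all_iff bterm_conv)
  ultimately show ?thesis using s es(2,3) by (intro that[of "\<lambda>n. map conv (es n)"]) simp_all
qed

lemma walsh_finite: assumes "walsh X I" shows "sqnorm PM X < \<infinity>"
proof -
  have [measurable]: "X \<in> borel_measurable PM" using assms by (auto simp: walsh_def)
  obtain l where l: "\<And>n. simple (l n)" "(\<lambda>n. sqnorm PM (\<lambda>z. sproc (l n) z - X z)) \<longlonglongrightarrow> 0"
    using assms by (auto simp: walsh_def)
  note [measurable] = sproc_measurable[OF l(1)]
  have "eventually (\<lambda>n. sqnorm PM (\<lambda>z. sproc (l n) z - X z) < 1) sequentially" by (rule order_tendstoD(2)[OF l(2)]) simp
  then obtain n where n: "sqnorm PM (\<lambda>z. sproc (l n) z - X z) < 1" by (auto simp: eventually_sequentially)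
  have "sqnorm PM X \<le> 2 * sqnorm PM (sproc (l n)) + 2 * sqnorm PM (\<lambda>z. sproc (l n) z - X z)"
    using sqnorm_diff_le[of "sproc (l n)" PM "\<lambda>z. sproc (l n) z - X z"] by simp
  also have "\<dots> < \<infinity>"
    using n less_trans[OF n, of \<top>] unfolding sint_isometry[OF l(1), symmetric] sqnorm_sqint[OF sint_sqint[OF l(1)]]
    by (simp add: ennreal_mult_less_top)
  finally show ?thesis .
qed

end

section \<open>The mild solution and finite speed of propagation\<close>

locale mild_wave = white_noise_space M \<xi> for M :: "'a measure" and \<xi> +
  fixes \<sigma> :: "real \<Rightarrow> real" and u :: "real \<Rightarrow> real \<Rightarrow> 'a \<Rightarrow> real" and L :: real
  assumes lip: "\<And>a b. \<bar>\<sigma> a - \<sigma> b\<bar> \<le> L * \<bar>a - b\<bar>" and L0: "0 \<le> L"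
    and sol: "mild_solution M \<xi> \<sigma> u"
begin

lemma sigma_continuous: "continuous_on A \<sigma>"
proof -
  have "L-lipschitz_on A \<sigma>" using lip L0 by (auto intro!: lipschitz_onI simp: dist_real_def)
  then show ?thesis by (rule lipschitz_on_continuous_on)
qed

lemma sigma_measurable [measurable]: "\<sigma> \<in> borel_measurable borel"
  by (rule borel_measurable_continuous_onI[OF sigma_continuous])

lemma wn_filtration_space: "F \<in> wn_filtration M \<xi> a \<Longrightarrow> F \<subseteq> space M"
  using sets.sets_into_space[of F "noise (past a)"] by (simp add: wn_filtration_noise)

definition Omega0 :: "((real \<times> real) \<times> 'a) set" where "Omega0 = ({0..} \<times> UNIV) \<times> space M"

definition pgen :: "((real \<times> real) \<times> 'a) set set" where
  "pgen = {({a<..b} \<times> A) \<times> F | a b A F. 0 \<le> a \<and> A \<in> sets lborel \<and> F \<in> wn_filtration M \<xi> a}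
      \<union> {({0} \<times> A) \<times> F | A F. A \<in> sets lborel \<and> F \<in> wn_filtration M \<xi> 0}"

lemma pgen_cases:
  assumes "g \<in> pgen"
  obtains a b A F where "g = ({a<..b} \<times> A) \<times> F" "0 \<le> a" "A \<in> sets lborel" "F \<in> wn_filtration M \<xi> a"
  | A F where "g = ({0} \<times> A) \<times> F" "A \<in> sets lborel" "F \<in> wn_filtration M \<xi> 0"
  using assms unfolding pgen_def by blast

lemma pgen_Pow: "pgen \<subseteq> Pow Omega0"
proof
  fix g assume "g \<in> pgen"
  then show "g \<in> Pow Omega0"
    by (cases rule: pgen_cases) (auto simp: Omega0_def dest: wn_filtration_space)
qed

lemma predictable_measure_eq: "predictable_measure M \<xi> = sigma Omega0 pgen"
  unfolding predictable_measure_def Omega0_def pgen_def ..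

lemma u_predictable: "(\<lambda>z. u (fst (fst z)) (snd (fst z)) (snd z)) \<in> borel_measurable (sigma Omega0 pgen)"
  using sol unfolding mild_solution_def predictable_def predictable_measure_eq by (simp add: case_prod_beta')

lemma Times_borel: "A \<in> sets borel \<Longrightarrow> B \<in> sets borel \<Longrightarrow> A \<times> B \<in> sets (borel :: (real \<times> real) measure)"
  using pair_measureI[of A borel B borel] unfolding borel_prod by blast

text \<open>Predictability constrains \<open>u\<close> at nonnegative times only, so it is extended
  by zero outside \<open>Omega0\<close>. Generating rectangles of the predictable sigma-algebra are
  measurable rectangles of the product.\<close>

lemma u_joint: "(\<lambda>z. if z \<in> Omega0 then u (fst (fst z)) (snd (fst z)) (snd z) else 0) \<in> borel_measurable PM"
proof -
  have Om: "Omega0 \<in> sets PM" unfolding Omega0_def by (intro pair_measureI) (auto intro!: Times_borel)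
  have "(\<lambda>z. z) \<in> measurable (restrict_space PM Omega0) (sigma Omega0 pgen)"
  proof (rule measurable_measure_of[OF pgen_Pow])
    show "(\<lambda>z. z) \<in> space (restrict_space PM Omega0) \<rightarrow> Omega0" by (auto simp: space_restrict_space)
    fix g assume g: "g \<in> pgen"
    then have "g \<in> sets PM"
    proof (cases rule: pgen_cases)
      case (1 a b A F)
      then show ?thesis using sets_noise_sub[of "past a"] by (auto simp: wn_filtration_noise intro!: pair_measureI Times_borel)
    next
      case (2 A F)
      then show ?thesis using sets_noise_sub[of "past 0"] by (auto simp: wn_filtration_noise intro!: pair_measureI Times_borel)
    qed
    moreover have gO: "g \<subseteq> Omega0" using g pgen_Pow by auto
    moreover have "(\<lambda>z. z) -` g \<inter> space (restrict_space PM Omega0) = g"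
      using gO sets.sets_into_space[OF Om] by (auto simp: space_restrict_space)
    ultimately show "(\<lambda>z. z) -` g \<inter> space (restrict_space PM Omega0) \<in> sets (restrict_space PM Omega0)"
      using Om by (simp add: sets_restrict_space_iff)
  qed
  from measurable_compose[OF this u_predictable]
  show ?thesis using Om by (subst measurable_restrict_space_iff[symmetric]) auto
qed

text \<open>The section at \<open>(s, y)\<close> of a generator over \<open>{a<..b}\<close> is
  either empty or, when \<open>a < s\<close>, an event known at time \<open>a\<close> and hence at
  time \<open>s\<close>.\<close>

lemma u_adapted:
  assumes "0 \<le> s" shows "u s y \<in> borel_measurable (noise (past s))"
proof -
  have "(\<lambda>\<omega>. ((s, y), \<omega>)) \<in> measurable (noise (past s)) (sigma Omega0 pgen)"
  proof (rule measurable_measure_of[OF pgen_Pow])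
    show "(\<lambda>\<omega>. ((s, y), \<omega>)) \<in> space (noise (past s)) \<rightarrow> Omega0" using assms by (auto simp: Omega0_def)
    fix g assume g: "g \<in> pgen"
    then show "(\<lambda>\<omega>. ((s, y), \<omega>)) -` g \<inter> space (noise (past s)) \<in> sets (noise (past s))"
    proof (cases rule: pgen_cases)
      case (1 a b A F)
      have "(\<lambda>\<omega>. ((s, y), \<omega>)) -` g \<inter> space (noise (past s)) = (if s \<in> {a<..b} \<and> y \<in> A then F else {})"
        using wn_filtration_space[OF 1(4)] by (auto simp: 1(1))
      moreover have "s \<in> {a<..b} \<Longrightarrow> F \<in> sets (noise (past s))"
        using noise_mono[OF past_mono[of a s]] 1(4) by (auto simp: wn_filtration_noise)
      ultimately show ?thesis by auto
    next
      case (2 A F)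
      have "(\<lambda>\<omega>. ((s, y), \<omega>)) -` g \<inter> space (noise (past s)) = (if s = 0 \<and> y \<in> A then F else {})"
        using wn_filtration_space[OF 2(3)] by (auto simp: 2(1))
      then show ?thesis using 2 by (auto simp: wn_filtration_noise)
    qed
  qed
  from measurable_compose[OF this u_predictable] show ?thesis by simp
qed

lemma u_measurable [measurable]: "0 \<le> s \<Longrightarrow> u s y \<in> borel_measurable M"
  using noise_measurable_M[OF u_adapted] .

definition su :: "(real \<times> real) \<times> 'a \<Rightarrow> real" where
  "su z = (if z \<in> Omega0 then \<sigma> (u (fst (fst z)) (snd (fst z)) (snd z)) else 0)"

lemma su_measurable [measurable]: "su \<in> borel_measurable PM"
proof -
  have Om[measurable]: "Omega0 \<in> sets PM" unfolding Omega0_def by (intro pair_measureI) (auto intro!: Times_borel)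
  note [measurable] = u_joint
  have "(\<lambda>z. if z \<in> Omega0 then \<sigma> (if z \<in> Omega0 then u (fst (fst z)) (snd (fst z)) (snd z) else 0) else 0) \<in> borel_measurable PM"
    by measurable
  also have "(\<lambda>z. if z \<in> Omega0 then \<sigma> (if z \<in> Omega0 then u (fst (fst z)) (snd (fst z)) (snd z) else 0) else 0) = su"
    by (auto simp: su_def)
  finally show ?thesis .
qed

definition Xc :: "(real \<times> real) set \<Rightarrow> (real \<times> real) \<times> 'a \<Rightarrow> real" where
  "Xc D z = indicator D (fst z) * su z"

lemma Xc_measurable [measurable]: "D \<in> sets borel \<Longrightarrow> Xc D \<in> borel_measurable PM"
  unfolding Xc_def[abs_def]
  by (intro borel_measurable_times su_measurable measurable_compose[OF measurable_fst, where g="indicator D"]) simp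

lemma u_approx:
  assumes "0 \<le> t"
  obtains l where "\<And>n. simple (l n)" "\<And>n. list_all bterm (l n)"
    "(\<lambda>n. sqnorm PM (\<lambda>z. sproc (l n) z - Xc (light_cone x t) z)) \<longlonglongrightarrow> 0" "(\<lambda>n. sqnorm M (\<lambda>\<omega>. sint (l n) \<omega> - (u t x \<omega> - 1))) \<longlonglongrightarrow> 0"
proof -
  note [measurable] = u_measurable[OF assms]
  let ?X = "\<lambda>p \<omega>. indicator (light_cone x t) p * \<sigma> (u (fst p) (snd p) \<omega>)"
  obtain I where I: "walsh_integral M \<xi> ?X I" "AE \<omega> in M. u t x \<omega> = 1 + I \<omega>"
    using sol assms unfolding mild_solution_def by blast
  have e: "?X (fst z) (snd z) = Xc (light_cone x t) z" if "z \<in> space PM" for z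
    using that by (auto simp: Xc_def su_def Omega0_def indicator_def light_cone_def space_pair_measure)
  have m: "(\<lambda>z. ?X (fst z) (snd z)) \<in> borel_measurable PM"
    by (subst measurable_cong[OF e], assumption) measurable
  have ae: "AE \<omega> in M. u t x \<omega> - 1 = I \<omega>" using I(2) by (auto elim!: eventually_mono)
  have "sqnorm PM (\<lambda>z. sproc l z - ?X (fst z) (snd z)) = sqnorm PM (\<lambda>z. sproc l z - Xc (light_cone x t) z)" for l
    by (rule sqnorm_cong) (simp only: e)
  note eq = this
  show ?thesis
  proof (rule walsh_approx[OF I(1) m _ ae])
    show "(\<lambda>\<omega>. u t x \<omega> - 1) \<in> borel_measurable M" by measurable
    fix l assume "\<And>n. simple (l n)" "\<And>n. list_all bterm (l n)"
      "(\<lambda>n. sqnorm PM (\<lambda>z. sproc (l n) z - ?X (fst z) (snd z))) \<longlonglongrightarrow> 0" "(\<lambda>n. sqnorm M (\<lambda>\<omega>. sint (l n) \<omega> - (u t x \<omega> - 1))) \<longlonglongrightarrow> 0"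
    then show ?thesis unfolding eq by (rule that)
  qed
qed

lemma u_walsh: assumes "0 \<le> t" shows "walsh (Xc (light_cone x t)) (\<lambda>\<omega>. u t x \<omega> - 1)"
proof -
  note [measurable] = u_measurable[OF assms]
  show ?thesis
  proof (rule u_approx[OF assms, of x])
    fix l assume l: "\<And>n. simple (l n)"
      "(\<lambda>n. sqnorm PM (\<lambda>z. sproc (l n) z - Xc (light_cone x t) z)) \<longlonglongrightarrow> 0" "(\<lambda>n. sqnorm M (\<lambda>\<omega>. sint (l n) \<omega> - (u t x \<omega> - 1))) \<longlonglongrightarrow> 0"
    show ?thesis unfolding walsh_def by (intro conjI exI[of _ l] allI l Xc_measurable light_cone_borel) measurable
  qed
qed

lemma u_sqint: "0 \<le> s \<Longrightarrow> sqint M (u s y)"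
  using sqint_add[OF walsh_bound(2)[OF u_walsh] sqint_const[of 1], of s y] by simp

lemma sqnorm_Xc: "D \<in> sets borel \<Longrightarrow> sqnorm PM (Xc D) = (\<integral>\<^sup>+p. indicator D p * sqnorm M (\<lambda>\<omega>. su (p, \<omega>)) \<partial>lborel)"
proof -
  assume [measurable]: "D \<in> sets borel"
  have "sqnorm PM (Xc D) = (\<integral>\<^sup>+p. sqnorm M (\<lambda>\<omega>. indicator D p * su (p, \<omega>)) \<partial>lborel)" by (subst sqnorm_PM) (auto simp: Xc_def)
  also have "\<dots> = (\<integral>\<^sup>+p. indicator D p * sqnorm M (\<lambda>\<omega>. su (p, \<omega>)) \<partial>lborel)"
    by (intro nn_integral_cong) (auto simp: sqnorm_cmult indicator_def sqnorm_def)
  finally show ?thesis .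
qed

lemma su_eq: "0 \<le> fst p \<Longrightarrow> \<omega> \<in> space M \<Longrightarrow> su (p, \<omega>) = \<sigma> (u (fst p) (snd p) \<omega>)"
  by (auto simp: su_def Omega0_def mem_Times_iff)

text \<open>For a point of the cone, the integrand over its own backward cone is a restriction of
  the integrand over the large one. The latter has finite norm because it is the integrand of a
  Walsh integral, and \<open>walsh_bound\<close> turns this into one bound for all points.\<close>

lemma u_bound: "\<exists>K\<ge>0. \<forall>s y. (s, y) \<in> light_cone x t \<longrightarrow> sqnorm M (\<lambda>\<omega>. u s y \<omega> - 1) \<le> ennreal K"
proof (cases "0 \<le> t")
  case True
  let ?N = "4 * sqnorm PM (Xc (light_cone x t))"
  have "?N < \<infinity>" using walsh_finite[OF u_walsh[OF True]] by (auto simp: ennreal_mult_less_top)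
  then have f: "?N = ennreal (enn2real ?N)" by (simp add: less_top)
  have "sqnorm M (\<lambda>\<omega>. u s y \<omega> - 1) \<le> ?N" if "(s, y) \<in> light_cone x t" for s y
  proof -
    have s: "0 \<le> s" using that by (auto simp: light_cone_def)
    have "sqnorm M (\<lambda>\<omega>. u s y \<omega> - 1) \<le> 4 * sqnorm PM (Xc (light_cone y s))" by (rule walsh_bound(1)[OF u_walsh[OF s]])
    also have "\<dots> \<le> ?N" using light_cone_mono[OF that]
      by (intro mult_left_mono sqnorm_mono) (auto simp: Xc_def indicator_def)
    finally show ?thesis .
  qed
  then show ?thesis using f by (intro exI[of _ "enn2real ?N"]) auto
qed (auto simp: light_cone_def intro!: exI[of _ 0])

lemma sigma_diff_sqnorm: "sqnorm M (\<lambda>\<omega>. \<sigma> (f \<omega>) - \<sigma> (g \<omega>)) \<le> ennreal (L\<^sup>2) * sqnorm M (\<lambda>\<omega>. f \<omega> - g \<omega>)"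
  if [measurable]: "f \<in> borel_measurable M" "g \<in> borel_measurable M"
proof -
  have "sqnorm M (\<lambda>\<omega>. \<sigma> (f \<omega>) - \<sigma> (g \<omega>)) \<le> sqnorm M (\<lambda>\<omega>. L * (f \<omega> - g \<omega>))"
    by (rule sqnorm_mono) (use lip L0 in \<open>auto simp: abs_mult\<close>)
  then show ?thesis by (simp add: sqnorm_cmult)
qed

lemma sigma_sqint: "sqint M f \<Longrightarrow> sqint M (\<lambda>\<omega>. \<sigma> (f \<omega>))"
proof -
  assume f: "sqint M f"
  then have [measurable]: "f \<in> borel_measurable M" by (simp add: sqint_def)
  have "sqnorm M (\<lambda>\<omega>. \<sigma> (f \<omega>) - \<sigma> 0) < \<infinity>"
    using sigma_diff_sqnorm[of f "\<lambda>_. 0"] sqnorm_finite[of f M] f by (auto simp: ennreal_mult_less_top intro: le_less_trans)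
  then have "sqint M (\<lambda>\<omega>. \<sigma> (f \<omega>) - \<sigma> 0)" by (subst (asm) sqnorm_finite) auto
  from sqint_add[OF this sqint_const[of "\<sigma> 0"]] show ?thesis by simp
qed

lemma su_bound: "\<exists>K\<ge>0. \<forall>p\<in>light_cone x t. sqnorm M (\<lambda>\<omega>. su (p, \<omega>)) \<le> ennreal K"
proof -
  obtain K where K: "K \<ge> 0" "\<And>s y. (s, y) \<in> light_cone x t \<Longrightarrow> sqnorm M (\<lambda>\<omega>. u s y \<omega> - 1) \<le> ennreal K" using u_bound by blast
  have "sqnorm M (\<lambda>\<omega>. su (p, \<omega>)) \<le> ennreal (2 * (L\<^sup>2 * K) + 2 * (\<sigma> 1)\<^sup>2)" if p: "p \<in> light_cone x t" for p
  proof -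
    have s: "0 \<le> fst p" using p by (auto simp: light_cone_def)
    note [measurable] = u_measurable[OF s]
    have "sqnorm M (\<lambda>\<omega>. su (p, \<omega>)) = sqnorm M (\<lambda>\<omega>. (\<sigma> (u (fst p) (snd p) \<omega>) - \<sigma> 1) + \<sigma> 1)" by (rule sqnorm_cong) (simp add: su_eq s)
    also have "\<dots> \<le> 2 * sqnorm M (\<lambda>\<omega>. \<sigma> (u (fst p) (snd p) \<omega>) - \<sigma> 1) + 2 * sqnorm M (\<lambda>\<omega>. \<sigma> 1)" by (rule sqnorm_add_le) measurable
    also have "sqnorm M (\<lambda>\<omega>. \<sigma> 1) = ennreal ((\<sigma> 1)\<^sup>2)" by (simp add: sqnorm_def emeasure_space_1)
    also have "sqnorm M (\<lambda>\<omega>. \<sigma> (u (fst p) (snd p) \<omega>) - \<sigma> 1) \<le> ennreal (L\<^sup>2) * ennreal K"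
      by (rule order_trans[OF sigma_diff_sqnorm]) (use K(2)[of "fst p" "snd p"] p in \<open>auto intro!: mult_left_mono\<close>)
    finally show ?thesis using K(1) by (simp add: ennreal_mult ennreal_plus add_mono mult_left_mono)
  qed
  then show ?thesis using K(1) by (intro exI[of _ "2 * (L\<^sup>2 * K) + 2 * (\<sigma> 1)\<^sup>2"]) auto
qed

text \<open>When one point lies in the backward cone of the other, the cones are nested, and the
  difference of the two values is an integral over a region of area
  \<open>s\<^sup>2 - s'\<^sup>2\<close>, at most \<open>2 * T * (s - s')\<close>. The 8 is this 2
  times the 4 of \<open>walsh_bound\<close>.\<close>

lemma u_increment:
  assumes K: "0 \<le> K" "\<And>p. p \<in> light_cone x T \<Longrightarrow> sqnorm M (\<lambda>\<omega>. su (p, \<omega>)) \<le> ennreal K"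
    and p: "(s, y) \<in> light_cone x T" and p': "(s', y') \<in> light_cone y s"
  shows "sqnorm M (\<lambda>\<omega>. u s y \<omega> - u s' y' \<omega>) \<le> ennreal (8 * K * T * (s - s'))"
proof -
  have s: "0 \<le> s" "s \<le> T" "0 \<le> s'" "s' \<le> s" using p p' by (auto simp: light_cone_def)
  let ?D = "light_cone y s - light_cone y' s'"
  have "walsh (\<lambda>z. Xc (light_cone y s) z - Xc (light_cone y' s') z) (\<lambda>\<omega>. (u s y \<omega> - 1) - (u s' y' \<omega> - 1))"
    by (intro walsh_diff u_walsh s)
  from walsh_bound(1)[OF this] have "sqnorm M (\<lambda>\<omega>. u s y \<omega> - u s' y' \<omega>) \<le> 4 * sqnorm PM (\<lambda>z. Xc (light_cone y s) z - Xc (light_cone y' s') z)" by simp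
  also have "(\<lambda>z. Xc (light_cone y s) z - Xc (light_cone y' s') z) = Xc ?D"
    using light_cone_mono[OF p'] by (auto simp: Xc_def indicator_def fun_eq_iff)
  also have "sqnorm PM (Xc ?D) \<le> (\<integral>\<^sup>+p. ennreal K * indicator ?D p \<partial>lborel)"
    unfolding sqnorm_Xc[OF sets.Diff[OF light_cone_borel light_cone_borel]]
    by (intro nn_integral_mono) (use light_cone_mono[OF p] K(2) in \<open>auto simp: indicator_def\<close>)
  also have "\<dots> = ennreal K * ennreal (s\<^sup>2 - s'\<^sup>2)"
    using emeasure_light_cone_diff[OF s(3) p'] by (subst nn_integral_cmult_indicator) auto
  also have "\<dots> = ennreal (K * (s\<^sup>2 - s'\<^sup>2))" using K(1) by (simp add: ennreal_mult')
  finally have "sqnorm M (\<lambda>\<omega>. u s y \<omega> - u s' y' \<omega>) \<le> 4 * ennreal (K * (s\<^sup>2 - s'\<^sup>2))" by (simp add: mult_left_mono)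
  also have "\<dots> = ennreal (4 * (K * (s\<^sup>2 - s'\<^sup>2)))" by (subst ennreal_mult') auto
  also have "\<dots> \<le> ennreal (8 * K * T * (s - s'))"
  proof (rule ennreal_leI)
    have "s\<^sup>2 - s'\<^sup>2 = (s + s') * (s - s')" by (simp add: power2_eq_square algebra_simps)
    also have "\<dots> \<le> (2 * T) * (s - s')" using s by (intro mult_right_mono) auto
    finally have "K * (s\<^sup>2 - s'\<^sup>2) \<le> K * ((2 * T) * (s - s'))" using K(1) by (rule mult_left_mono)
    then show "4 * (K * (s\<^sup>2 - s'\<^sup>2)) \<le> 8 * K * T * (s - s')" by (simp add: mult.assoc)
  qed
  finally show ?thesis .
qed

end

section \<open>Projection on the noise in a region\<close>

context white_noise_space
begin

lemma fms_noise: "finite_measure_subalgebra M (noise D)"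
  by (simp add: finite_measure_subalgebra_def finite_measure_subalgebra_axioms_def subalgebra_noise finite_measure_axioms)

text \<open>For a variable known at time \<open>a\<close>, conditioning on the noise in
  \<open>D\<close> gives the same as conditioning on the noise in \<open>D \<inter> past a\<close>:
  the noise in \<open>D\<close> after \<open>a\<close> is independent of both. The projection
  \<open>k\<close> is thus measurable with respect to the noise in \<open>D\<close> and still known
  at time \<open>a\<close>, so it can serve as a factor of a simple integrand.\<close>

lemma noise_projection:
  assumes D: "D \<in> sets borel" and h: "h \<in> borel_measurable (noise (past a))" and hb: "\<And>\<omega>. \<bar>h \<omega>\<bar> \<le> c"
  obtains k where "k \<in> borel_measurable (noise (D \<inter> past a))" "\<And>\<omega>. \<bar>k \<omega>\<bar> \<le> c"
    "\<And>Y. Y \<in> borel_measurable (noise D) \<Longrightarrow> sqint M Y \<Longrightarrow> (\<integral>\<omega>. (h \<omega> - k \<omega>) * Y \<omega> \<partial>M) = 0"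
proof -
  interpret S: finite_measure_subalgebra M "noise (D \<inter> past a)" by (rule fms_noise)
  interpret T: finite_measure_subalgebra M "noise D" by (rule fms_noise)
  have hM[measurable]: "h \<in> borel_measurable M" by (rule noise_measurable_M[OF h])
  have hi: "integrable M h" by (rule integrable_const_bound[where B=c]) (use hb in auto)
  define k0 where "k0 = real_cond_exp M (noise (D \<inter> past a)) h"
  \<comment> \<open>The conditional expectation lies between \<open>- c\<close> and \<open>c\<close>
    almost surely; clamping makes the bound hold everywhere without leaving the
    sigma-algebra.\<close>
  define k where "k \<omega> = max (-c) (min c (k0 \<omega>))" for \<omega>
  have c0: "0 \<le> c" using order_trans[OF abs_ge_zero hb] .
  have k0m[measurable]: "k0 \<in> borel_measurable (noise (D \<inter> past a))" unfolding k0_def by simp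
  have km: "k \<in> borel_measurable (noise (D \<inter> past a))" unfolding k_def[abs_def] by measurable
  have kM[measurable]: "k \<in> borel_measurable M" by (rule noise_measurable_M[OF km])
  have kb: "\<bar>k \<omega>\<bar> \<le> c" for \<omega> using c0 by (auto simp: k_def)
  have ki: "integrable M k" by (rule integrable_const_bound[where B=c]) (use kb in auto)
  have "AE \<omega> in M. h \<omega> \<le> c" "AE \<omega> in M. - c \<le> h \<omega>" using hb by (auto simp: abs_le_iff minus_le_iff)
  then have "AE \<omega> in M. k0 \<omega> \<le> c" "AE \<omega> in M. - c \<le> k0 \<omega>"
    unfolding k0_def using S.real_cond_exp_le_c[OF hi] S.real_cond_exp_ge_c[OF hi] by auto
  then have kk: "AE \<omega> in M. k0 \<omega> = k \<omega>" by eventually_elim (auto simp: k_def)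
  have orth0: "(\<integral>\<omega>. (h \<omega> - k \<omega>) * Y \<omega> \<partial>M) = 0"
    if Y: "Y \<in> borel_measurable (noise (D \<inter> past a))" and Yb: "\<And>\<omega>. \<bar>Y \<omega>\<bar> \<le> 1" for Y
  proof -
    have [measurable]: "Y \<in> borel_measurable M" by (rule noise_measurable_M[OF Y])
    have [measurable]: "k0 \<in> borel_measurable M" by (rule noise_measurable_M[OF k0m])
    have bd: "\<bar>Y \<omega> * f\<bar> \<le> c" if "\<bar>f\<bar> \<le> c" for \<omega> f
      using mult_mono[OF Yb[of \<omega>] that] by (simp add: abs_mult)
    have i: "integrable M (\<lambda>\<omega>. Y \<omega> * h \<omega>)" "integrable M (\<lambda>\<omega>. Y \<omega> * k \<omega>)"
      by (rule integrable_const_bound[where B=c]; use bd hb kb in auto)+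
    have "(\<integral>\<omega>. Y \<omega> * k \<omega> \<partial>M) = (\<integral>\<omega>. Y \<omega> * k0 \<omega> \<partial>M)"
      by (rule integral_cong_AE) (use kk in \<open>auto elim!: eventually_mono\<close>)
    also have "\<dots> = (\<integral>\<omega>. Y \<omega> * h \<omega> \<partial>M)" unfolding k0_def by (rule S.real_cond_exp_intg(2)[OF i(1) Y hM])
    finally show ?thesis using i by (simp add: left_diff_distrib right_diff_distrib mult.commute)
  qed
  have set0: "(\<integral>\<omega>. (h \<omega> - k \<omega>) * indicator A \<omega> \<partial>M) = 0" if A: "A \<in> sets (noise D)" for A
  proof (rule noise_total[OF _ _ _ A, where c="2 * c"])
    show "\<bar>h \<omega> - k \<omega>\<bar> \<le> 2 * c" for \<omega> using hb[of \<omega>] kb[of \<omega>] by linarith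
    fix \<phi> assume \<phi>: "L2_st \<phi>" "\<And>p. p \<notin> D \<Longrightarrow> \<phi> p = 0"
    \<comment> \<open>The test function is split at time \<open>a\<close>. By the addition formulas
      its cosine and sine become sums of products of an early factor, to which \<open>orth0\<close>
      applies, and a late factor independent of it.\<close>
    define \<phi>1 where "\<phi>1 = (\<lambda>p. indicator (past a) p * \<phi> p)"
    define \<phi>2 where "\<phi>2 = (\<lambda>p. indicator (- past a) p * \<phi> p)"
    have L: "L2_st \<phi>1" "L2_st \<phi>2" unfolding \<phi>1_def \<phi>2_def by (intro L2_st_indicator_mult \<phi>; measurable)+
    have "(\<lambda>p. \<phi>1 p + \<phi>2 p) = \<phi>" by (auto simp: \<phi>1_def \<phi>2_def indicator_def)
    then have ae: "AE \<omega> in M. \<xi> \<phi> \<omega> = \<xi> \<phi>1 \<omega> + \<xi> \<phi>2 \<omega>" using xi_add[OF L] by simp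
    note [measurable] = xi_measurable[OF \<phi>(1)] xi_measurable[OF L(1)] xi_measurable[OF L(2)]
    have x1[measurable]: "\<xi> \<phi>1 \<in> borel_measurable (noise (D \<inter> past a))"
      by (rule xi_noise[OF L(1)]) (use \<phi>(2) in \<open>auto simp: \<phi>1_def indicator_def\<close>)
    have x1'[measurable]: "\<xi> \<phi>1 \<in> borel_measurable (noise (past a))" by (rule noise_measurable_mono[OF x1 Int_lower2])
    have k'[measurable]: "k \<in> borel_measurable (noise (past a))" by (rule noise_measurable_mono[OF km Int_lower2])
    note [measurable] = h
    have z: "(\<integral>\<omega>. ((h \<omega> - k \<omega>) * f (\<xi> \<phi>1 \<omega>)) * g (\<xi> \<phi>2 \<omega>) \<partial>M) = 0 \<and> integrable M (\<lambda>\<omega>. ((h \<omega> - k \<omega>) * f (\<xi> \<phi>1 \<omega>)) * g (\<xi> \<phi>2 \<omega>))"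
      if fm[measurable]: "f \<in> borel_measurable borel" and gm[measurable]: "g \<in> borel_measurable borel" and fb: "\<And>x. \<bar>f x\<bar> \<le> 1" and gb: "\<And>x. \<bar>g x\<bar> \<le> 1" for f g :: "real \<Rightarrow> real"
    proof -
      have Ym: "(\<lambda>\<omega>. (h \<omega> - k \<omega>) * f (\<xi> \<phi>1 \<omega>)) \<in> borel_measurable (noise (past a))" by measurable
      have "indep_var borel (\<lambda>\<omega>. (h \<omega> - k \<omega>) * f (\<xi> \<phi>1 \<omega>)) borel (\<xi> \<phi>2)"
        by (rule noise_indep_var[OF L(2) _ Ym]) (auto simp: \<phi>2_def)
      then have iv: "indep_var borel ((\<lambda>x. x) \<circ> (\<lambda>\<omega>. (h \<omega> - k \<omega>) * f (\<xi> \<phi>1 \<omega>))) borel (g \<circ> \<xi> \<phi>2)"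
        by (rule indep_var_compose) auto
      have i1: "integrable M ((\<lambda>x. x) \<circ> (\<lambda>\<omega>. (h \<omega> - k \<omega>) * f (\<xi> \<phi>1 \<omega>)))"
      proof (rule integrable_const_bound[where B="2 * c"])
        have "\<bar>h \<omega> - k \<omega>\<bar> * \<bar>f (\<xi> \<phi>1 \<omega>)\<bar> \<le> 2 * c * 1" for \<omega>
          using hb[of \<omega>] kb[of \<omega>] fb by (intro mult_mono) auto
        then show "AE \<omega> in M. norm (((\<lambda>x. x) \<circ> (\<lambda>\<omega>. (h \<omega> - k \<omega>) * f (\<xi> \<phi>1 \<omega>))) \<omega>) \<le> 2 * c" by (auto simp: abs_mult)
      qed (simp add: comp_def)
      have i2: "integrable M (g \<circ> \<xi> \<phi>2)" by (rule integrable_const_bound[where B=1]) (use gb in \<open>auto simp: comp_def\<close>)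
      have "(\<integral>\<omega>. (h \<omega> - k \<omega>) * f (\<xi> \<phi>1 \<omega>) \<partial>M) = 0" by (rule orth0) (use fb in \<open>auto\<close>)
      then show ?thesis using indep_var_integrable[OF iv i1 i2] indep_var_lebesgue_integral[OF iv i1 i2] by (simp add: comp_def)
    qed
    have "(\<integral>\<omega>. (h \<omega> - k \<omega>) * cos (\<xi> \<phi> \<omega>) \<partial>M) = (\<integral>\<omega>. ((h \<omega> - k \<omega>) * cos (\<xi> \<phi>1 \<omega>)) * cos (\<xi> \<phi>2 \<omega>) - ((h \<omega> - k \<omega>) * sin (\<xi> \<phi>1 \<omega>)) * sin (\<xi> \<phi>2 \<omega>) \<partial>M)"
      by (rule integral_cong_AE) (use ae in \<open>auto elim!: eventually_mono simp: cos_add algebra_simps\<close>)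
    moreover have "(\<integral>\<omega>. (h \<omega> - k \<omega>) * sin (\<xi> \<phi> \<omega>) \<partial>M) = (\<integral>\<omega>. ((h \<omega> - k \<omega>) * sin (\<xi> \<phi>1 \<omega>)) * cos (\<xi> \<phi>2 \<omega>) + ((h \<omega> - k \<omega>) * cos (\<xi> \<phi>1 \<omega>)) * sin (\<xi> \<phi>2 \<omega>) \<partial>M)"
      by (rule integral_cong_AE) (use ae in \<open>auto elim!: eventually_mono simp: sin_add algebra_simps\<close>)
    ultimately show "(\<integral>\<omega>. (h \<omega> - k \<omega>) * cos (\<xi> \<phi> \<omega>) \<partial>M) = 0 \<and> (\<integral>\<omega>. (h \<omega> - k \<omega>) * sin (\<xi> \<phi> \<omega>) \<partial>M) = 0"
      using z[of cos cos] z[of sin sin] z[of sin cos] z[of cos sin] by simp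
  qed measurable
  have kD: "k \<in> borel_measurable (noise D)" by (rule noise_measurable_mono[OF km Int_lower1])
  \<comment> \<open>Identifying \<open>k\<close> as a version of the conditional expectation given
    all of \<open>noise D\<close> extends the orthogonality from events to square integrable
    \<open>Y\<close>.\<close>
  have "AE \<omega> in M. real_cond_exp M (noise D) h \<omega> = k \<omega>"
  proof (rule T.real_cond_exp_charact)
    fix A assume A: "A \<in> sets (noise D)"
    then have AM: "A \<in> sets M" using subsetD[OF sets_noise_sub] by blast
    have "integrable M (\<lambda>\<omega>. indicator A \<omega> * h \<omega>)" "integrable M (\<lambda>\<omega>. indicator A \<omega> * k \<omega>)"
      using integrable_mult_indicator[OF AM hi] integrable_mult_indicator[OF AM ki] by simp_all
    then show "(LINT x:A|M. h x) = (LINT x:A|M. k x)"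
      using set0[OF A] by (simp add: set_lebesgue_integral_def left_diff_distrib right_diff_distrib mult.commute)
  qed (fact hi ki kD)+
  then have kk2: "AE \<omega> in M. real_cond_exp M (noise D) h \<omega> = k \<omega>" .
  show thesis
  proof (rule that[of k])
    fix Y assume Y: "Y \<in> borel_measurable (noise D)" "sqint M Y"
    have [measurable]: "Y \<in> borel_measurable M" using Y by (simp add: sqint_def)
    have i: "integrable M (\<lambda>\<omega>. Y \<omega> * h \<omega>)" "integrable M (\<lambda>\<omega>. Y \<omega> * k \<omega>)"
      by (intro sqint_mult_integrable Y sqint_bounded[where c=c] hM kM hb kb)+
    have "(\<integral>\<omega>. Y \<omega> * k \<omega> \<partial>M) = (\<integral>\<omega>. Y \<omega> * real_cond_exp M (noise D) h \<omega> \<partial>M)"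
      by (rule integral_cong_AE) (use kk2 in \<open>auto elim!: eventually_mono\<close>)
    also have "\<dots> = (\<integral>\<omega>. Y \<omega> * h \<omega> \<partial>M)" by (rule T.real_cond_exp_intg(2)[OF i(1) Y(1) hM])
    finally show "(\<integral>\<omega>. (h \<omega> - k \<omega>) * Y \<omega> \<partial>M) = 0" using i by (simp add: left_diff_distrib right_diff_distrib mult.commute)
  qed (fact km kb)+
qed

text \<open>Every random factor is replaced by its projection, so at each fixed \<open>p\<close> the
  value of \<open>m\<close> is the orthogonal projection of the value of \<open>l\<close>.
  Restricted to \<open>E \<subseteq> D\<close>, the integral of \<open>m\<close> involves only
  projected factors and noise in \<open>E\<close>, whence its measurability.\<close>

lemma simple_projection:
  assumes D: "D \<in> sets borel" and "simple l" "list_all bterm l"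
  shows "\<exists>m. simple m \<and> (\<forall>p. (\<lambda>\<omega>. sproc m (p, \<omega>)) \<in> borel_measurable (noise D)) \<and>
    (\<forall>p Y. Y \<in> borel_measurable (noise D) \<longrightarrow> sqint M Y \<longrightarrow> (\<integral>\<omega>. (sproc l (p, \<omega>) - sproc m (p, \<omega>)) * Y \<omega> \<partial>M) = 0) \<and>
    (\<forall>E\<subseteq>D. E \<in> sets borel \<longrightarrow> sint (restr E m) \<in> borel_measurable (noise D))"
  using assms(2,3)
proof (induction l)
  case Nil
  show ?case by (rule exI[of _ "[]"]) (simp add: restr_def sint_def[abs_def])
next
  case (Cons x l)
  obtain h a \<phi> where x: "x = (h, a, \<phi>)" by (cases x)
  have t: "sterm (h, a, \<phi>)" and l: "simple l" "list_all bterm l" and b: "bterm (h, a, \<phi>)" using Cons.prems by (auto simp: x)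
  have L: "L2_st \<phi>" using t by simp
  from b obtain c where c: "\<And>\<omega>. \<bar>h \<omega>\<bar> \<le> c" by auto
  have hm: "h \<in> borel_measurable (noise (past a))" using t by simp
  obtain k where k: "k \<in> borel_measurable (noise (D \<inter> past a))" "\<And>\<omega>. \<bar>k \<omega>\<bar> \<le> c"
    "\<And>Y. Y \<in> borel_measurable (noise D) \<Longrightarrow> sqint M Y \<Longrightarrow> (\<integral>\<omega>. (h \<omega> - k \<omega>) * Y \<omega> \<partial>M) = 0"
    by (rule noise_projection[OF D hm c]) blast
  have kM: "k \<in> borel_measurable M" by (rule noise_measurable_M[OF k(1)])
  have ks: "sqint M k" by (rule sqint_bounded[OF kM k(2)])
  have kt: "sterm (k, a, \<phi>)" using noise_measurable_mono[OF k(1) Int_lower2] ks t by simp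
  have kD[measurable]: "k \<in> borel_measurable (noise D)" by (rule noise_measurable_mono[OF k(1) Int_lower1])
  from Cons.IH[OF l] obtain m where m: "simple m" "\<And>p. (\<lambda>\<omega>. sproc m (p, \<omega>)) \<in> borel_measurable (noise D)"
    "\<And>p Y. Y \<in> borel_measurable (noise D) \<Longrightarrow> sqint M Y \<Longrightarrow> (\<integral>\<omega>. (sproc l (p, \<omega>) - sproc m (p, \<omega>)) * Y \<omega> \<partial>M) = 0"
    "\<And>E. E \<subseteq> D \<Longrightarrow> E \<in> sets borel \<Longrightarrow> sint (restr E m) \<in> borel_measurable (noise D)" by blast
  note [measurable] = m(2)
  show ?case
  proof (intro exI[of _ "(k, a, \<phi>) # m"] conjI allI impI)
    show "simple ((k, a, \<phi>) # m)" using kt m(1) by simp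
    show "(\<lambda>\<omega>. sproc ((k, a, \<phi>) # m) (p, \<omega>)) \<in> borel_measurable (noise D)" for p by simp
    fix p Y assume Y: "Y \<in> borel_measurable (noise D)" "sqint M Y"
    have hk: "sqint M (\<lambda>\<omega>. h \<omega> - k \<omega>)" using t ks by (auto intro: sqint_diff)
    have lm: "sqint M (\<lambda>\<omega>. sproc l (p, \<omega>) - sproc m (p, \<omega>))" by (intro sqint_diff sproc_sqint l m)
    have "(\<integral>\<omega>. (sproc (x # l) (p, \<omega>) - sproc ((k, a, \<phi>) # m) (p, \<omega>)) * Y \<omega> \<partial>M) =
      (\<integral>\<omega>. \<phi> p * ((h \<omega> - k \<omega>) * Y \<omega>) + (sproc l (p, \<omega>) - sproc m (p, \<omega>)) * Y \<omega> \<partial>M)"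
      by (rule Bochner_Integration.integral_cong) (simp_all add: x algebra_simps)
    also have "\<dots> = 0" using k(3)[OF Y] m(3)[OF Y, of p] sqint_mult_integrable[OF hk Y(2)] sqint_mult_integrable[OF lm Y(2)] by simp
    finally show "(\<integral>\<omega>. (sproc (x # l) (p, \<omega>) - sproc ((k, a, \<phi>) # m) (p, \<omega>)) * Y \<omega> \<partial>M) = 0" .
  next
    fix E assume E: "E \<subseteq> D" "E \<in> sets borel"
    have [measurable]: "\<xi> (\<lambda>p. indicator E p * \<phi> p) \<in> borel_measurable (noise D)"
      by (rule xi_noise[OF L2_st_indicator_mult[OF L E(2)]]) (use E(1) in \<open>auto simp: indicator_def\<close>)
    note [measurable] = m(4)[OF E]
    have "sint (restr E ((k, a, \<phi>) # m)) = (\<lambda>\<omega>. k \<omega> * \<xi> (\<lambda>p. indicator E p * \<phi> p) \<omega> + sint (restr E m) \<omega>)"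
      by (simp add: restr_def fun_eq_iff)
    then show "sint (restr E ((k, a, \<phi>) # m)) \<in> borel_measurable (noise D)" by simp
  qed
qed

lemma sqnorm_best_approx:
  assumes e: "sqint M e" "sqint M f" and g: "sqint M g"
    and o: "(\<integral>\<omega>. (e \<omega> - f \<omega>) * (f \<omega> - g \<omega>) \<partial>M) = 0"
  shows "sqnorm M (\<lambda>\<omega>. e \<omega> - f \<omega>) \<le> sqnorm M (\<lambda>\<omega>. e \<omega> - g \<omega>)"
proof -
  have s: "sqint M (\<lambda>\<omega>. e \<omega> - f \<omega>)" "sqint M (\<lambda>\<omega>. f \<omega> - g \<omega>)" "sqint M (\<lambda>\<omega>. e \<omega> - g \<omega>)" using e g by (auto intro: sqint_diff)
  have "(\<lambda>\<omega>. (e \<omega> - g \<omega>)\<^sup>2) = (\<lambda>\<omega>. (e \<omega> - f \<omega>)\<^sup>2 + 2 * ((e \<omega> - f \<omega>) * (f \<omega> - g \<omega>)) + (f \<omega> - g \<omega>)\<^sup>2)"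
    by (auto simp: power2_eq_square algebra_simps)
  then have "(\<integral>\<omega>. (e \<omega> - g \<omega>)\<^sup>2 \<partial>M) = (\<integral>\<omega>. (e \<omega> - f \<omega>)\<^sup>2 \<partial>M) + (\<integral>\<omega>. (f \<omega> - g \<omega>)\<^sup>2 \<partial>M)"
    using s sqint_mult_integrable[OF s(1,2)] o by (simp add: sqint_def)
  then show ?thesis using s by (simp add: sqnorm_sqint)
qed

end

text \<open>Each time slice of the cone has length at most \<open>2 * T\<close>. An explicit
  primitive \<open>F\<close> is used because the Gronwall iteration produces powers of time.\<close>

lemma light_cone_integral_le:
  assumes f[measurable]: "f \<in> borel_measurable borel" and T: "0 \<le> s" "s \<le> T" and F: "\<And>r. 0 \<le> r \<Longrightarrow> r \<le> s \<Longrightarrow> DERIV F r :> f r"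
    and f0: "\<And>r. 0 \<le> r \<Longrightarrow> 0 \<le> f r"
  shows "(\<integral>\<^sup>+p. indicator (light_cone y s) p * ennreal (f (fst p)) \<partial>lborel) \<le> ennreal (2 * T * (F s - F 0))"
proof -
  have [measurable]: "light_cone y s \<in> sets (borel \<Otimes>\<^sub>M borel)" by (simp only: borel_prod light_cone_borel)
  have "(\<integral>\<^sup>+p. indicator (light_cone y s) p * ennreal (f (fst p)) \<partial>lborel) =
     (\<integral>\<^sup>+p. indicator (light_cone y s) p * ennreal (f (fst p)) \<partial>(lborel \<Otimes>\<^sub>M lborel))" by (simp only: lborel_prod)
  also have "\<dots> = (\<integral>\<^sup>+r. \<integral>\<^sup>+z. indicator (light_cone y s) (r, z) * ennreal (f r) \<partial>lborel \<partial>lborel)"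
    by (subst lborel.nn_integral_fst[symmetric]) (simp_all, measurable)
  also have "\<dots> \<le> (\<integral>\<^sup>+r. ennreal (2 * T * f r) * indicator {0..s} r \<partial>lborel)"
  proof (rule nn_integral_mono)
    fix r
    have "(\<integral>\<^sup>+z. indicator (light_cone y s) (r, z) * ennreal (f r) \<partial>lborel) \<le>
      (\<integral>\<^sup>+z. (ennreal (f r) * indicator {0..s} r) * indicator {y - (s - r)..y + (s - r)} z \<partial>lborel)"
      by (intro nn_integral_mono) (auto simp: indicator_def light_cone_def)
    also have "\<dots> = (ennreal (f r) * indicator {0..s} r) * emeasure lborel {y - (s - r)..y + (s - r)}"
      by (subst nn_integral_cmult_indicator) auto
    also have "\<dots> \<le> ennreal (2 * T * f r) * indicator {0..s} r"
    proof (cases "r \<in> {0..s}")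
      case True
      then have "ennreal (f r) * ennreal (2 * (s - r)) \<le> ennreal (f r) * ennreal (2 * T)"
        using T by (intro mult_left_mono ennreal_leI) auto
      also have "\<dots> = ennreal (2 * T * f r)" using T by (subst ennreal_mult''[symmetric]) (auto simp: mult.commute)
      finally show ?thesis using True by simp
    qed simp
    finally show "(\<integral>\<^sup>+z. indicator (light_cone y s) (r, z) * ennreal (f r) \<partial>lborel) \<le> ennreal (2 * T * f r) * indicator {0..s} r" .
  qed
  also have "\<dots> = ennreal (2 * T * F s - 2 * T * F 0)"
    by (rule nn_integral_FTC_Icc) (use T F f0 in \<open>auto intro!: DERIV_cmult\<close>)
  finally show ?thesis by (simp add: right_diff_distrib)
qed

section \<open>Gronwall iteration inside a cone\<close>

context mild_wave
begin

text \<open>The new approximant is the integral over the small cone \<open>D\<close> with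
  coefficients projected on the noise in the large cone \<open>Q\<close>. At each point of
  \<open>D\<close> the projection is the best approximation by variables of \<open>noise Q\<close>,
  hence no worse than \<open>\<sigma>\<close> applied to the approximant from \<open>IH\<close>;
  Lipschitz continuity and the isometry then turn the error \<open>f\<close> into its primitive.
  Projecting on \<open>Q\<close> and not on \<open>D\<close> keeps one sigma-algebra through all
  iterations.\<close>

lemma u_gronwall_step:
  assumes f[measurable]: "f \<in> borel_measurable borel" and F: "\<And>r. DERIV F r :> f r" and f0: "\<And>r. 0 \<le> r \<Longrightarrow> 0 \<le> f r"
    and IH: "\<And>r z. (r, z) \<in> light_cone x T \<Longrightarrow> \<exists>g. g \<in> borel_measurable (noise (light_cone x T)) \<and> sqint M g \<and> sqnorm M (\<lambda>\<omega>. u r z \<omega> - g \<omega>) \<le> ennreal (f r)"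
    and sy: "(s, y) \<in> light_cone x T" and e: "e > 0"
  shows "\<exists>g. g \<in> borel_measurable (noise (light_cone x T)) \<and> sqint M g \<and> sqnorm M (\<lambda>\<omega>. u s y \<omega> - g \<omega>) \<le> ennreal (8 * L\<^sup>2 * T * (F s - F 0) + 6 * e)"
proof -
  define Q where "Q = light_cone x T"
  define D where "D = light_cone y s"
  have s: "0 \<le> s" "s \<le> T" using sy by (auto simp: light_cone_def)
  have DQ: "D \<subseteq> Q" unfolding D_def Q_def by (rule light_cone_mono[OF sy])
  have Qb: "Q \<in> sets borel" and Db: "D \<in> sets borel" by (auto simp: Q_def D_def)
  have us: "sqint M (u s y)" and um[measurable]: "u s y \<in> borel_measurable M" using u_sqint[OF s(1)] s by auto
  obtain l where l: "simple l" "list_all bterm l" "sqnorm PM (\<lambda>z. sproc l z - Xc D z) \<le> ennreal e" "sqnorm M (\<lambda>\<omega>. sint l \<omega> - (u s y \<omega> - 1)) \<le> ennreal e"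
  proof (rule u_approx[OF s(1), of y])
    fix l assume l: "\<And>n. simple (l n)" "\<And>n. list_all bterm (l n)"
      "(\<lambda>n. sqnorm PM (\<lambda>z. sproc (l n) z - Xc (light_cone y s) z)) \<longlonglongrightarrow> 0" "(\<lambda>n. sqnorm M (\<lambda>\<omega>. sint (l n) \<omega> - (u s y \<omega> - 1))) \<longlonglongrightarrow> 0"
    have "eventually (\<lambda>n. sqnorm PM (\<lambda>z. sproc (l n) z - Xc (light_cone y s) z) < ennreal e \<and> sqnorm M (\<lambda>\<omega>. sint (l n) \<omega> - (u s y \<omega> - 1)) < ennreal e) sequentially"
      using e by (intro eventually_conj order_tendstoD(2)[OF l(3)] order_tendstoD(2)[OF l(4)]) auto
    then obtain n where "sqnorm PM (\<lambda>z. sproc (l n) z - Xc (light_cone y s) z) < ennreal e" "sqnorm M (\<lambda>\<omega>. sint (l n) \<omega> - (u s y \<omega> - 1)) < ennreal e"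
      by (auto simp: eventually_sequentially)
    then show thesis using that[of "l n"] l(1,2) by (simp add: D_def)
  qed
  obtain m where m: "simple m" "\<And>p. (\<lambda>\<omega>. sproc m (p, \<omega>)) \<in> borel_measurable (noise Q)"
    "\<And>p Y. Y \<in> borel_measurable (noise Q) \<Longrightarrow> sqint M Y \<Longrightarrow> (\<integral>\<omega>. (sproc l (p, \<omega>) - sproc m (p, \<omega>)) * Y \<omega> \<partial>M) = 0"
    "\<And>E. E \<subseteq> Q \<Longrightarrow> E \<in> sets borel \<Longrightarrow> sint (restr E m) \<in> borel_measurable (noise Q)"
    using simple_projection[OF Qb l(1,2)] by blast
  \<comment> \<open>The integrand of the error: what \<open>l\<close> has outside \<open>D\<close>,
    and inside \<open>D\<close> its difference from the projection.\<close>
  define k where "k = restr (- D) l @ restr D l @ negl (restr D m)"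
  have ks: "simple k" unfolding k_def using l(1) m(1) Db by (simp add: simple_restr simple_negl)
  define g where "g \<omega> = 1 + sint (restr D m) \<omega>" for \<omega>
  have gm: "g \<in> borel_measurable (noise Q)" unfolding g_def[abs_def] using m(4)[OF DQ Db] by simp
  have gs: "sqint M g" unfolding g_def[abs_def] by (intro sqint_add sqint_const sint_sqint simple_restr m Db)
  have [measurable]: "sint l \<in> borel_measurable M" "sint k \<in> borel_measurable M" "g \<in> borel_measurable M"
    using sint_sqint[OF l(1)] sint_sqint[OF ks] gs by (auto simp: sqint_def)
  note [measurable] = sproc_measurable[OF l(1)] sproc_measurable[OF ks]
  have ae: "AE \<omega> in M. u s y \<omega> - g \<omega> = sint k \<omega> - (sint l \<omega> - (u s y \<omega> - 1))"
    using sint_restr_split[OF l(1) Db] by eventually_elim (simp add: g_def k_def)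
  have "sqnorm M (\<lambda>\<omega>. u s y \<omega> - g \<omega>) = sqnorm M (\<lambda>\<omega>. sint k \<omega> - (sint l \<omega> - (u s y \<omega> - 1)))" by (rule sqnorm_cong_AE[OF ae])
  also have "\<dots> \<le> 2 * sqnorm M (sint k) + 2 * sqnorm M (\<lambda>\<omega>. sint l \<omega> - (u s y \<omega> - 1))" by (rule sqnorm_diff_le) measurable
  also have "\<dots> \<le> 2 * sqnorm M (sint k) + 2 * ennreal e" by (intro add_left_mono mult_left_mono l) auto
  also have "sqnorm M (sint k) = sqnorm PM (sproc k)" by (rule sint_isometry[OF ks])
  also have "\<dots> = (\<integral>\<^sup>+p. sqnorm M (\<lambda>\<omega>. sproc k (p, \<omega>)) \<partial>lborel)" by (rule sqnorm_PM) measurable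
  also have "\<dots> \<le> (\<integral>\<^sup>+p. 2 * sqnorm M (\<lambda>\<omega>. sproc l (p, \<omega>) - Xc D (p, \<omega>)) + indicator D p * ennreal (2 * L\<^sup>2 * f (fst p)) \<partial>lborel)"
  proof (rule nn_integral_mono)
    fix p :: "real \<times> real"
    have sl: "sqint M (\<lambda>\<omega>. sproc l (p, \<omega>))" "sqint M (\<lambda>\<omega>. sproc m (p, \<omega>))" by (intro sproc_sqint l m)+
    have [measurable]: "(\<lambda>\<omega>. sproc l (p, \<omega>)) \<in> borel_measurable M" using sl by (simp add: sqint_def)
    have sk: "sproc k (p, \<omega>) = (if p \<in> D then sproc l (p, \<omega>) - sproc m (p, \<omega>) else sproc l (p, \<omega>))" for \<omega>
      by (simp add: k_def sproc_restr)
    show "sqnorm M (\<lambda>\<omega>. sproc k (p, \<omega>)) \<le> 2 * sqnorm M (\<lambda>\<omega>. sproc l (p, \<omega>) - Xc D (p, \<omega>)) + indicator D p * ennreal (2 * L\<^sup>2 * f (fst p))"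
    proof (cases "p \<in> D")
      case False
      then have "sqnorm M (\<lambda>\<omega>. sproc k (p, \<omega>)) = sqnorm M (\<lambda>\<omega>. sproc l (p, \<omega>) - Xc D (p, \<omega>))" by (simp add: sk Xc_def)
      also have "\<dots> \<le> 2 * \<dots>" using mult_right_mono[of 1 "2::ennreal" "sqnorm M (\<lambda>\<omega>. sproc l (p, \<omega>) - Xc D (p, \<omega>))"] by simp
      finally show ?thesis using False by simp
    next
      case True
      then have pQ: "(fst p, snd p) \<in> light_cone x T" and p0: "0 \<le> fst p" using DQ by (auto simp: Q_def light_cone_def)
      obtain v where v: "v \<in> borel_measurable (noise Q)" "sqint M v" "sqnorm M (\<lambda>\<omega>. u (fst p) (snd p) \<omega> - v \<omega>) \<le> ennreal (f (fst p))"
        using IH[OF pQ] by (auto simp: Q_def)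
      note [measurable] = u_measurable[OF p0]
      have vM[measurable]: "v \<in> borel_measurable M" using v by (simp add: sqint_def)
      have w: "(\<lambda>\<omega>. \<sigma> (v \<omega>)) \<in> borel_measurable (noise Q)" using v(1) by measurable
      have ws: "sqint M (\<lambda>\<omega>. \<sigma> (v \<omega>))" by (rule sigma_sqint[OF v(2)])
      have "sqnorm M (\<lambda>\<omega>. sproc k (p, \<omega>)) = sqnorm M (\<lambda>\<omega>. sproc l (p, \<omega>) - sproc m (p, \<omega>))" using True by (simp add: sk)
      \<comment> \<open>Here the orthogonality of the projection error to all square integrable
        variables of \<open>noise Q\<close> enters, applied to
        \<open>sproc m - \<sigma>(v)\<close>.\<close>
      also have "\<dots> \<le> sqnorm M (\<lambda>\<omega>. sproc l (p, \<omega>) - \<sigma> (v \<omega>))"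
        by (intro sqnorm_best_approx sl ws m(3) borel_measurable_diff m(2) w sqint_diff)
      also have "\<dots> \<le> 2 * sqnorm M (\<lambda>\<omega>. sproc l (p, \<omega>) - \<sigma> (u (fst p) (snd p) \<omega>)) + 2 * sqnorm M (\<lambda>\<omega>. \<sigma> (u (fst p) (snd p) \<omega>) - \<sigma> (v \<omega>))"
        by (rule sqnorm_triangle) measurable
      also have "sqnorm M (\<lambda>\<omega>. sproc l (p, \<omega>) - \<sigma> (u (fst p) (snd p) \<omega>)) = sqnorm M (\<lambda>\<omega>. sproc l (p, \<omega>) - Xc D (p, \<omega>))"
        using True p0 by (intro sqnorm_cong) (simp add: Xc_def su_eq)
      also have "sqnorm M (\<lambda>\<omega>. \<sigma> (u (fst p) (snd p) \<omega>) - \<sigma> (v \<omega>)) \<le> ennreal (L\<^sup>2) * ennreal (f (fst p))"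
        by (rule order_trans[OF sigma_diff_sqnorm]) (use v(3) in \<open>auto intro!: mult_left_mono\<close>)
      also have "2 * (ennreal (L\<^sup>2) * ennreal (f (fst p))) = ennreal (2 * L\<^sup>2 * f (fst p))"
        using f0[OF p0] by (simp add: ennreal_mult mult.assoc)
      finally show ?thesis using True by (simp add: add_left_mono mult_left_mono)
    qed
  qed
  also have "\<dots> = 2 * (\<integral>\<^sup>+p. sqnorm M (\<lambda>\<omega>. sproc l (p, \<omega>) - Xc D (p, \<omega>)) \<partial>lborel) + (\<integral>\<^sup>+p. indicator D p * ennreal (2 * L\<^sup>2 * f (fst p)) \<partial>lborel)"
  proof -
    have [measurable]: "(\<lambda>p. sqnorm M (\<lambda>\<omega>. sproc l (p, \<omega>) - Xc D (p, \<omega>))) \<in> borel_measurable lborel"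
      unfolding sqnorm_def using Xc_measurable[OF Db] by measurable
    have [measurable]: "(\<lambda>p::real\<times>real. indicator D p * ennreal (2 * L\<^sup>2 * f (fst p))) \<in> borel_measurable lborel"
    proof -
      have [measurable]: "fst \<in> borel_measurable (borel :: (real \<times> real) measure)"
        by (intro borel_measurable_continuous_onI continuous_on_fst continuous_on_id)
      note [measurable] = Db
      show ?thesis by measurable
    qed
    show ?thesis by (subst nn_integral_add; (subst nn_integral_cmult)?) auto
  qed
  also have "(\<integral>\<^sup>+p. sqnorm M (\<lambda>\<omega>. sproc l (p, \<omega>) - Xc D (p, \<omega>)) \<partial>lborel) = sqnorm PM (\<lambda>z. sproc l z - Xc D z)"
    using Xc_measurable[OF Db] by (subst sqnorm_PM) auto
  also have "\<dots> \<le> ennreal e" by (rule l)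
  also have "(\<integral>\<^sup>+p. indicator D p * ennreal (2 * L\<^sup>2 * f (fst p)) \<partial>lborel) \<le> ennreal (2 * T * (2 * L\<^sup>2 * F s - 2 * L\<^sup>2 * F 0))"
    unfolding D_def by (rule light_cone_integral_le) (use s F f0 in \<open>auto intro!: DERIV_cmult\<close>)
  finally have "sqnorm M (\<lambda>\<omega>. u s y \<omega> - g \<omega>) \<le> 2 * (2 * ennreal e + ennreal (2 * T * (2 * L\<^sup>2 * F s - 2 * L\<^sup>2 * F 0))) + 2 * ennreal e"
    by (simp add: add_mono mult_left_mono)
  \<comment> \<open>The constants combine as
    \<open>2 * (2 * T) * (2 * L\<^sup>2) = 8 * L\<^sup>2 * T\<close> and
    \<open>2 * 2 * e + 2 * e = 6 * e\<close>.\<close>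
  also have "\<dots> \<le> ennreal (8 * L\<^sup>2 * T * (F s - F 0) + 6 * e)"
  proof -
    have Fm: "F 0 \<le> F s" by (rule DERIV_nonneg_imp_nondecreasing[OF s(1)]) (use F f0 in auto)
    have n: "0 \<le> 2 * T * (2 * L\<^sup>2 * F s - 2 * L\<^sup>2 * F 0)"
      using s Fm by (auto intro!: mult_nonneg_nonneg simp: right_diff_distrib[symmetric])
    have "2 * (2 * ennreal e + ennreal (2 * T * (2 * L\<^sup>2 * F s - 2 * L\<^sup>2 * F 0))) + 2 * ennreal e
      = ennreal (2 * (2 * e + (2 * T * (2 * L\<^sup>2 * F s - 2 * L\<^sup>2 * F 0))) + 2 * e)"
    proof -
      have "2 * (2 * ennreal e + ennreal a) + 2 * ennreal e = ennreal (2 * (2 * e + a) + 2 * e)" if "0 \<le> a" for a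
      proof -
        have "4 * ennreal e + 2 * ennreal e = 6 * ennreal e" by (simp add: distrib_right[symmetric])
        then show ?thesis using e that by (simp add: ennreal_plus ennreal_mult distrib_left)
      qed
      from this[OF n] show ?thesis .
    qed
    also have "\<dots> = ennreal (8 * L\<^sup>2 * T * (F s - F 0) + 6 * e)" by (simp add: algebra_simps)
    finally show ?thesis by simp
  qed
  finally show ?thesis using gm gs unfolding Q_def by blast
qed

text \<open>Finite speed of propagation. Starting from the constant 1, the iteration reaches mean
  square error \<open>K * (c * r) ^ n / fact n\<close> up to an arbitrary slack \<open>e\<close>,
  which is present because each step works with an approximant of the Walsh integral. So
  \<open>u s y\<close> is an \<open>L2\<close> limit of variables of the cone, and completeness of
  \<open>noise\<close> makes it one of them.\<close>

lemma u_light_cone_measurable: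
  assumes sy: "(s, y) \<in> light_cone x T"
  shows "u s y \<in> borel_measurable (noise (light_cone x T))"
proof -
  have s: "0 \<le> s" "s \<le> T" using sy by (auto simp: light_cone_def)
  obtain K where K: "K \<ge> 0" "\<And>s y. (s, y) \<in> light_cone x T \<Longrightarrow> sqnorm M (\<lambda>\<omega>. u s y \<omega> - 1) \<le> ennreal K" using u_bound by blast
  define c where "c = 8 * L\<^sup>2 * T"
  have c0: "0 \<le> c" using s by (simp add: c_def)
  have claim: "\<forall>r z e. (r, z) \<in> light_cone x T \<longrightarrow> e > 0 \<longrightarrow>
    (\<exists>g. g \<in> borel_measurable (noise (light_cone x T)) \<and> sqint M g \<and> sqnorm M (\<lambda>\<omega>. u r z \<omega> - g \<omega>) \<le> ennreal (K * (c * r) ^ n / fact n + e))" for n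
  proof (induction n)
    case 0
    show ?case
    proof (intro allI impI)
      fix r z and e :: real assume "(r, z) \<in> light_cone x T" "e > 0"
      then show "\<exists>g. g \<in> borel_measurable (noise (light_cone x T)) \<and> sqint M g \<and> sqnorm M (\<lambda>\<omega>. u r z \<omega> - g \<omega>) \<le> ennreal (K * (c * r) ^ 0 / fact 0 + e)"
        by (intro exI[of _ "\<lambda>_. 1"]) (auto simp: sqint_const intro!: order_trans[OF K(2)] ennreal_leI)
    qed
  next
    case (Suc n)
    show ?case
    proof (intro allI impI)
      fix r z and e :: real assume rz: "(r, z) \<in> light_cone x T" and e: "e > 0"
      have r: "0 \<le> r" using rz by (auto simp: light_cone_def)
      \<comment> \<open>Chosen so that the slack of the previous stage, multiplied by
        \<open>c * r\<close>, stays below \<open>e / 2\<close>; the other half is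
        \<open>6 * (e / 12)\<close>. Adding 1 avoids a zero denominator.\<close>
      define e' where "e' = e / (2 * (c * r + 1))"
      have cr: "c * r + 1 > 0" using mult_nonneg_nonneg[OF c0 r] by linarith
      have e': "e' > 0" using e cr by (simp add: e'_def)
      define F where "F r = (K * c ^ n / fact (Suc n)) * r ^ Suc n + e' * r" for r
      define f where "f r = K * (c * r) ^ n / fact n + e'" for r
      have DF: "DERIV F r :> f r" for r
      proof -
        have "DERIV F r :> (K * c ^ n / fact (Suc n)) * (real (Suc n) * r ^ (Suc n - Suc 0)) + e' * 1"
          unfolding F_def by (intro DERIV_add DERIV_cmult DERIV_pow DERIV_ident)
        also have "(K * c ^ n / fact (Suc n)) * (real (Suc n) * r ^ (Suc n - Suc 0)) + e' * 1 = f r"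
          unfolding f_def fact_Suc by (simp add: power_mult_distrib del: of_nat_Suc)
        finally show ?thesis .
      qed
      have fm: "f \<in> borel_measurable borel" unfolding f_def by measurable
      have f0: "0 \<le> f r" if "0 \<le> r" for r using that c0 K(1) e' by (auto simp: f_def)
      from Suc.IH e' have "\<And>r z. (r, z) \<in> light_cone x T \<Longrightarrow> \<exists>g. g \<in> borel_measurable (noise (light_cone x T)) \<and> sqint M g \<and> sqnorm M (\<lambda>\<omega>. u r z \<omega> - g \<omega>) \<le> ennreal (f r)"
        by (auto simp: f_def)
      from u_gronwall_step[OF fm DF f0 this rz, where e="e / 12"] e
      obtain g where g: "g \<in> borel_measurable (noise (light_cone x T))" "sqint M g" "sqnorm M (\<lambda>\<omega>. u r z \<omega> - g \<omega>) \<le> ennreal (c * (F r - F 0) + 6 * (e / 12))"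
        unfolding c_def by auto
      have "c * (F r - F 0) + 6 * (e / 12) = K * (c * r) ^ Suc n / fact (Suc n) + (c * r * e' + e / 2)"
        by (simp add: F_def power_mult_distrib algebra_simps)
      also have "c * r * e' \<le> e / 2"
      proof -
        have "c * r * e' \<le> (c * r + 1) * e'" using e' by (intro mult_right_mono) auto
        also have "\<dots> = e / 2" using cr by (simp add: e'_def field_simps)
        finally show ?thesis .
      qed
      finally have "c * (F r - F 0) + 6 * (e / 12) \<le> K * (c * r) ^ Suc n / fact (Suc n) + e" by simp
      then show "\<exists>g. g \<in> borel_measurable (noise (light_cone x T)) \<and> sqint M g \<and> sqnorm M (\<lambda>\<omega>. u r z \<omega> - g \<omega>) \<le> ennreal (K * (c * r) ^ Suc n / fact (Suc n) + e)"
        using g order_trans[OF g(3) ennreal_leI] by blast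
    qed
  qed
  have "\<exists>g. g \<in> borel_measurable (noise (light_cone x T)) \<and> sqint M g \<and> sqnorm M (\<lambda>\<omega>. u s y \<omega> - g \<omega>) \<le> ennreal (K * (c * s) ^ n / fact n + 1 / real (Suc n))" for n
    using claim[of n] sy by auto
  then obtain g where g: "\<And>n. g n \<in> borel_measurable (noise (light_cone x T))" "\<And>n. sqint M (g n)"
    "\<And>n. sqnorm M (\<lambda>\<omega>. u s y \<omega> - g n \<omega>) \<le> ennreal (K * (c * s) ^ n / fact n + 1 / real (Suc n))" by metis
  have b0: "0 \<le> K * (c * s) ^ n / fact n + 1 / real (Suc n)" for n using K(1) c0 s by auto
  have us: "sqint M (u s y)" using u_sqint s by auto
  have gs: "sqint M (\<lambda>\<omega>. g n \<omega> - u s y \<omega>)" for n by (intro sqint_diff g us)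
  show ?thesis
  proof (rule complete_L2_limit[OF subalgebra_noise null_sets_noise g(1)])
    show "u s y \<in> borel_measurable M" using us by (simp add: sqint_def)
    show "integrable M (\<lambda>\<omega>. (g n \<omega> - u s y \<omega>)\<^sup>2)" for n using gs by (simp add: sqint_def)
    have le: "(\<integral>\<omega>. (g n \<omega> - u s y \<omega>)\<^sup>2 \<partial>M) \<le> K * (c * s) ^ n / fact n + 1 / real (Suc n)" for n
      using g(3)[of n] b0[of n] unfolding sqnorm_commute[of M "u s y"] sqnorm_sqint[OF gs] by (subst (asm) ennreal_le_iff) auto
    have "(\<lambda>n. K * (inverse (fact n) * (c * s) ^ n) + 1 / real (Suc n)) \<longlonglongrightarrow> K * 0 + 0"
      by (intro tendsto_add tendsto_mult tendsto_const LIMSEQ_Suc[OF lim_1_over_n] summable_LIMSEQ_zero[OF summable_exp])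
    then have lim: "(\<lambda>n. K * (c * s) ^ n / fact n + 1 / real (Suc n)) \<longlonglongrightarrow> 0" by (simp add: field_simps)
    show "(\<lambda>n. \<integral>\<omega>. (g n \<omega> - u s y \<omega>)\<^sup>2 \<partial>M) \<longlonglongrightarrow> 0"
      by (rule tendsto_sandwich[OF _ _ tendsto_const lim]) (use le in \<open>auto intro!: always_eventually\<close>)
  qed
qed

end

section \<open>Freezing the integrand on the boundary of the cone\<close>

locale mild_wave_at = mild_wave M \<xi> \<sigma> u L for M :: "'a measure" and \<xi> \<sigma> u L +
  fixes t x :: real
  assumes t0: "0 < t"
    and cont: "\<And>\<omega>. \<omega> \<in> space M \<Longrightarrow> continuous_on ({0..} \<times> UNIV) (\<lambda>(s, y). u s y \<omega>)"
begin

definition yy :: "nat \<Rightarrow> nat \<Rightarrow> real" where "yy n j = x - t + t * real j / real n"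

text \<open>The integrand on the \<open>j\<close>-th cell is frozen at the end point farther from \<open>x\<close>, so that the
  frozen value is known before the cell begins.\<close>

definition zz :: "nat \<Rightarrow> nat \<Rightarrow> real" where "zz n j = (if j < n then yy n j else yy n (Suc j))"
definition tt :: "nat \<Rightarrow> nat \<Rightarrow> real" where "tt n j = t - \<bar>x - zz n j\<bar>"
definition V :: "nat \<Rightarrow> nat \<Rightarrow> 'a \<Rightarrow> real" where "V n j \<omega> = \<sigma> (u (tt n j) (zz n j) \<omega>)"
text \<open>The part, above the \<open>j\<close>-th interval, of the strip between the cones of
  heights \<open>t + r\<close> and \<open>t + r'\<close>. Half-open conditions in both directions
  make neighbouring cells disjoint and consecutive ones fit together exactly.\<close>

definition cell :: "nat \<Rightarrow> nat \<Rightarrow> real \<Rightarrow> real \<Rightarrow> (real \<times> real) set" where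
  "cell n j r r' = {(s, y). yy n j < y \<and> y \<le> yy n (Suc j) \<and> t + r < s + \<bar>y - x\<bar> \<and> s + \<bar>y - x\<bar> \<le> t + r'}"

lemma yy_le: "i \<le> j \<Longrightarrow> yy n i \<le> yy n j"
  using t0 by (auto simp: yy_def intro!: divide_right_mono mult_left_mono)

lemma yy_Suc: "0 < n \<Longrightarrow> yy n (Suc j) = yy n j + t / real n"
  by (simp add: yy_def field_simps)

lemma yy_bounds:
  assumes "0 < n"
  shows "yy n 0 = x - t" "yy n n = x" "yy n (2 * n) = x + t"
  using assms by (simp_all add: yy_def field_simps)

lemma zz_bounds:
  assumes n: "0 < n" and j: "j < 2 * n"
  shows "\<bar>x - zz n j\<bar> \<le> t" "0 \<le> tt n j" "tt n j \<le> t" "(tt n j, zz n j) \<in> light_cone x t"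
proof -
  show 1: "\<bar>x - zz n j\<bar> \<le> t"
  proof (cases "j < n")
    case True
    then show ?thesis using yy_le[of 0 j n] yy_le[of j n n] yy_bounds[OF n] by (auto simp: zz_def)
  next
    case False
    then show ?thesis using yy_le[of n "Suc j" n] yy_le[of "Suc j" "2*n" n] yy_bounds[OF n] j by (auto simp: zz_def)
  qed
  then show "0 \<le> tt n j" "tt n j \<le> t" "(tt n j, zz n j) \<in> light_cone x t"
    by (auto simp: tt_def light_cone_def)
qed

lemma zz_far:
  assumes n: "0 < n" and j: "j < 2 * n" and y: "yy n j < y" "y \<le> yy n (Suc j)"
  shows "\<bar>zz n j - x\<bar> - \<bar>y - x\<bar> = \<bar>zz n j - y\<bar>" "\<bar>zz n j - y\<bar> \<le> t / real n" "\<bar>y - x\<bar> \<le> t"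
proof -
  have "\<bar>zz n j - x\<bar> - \<bar>y - x\<bar> = \<bar>zz n j - y\<bar> \<and> \<bar>zz n j - y\<bar> \<le> t / real n"
  proof (cases "j < n")
    case True
    then have "y \<le> x" using y yy_le[of "Suc j" n n] yy_bounds[OF n] by auto
    then show ?thesis using y True yy_Suc[OF n, of j] by (auto simp: zz_def)
  next
    case False
    then have "x < y" using y yy_le[of n j n] yy_bounds[OF n] by auto
    then show ?thesis using y False yy_Suc[OF n, of j] by (auto simp: zz_def)
  qed
  then show 1: "\<bar>zz n j - x\<bar> - \<bar>y - x\<bar> = \<bar>zz n j - y\<bar>" "\<bar>zz n j - y\<bar> \<le> t / real n" by auto
  then show "\<bar>y - x\<bar> \<le> t" using zz_bounds(1)[OF n j] by linarith
qed

lemma cell_borel [measurable]: "cell n j r r' \<in> sets borel"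
proof -
  have "cell n j r r' = {p. yy n j < snd p} \<inter> {p. snd p \<le> yy n (Suc j)} \<inter> {p. t + r < fst p + \<bar>snd p - x\<bar>} \<inter> {p. fst p + \<bar>snd p - x\<bar> \<le> t + r'}"
    by (auto simp: cell_def)
  moreover have "open {p :: real \<times> real. yy n j < snd p}" "open {p :: real \<times> real. t + r < fst p + \<bar>snd p - x\<bar>}"
    by (intro open_Collect_less continuous_intros)+
  moreover have "closed {p :: real \<times> real. snd p \<le> yy n (Suc j)}" "closed {p :: real \<times> real. fst p + \<bar>snd p - x\<bar> \<le> t + r'}"
    by (intro closed_Collect_le continuous_intros)+
  ultimately show ?thesis by (simp add: borel_open borel_closed sets.Int)
qed

lemma emeasure_cell:
  assumes "0 < n" "r \<le> r'"
  shows "emeasure lborel (cell n j r r') = ennreal (t / real n * (r' - r))"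
proof -
  have sec: "(\<lambda>s. (s, y)) -` cell n j r r' = (if yy n j < y \<and> y \<le> yy n (Suc j) then {t + r - \<bar>y - x\<bar><..t + r' - \<bar>y - x\<bar>} else {})" for y
    by (auto simp: cell_def)
  have "emeasure lborel (cell n j r r') = (\<integral>\<^sup>+y. emeasure lborel ((\<lambda>s. (s, y)) -` cell n j r r') \<partial>lborel)"
    unfolding lborel_prod[symmetric] by (rule lborel_pair.emeasure_pair_measure_alt2) (simp only: sets_lborel lborel_prod cell_borel)
  also have "\<dots> = (\<integral>\<^sup>+y. ennreal (r' - r) * indicator {yy n j<..yy n (Suc j)} y \<partial>lborel)"
    unfolding sec using assms by (intro nn_integral_cong) (auto simp: indicator_def)
  also have "\<dots> = ennreal (r' - r) * ennreal (t / real n)"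
    using yy_Suc[OF assms(1), of j] t0 by (subst nn_integral_cmult_indicator) auto
  finally show ?thesis using assms t0 by (simp add: ennreal_mult'[symmetric] mult.commute)
qed

lemma cell_sub:
  assumes "0 < n" "j < 2 * n" "0 \<le> r"
  shows "cell n j r r' \<subseteq> light_cone x (t + r')" "cell n j r r' \<inter> light_cone x (t + r) = {}" "cell n j r r' \<inter> past (tt n j) = {}"
proof -
  show "cell n j r r' \<subseteq> light_cone x (t + r')"
    using zz_far(3)[OF assms(1,2)] assms(3) by (fastforce simp: cell_def light_cone_def)
  show "cell n j r r' \<inter> light_cone x (t + r) = {}" by (auto simp: cell_def light_cone_def)
  have False if "(s, y) \<in> cell n j r r'" "s \<le> tt n j" for s y
  proof -
    have y: "yy n j < y" "y \<le> yy n (Suc j)" and "t + r < s + \<bar>y - x\<bar>" using that(1) by (auto simp: cell_def)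
    then show False using zz_far(1)[OF assms(1,2) y] assms(3) that(2) unfolding tt_def by linarith
  qed
  then show "cell n j r r' \<inter> past (tt n j) = {}" by (auto simp: past_def)
qed

lemma cell_nonneg:
  assumes "0 < n" "j < 2 * n" "0 \<le> r" shows "cell n j r r' \<subseteq> {0..} \<times> UNIV"
  using cell_sub(1)[OF assms, of r'] by (auto simp: light_cone_def)

lemma cell_disjoint: "i \<noteq> j \<Longrightarrow> cell n i r r' \<inter> cell n j q q' = {}"
proof -
  have "cell n i r r' \<inter> cell n j q q' = {}" if "i < j" for i j r r' q q'
    using yy_le[of "Suc i" j n] that by (auto simp: cell_def)
  then show "i \<noteq> j \<Longrightarrow> ?thesis" by (metis inf_commute linorder_neqE_nat)
qed

lemma cell_split:
  assumes "r \<le> r'" "r' \<le> r''"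
  shows "indicator (cell n j r r'') p = (indicator (cell n j r r') p + indicator (cell n j r' r'') p :: real)"
  using assms by (auto simp: indicator_def cell_def)

lemma cell_L2: "0 < n \<Longrightarrow> j < 2 * n \<Longrightarrow> 0 \<le> r \<Longrightarrow> r \<le> r' \<Longrightarrow> L2_st (indicator (cell n j r r'))"
  by (intro L2_st_indicator cell_borel cell_nonneg) (auto simp: emeasure_cell)

text \<open>Supplies what \<open>u_increment\<close> asks for: nested cones, with a time lag of the
  size of strip width plus mesh.\<close>

lemma cell_back:
  assumes "0 < n" "j < 2 * n" "0 \<le> r" and p: "(s, y) \<in> cell n j r r'"
  shows "(tt n j, zz n j) \<in> light_cone y s" "s - tt n j \<le> r' + t / real n"
proof -
  have y: "yy n j < y" "y \<le> yy n (Suc j)" and s: "t + r < s + \<bar>y - x\<bar>" "s + \<bar>y - x\<bar> \<le> t + r'" using p by (auto simp: cell_def)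
  note z = zz_far[OF assms(1,2) y] zz_bounds(2)[OF assms(1,2)]
  have e: "\<bar>x - zz n j\<bar> = \<bar>zz n j - x\<bar>" by simp
  show "s - tt n j \<le> r' + t / real n" using z s unfolding tt_def e by linarith
  have "tt n j \<le> s" "\<bar>zz n j - y\<bar> \<le> s - tt n j" using z s assms(3) unfolding tt_def e by linarith+
  then show "(tt n j, zz n j) \<in> light_cone y s" using z(4) by (simp add: light_cone_def)
qed

text \<open>The strip also has points outside the interval over which the cells stand, at the two
  feet of the cone. They fit into two squares of side \<open>r\<close>, whose area is of second
  order.\<close>

definition corner :: "real \<Rightarrow> (real \<times> real) set" where
  "corner r = {0..r} \<times> {x - t - r..x - t} \<union> {0..r} \<times> {x + t..x + t + r}"

lemma corner_borel [measurable]: "corner r \<in> sets borel"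
  unfolding corner_def by (intro sets.Un Times_borel) auto

lemma emeasure_corner: "0 \<le> r \<Longrightarrow> emeasure lborel (corner r) \<le> ennreal (2 * r\<^sup>2)"
proof -
  assume r: "0 \<le> r"
  have b: "emeasure lborel ({a..b} \<times> {c..d}) = ennreal ((b - a) * (d - c))" if "a \<le> b" "c \<le> d" for a b c d :: real
    unfolding lborel_prod[symmetric] using that by (subst lborel.emeasure_pair_measure_Times) (auto simp: ennreal_mult)
  have "emeasure lborel (corner r) \<le> emeasure lborel ({0..r} \<times> {x - t - r..x - t}) + emeasure lborel ({0..r} \<times> {x + t..x + t + r})"
    unfolding corner_def by (rule emeasure_subadditive) (auto intro!: Times_borel)
  also have "\<dots> = ennreal (2 * r\<^sup>2)" using r by (simp add: b power2_eq_square flip: ennreal_plus)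
  finally show ?thesis .
qed

lemma cells_cover:
  assumes n: "0 < n" and p: "(s, y) \<in> light_cone x (t + r)" "(s, y) \<notin> light_cone x t" "\<And>j. j < 2 * n \<Longrightarrow> (s, y) \<notin> cell n j 0 r"
  shows "(s, y) \<in> corner r"
proof -
  have s: "0 \<le> s" "\<bar>y - x\<bar> \<le> t + r - s" "t < s + \<bar>y - x\<bar>" using p(1,2) by (auto simp: light_cone_def)
  have "t \<le> \<bar>y - x\<bar>"
  proof (rule ccontr)
    assume "\<not> t \<le> \<bar>y - x\<bar>"
    then have y: "\<bar>y - x\<bar> < t" by simp
    define q where "q = (y - x + t) * real n / t"
    have q: "0 < q" "q < 2 * real n"
    proof -
      have "0 < y - x + t" "y - x + t < 2 * t" using y by auto
      then show "0 < q" unfolding q_def using n t0 by simp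
      have "(y - x + t) * real n < 2 * t * real n" using \<open>y - x + t < 2 * t\<close> n by (intro mult_strict_right_mono) auto
      then show "q < 2 * real n" unfolding q_def using t0 by (simp add: field_simps)
    qed
    \<comment> \<open>Intervals are open on the left and closed on the right, so an exact grid point
      belongs to the cell on its left; hence the ceiling minus one and not the floor.\<close>
    define j where "j = nat (\<lceil>q\<rceil> - 1)"
    have j: "real j < q" "q \<le> real j + 1" unfolding j_def using q by linarith+
    then have j2: "j < 2 * n" using q by linarith
    have "y = x - t + t * q / real n" unfolding q_def using n t0 by (simp add: field_simps)
    then have "yy n j < y" "y \<le> yy n (Suc j)"
      using j n t0 by (auto simp: yy_def intro!: divide_strict_right_mono mult_strict_left_mono divide_right_mono mult_left_mono)
    then have "(s, y) \<in> cell n j 0 r" using s by (auto simp: cell_def)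
    then show False using p(3)[OF j2] by simp
  qed
  then show ?thesis using s unfolding corner_def by (cases "y \<le> x") auto
qed

lemma V_measurable:
  assumes "0 < n" "j < 2 * n"
  shows "sqint M (V n j)" "V n j \<in> borel_measurable (noise (past (tt n j)))" "V n j \<in> borel_measurable (noise (light_cone x t))"
proof -
  note z = zz_bounds[OF assms]
  show "sqint M (V n j)" unfolding V_def[abs_def] by (rule sigma_sqint[OF u_sqint[OF z(2)]])
  show "V n j \<in> borel_measurable (noise (past (tt n j)))" unfolding V_def[abs_def]
    by (rule measurable_compose[OF u_adapted[OF z(2)] sigma_measurable])
  show "V n j \<in> borel_measurable (noise (light_cone x t))" unfolding V_def[abs_def]
    by (rule measurable_compose[OF u_light_cone_measurable[OF z(4)] sigma_measurable])
qed

definition vl :: "nat \<Rightarrow> real \<Rightarrow> real \<Rightarrow> 'a integrand" where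
  "vl n r r' = map (\<lambda>j. (V n j, tt n j, indicator (cell n j r r'))) [0..<2 * n]"

definition Xi :: "nat \<Rightarrow> nat \<Rightarrow> real \<Rightarrow> real \<Rightarrow> 'a \<Rightarrow> real" where
  "Xi n j r r' = \<xi> (indicator (cell n j r r'))"

lemma sint_vl: "sint (vl n r r') \<omega> = (\<Sum>j<2 * n. V n j \<omega> * Xi n j r r' \<omega>)"
  by (simp add: sint_def vl_def comp_def Xi_def interv_sum_list_conv_sum_set_nat atLeast_upt[symmetric] lessThan_atLeast0)

lemma sproc_vl: "sproc (vl n r r') (p, \<omega>) = (\<Sum>j<2 * n. V n j \<omega> * indicator (cell n j r r') p)"
  by (simp add: sproc_def vl_def comp_def interv_sum_list_conv_sum_set_nat atLeast_upt[symmetric] lessThan_atLeast0)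

lemma simple_vl:
  assumes "0 < n" "0 \<le> r" "r \<le> r'" shows "simple (vl n r r')"
proof -
  have "sterm (V n j, tt n j, indicator (cell n j r r'))" if "j < 2 * n" for j
    using V_measurable[OF assms(1) that] cell_L2[OF assms(1) that assms(2,3)] cell_sub(3)[OF assms(1) that assms(2), of r']
    by (auto simp: indicator_def)
  then show ?thesis by (auto simp: vl_def list_all_iff)
qed

definition R :: "nat \<Rightarrow> real \<Rightarrow> 'a \<Rightarrow> real" where
  "R n r \<omega> = (u (t + r) x \<omega> - u t x \<omega>) - sint (vl n 0 r) \<omega>"

lemma Xi_measurable:
  assumes "0 < n" "j < 2 * n" "0 \<le> r" "r \<le> r'"
  shows "Xi n j r r' \<in> borel_measurable (noise (light_cone x (t + r')))" "Xi n j r r' \<in> borel_measurable M"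
proof -
  show "Xi n j r r' \<in> borel_measurable (noise (light_cone x (t + r')))" unfolding Xi_def
    by (rule xi_noise[OF cell_L2[OF assms]]) (use cell_sub(1)[OF assms(1-3), of r'] in \<open>auto simp: indicator_def\<close>)
  then show "Xi n j r r' \<in> borel_measurable M" by (rule noise_measurable_M)
qed

lemma Xi_add:
  assumes "0 < n" "j < 2 * n" "0 \<le> r" "r \<le> r'" "r' \<le> r''"
  shows "AE \<omega> in M. Xi n j r r'' \<omega> = Xi n j r r' \<omega> + Xi n j r' r'' \<omega>"
proof -
  have "(indicator (cell n j r r'') :: _ \<Rightarrow> real) = (\<lambda>p. indicator (cell n j r r') p + indicator (cell n j r' r'') p)"
    using cell_split[OF assms(4,5)] by auto
  then show ?thesis unfolding Xi_def using xi_add[OF cell_L2[OF assms(1-4)] cell_L2[of n j r' r'']] assms by auto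
qed

lemma Xi_add_all:
  assumes "0 < n" "0 \<le> r" "r \<le> r'" "r' \<le> r''"
  shows "AE \<omega> in M. \<forall>j<2 * n. Xi n j r r'' \<omega> = Xi n j r r' \<omega> + Xi n j r' r'' \<omega>"
proof -
  have "AE \<omega> in M. \<forall>j\<in>{..<2 * n}. Xi n j r r'' \<omega> = Xi n j r r' \<omega> + Xi n j r' r'' \<omega>"
    by (rule AE_finite_allI) (use Xi_add assms in auto)
  then show ?thesis by (auto elim: eventually_mono)
qed

lemma R_measurable:
  assumes "0 < n" "0 \<le> r"
  shows "R n r \<in> borel_measurable (noise (light_cone x (t + r)))" "sqint M (R n r)"
proof -
  have c: "light_cone x t \<subseteq> light_cone x (t + r)" using assms by (intro light_cone_mono') auto
  have [measurable]: "u (t + r) x \<in> borel_measurable (noise (light_cone x (t + r)))" "u t x \<in> borel_measurable (noise (light_cone x (t + r)))"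
    using t0 assms by (intro u_light_cone_measurable; auto simp: light_cone_def)+
  have [measurable]: "V n j \<in> borel_measurable (noise (light_cone x (t + r)))" if "j < 2 * n" for j
    by (rule noise_measurable_mono[OF V_measurable(3)[OF assms(1) that] c])
  have [measurable]: "Xi n j 0 r \<in> borel_measurable (noise (light_cone x (t + r)))" if "j < 2 * n" for j
    using Xi_measurable(1)[OF assms(1) that order_refl assms(2)] .
  have [measurable]: "(\<lambda>\<omega>. \<Sum>j<2 * n. V n j \<omega> * Xi n j 0 r \<omega>) \<in> borel_measurable (noise (light_cone x (t + r)))"
    by (rule borel_measurable_sum) simp
  show "R n r \<in> borel_measurable (noise (light_cone x (t + r)))" unfolding R_def[abs_def] sint_vl by measurable
  show "sqint M (R n r)" unfolding R_def[abs_def] using t0 assms by (intro sqint_diff u_sqint sint_sqint simple_vl) auto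
qed

text \<open>The martingale property of the remainder along growing cones. The increment from
  \<open>r\<close> to \<open>r'\<close> is a Walsh integral whose integrand vanishes on the cone of
  height \<open>t + r\<close>.\<close>

lemma R_orthogonal:
  assumes n: "0 < n" and r: "0 \<le> r" "r \<le> r'" and Y: "Y \<in> borel_measurable (noise (light_cone x (t + r)))" "sqint M Y"
  shows "(\<integral>\<omega>. (R n r' \<omega> - R n r \<omega>) * Y \<omega> \<partial>M) = 0"
proof -
  let ?I = "\<lambda>\<omega>. ((u (t + r') x \<omega> - 1) - (u (t + r) x \<omega> - 1)) - sint (vl n r r') \<omega>"
  have S: "walsh (\<lambda>z. (Xc (light_cone x (t + r')) z - Xc (light_cone x (t + r)) z) - sproc (vl n r r') z) ?I"
    using t0 r by (intro walsh_diff u_walsh walsh_simple simple_vl n) auto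
  have z: "(\<integral>\<omega>. ?I \<omega> * Y \<omega> \<partial>M) = 0"
  proof (rule walsh_orthogonal[OF S light_cone_borel _ Y])
    fix p \<omega> assume p: "p \<in> light_cone x (t + r)"
    moreover have "p \<in> light_cone x (t + r')" using p light_cone_mono'[of "t + r" "t + r'" x] r by auto
    moreover have "p \<notin> cell n j r r'" if "j < 2 * n" for j using cell_sub(2)[OF n that r(1), of r'] p by auto
    ultimately show "Xc (light_cone x (t + r')) (p, \<omega>) - Xc (light_cone x (t + r)) (p, \<omega>) - sproc (vl n r r') (p, \<omega>) = 0"
      by (simp add: Xc_def sproc_vl indicator_def)
  qed
  have [measurable]: "R n r \<in> borel_measurable M" "R n r' \<in> borel_measurable M" "Y \<in> borel_measurable M"
    using R_measurable(2)[OF n r(1)] R_measurable(2)[OF n, of r'] r Y by (auto simp: sqint_def)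
  have [measurable]: "?I \<in> borel_measurable M" using S by (simp add: walsh_def)
  have "(\<integral>\<omega>. (R n r' \<omega> - R n r \<omega>) * Y \<omega> \<partial>M) = (\<integral>\<omega>. ?I \<omega> * Y \<omega> \<partial>M)"
  proof (rule integral_cong_AE)
    show "AE \<omega> in M. (R n r' \<omega> - R n r \<omega>) * Y \<omega> = ?I \<omega> * Y \<omega>"
      using Xi_add_all[OF n order_refl r]
    proof eventually_elim
      case (elim \<omega>)
      then have "sint (vl n 0 r') \<omega> = sint (vl n 0 r) \<omega> + sint (vl n r r') \<omega>"
        by (simp add: sint_vl sum.distrib[symmetric] distrib_left)
      then show ?case by (simp add: R_def)
    qed
  qed measurable
  then show ?thesis using z by simp
qed

text \<open>On the cells, of total area \<open>2 * t * r\<close>, the integrand of the remainder is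
  the difference of \<open>\<sigma>(u)\<close> and its frozen value, with mean square of order
  \<open>r + t / n\<close>. Off the cells it lives on the corner, of area at most
  \<open>2 * r\<^sup>2\<close>. Mesh and width stay independent here because they are coupled in
  different ways later.\<close>

lemma R_bound: "\<exists>C\<ge>0. \<forall>n>0. \<forall>r. 0 \<le> r \<longrightarrow> r \<le> 1 \<longrightarrow> (\<integral>\<omega>. (R n r \<omega>)\<^sup>2 \<partial>M) \<le> C * r * (r + 1 / real n)"
proof -
  obtain K where K: "K \<ge> 0" "\<And>p. p \<in> light_cone x (t + 1) \<Longrightarrow> sqnorm M (\<lambda>\<omega>. su (p, \<omega>)) \<le> ennreal K" using su_bound by blast
  \<comment> \<open>64 is 4 from \<open>walsh_bound\<close>, 2 from the area and 8 from
    \<open>u_increment\<close>; the 8 in front of \<open>K\<close> is 4 times the 2 in the corner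
    area. The factor \<open>1 + t\<close> replaces \<open>r + t / n\<close> by a multiple of
    \<open>r + 1 / n\<close>.\<close>
  define C where "C = 64 * L\<^sup>2 * K * (t + 1) * t * (1 + t) + 8 * K"
  have C0: "0 \<le> C" unfolding C_def using K t0 by auto
  have "(\<integral>\<omega>. (R n r \<omega>)\<^sup>2 \<partial>M) \<le> C * r * (r + 1 / real n)" if n: "0 < n" and r: "0 \<le> r" "r \<le> 1" for n r
  proof -
    define A where "A = L\<^sup>2 * (8 * K * (t + 1) * (r + t / real n))"
    have A0: "0 \<le> A" unfolding A_def using K t0 r by auto
    let ?X = "\<lambda>z. (Xc (light_cone x (t + r)) z - Xc (light_cone x t) z) - sproc (vl n 0 r) z"
    have S: "walsh ?X (\<lambda>\<omega>. ((u (t + r) x \<omega> - 1) - (u t x \<omega> - 1)) - sint (vl n 0 r) \<omega>)"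
      using t0 r by (intro walsh_diff u_walsh walsh_simple simple_vl n) auto
    have Xm: "?X \<in> borel_measurable PM" using S by (simp add: walsh_def)
    have "sqnorm M (R n r) = sqnorm M (\<lambda>\<omega>. ((u (t + r) x \<omega> - 1) - (u t x \<omega> - 1)) - sint (vl n 0 r) \<omega>)" by (rule sqnorm_cong) (simp add: R_def)
    also have "\<dots> \<le> 4 * sqnorm PM ?X" by (rule walsh_bound(1)[OF S])
    also have "sqnorm PM ?X = (\<integral>\<^sup>+p. sqnorm M (\<lambda>\<omega>. ?X (p, \<omega>)) \<partial>lborel)" by (rule sqnorm_PM[OF Xm])
    also have "\<dots> \<le> (\<integral>\<^sup>+p. (\<Sum>j<2 * n. ennreal A * indicator (cell n j 0 r) p) + ennreal K * indicator (corner r) p \<partial>lborel)"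
    proof (rule nn_integral_mono)
      fix p :: "real \<times> real"
      show "sqnorm M (\<lambda>\<omega>. ?X (p, \<omega>)) \<le> (\<Sum>j<2 * n. ennreal A * indicator (cell n j 0 r) p) + ennreal K * indicator (corner r) p"
      proof (cases "\<exists>j<2 * n. p \<in> cell n j 0 r")
        case True
        then obtain j where j: "j < 2 * n" "p \<in> cell n j 0 r" by auto
        obtain s y where p: "p = (s, y)" by (cases p)
        have oth: "p \<notin> cell n i 0 r" if "i \<noteq> j" for i using cell_disjoint[OF that, of n 0 r 0 r] j by auto
        have p1: "p \<in> light_cone x (t + r)" "p \<notin> light_cone x t"
          using cell_sub(1)[OF n j(1) order_refl, of r] cell_sub(2)[OF n j(1) order_refl, of r] j(2) by auto
        then have p2: "p \<in> light_cone x (t + 1)" using light_cone_mono'[of "t + r" "t + 1" x] r by auto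
        have s0: "0 \<le> s" using p1 p by (auto simp: light_cone_def)
        have sv: "sproc (vl n 0 r) (p, \<omega>) = V n j \<omega>" for \<omega>
        proof -
          have "sproc (vl n 0 r) (p, \<omega>) = (\<Sum>i<2 * n. if i = j then V n i \<omega> else 0)"
            unfolding sproc_vl using j(2) oth by (intro sum.cong) (auto simp: indicator_def)
          then show ?thesis using j(1) by simp
        qed
        note z = zz_bounds[OF n j(1)]
        note [measurable] = u_measurable[OF s0] u_measurable[OF z(2)]
        have "sqnorm M (\<lambda>\<omega>. ?X (p, \<omega>)) = sqnorm M (\<lambda>\<omega>. \<sigma> (u s y \<omega>) - \<sigma> (u (tt n j) (zz n j) \<omega>))"
          using p1 p s0 by (intro sqnorm_cong) (simp add: sv[unfolded p] Xc_def V_def su_eq)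
        also have "\<dots> \<le> ennreal (L\<^sup>2) * sqnorm M (\<lambda>\<omega>. u s y \<omega> - u (tt n j) (zz n j) \<omega>)" by (rule sigma_diff_sqnorm) measurable
        also have "\<dots> \<le> ennreal (L\<^sup>2) * ennreal (8 * K * (t + 1) * (r + t / real n))"
        proof (rule mult_left_mono)
          have "sqnorm M (\<lambda>\<omega>. u s y \<omega> - u (tt n j) (zz n j) \<omega>) \<le> ennreal (8 * K * (t + 1) * (s - tt n j))"
            by (rule u_increment[OF K]) (use p2 p cell_back(1)[OF n j(1) order_refl, of s y r] j(2) in auto)
          also have "\<dots> \<le> ennreal (8 * K * (t + 1) * (r + t / real n))"
            using cell_back(2)[OF n j(1) order_refl, of s y r] j(2) p K(1) t0 by (intro ennreal_leI mult_left_mono) auto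
          finally show "sqnorm M (\<lambda>\<omega>. u s y \<omega> - u (tt n j) (zz n j) \<omega>) \<le> ennreal (8 * K * (t + 1) * (r + t / real n))" .
        qed simp
        also have "\<dots> = ennreal A * indicator (cell n j 0 r) p" using j(2) by (simp add: A_def ennreal_mult')
        also have "\<dots> \<le> (\<Sum>j<2 * n. ennreal A * indicator (cell n j 0 r) p)" using j(1) by (intro member_le_sum) auto
        finally show ?thesis by (rule order_trans) simp
      next
        case False
        then have sv: "sproc (vl n 0 r) (p, \<omega>) = 0" for \<omega> unfolding sproc_vl by (auto intro!: sum.neutral simp: indicator_def)
        show ?thesis
        proof (cases "p \<in> light_cone x (t + r) \<and> p \<notin> light_cone x t")
          case True
          then have c: "p \<in> corner r" using cells_cover[OF n, of "fst p" "snd p" r] False by auto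
          have p2: "p \<in> light_cone x (t + 1)" using True light_cone_mono'[of "t + r" "t + 1" x] r by auto
          have "sqnorm M (\<lambda>\<omega>. ?X (p, \<omega>)) = sqnorm M (\<lambda>\<omega>. su (p, \<omega>))" using True by (simp add: sv Xc_def)
          also have "\<dots> \<le> ennreal K * indicator (corner r) p" using K(2)[OF p2] c by simp
          finally show ?thesis by (simp add: add_increasing)
        next
          case not: False
          then have "Xc (light_cone x (t + r)) (p, \<omega>) = Xc (light_cone x t) (p, \<omega>)" for \<omega>
            using light_cone_mono'[of t "t + r" x] r by (auto simp: Xc_def indicator_def)
          then have "sqnorm M (\<lambda>\<omega>. ?X (p, \<omega>)) = 0" by (simp add: sv sqnorm_def)
          then show ?thesis by simp
        qed
      qed
    qed
    also have "\<dots> = (\<Sum>j<2 * n. ennreal A * emeasure lborel (cell n j 0 r)) + ennreal K * emeasure lborel (corner r)"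
    proof -
      have 1: "(\<integral>\<^sup>+p. (\<Sum>j<2 * n. ennreal A * indicator (cell n j 0 r) p) \<partial>lborel) = (\<Sum>j<2 * n. ennreal A * emeasure lborel (cell n j 0 r))"
        using cell_borel by (subst nn_integral_sum) (simp_all add: nn_integral_cmult_indicator del: sum_mult_indicator)
      show ?thesis unfolding 1[symmetric] using cell_borel corner_borel
        by (subst nn_integral_add) (simp_all add: nn_integral_cmult_indicator)
    qed
    also have "\<dots> \<le> ennreal (2 * t * r * A) + ennreal (2 * K * r\<^sup>2)"
    proof (rule add_mono)
      have "(\<Sum>j<2 * n. ennreal A * emeasure lborel (cell n j 0 r)) = (\<Sum>j<2 * n. ennreal (A * (t / real n * r)))"
        using n r A0 t0 by (intro sum.cong) (simp_all add: emeasure_cell ennreal_mult'[symmetric])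
      also have "\<dots> = ennreal (\<Sum>j<2 * n. A * (t / real n * r))" using A0 t0 r by (subst sum_ennreal) auto
      also have "(\<Sum>j<2 * n. A * (t / real n * r)) = 2 * t * r * A" using n by (simp add: field_simps)
      finally show "(\<Sum>j<2 * n. ennreal A * emeasure lborel (cell n j 0 r)) \<le> ennreal (2 * t * r * A)" by simp
      have "ennreal K * emeasure lborel (corner r) \<le> ennreal K * ennreal (2 * r\<^sup>2)" by (intro mult_left_mono emeasure_corner r) auto
      also have "\<dots> = ennreal (2 * K * r\<^sup>2)" using K(1) by (simp add: ennreal_mult'[symmetric] mult_ac)
      finally show "ennreal K * emeasure lborel (corner r) \<le> ennreal (2 * K * r\<^sup>2)" .
    qed
    also have "\<dots> = ennreal (2 * t * r * A + 2 * K * r\<^sup>2)" using t0 r A0 K(1) by (simp add: ennreal_plus)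
    finally have "sqnorm M (R n r) \<le> 4 * ennreal (2 * t * r * A + 2 * K * r\<^sup>2)" by (simp add: mult_left_mono)
    also have "\<dots> = ennreal (4 * (2 * t * r * A + 2 * K * r\<^sup>2))" by (subst ennreal_mult') auto
    finally have "(\<integral>\<omega>. (R n r \<omega>)\<^sup>2 \<partial>M) \<le> 4 * (2 * t * r * A + 2 * K * r\<^sup>2)"
      unfolding sqnorm_sqint[OF R_measurable(2)[OF n r(1)]] using t0 r A0 K(1) by (subst (asm) ennreal_le_iff) auto
    also have "\<dots> \<le> C * r * (r + 1 / real n)"
    proof -
      have q: "r + t / real n \<le> (1 + t) * (r + 1 / real n)" using r t0 n by (simp add: field_simps)
      have "4 * (2 * t * r * A) = (64 * L\<^sup>2 * K * (t + 1) * t * r) * (r + t / real n)" by (simp add: A_def)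
      also have "\<dots> \<le> (64 * L\<^sup>2 * K * (t + 1) * t * r) * ((1 + t) * (r + 1 / real n))" using K(1) t0 r by (intro mult_left_mono q) auto
      finally have 1: "4 * (2 * t * r * A) \<le> (64 * L\<^sup>2 * K * (t + 1) * t * (1 + t)) * r * (r + 1 / real n)" by (simp add: mult_ac)
      have "4 * (2 * K * r\<^sup>2) = 8 * K * r * r" by (simp add: power2_eq_square)
      also have "\<dots> \<le> 8 * K * r * (r + 1 / real n)" using K(1) r by (intro mult_left_mono) auto
      finally have 2: "4 * (2 * K * r\<^sup>2) \<le> 8 * K * r * (r + 1 / real n)" .
      have d: "(a + b) * r * q = a * r * q + b * r * q" for a b q :: real by (simp add: algebra_simps)
      show ?thesis unfolding C_def d distrib_left[of 4] by (rule add_mono[OF 1 2])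
    qed
    finally show ?thesis .
  qed
  then show ?thesis using C0 by blast
qed

end

section \<open>Tagged Riemann sums and comparison of characteristic functions\<close>

lemma tagged_riemann_sums:
  fixes f :: "real \<Rightarrow> real"
  assumes c: "continuous_on {a..b} f" and ab: "a < b" and e: "e > 0"
  shows "\<exists>N. \<forall>m\<ge>N. m > 0 \<longrightarrow> (\<forall>z. (\<forall>j<m. a + real j * (b - a) / real m \<le> z j \<and> z j \<le> a + real (Suc j) * (b - a) / real m) \<longrightarrow>
     \<bar>(\<Sum>j<m. f (z j) * ((b - a) / real m)) - integral {a..b} f\<bar> \<le> e)"
proof -
  define e' where "e' = e / (b - a)"
  have e': "e' > 0" using e ab by (simp add: e'_def)
  have "uniformly_continuous_on {a..b} f" by (rule compact_uniformly_continuous[OF c compact_Icc])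
  then obtain d where d: "d > 0" "\<And>y z. y \<in> {a..b} \<Longrightarrow> z \<in> {a..b} \<Longrightarrow> \<bar>z - y\<bar> < d \<Longrightarrow> \<bar>f z - f y\<bar> < e'"
    using e' unfolding uniformly_continuous_on_def dist_real_def by metis
  obtain N :: nat where N: "(b - a) / d < real N" using reals_Archimedean2 by blast
  show ?thesis
  proof (intro exI[of _ N] allI impI)
    fix m :: nat and z assume m: "N \<le> m" "0 < m"
      and z: "\<forall>j<m. a + real j * (b - a) / real m \<le> z j \<and> z j \<le> a + real (Suc j) * (b - a) / real m"
    define h where "h = (b - a) / real m"
    define p where "p j = a + real j * h" for j
    have h: "0 < h" using ab m by (simp add: h_def)
    have hd: "h < d"
    proof -
      have "(b - a) / d < real m" using N m by linarith
      then show ?thesis using d(1) m by (simp add: h_def field_simps)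
    qed
    have pm: "p m = b" using m by (simp add: p_def h_def)
    have p0: "p 0 = a" by (simp add: p_def)
    have ps: "p (Suc j) = p j + h" for j by (simp add: p_def algebra_simps)
    have pmono: "i \<le> j \<Longrightarrow> p i \<le> p j" for i j using h by (simp add: p_def mult_right_mono)
    have zp: "p j \<le> z j" "z j \<le> p (Suc j)" if "j < m" for j using z that by (auto simp: p_def h_def)
    \<comment> \<open>Induction over the subintervals. Tag and running point are closer than
      \<open>d\<close>, so one subinterval contributes at most \<open>e' * h\<close>, and all
      together \<open>e' * (b - a) = e\<close>.\<close>
    have "k \<le> m \<Longrightarrow> \<bar>(\<Sum>j<k. f (z j) * h) - integral {a..p k} f\<bar> \<le> e' * (real k * h)" for k
    proof (induction k)
      case 0 then show ?case by (simp add: p0)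
    next
      case (Suc k)
      have le: "a \<le> p k" "p k \<le> p (Suc k)" "p (Suc k) \<le> b" using pmono[of 0 k] pmono[of k "Suc k"] pmono[of "Suc k" m] Suc.prems p0 pm by auto
      have c1: "continuous_on {a..p (Suc k)} f" "continuous_on {p k..p (Suc k)} f" using le by (auto intro: continuous_on_subset[OF c])
      have i: "integral {a..p (Suc k)} f = integral {a..p k} f + integral {p k..p (Suc k)} f"
        by (rule Henstock_Kurzweil_Integration.integral_combine[symmetric, OF le(1,2) integrable_continuous_real[OF c1(1)]])
      have "norm (integral {p k..p (Suc k)} (\<lambda>y. f (z k) - f y)) \<le> e' * (p (Suc k) - p k)"
      proof (rule integral_bound[OF le(2)])
        show "continuous_on {p k..p (Suc k)} (\<lambda>y. f (z k) - f y)" by (intro continuous_intros c1)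
        fix y assume y: "y \<in> {p k..p (Suc k)}"
        have "\<bar>z k - y\<bar> \<le> h" using zp[of k] Suc.prems y ps[of k] by auto
        then have "\<bar>f (z k) - f y\<bar> < e'" using zp[of k] Suc.prems y le hd by (intro d(2)) auto
        then show "norm (f (z k) - f y) \<le> e'" by simp
      qed
      moreover have "integral {p k..p (Suc k)} (\<lambda>y. f (z k) - f y) = integral {p k..p (Suc k)} (\<lambda>y. f (z k)) - integral {p k..p (Suc k)} f"
        by (rule Henstock_Kurzweil_Integration.integral_diff) (intro integrable_continuous_real c1 continuous_on_const)+
      moreover have "integral {p k..p (Suc k)} (\<lambda>y. f (z k)) = f (z k) * h" using h ps by simp
      ultimately have "\<bar>f (z k) * h - integral {p k..p (Suc k)} f\<bar> \<le> e' * h" using ps h by (simp add: mult.commute)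
      moreover have "\<bar>(\<Sum>j<k. f (z j) * h) - integral {a..p k} f\<bar> \<le> e' * (real k * h)" using Suc by simp
      moreover have "e' * (real (Suc k) * h) = e' * (real k * h) + e' * h" by (simp add: algebra_simps)
      ultimately show ?case unfolding i by simp
    qed
    from this[of m] have "\<bar>(\<Sum>j<m. f (z j) * h) - integral {a..b} f\<bar> \<le> e' * (real m * h)" by (simp add: pm)
    also have "e' * (real m * h) = e" using m ab by (simp add: h_def e'_def)
    finally show "\<bar>(\<Sum>j<m. f (z j) * ((b - a) / real m)) - integral {a..b} f\<bar> \<le> e" by (simp add: h_def)
  qed
qed

lemma tagged_riemann_sums_limit:
  fixes f :: "real \<Rightarrow> real"
  assumes c: "continuous_on {a..b} f" and ab: "a < b"
    and z: "\<And>m j. 0 < m \<Longrightarrow> a + real j * (b - a) / real m \<le> z m j \<and> z m j \<le> a + real (Suc j) * (b - a) / real m"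
  shows "(\<lambda>m. \<Sum>j<m. f (z m j) * ((b - a) / real m)) \<longlonglongrightarrow> integral {a..b} f"
proof (rule LIMSEQ_I)
  fix e :: real assume e: "0 < e"
  from tagged_riemann_sums[OF c ab half_gt_zero[OF e]]
  obtain N where N: "\<forall>m\<ge>N. m > 0 \<longrightarrow> (\<forall>z. (\<forall>j<m. a + real j * (b - a) / real m \<le> z j \<and> z j \<le> a + real (Suc j) * (b - a) / real m) \<longrightarrow>
     \<bar>(\<Sum>j<m. f (z j) * ((b - a) / real m)) - integral {a..b} f\<bar> \<le> e / 2)" ..
  show "\<exists>no. \<forall>m\<ge>no. norm ((\<Sum>j<m. f (z m j) * ((b - a) / real m)) - integral {a..b} f) < e"
  proof (intro exI[of _ "Suc N"] allI impI)
    fix m assume "Suc N \<le> m"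
    then have "\<bar>(\<Sum>j<m. f (z m j) * ((b - a) / real m)) - integral {a..b} f\<bar> \<le> e / 2"
      by (intro N[rule_format]) (use z in auto)
    then show "norm ((\<Sum>j<m. f (z m j) * ((b - a) / real m)) - integral {a..b} f) < e" using e by simp
  qed
qed

lemma iexp_lipschitz: "cmod (iexp a - iexp b) \<le> \<bar>a - b\<bar>"
proof -
  have "iexp a = iexp b * iexp (a - b)" by (simp add: exp_add[symmetric] algebra_simps)
  then have "iexp a - iexp b = iexp b * (iexp (a - b) - 1)" by (simp add: right_diff_distrib)
  then have "cmod (iexp a - iexp b) = cmod (iexp (a - b) - 1)" by (simp add: norm_mult)
  also have "\<dots> \<le> \<bar>a - b\<bar>" using iexp_approx1[of "a - b" 0] by simp
  finally show ?thesis .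
qed

lemma (in prob_space) char_diff_le:
  assumes X: "X \<in> borel_measurable M" "Y \<in> borel_measurable M" and i: "integrable M (\<lambda>\<omega>. X \<omega> - Y \<omega>)"
  shows "cmod ((CLINT \<omega>|M. iexp (X \<omega>)) - (CLINT \<omega>|M. iexp (Y \<omega>))) \<le> (\<integral>\<omega>. \<bar>X \<omega> - Y \<omega>\<bar> \<partial>M)"
proof -
  have ix: "complex_integrable M (\<lambda>\<omega>. iexp (X \<omega>))" "complex_integrable M (\<lambda>\<omega>. iexp (Y \<omega>))"
    using X by (auto intro!: integrable_iexp)
  have "cmod ((CLINT \<omega>|M. iexp (X \<omega>)) - (CLINT \<omega>|M. iexp (Y \<omega>))) = cmod (CLINT \<omega>|M. iexp (X \<omega>) - iexp (Y \<omega>))"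
    using ix by simp
  also have "\<dots> \<le> (\<integral>\<omega>. cmod (iexp (X \<omega>) - iexp (Y \<omega>)) \<partial>M)" by (rule integral_norm_bound)
  also have "\<dots> \<le> (\<integral>\<omega>. \<bar>X \<omega> - Y \<omega>\<bar> \<partial>M)"
    by (rule integral_mono) (use ix i iexp_lipschitz in auto)
  finally show ?thesis .
qed

lemma (in prob_space) abs_expectation_le_sqrt:
  assumes "sqint M f" shows "(\<integral>\<omega>. \<bar>f \<omega>\<bar> \<partial>M) \<le> sqrt (\<integral>\<omega>. (f \<omega>)\<^sup>2 \<partial>M)"
proof -
  have "sqint M (\<lambda>\<omega>. \<bar>f \<omega>\<bar>)" using assms by (auto simp: sqint_def intro: borel_measurable_abs)
  from sqint_Cauchy_Schwarz[OF this sqint_const[of 1]]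
  have "(\<integral>\<omega>. \<bar>f \<omega>\<bar> \<partial>M)\<^sup>2 \<le> (\<integral>\<omega>. (f \<omega>)\<^sup>2 \<partial>M)" by (simp add: prob_space)
  then show ?thesis by (rule real_le_rsqrt)
qed

section \<open>Characteristic functions of the normalised increments\<close>

context mild_wave_at
begin

definition S :: "'a \<Rightarrow> real" where
  "S \<omega> = integral {x - t..x + t} (\<lambda>y. (\<sigma> (u (t - \<bar>x - y\<bar>) y \<omega>))\<^sup>2)"

definition Sn :: "nat \<Rightarrow> 'a \<Rightarrow> real" where
  "Sn n \<omega> = (\<Sum>j<2 * n. (V n j \<omega>)\<^sup>2 * (t / real n))"

lemma boundary_continuous:
  assumes "\<omega> \<in> space M" shows "continuous_on {x - t..x + t} (\<lambda>y. \<sigma> (u (t - \<bar>x - y\<bar>) y \<omega>))"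
proof -
  have "continuous_on {x - t..x + t} (\<lambda>y. (\<lambda>(s, y). u s y \<omega>) (t - \<bar>x - y\<bar>, y))"
    by (rule continuous_on_compose2[OF cont[OF assms]]) (auto intro!: continuous_intros)
  then have c: "continuous_on {x - t..x + t} (\<lambda>y. u (t - \<bar>x - y\<bar>) y \<omega>)" by simp
  show ?thesis by (rule continuous_on_compose2[OF sigma_continuous[of UNIV] c]) simp
qed

lemma boundary_sq_continuous:
  "\<omega> \<in> space M \<Longrightarrow> continuous_on {x - t..x + t} (\<lambda>y. (\<sigma> (u (t - \<bar>x - y\<bar>) y \<omega>))\<^sup>2)"
  by (intro continuous_on_power boundary_continuous)

lemma Sn_limit:
  assumes \<omega>: "\<omega> \<in> space M" shows "(\<lambda>n. Sn n \<omega>) \<longlonglongrightarrow> S \<omega>"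
proof (rule LIMSEQ_I)
  fix e :: real assume e: "0 < e"
  let ?f = "\<lambda>y. (\<sigma> (u (t - \<bar>x - y\<bar>) y \<omega>))\<^sup>2"
  obtain N where N: "\<And>m z. N \<le> m \<Longrightarrow> m > 0 \<Longrightarrow> (\<forall>j<m. (x - t) + real j * ((x + t) - (x - t)) / real m \<le> z j \<and> z j \<le> (x - t) + real (Suc j) * ((x + t) - (x - t)) / real m) \<Longrightarrow>
     \<bar>(\<Sum>j<m. ?f (z j) * (((x + t) - (x - t)) / real m)) - integral {x - t..x + t} ?f\<bar> \<le> e / 2"
    using tagged_riemann_sums[OF boundary_sq_continuous[OF \<omega>], of "e / 2"] t0 e by auto
  have "norm (Sn n \<omega> - S \<omega>) < e" if n: "n \<ge> Suc N" for n
  proof -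
    have yn: "x - t + real j * (2 * t) / real (2 * n) = yy n j" for j using n by (simp add: yy_def field_simps)
    have "\<bar>(\<Sum>j<2 * n. ?f (zz n j) * (((x + t) - (x - t)) / real (2 * n))) - integral {x - t..x + t} ?f\<bar> \<le> e / 2"
      by (rule N) (use n yy_le in \<open>auto simp: yn zz_def simp del: of_nat_Suc of_nat_mult\<close>)
    also have "(\<Sum>j<2 * n. ?f (zz n j) * (((x + t) - (x - t)) / real (2 * n))) = Sn n \<omega>"
      unfolding Sn_def V_def tt_def using n by (intro sum.cong) (auto simp: field_simps)
    finally show ?thesis using e by (simp add: S_def)
  qed
  then show "\<exists>no. \<forall>n\<ge>no. norm (Sn n \<omega> - S \<omega>) < e" by blast
qed

lemma Sn_nonneg: "0 \<le> Sn n \<omega>" using t0 by (auto simp: Sn_def intro!: sum_nonneg)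

lemma Sn_measurable: "0 < n \<Longrightarrow> Sn n \<in> borel_measurable (noise (light_cone x t))"
  unfolding Sn_def[abs_def] using V_measurable(3)[of n] by (intro borel_measurable_sum borel_measurable_times borel_measurable_power) auto

lemma S_nonneg: "\<omega> \<in> space M \<Longrightarrow> 0 \<le> S \<omega>"
  by (rule LIMSEQ_le_const[OF Sn_limit]) (auto intro: Sn_nonneg)

lemma S_measurable: "S \<in> borel_measurable M"
proof (rule borel_measurable_LIMSEQ_metric)
  show "Sn (Suc n) \<in> borel_measurable M" for n by (rule noise_measurable_M[OF Sn_measurable]) simp
  show "(\<lambda>n. Sn (Suc n) \<omega>) \<longlonglongrightarrow> S \<omega>" if "\<omega> \<in> space M" for \<omega> by (rule LIMSEQ_Suc[OF Sn_limit[OF that]])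
qed

lemma S_exp_limit:
  "(\<lambda>n. \<integral>\<omega>. exp (- (c * Sn (Suc n) \<omega>)) \<partial>M) \<longlonglongrightarrow> (\<integral>\<omega>. exp (- (c * S \<omega>)) \<partial>M)" if "0 \<le> c"
proof (rule integral_dominated_convergence[where w="\<lambda>_. 1"])
  have [measurable]: "Sn (Suc n) \<in> borel_measurable M" for n by (rule noise_measurable_M[OF Sn_measurable]) simp
  note [measurable] = S_measurable
  show "(\<lambda>\<omega>. exp (- (c * S \<omega>))) \<in> borel_measurable M" "\<And>n. (\<lambda>\<omega>. exp (- (c * Sn (Suc n) \<omega>))) \<in> borel_measurable M" by measurable
  show "AE \<omega> in M. (\<lambda>n. exp (- (c * Sn (Suc n) \<omega>))) \<longlonglongrightarrow> exp (- (c * S \<omega>))"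
    by (rule AE_I2) (intro tendsto_intros LIMSEQ_Suc[OF Sn_limit])
qed (use that Sn_nonneg in auto)

text \<open>For constant coefficients the sum is a Wiener integral supported off the cone of height
  \<open>t + r\<close>, so \<open>noise_char\<close> gives its conditional law.
  \<open>conditional_gaussian\<close> then admits coefficients known from the noise in that
  cone.\<close>

lemma frozen_char:
  assumes n: "0 < n" and r: "0 \<le> r" "r \<le> r'"
    and a: "\<And>j. j < 2 * n \<Longrightarrow> a j \<in> borel_measurable (noise (light_cone x (t + r)))"
    and A: "A \<in> sets (noise (light_cone x (t + r)))"
  shows "(CLINT \<omega>|M. indicator A \<omega> *\<^sub>R iexp (\<Sum>j<2 * n. a j \<omega> * Xi n j r r' \<omega>)) =
    complex_of_real (\<integral>\<omega>. indicator A \<omega> * exp (- (\<Sum>j<2 * n. (a j \<omega>)\<^sup>2 * (t / real n * (r' - r))) / 2) \<partial>M)"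
proof (rule conditional_gaussian[OF subalgebra_noise _ _ _ a A])
  show "Xi n j r r' \<in> borel_measurable M" if "j < 2 * n" for j by (rule Xi_measurable(2)[OF n that r])
  show "0 \<le> t / real n * (r' - r)" using t0 r by auto
  fix \<alpha> A assume A: "A \<in> sets (noise (light_cone x (t + r)))"
  have AM[measurable]: "A \<in> sets M" using subsetD[OF sets_noise_sub A] .
  define \<psi> where "\<psi> p = (\<Sum>j<2 * n. \<alpha> j * (indicator (cell n j r r') p :: real))" for p
  have L: "L2_st \<psi>" unfolding \<psi>_def[abs_def] by (intro L2_st_sum L2_st_cmult cell_L2 n r) auto
  note [measurable] = xi_measurable[OF L]
  have [measurable]: "(\<lambda>\<omega>. \<Sum>j<2 * n. \<alpha> j * Xi n j r r' \<omega>) \<in> borel_measurable M"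
    using Xi_measurable(2)[OF n _ r] by (intro borel_measurable_sum borel_measurable_times) auto
  have ae: "AE \<omega> in M. \<xi> \<psi> \<omega> = (\<Sum>j<2 * n. \<alpha> j * Xi n j r r' \<omega>)"
    unfolding Xi_def \<psi>_def[abs_def] by (intro xi_sum cell_L2 n r) auto
  \<comment> \<open>The cells are disjoint, so at each point at most one summand is nonzero and
    squaring goes through the sum.\<close>
  have sq: "(\<psi> p)\<^sup>2 = (\<Sum>j<2 * n. (\<alpha> j)\<^sup>2 * indicator (cell n j r r') p)" for p
  proof (cases "\<exists>j<2 * n. p \<in> cell n j r r'")
    case True
    then obtain i where i: "i < 2 * n" "p \<in> cell n i r r'" by auto
    have d: "p \<notin> cell n j r r'" if "j \<noteq> i" for j using cell_disjoint[OF that, of n r r' r r'] i by auto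
    have "\<psi> p = (\<Sum>j<2 * n. if j = i then \<alpha> j else 0)" unfolding \<psi>_def using i d by (intro sum.cong) (auto simp: indicator_def)
    moreover have "(\<Sum>j<2 * n. (\<alpha> j)\<^sup>2 * indicator (cell n j r r') p) = (\<Sum>j<2 * n. if j = i then (\<alpha> j)\<^sup>2 else 0)"
      using i d by (intro sum.cong) (auto simp: indicator_def)
    ultimately show ?thesis using i by simp
  qed (auto simp: indicator_def \<psi>_def)
  have fin: "emeasure lborel (cell n j r r') < \<infinity>" for j using emeasure_cell[OF n r(2)] by simp
  have mc: "measure lborel (cell n j r r') = t / real n * (r' - r)" for j
    using emeasure_cell[OF n r(2), of j] t0 r by (simp add: measure_def)
  have "L2_norm_sq \<psi> = (\<Sum>j<2 * n. (\<alpha> j)\<^sup>2 * (t / real n * (r' - r)))"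
    unfolding L2_norm_sq_def sq using fin cell_borel by (subst Bochner_Integration.integral_sum) (auto simp: mc)
  moreover have "(CLINT \<omega>|M. indicator A \<omega> *\<^sub>R iexp (\<Sum>j<2 * n. \<alpha> j * Xi n j r r' \<omega>)) = (CLINT \<omega>|M. indicator A \<omega> *\<^sub>R iexp (\<xi> \<psi> \<omega>))"
  proof (rule integral_cong_AE)
    show "AE \<omega> in M. indicator A \<omega> *\<^sub>R iexp (\<Sum>j<2 * n. \<alpha> j * Xi n j r r' \<omega>) = indicator A \<omega> *\<^sub>R iexp (\<xi> \<psi> \<omega>)"
      using ae by eventually_elim simp
  qed measurable
  moreover have "(CLINT \<omega>|M. indicator A \<omega> *\<^sub>R iexp (\<xi> \<psi> \<omega>)) = complex_of_real (prob A * exp (- L2_norm_sq \<psi> / 2))"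
    by (rule noise_char[OF L _ A]) (use cell_sub(2)[OF n _ r(1), of _ r'] in \<open>auto intro!: sum.neutral simp: indicator_def \<psi>_def\<close>)
  ultimately show "(CLINT \<omega>|M. indicator A \<omega> *\<^sub>R iexp (\<Sum>j<2 * n. \<alpha> j * Xi n j r r' \<omega>)) =
     complex_of_real (prob A * exp (- (\<Sum>j<2 * n. (\<alpha> j)\<^sup>2 * (t / real n * (r' - r))) / 2))" by simp
qed

lemma frozen_sum_char:
  assumes n: "0 < n" and e: "0 < e"
  shows "(CLINT \<omega>|M. iexp (l * (sint (vl n 0 e) \<omega> / sqrt e))) = complex_of_real (\<integral>\<omega>. exp (- (l\<^sup>2 / 2 * Sn n \<omega>)) \<partial>M)"
proof -
  have sp: "space M \<in> sets (noise (light_cone x (t + 0)))" using sets.top[of "noise (light_cone x (t + 0))"] by simp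
  have a: "(\<lambda>\<omega>. l / sqrt e * V n j \<omega>) \<in> borel_measurable (noise (light_cone x (t + 0)))" if "j < 2 * n" for j
    using V_measurable(3)[OF n that] by simp
  have 1: "l * (sint (vl n 0 e) \<omega> / sqrt e) = (\<Sum>j<2 * n. l / sqrt e * V n j \<omega> * Xi n j 0 e \<omega>)" for \<omega>
    by (simp add: sint_vl sum_distrib_left sum_divide_distrib field_simps)
  have 2: "(\<Sum>j<2 * n. (l / sqrt e * V n j \<omega>)\<^sup>2 * (t / real n * (e - 0))) / 2 = l\<^sup>2 / 2 * Sn n \<omega>" for \<omega>
    unfolding Sn_def sum_distrib_left sum_divide_distrib using e
    by (intro sum.cong refl) (simp add: power_mult_distrib power_divide field_simps)
  have "(CLINT \<omega>|M. iexp (l * (sint (vl n 0 e) \<omega> / sqrt e))) = (CLINT \<omega>|M. indicator (space M) \<omega> *\<^sub>R iexp (\<Sum>j<2 * n. l / sqrt e * V n j \<omega> * Xi n j 0 e \<omega>))"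
    unfolding 1 by (rule Bochner_Integration.integral_cong) auto
  also have "\<dots> = complex_of_real (\<integral>\<omega>. indicator (space M) \<omega> * exp (- (\<Sum>j<2 * n. (l / sqrt e * V n j \<omega>)\<^sup>2 * (t / real n * (e - 0))) / 2) \<partial>M)"
    by (rule frozen_char[OF n order_refl _ a sp]) (use e in auto)
  also have "(\<integral>\<omega>. indicator (space M) \<omega> * exp (- (\<Sum>j<2 * n. (l / sqrt e * V n j \<omega>)\<^sup>2 * (t / real n * (e - 0))) / 2) \<partial>M) =
    (\<integral>\<omega>. exp (- (l\<^sup>2 / 2 * Sn n \<omega>)) \<partial>M)"
    using 2 by (intro Bochner_Integration.integral_cong) (auto simp: minus_divide_left[symmetric] simp del: minus_divide_left)
  finally show ?thesis .
qed

text \<open>After division by \<open>sqrt (e n)\<close> the remainder has mean square at most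
  \<open>C * (e n + 1 / Suc n)\<close>. It vanishes without any relation between the decay of
  \<open>e\<close> and the mesh, so the mesh \<open>1 / Suc n\<close> may be used.\<close>

lemma increment_char_limit:
  assumes e: "\<And>n. 0 < e n" "e \<longlonglongrightarrow> 0"
  shows "(\<lambda>n. char (distr M borel (\<lambda>\<omega>. (u (t + e n) x \<omega> - u t x \<omega>) / sqrt (e n))) l) \<longlonglongrightarrow> complex_of_real (\<integral>\<omega>. exp (- (l\<^sup>2 / 2 * S \<omega>)) \<partial>M)"
proof -
  obtain C where C: "C \<ge> 0" "\<And>n r. n > 0 \<Longrightarrow> 0 \<le> r \<Longrightarrow> r \<le> 1 \<Longrightarrow> (\<integral>\<omega>. (R n r \<omega>)\<^sup>2 \<partial>M) \<le> C * r * (r + 1 / real n)"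
    using R_bound by blast
  let ?N = "\<lambda>n \<omega>. (u (t + e n) x \<omega> - u t x \<omega>) / sqrt (e n)"
  let ?D = "\<lambda>n \<omega>. sint (vl (Suc n) 0 (e n)) \<omega> / sqrt (e n)"
  have um[measurable]: "u (t + e n) x \<in> borel_measurable M" "u t x \<in> borel_measurable M" for n
    using t0 e(1)[of n] by (intro u_measurable; simp)+
  have sm[measurable]: "sint (vl (Suc n) 0 (e n)) \<in> borel_measurable M" for n
    using sint_sqint[OF simple_vl[of "Suc n" 0 "e n"]] e(1)[of n] by (simp add: sqint_def)
  have ch: "char (distr M borel (?N n)) l = (CLINT \<omega>|M. iexp (l * ?N n \<omega>))" for n
    unfolding char_def by (subst integral_distr) auto
  have bound: "cmod ((CLINT \<omega>|M. iexp (l * ?N n \<omega>)) - (CLINT \<omega>|M. iexp (l * ?D n \<omega>))) \<le> \<bar>l\<bar> * sqrt (C * (e n + 1 / real (Suc n)))" if e1: "e n \<le> 1" for n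
  proof -
    have Rs: "sqint M (R (Suc n) (e n))" using R_measurable(2)[of "Suc n" "e n"] e(1)[of n] by simp
    have d: "l * ?N n \<omega> - l * ?D n \<omega> = (l / sqrt (e n)) * R (Suc n) (e n) \<omega>" for \<omega>
      by (simp add: R_def diff_divide_distrib right_diff_distrib)
    have "cmod ((CLINT \<omega>|M. iexp (l * ?N n \<omega>)) - (CLINT \<omega>|M. iexp (l * ?D n \<omega>))) \<le> (\<integral>\<omega>. \<bar>l * ?N n \<omega> - l * ?D n \<omega>\<bar> \<partial>M)"
      by (rule char_diff_le; (measurable)?) (use sqint_integrable[OF Rs] in \<open>simp only: d, simp\<close>)
    also have "\<dots> = (\<bar>l\<bar> / sqrt (e n)) * (\<integral>\<omega>. \<bar>R (Suc n) (e n) \<omega>\<bar> \<partial>M)" unfolding d using e(1)[of n] by (simp add: abs_mult)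
    also have "\<dots> \<le> (\<bar>l\<bar> / sqrt (e n)) * sqrt (C * e n * (e n + 1 / real (Suc n)))"
    proof (rule mult_left_mono)
      have "(\<integral>\<omega>. \<bar>R (Suc n) (e n) \<omega>\<bar> \<partial>M) \<le> sqrt (\<integral>\<omega>. (R (Suc n) (e n) \<omega>)\<^sup>2 \<partial>M)" by (rule abs_expectation_le_sqrt[OF Rs])
      also have "\<dots> \<le> sqrt (C * e n * (e n + 1 / real (Suc n)))" using e(1)[of n] e1 by (intro real_sqrt_le_mono C) auto
      finally show "(\<integral>\<omega>. \<bar>R (Suc n) (e n) \<omega>\<bar> \<partial>M) \<le> sqrt (C * e n * (e n + 1 / real (Suc n)))" .
      show "0 \<le> \<bar>l\<bar> / sqrt (e n)" using e(1)[of n] by simp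
    qed
    also have "C * e n * (e n + 1 / real (Suc n)) = e n * (C * (e n + 1 / real (Suc n)))" by (simp add: mult_ac)
    also have "(\<bar>l\<bar> / sqrt (e n)) * sqrt (e n * (C * (e n + 1 / real (Suc n)))) = \<bar>l\<bar> * sqrt (C * (e n + 1 / real (Suc n)))"
      using e(1)[of n] by (simp add: real_sqrt_mult)
    finally show ?thesis .
  qed
  have "(\<lambda>n. \<bar>l\<bar> * sqrt (C * (e n + 1 / real (Suc n)))) \<longlonglongrightarrow> \<bar>l\<bar> * sqrt (C * (0 + 0))"
    by (intro tendsto_intros e(2) LIMSEQ_Suc[OF lim_1_over_n])
  then have z: "(\<lambda>n. \<bar>l\<bar> * sqrt (C * (e n + 1 / real (Suc n)))) \<longlonglongrightarrow> 0" by simp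
  have "eventually (\<lambda>n. e n < 1) sequentially" by (rule order_tendstoD(2)[OF e(2)]) simp
  then have "eventually (\<lambda>n. cmod ((CLINT \<omega>|M. iexp (l * ?N n \<omega>)) - (CLINT \<omega>|M. iexp (l * ?D n \<omega>))) \<le> \<bar>l\<bar> * sqrt (C * (e n + 1 / real (Suc n)))) sequentially"
    by (rule eventually_mono) (intro bound, simp)
  from Lim_null_comparison[OF this z]
  have "(\<lambda>n. (CLINT \<omega>|M. iexp (l * ?N n \<omega>)) - (CLINT \<omega>|M. iexp (l * ?D n \<omega>))) \<longlonglongrightarrow> 0" .
  moreover have "(\<lambda>n. CLINT \<omega>|M. iexp (l * ?D n \<omega>)) \<longlonglongrightarrow> complex_of_real (\<integral>\<omega>. exp (- (l\<^sup>2 / 2 * S \<omega>)) \<partial>M)"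
    unfolding frozen_sum_char[OF zero_less_Suc e(1)] by (intro tendsto_of_real S_exp_limit) simp
  ultimately have "(\<lambda>n. ((CLINT \<omega>|M. iexp (l * ?N n \<omega>)) - (CLINT \<omega>|M. iexp (l * ?D n \<omega>))) + (CLINT \<omega>|M. iexp (l * ?D n \<omega>))) \<longlonglongrightarrow> 0 + complex_of_real (\<integral>\<omega>. exp (- (l\<^sup>2 / 2 * S \<omega>)) \<partial>M)"
    by (rule tendsto_add)
  then show ?thesis unfolding ch by simp
qed

end

section \<open>Smooth test functions generate the noise in a cone\<close>

text \<open>The classical flat functions, with a polynomial in \<open>1 / z\<close> as prefactor so
  that the family is closed under differentiation.\<close>

definition expfun :: "real poly \<Rightarrow> real \<Rightarrow> real" where
  "expfun P z = (if z > 0 then poly P (1 / z) * exp (- (1 / z)) else 0)"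

lemma poly_exp_decay: "((\<lambda>y. poly P y * exp (- y)) \<longlongrightarrow> (0::real)) at_top"
proof -
  have "((\<lambda>y::real. \<Sum>i\<le>degree P. coeff P i * (y ^ i / exp y)) \<longlongrightarrow> (\<Sum>i\<le>degree P. coeff P i * 0)) at_top"
    by (intro tendsto_intros tendsto_power_div_exp_0)
  moreover have "(\<lambda>y::real. \<Sum>i\<le>degree P. coeff P i * (y ^ i / exp y)) = (\<lambda>y. poly P y * exp (- y))"
    by (auto simp: poly_altdef sum_distrib_right sum_divide_distrib exp_minus field_simps)
  ultimately show ?thesis by simp
qed

text \<open>For positive \<open>z\<close> the chain rule multiplies \<open>(P - P')(1 / z)\<close>
  by \<open>1 / z^2\<close>, that is, the polynomial by the square of the indeterminate. At 0 the
  difference quotient is again a polynomial in \<open>1 / z\<close> times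
  \<open>exp (- (1 / z))\<close>, which tends to 0.\<close>

lemma expfun_DERIV: "DERIV (expfun P) z :> expfun ([:0, 0, 1:] * (P - pderiv P)) z"
proof -
  consider "z > 0" | "z < 0" | "z = 0" by linarith
  then show ?thesis
  proof cases
    case 1
    have "DERIV (\<lambda>z. poly P (1 / z) * exp (- (1 / z))) z :> expfun ([:0, 0, 1:] * (P - pderiv P)) z"
      using 1 by (auto intro!: derivative_eq_intros DERIV_chain2[OF poly_DERIV] simp: expfun_def field_simps power2_eq_square)
    moreover have "eventually (\<lambda>z. z > 0) (nhds z)" using eventually_nhds_in_open[of "{0<..}" z] 1 by auto
    then have ev: "eventually (\<lambda>z. expfun P z = poly P (1 / z) * exp (- (1 / z))) (nhds z)"
      by (rule eventually_mono) (simp add: expfun_def)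
    ultimately show ?thesis by (subst DERIV_cong_ev[OF refl ev refl])
  next
    case 2
    have "eventually (\<lambda>z. z < 0) (nhds z)" using eventually_nhds_in_open[of "{..<0}" z] 2 by auto
    then have ev: "eventually (\<lambda>z. expfun P z = 0) (nhds z)" by (rule eventually_mono) (simp add: expfun_def)
    have "DERIV (\<lambda>z. 0) z :> expfun ([:0, 0, 1:] * (P - pderiv P)) z" using 2 by (simp add: expfun_def)
    then show ?thesis by (subst DERIV_cong_ev[OF refl ev refl])
  next
    case 3
    have r: "((\<lambda>h. expfun P h / h) \<longlongrightarrow> 0) (at_right 0)"
    proof -
      have "((\<lambda>h. poly (pCons 0 P) (inverse h) * exp (- inverse h)) \<longlongrightarrow> (0::real)) (at_right 0)"
        by (rule filterlim_compose[OF poly_exp_decay filterlim_inverse_at_top_right])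
      moreover have "eventually (\<lambda>h. poly (pCons 0 P) (inverse h) * exp (- inverse h) = expfun P h / h) (at_right 0)"
        unfolding eventually_at_right_field by (intro exI[of _ 1]) (auto simp: expfun_def field_simps)
      ultimately show ?thesis by (simp cong: tendsto_cong)
    qed
    have "eventually (\<lambda>h. expfun P h / h = 0) (at_left 0)"
      unfolding eventually_at_left_field by (intro exI[of _ "-1"]) (auto simp: expfun_def)
    then have l: "((\<lambda>h. expfun P h / h) \<longlongrightarrow> 0) (at_left 0)" by (rule tendsto_eventually)
    have "((\<lambda>h. expfun P h / h) \<longlongrightarrow> 0) (at 0)" using l r by (simp add: filterlim_split_at)
    then show ?thesis using 3 by (simp add: DERIV_def expfun_def)
  qed
qed

text \<open>\<open>smooth_fun\<close> asks for differentiability of all iterated directional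
  derivatives. A class of differentiable functions closed under directional derivatives settles all
  orders at once; affine arguments suffice to cut out boxes and cones.\<close>

inductive_set smooth_class :: "(real \<times> real \<Rightarrow> real) set" where
  base: "(\<lambda>p. expfun P (\<alpha> * fst p + \<beta> * snd p + \<gamma>)) \<in> smooth_class"
| cmult: "f \<in> smooth_class \<Longrightarrow> (\<lambda>p. c * f p) \<in> smooth_class"
| add: "f \<in> smooth_class \<Longrightarrow> g \<in> smooth_class \<Longrightarrow> (\<lambda>p. f p + g p) \<in> smooth_class"
| mult: "f \<in> smooth_class \<Longrightarrow> g \<in> smooth_class \<Longrightarrow> (\<lambda>p. f p * g p) \<in> smooth_class"

lemma smooth_class_derivative:
  "f \<in> smooth_class \<Longrightarrow> \<exists>D. (\<forall>p. (f has_derivative D p) (at p)) \<and> (\<forall>v. (\<lambda>p. D p v) \<in> smooth_class)"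
proof (induction rule: smooth_class.induct)
  case (base P \<alpha> \<beta> \<gamma>)
  let ?Q = "[:0, 0, 1:] * (P - pderiv P)" and ?l = "\<lambda>p. \<alpha> * fst p + \<beta> * snd p + \<gamma>"
  show ?case
  proof (intro exI[of _ "\<lambda>p v. (\<alpha> * fst v + \<beta> * snd v) * expfun ?Q (?l p)"] conjI allI)
    fix p :: "real \<times> real"
    have 1: "(?l has_derivative (\<lambda>v. \<alpha> * fst v + \<beta> * snd v)) (at p)" by (auto intro!: derivative_eq_intros)
    have "(expfun P has_derivative (\<lambda>h. h * expfun ?Q (?l p))) (at (?l p))"
    proof -
      have "(*) d = (\<lambda>h. h * d)" for d :: real by (simp add: fun_eq_iff)
      then show ?thesis using expfun_DERIV[of P "?l p"] unfolding has_field_derivative_def by metis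
    qed
    from has_derivative_compose[OF 1 this]
    show "((\<lambda>p. expfun P (?l p)) has_derivative (\<lambda>v. (\<alpha> * fst v + \<beta> * snd v) * expfun ?Q (?l p))) (at p)" .
  next
    fix v :: "real \<times> real"
    show "(\<lambda>p. (\<alpha> * fst v + \<beta> * snd v) * expfun ?Q (?l p)) \<in> smooth_class"
      by (intro smooth_class.cmult smooth_class.base)
  qed
next
  case (cmult f c)
  then obtain D where "\<forall>p. (f has_derivative D p) (at p)" "\<forall>v. (\<lambda>p. D p v) \<in> smooth_class" by blast
  then show ?case by (intro exI[of _ "\<lambda>p v. c * D p v"]) (auto intro!: has_derivative_mult_right smooth_class.cmult)
next
  case (add f g)
  then obtain D E where "\<forall>p. (f has_derivative D p) (at p)" "\<forall>v. (\<lambda>p. D p v) \<in> smooth_class"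
    "\<forall>p. (g has_derivative E p) (at p)" "\<forall>v. (\<lambda>p. E p v) \<in> smooth_class" by blast
  then show ?case by (intro exI[of _ "\<lambda>p v. D p v + E p v"]) (auto intro!: has_derivative_add smooth_class.add)
next
  case (mult f g)
  then obtain D E where "\<forall>p. (f has_derivative D p) (at p)" "\<forall>v. (\<lambda>p. D p v) \<in> smooth_class"
    "\<forall>p. (g has_derivative E p) (at p)" "\<forall>v. (\<lambda>p. E p v) \<in> smooth_class" by blast
  with mult.hyps show ?case
    by (intro exI[of _ "\<lambda>p v. f p * E p v + D p v * g p"]) (auto intro!: has_derivative_mult smooth_class.add smooth_class.mult)
qed

lemma smooth_class_smooth: assumes "f \<in> smooth_class" shows "smooth_fun f"
proof -
  have "dir_deriv vs f \<in> smooth_class" for vs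
  proof (induction vs)
    case (Cons v vs)
    obtain D where D: "\<forall>p. (dir_deriv vs f has_derivative D p) (at p)" "\<forall>v. (\<lambda>p. D p v) \<in> smooth_class"
      using smooth_class_derivative[OF Cons] by blast
    have "frechet_derivative (dir_deriv vs f) (at p) = D p" for p by (rule frechet_derivative_at[OF spec[OF D(1)], symmetric])
    then show ?case using spec[OF D(2), of v] by (simp only: dir_deriv.simps)
  qed (use assms in simp)
  then show ?thesis unfolding smooth_fun_def using smooth_class_derivative by (meson differentiableI)
qed

lemma smooth_class_continuous: assumes "f \<in> smooth_class" shows "continuous_on UNIV f"
proof -
  obtain D where D: "\<forall>p. (f has_derivative D p) (at p)" using smooth_class_derivative[OF assms] by blast
  show ?thesis by (intro continuous_at_imp_continuous_on ballI has_derivative_continuous[OF spec[OF D]])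
qed

lemma expfun_1: "expfun 1 z = (if z > 0 then exp (- (1 / z)) else 0)" by (simp add: expfun_def)

lemma expfun_1_bounds: "0 \<le> expfun 1 z" "expfun 1 z \<le> 1" by (auto simp: expfun_1)

text \<open>Smooth approximation of the indicator of the positive half line from inside: every
  approximant vanishes for \<open>z \<le> 0\<close>, so supports are never enlarged.\<close>

lemma expfun_1_limit: "(\<lambda>n. expfun 1 (real (Suc n) * z)) \<longlonglongrightarrow> (if z > 0 then 1 else 0)"
proof (cases "z > 0")
  case True
  have "(\<lambda>n. exp (- (1 / z * (1 / real (Suc n))))) \<longlonglongrightarrow> exp (- (1 / z * 0))"
    by (intro tendsto_intros LIMSEQ_Suc[OF lim_1_over_n])
  moreover have "expfun 1 (real (Suc n) * z) = exp (- (1 / z * (1 / real (Suc n))))" for n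
    unfolding expfun_1 using True by simp
  ultimately show ?thesis using True by simp
qed (simp add: expfun_1 zero_less_mult_iff)

section \<open>Boxes and open cones as approximable sets\<close>

lemma mem_box_pair:
  fixes a b p :: "real \<times> real"
  shows "p \<in> box a b \<longleftrightarrow> fst a < fst p \<and> fst p < fst b \<and> snd a < snd p \<and> snd p < snd b"
  by (auto simp: mem_box Basis_prod_def inner_prod_def)

lemma mem_cbox_pair:
  fixes a b p :: "real \<times> real"
  shows "p \<in> cbox a b \<longleftrightarrow> fst a \<le> fst p \<and> fst p \<le> fst b \<and> snd a \<le> snd p \<and> snd p \<le> snd b"
  by (auto simp: mem_box Basis_prod_def inner_prod_def)

text \<open>Written as positivity of three affine functions, so that a product of three flat
  functions approximates the indicator.\<close>

definition open_cone :: "real \<Rightarrow> real \<Rightarrow> (real \<times> real) set" where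
  "open_cone x s = {p. 0 < fst p \<and> 0 < s - fst p - (snd p - x) \<and> 0 < s - fst p + (snd p - x)}"

lemma open_cone_borel [measurable]: "open_cone x s \<in> sets borel"
proof -
  have "open (open_cone x s)" unfolding open_cone_def
    by (intro open_Collect_conj open_Collect_less continuous_intros)
  then show ?thesis by simp
qed

lemma open_cone_subset: "open_cone x s \<subseteq> light_cone x s"
  by (auto simp: open_cone_def light_cone_def)

lemma light_cone_open_cone: "t < s \<Longrightarrow> p \<in> light_cone x t \<Longrightarrow> fst p \<noteq> 0 \<Longrightarrow> p \<in> open_cone x s"
  by (auto simp: open_cone_def light_cone_def)

lemma AE_fst_nonzero: "AE p in (lborel :: (real \<times> real) measure). fst p \<noteq> 0"
proof (rule AE_I[where N="{0} \<times> UNIV"])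
  have "emeasure lborel ({0::real} \<times> (UNIV :: real set)) = emeasure lborel {0::real} * emeasure lborel (UNIV :: real set)"
    unfolding lborel_prod[symmetric] by (rule lborel.emeasure_pair_measure_Times) auto
  then show "emeasure lborel ({0} \<times> UNIV :: (real \<times> real) set) = 0" by simp
  have "closed ({0} \<times> UNIV :: (real \<times> real) set)" by (intro closed_Times) auto
  then show "({0} \<times> UNIV :: (real \<times> real) set) \<in> sets lborel" by simp
qed auto

lemma light_cone_finite: "emeasure lborel (light_cone x s) < \<infinity>"
proof (cases "0 \<le> s")
  case False
  then have "light_cone x s = {}" by (auto simp: light_cone_def)
  then show ?thesis by simp
qed (simp add: emeasure_light_cone)

lemma L2_st_bounded_cone:
  assumes [measurable]: "f \<in> borel_measurable borel" and b: "\<And>p. \<bar>f p\<bar> \<le> 1" and z: "\<And>p. p \<notin> light_cone x s \<Longrightarrow> f p = 0"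
  shows "L2_st f"
proof -
  have i: "integrable lborel (indicator (light_cone x s) :: _ \<Rightarrow> real)"
    using light_cone_finite by (intro integrable_real_indicator) auto
  have "integrable lborel (\<lambda>p. (f p)\<^sup>2)"
  proof (rule Bochner_Integration.integrable_bound[OF i])
    have "(f p)\<^sup>2 \<le> indicator (light_cone x s) p" for p
      using b[of p] z[of p] by (cases "p \<in> light_cone x s") (auto simp: abs_square_le_1)
    then show "AE p in lborel. norm ((f p)\<^sup>2) \<le> norm (indicator (light_cone x s) p :: real)" by auto
  qed measurable
  moreover have "f (s', y) = 0" if "s' < 0" for s' y using z[of "(s', y)"] that by (auto simp: light_cone_def)
  ultimately show ?thesis by (auto simp: L2_st_def)
qed

context white_noise_space
begin

lemma xi_limit_measurable:
  assumes N: "subalgebra M N" "null_sets M \<subseteq> sets N"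
    and f: "\<And>n. L2_st (f n)" "\<And>n. \<xi> (f n) \<in> borel_measurable N" and g: "L2_st g"
    and lim: "\<And>p. (\<lambda>n. f n p) \<longlonglongrightarrow> g p" and w: "integrable lborel w" "\<And>n p. (f n p - g p)\<^sup>2 \<le> w p"
  shows "\<xi> g \<in> borel_measurable N"
proof (rule complete_L2_limit[OF N f(2)])
  have fg: "L2_st (\<lambda>p. f n p - g p)" for n using L2_st_lin[OF f(1) g, of 1 n "-1"] by simp
  show "\<xi> g \<in> borel_measurable M" by (rule xi_measurable[OF g])
  show "integrable M (\<lambda>\<omega>. (\<xi> (f n) \<omega> - \<xi> g \<omega>)\<^sup>2)" for n
    using sqint_diff[OF xi_moments(1)[OF f(1)] xi_moments(1)[OF g]] by (simp add: sqint_def)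
  have "(\<lambda>n. \<integral>p. (f n p - g p)\<^sup>2 \<partial>lborel) \<longlonglongrightarrow> (\<integral>p. 0 \<partial>(lborel :: (real \<times> real) measure))"
  proof (rule integral_dominated_convergence[OF _ _ w(1)])
    show "(\<lambda>p. (f n p - g p)\<^sup>2) \<in> borel_measurable lborel" for n using fg[of n] by (auto simp: L2_st_def)
    show "AE p in lborel. (\<lambda>n. (f n p - g p)\<^sup>2) \<longlonglongrightarrow> 0"
    proof (rule AE_I2)
      fix p
      have "(\<lambda>n. (f n p - g p)\<^sup>2) \<longlonglongrightarrow> (g p - g p)\<^sup>2" by (intro tendsto_intros lim)
      then show "(\<lambda>n. (f n p - g p)\<^sup>2) \<longlonglongrightarrow> 0" by simp
    qed
    show "AE p in lborel. norm ((f n p - g p)\<^sup>2) \<le> w p" for n using w(2) by simp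
  qed simp
  then show "(\<lambda>n. \<integral>\<omega>. (\<xi> (f n) \<omega> - \<xi> g \<omega>)\<^sup>2 \<partial>M) \<longlonglongrightarrow> 0" using xi_dist[OF f(1) g] by (simp add: L2_norm_sq_def)
qed

text \<open>Smooth functions supported in the cone of height \<open>s\<close> reach the indicators
  of boxes cut with the open cone, then those of all Borel subsets of it, and finally every
  \<open>L2\<close> function living there. Strictness of \<open>t < s\<close> places the closed cone
  of height \<open>t\<close> inside this open cone up to the line of time 0, which has measure
  zero.\<close>

lemma smooth_cone_total:
  assumes N: "subalgebra M N" "null_sets M \<subseteq> sets N"
    and gen: "\<And>\<phi>. smooth_fun \<phi> \<Longrightarrow> (\<And>p. p \<notin> light_cone x s \<Longrightarrow> \<phi> p = 0) \<Longrightarrow> \<xi> \<phi> \<in> borel_measurable N"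
    and \<phi>: "L2_st \<phi>" "\<And>p. p \<notin> light_cone x t \<Longrightarrow> \<phi> p = 0" and ts: "t < s"
  shows "\<xi> \<phi> \<in> borel_measurable N"
proof -
  define U where "U = open_cone x s"
  have Ub[measurable]: "U \<in> sets borel" by (simp add: U_def)
  have US: "U \<subseteq> light_cone x s" unfolding U_def by (rule open_cone_subset)
  have Ufin: "emeasure lborel U < \<infinity>" using emeasure_mono[OF US, of lborel] light_cone_finite[of x s] by (auto intro: le_less_trans)
  have Lind: "L2_st (\<lambda>p. indicator (A \<inter> U) p)" if "A \<in> sets borel" for A
    by (rule L2_st_bounded_cone[of _ x s]) (use that US in \<open>auto simp: indicator_def\<close>)
  have iC: "integrable lborel (\<lambda>p. indicator (light_cone x s) p :: real)"
    using light_cone_finite by (intro integrable_real_indicator) auto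
  have boxm: "\<xi> (indicator (B \<inter> U)) \<in> borel_measurable N" if B: "B = box a b" for a b :: "real \<times> real" and B
  proof -
    \<comment> \<open>Three factors cut out the open cone and four the box.\<close>
    define f where "f n p = expfun 1 (real (Suc n) * fst p) * expfun 1 (real (Suc n) * (s - fst p - (snd p - x))) * expfun 1 (real (Suc n) * (s - fst p + (snd p - x)))
      * expfun 1 (real (Suc n) * (fst p - fst a)) * expfun 1 (real (Suc n) * (fst b - fst p)) * expfun 1 (real (Suc n) * (snd p - snd a)) * expfun 1 (real (Suc n) * (snd b - snd p))" for n p
    have lin: "(\<lambda>p. expfun 1 (l p)) \<in> smooth_class" if "\<And>p. l p = \<alpha> * fst p + \<beta> * snd p + \<gamma>" for l \<alpha> \<beta> \<gamma>
      unfolding that by (rule smooth_class.base)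
    have e: "real (Suc n) * fst p = real (Suc n) * fst p + 0 * snd p + 0"
      "real (Suc n) * (s - fst p - (snd p - x)) = - real (Suc n) * fst p + - real (Suc n) * snd p + real (Suc n) * (s + x)"
      "real (Suc n) * (s - fst p + (snd p - x)) = - real (Suc n) * fst p + real (Suc n) * snd p + real (Suc n) * (s - x)"
      "real (Suc n) * (fst p - fst a) = real (Suc n) * fst p + 0 * snd p + - real (Suc n) * fst a"
      "real (Suc n) * (fst b - fst p) = - real (Suc n) * fst p + 0 * snd p + real (Suc n) * fst b"
      "real (Suc n) * (snd p - snd a) = 0 * fst p + real (Suc n) * snd p + - real (Suc n) * snd a"
      "real (Suc n) * (snd b - snd p) = 0 * fst p + - real (Suc n) * snd p + real (Suc n) * snd b" for n p
      by (simp_all add: algebra_simps del: of_nat_Suc)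
    have sc: "f n \<in> smooth_class" for n unfolding f_def[abs_def]
      by (intro smooth_class.mult lin[OF e(1)] lin[OF e(2)] lin[OF e(3)] lin[OF e(4)] lin[OF e(5)] lin[OF e(6)] lin[OF e(7)])
    have fz: "f n p = 0" if "p \<notin> B \<inter> U" for n p
      using that unfolding f_def B U_def open_cone_def
      by (auto simp: expfun_1 mem_box_pair mem_cbox_pair zero_less_mult_iff simp del: of_nat_Suc)
    have fb: "\<bar>f n p\<bar> \<le> 1" for n p
      unfolding f_def abs_mult by (intro mult_le_one mult_nonneg_nonneg) (auto simp: expfun_1_bounds abs_of_nonneg)
    have fm: "f n \<in> borel_measurable borel" for n by (rule borel_measurable_continuous_onI[OF smooth_class_continuous[OF sc]])
    have fz': "p \<notin> light_cone x s \<Longrightarrow> f n p = 0" for n p using US by (intro fz) auto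
    have fL: "L2_st (f n)" for n by (rule L2_st_bounded_cone[OF fm fb fz'])
    have lim: "(\<lambda>n. f n p) \<longlonglongrightarrow> indicator (B \<inter> U) p" for p
    proof (cases "p \<in> B \<inter> U")
      case True
      have "(\<lambda>n. f n p) \<longlonglongrightarrow> 1 * 1 * 1 * 1 * 1 * 1 * 1"
        unfolding f_def by (intro tendsto_mult; rule tendsto_eq_rhs[OF expfun_1_limit])
          (use True in \<open>auto simp: B U_def open_cone_def mem_box_pair mem_cbox_pair\<close>)
      then show ?thesis using True by simp
    qed (simp add: fz)
    have "\<xi> (\<lambda>p. indicator (B \<inter> U) p) \<in> borel_measurable N"
    proof (rule xi_limit_measurable[OF N fL _ _ lim iC])
      show "\<xi> (f n) \<in> borel_measurable N" for n by (rule gen[OF smooth_class_smooth[OF sc] fz'])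
      show "L2_st (\<lambda>p. indicator (B \<inter> U) p)" by (rule Lind) (simp add: B)
      show "(f n p - indicator (B \<inter> U) p)\<^sup>2 \<le> indicator (light_cone x s) p" for n p
      proof (cases "p \<in> B \<inter> U")
        case True
        have "0 \<le> f n p" unfolding f_def by (intro mult_nonneg_nonneg expfun_1_bounds)
        then have "\<bar>f n p - 1\<bar> \<le> 1" using fb[of n p] by auto
        then show ?thesis using True US by (auto simp: abs_square_le_1)
      qed (simp add: fz)
    qed
    then show ?thesis .
  qed
  have full: "\<xi> (indicator (UNIV \<inter> U)) \<in> borel_measurable N"
  proof -
    have "light_cone x s \<subseteq> box (-1, x - s - 1) (s + 1, x + s + 1)" by (auto simp: light_cone_def mem_box_pair mem_cbox_pair)
    then have "UNIV \<inter> U = box (-1, x - s - 1) (s + 1, x + s + 1) \<inter> U" using US by auto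
    then show ?thesis using boxm[OF refl] by metis
  qed
  \<comment> \<open>A Dynkin argument starting from boxes: complements are taken inside
    \<open>U\<close> and use \<open>full\<close>, countable disjoint unions use mean square
    continuity of the noise.\<close>
  have ind: "\<xi> (indicator (A \<inter> U)) \<in> borel_measurable N" if A: "A \<in> sets borel" for A
  proof -
    have 1: "Int_stable (range (\<lambda>(a, b). box a b :: (real \<times> real) set))" by (auto simp: Int_stable_def box_Int_box)
    have 2: "range (\<lambda>(a, b). box a b :: (real \<times> real) set) \<subseteq> Pow UNIV" by simp
    have 3: "A \<in> sigma_sets UNIV (range (\<lambda>(a, b). box a b))" using A by (simp add: borel_eq_box)
    from 1 2 3 have "A \<in> sets borel \<and> \<xi> (indicator (A \<inter> U)) \<in> borel_measurable N"
    proof (induction rule: sigma_sets_induct_disjoint)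
      case (basic B)
      then obtain a b :: "real \<times> real" where "B = box a b" by auto
      then show ?case using boxm[of B a b] by simp
    next
      case empty
      have "AE \<omega> in M. 0 = \<xi> (indicator ({} \<inter> U)) \<omega>" using xi_zero by (auto simp: indicator_def[abs_def])
      then have "\<xi> (indicator ({} \<inter> U)) \<in> borel_measurable N"
        by (rule complete_AE_cong[OF N borel_measurable_const xi_measurable[OF Lind[of "{}"]], rotated]) simp
      then show ?case by (intro conjI sets.empty_sets)
    next
      case (compl A)
      have A: "A \<in> sets borel" "\<xi> (indicator (A \<inter> U)) \<in> borel_measurable N" using compl by auto
      have Ac: "UNIV - A \<in> sets borel" using A by auto
      have "(\<lambda>p. indicator (UNIV \<inter> U) p - indicator (A \<inter> U) p :: real) = indicator ((UNIV - A) \<inter> U)" by (auto simp: indicator_def fun_eq_iff)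
      then have "AE \<omega> in M. \<xi> (indicator (UNIV \<inter> U)) \<omega> - \<xi> (indicator (A \<inter> U)) \<omega> = \<xi> (indicator ((UNIV - A) \<inter> U)) \<omega>"
        using xi_diff[OF Lind[of UNIV] Lind[OF A(1)]] by (auto elim!: eventually_mono)
      then have "\<xi> (indicator ((UNIV - A) \<inter> U)) \<in> borel_measurable N"
        by (rule complete_AE_cong[OF N borel_measurable_diff[OF full A(2)] xi_measurable[OF Lind[OF Ac]]])
      then show ?case using Ac by simp
    next
      case (union A)
      then have A: "\<And>i. A i \<in> sets borel" "\<And>i. \<xi> (indicator (A i \<inter> U)) \<in> borel_measurable N" by auto
      have UA: "(\<Union>i. A i) \<in> sets borel" using A by auto
      have d: "(\<Sum>i<n. indicator (A i \<inter> U) p) = (indicator ((\<Union>i<n. A i) \<inter> U) p :: real)" for n p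
      proof -
        have dj: "disjoint_family A" using union by (auto simp: disjoint_family_on_def)
        have "(\<Sum>i<n. indicator (A i \<inter> U) p) = (\<Sum>i<n. indicator (A i) p) * (indicator U p :: real)" by (simp add: indicator_inter_arith sum_distrib_right)
        also have "(\<Sum>i<n. indicator (A i) p) = (indicator (\<Union>i<n. A i) p :: real)"
          by (rule indicator_UN_disjoint[symmetric]) (use disjoint_family_on_mono[OF _ dj] in auto)
        finally show ?thesis by (simp add: indicator_inter_arith)
      qed
      have "\<xi> (\<lambda>p. indicator ((\<Union>i. A i) \<inter> U) p) \<in> borel_measurable N"
      proof (rule xi_limit_measurable[OF N _ _ _ _ iC, where f="\<lambda>n p. indicator ((\<Union>i<n. A i) \<inter> U) p"])
        have Un: "(\<Union>i<n. A i) \<in> sets borel" for n using A by auto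
        show L: "L2_st (\<lambda>p. indicator ((\<Union>i<n. A i) \<inter> U) p)" for n by (rule Lind[OF Un])
        show "L2_st (\<lambda>p. indicator ((\<Union>i. A i) \<inter> U) p)" by (rule Lind[OF UA])
        show "\<xi> (\<lambda>p. indicator ((\<Union>i<n. A i) \<inter> U) p) \<in> borel_measurable N" for n
        proof -
          have "AE \<omega> in M. (\<Sum>i<n. \<xi> (indicator (A i \<inter> U)) \<omega>) = \<xi> (\<lambda>p. indicator ((\<Union>i<n. A i) \<inter> U) p) \<omega>"
            using xi_sum[of "{..<n}" "\<lambda>i. indicator (A i \<inter> U)" "\<lambda>_. 1"] Lind[OF A(1)] by (auto simp: d)
          then show ?thesis by (rule complete_AE_cong[OF N borel_measurable_sum[OF A(2)] xi_measurable[OF L]])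
        qed
        show "(\<lambda>n. indicator ((\<Union>i<n. A i) \<inter> U) p :: real) \<longlonglongrightarrow> indicator ((\<Union>i. A i) \<inter> U) p" for p
          unfolding indicator_inter_arith by (intro tendsto_mult LIMSEQ_indicator_UN tendsto_const)
        show "(indicator ((\<Union>i<n. A i) \<inter> U) p - indicator ((\<Union>i. A i) \<inter> U) p)\<^sup>2 \<le> (indicator (light_cone x s) p :: real)" for n p
          using US by (auto simp: indicator_def)
      qed
      then show ?case using UA by simp
    qed
    then show ?thesis by simp
  qed
  have \<phi>m: "\<phi> \<in> borel_measurable borel" using \<phi> by (auto simp: L2_st_def)
  \<comment> \<open>The simple functions approximate relative to the base point 0, which bounds them
    by twice the modulus of \<open>\<phi>\<close>. Their distance to \<open>\<phi>\<close> is then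
    at most three times that modulus, whence the dominating function
    \<open>9 * (\<phi> p)\<^sup>2\<close> below.\<close>
  obtain v where v: "\<And>i. simple_function borel (v i)" "\<And>p. (\<lambda>i. v i p) \<longlonglongrightarrow> \<phi> p" "\<And>i p. \<bar>v i p\<bar> \<le> 2 * \<bar>\<phi> p\<bar>"
    using borel_measurable_implies_sequence_metric[OF \<phi>m, of 0] by (auto simp: dist_real_def)
  let ?g = "\<lambda>p. indicator U p * \<phi> p"
  have gL: "L2_st ?g" by (rule L2_st_indicator_mult[OF \<phi>(1) Ub])
  have "\<xi> ?g \<in> borel_measurable N"
  proof (rule xi_limit_measurable[OF N, where f="\<lambda>n p. indicator U p * v n p" and w="\<lambda>p. 9 * (\<phi> p)\<^sup>2"])
    have fin: "finite (range (v n))" for n using v(1)[of n] by (simp add: simple_function_def)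
    have lev: "v n -` {y} \<in> sets borel" for n y using simple_functionD(2)[OF v(1)[of n], of "{y}"] by simp
    have dec: "(\<lambda>p. indicator U p * v n p) = (\<lambda>p. \<Sum>y\<in>range (v n). y * indicator ((v n -` {y}) \<inter> U) p)" for n
    proof
      fix p
      have "(\<Sum>y\<in>range (v n). y * indicator ((v n -` {y}) \<inter> U) p) = (\<Sum>y\<in>range (v n). if y = v n p then y * indicator U p else 0)"
        by (intro sum.cong) (auto simp: indicator_def)
      also have "\<dots> = v n p * indicator U p" using fin by simp
      finally show "indicator U p * v n p = (\<Sum>y\<in>range (v n). y * indicator ((v n -` {y}) \<inter> U) p)" by (simp add: mult.commute)
    qed
    show L: "L2_st (\<lambda>p. indicator U p * v n p)" for n unfolding dec by (intro L2_st_sum L2_st_cmult Lind lev fin)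
    show "\<xi> (\<lambda>p. indicator U p * v n p) \<in> borel_measurable N" for n
    proof -
      have "AE \<omega> in M. (\<Sum>y\<in>range (v n). y * \<xi> (indicator ((v n -` {y}) \<inter> U)) \<omega>) = \<xi> (\<lambda>p. indicator U p * v n p) \<omega>"
        using xi_sum[OF fin[of n], where f="\<lambda>y. indicator ((v n -` {y}) \<inter> U)" and c="\<lambda>y. y"] Lind[OF lev] unfolding dec by (auto elim!: eventually_mono)
      note ae = this
      show ?thesis
        by (rule complete_AE_cong[OF N _ xi_measurable[OF L] ae]) (intro borel_measurable_sum borel_measurable_times borel_measurable_const ind lev)
    qed
    show "L2_st ?g" by (rule gL)
    show "(\<lambda>n. indicator U p * v n p) \<longlonglongrightarrow> indicator U p * \<phi> p" for p by (intro tendsto_intros v)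
    show "integrable lborel (\<lambda>p. 9 * (\<phi> p)\<^sup>2)" using \<phi> by (simp add: L2_st_def)
    show "(indicator U p * v n p - indicator U p * \<phi> p)\<^sup>2 \<le> 9 * (\<phi> p)\<^sup>2" for n p
    proof -
      have "\<bar>indicator U p * v n p - indicator U p * \<phi> p\<bar> \<le> \<bar>3 * \<phi> p\<bar>" using v(3)[of n p] by (auto simp: indicator_def)
      then have "(indicator U p * v n p - indicator U p * \<phi> p)\<^sup>2 \<le> (3 * \<phi> p)\<^sup>2" by (simp add: abs_le_square_iff)
      then show ?thesis by (simp add: power_mult_distrib)
    qed
  qed
  note gN = this
  have "AE \<omega> in M. \<xi> ?g \<omega> = \<xi> \<phi> \<omega>"
  proof (rule xi_cong_AE[OF gL \<phi>(1)])
    show "AE p in lborel. indicator U p * \<phi> p = \<phi> p"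
      using AE_fst_nonzero
    proof eventually_elim
      case (elim p)
      then show ?case using \<phi>(2)[of p] light_cone_open_cone[OF ts, of p x] by (cases "p \<in> light_cone x t") (auto simp: U_def)
    qed
  qed
  then show ?thesis by (rule complete_AE_cong[OF N gN xi_measurable[OF \<phi>(1)]])
qed

text \<open>This inclusion transfers the independence of the Brownian motion from \<open>G\<close>
  to the noise in the closed cone. It is shown in every \<open>G0\<close> with \<open>s > t\<close>,
  where there is room for smooth functions, and the intersection follows.\<close>

lemma noise_subset_G: "sets (noise (light_cone x t)) \<subseteq> G M \<xi> t x"
proof -
  have "sets (noise (light_cone x t)) \<subseteq> G0 M \<xi> s x" if s: "t < s" for s
  proof -
    define E where "E = {\<xi> \<phi> -` B \<inter> space M | \<phi> B. smooth_fun \<phi> \<and> (\<forall>p. p \<notin> light_cone x s \<longrightarrow> \<phi> p = 0) \<and> B \<in> sets borel} \<union> null_sets M"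
    \<comment> \<open>The assumptions on the noise concern \<open>L2_st\<close> only. A smooth
      function vanishing off the cone is bounded because the cone lies in a compact box, and after
      scaling \<open>L2_st_bounded_cone\<close> applies.\<close>
    have sL: "L2_st \<phi>" if "smooth_fun \<phi>" "\<And>p. p \<notin> light_cone x s \<Longrightarrow> \<phi> p = 0" for \<phi>
    proof -
      have "\<phi> differentiable (at p)" for p using that(1) unfolding smooth_fun_def by (metis dir_deriv.simps(1))
      then have c: "continuous_on UNIV \<phi>" by (intro continuous_at_imp_continuous_on ballI differentiable_imp_continuous_within)
      then have m: "\<phi> \<in> borel_measurable borel" by (rule borel_measurable_continuous_onI)
      have sub: "light_cone x s \<subseteq> cbox (0, x - s) (s, x + s)" by (auto simp: light_cone_def mem_box_pair mem_cbox_pair)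
      have "compact (\<phi> ` cbox (0, x - s) (s, x + s))" by (intro compact_continuous_image continuous_on_subset[OF c]) auto
      then obtain b where bb: "\<And>p. p \<in> cbox (0, x - s) (s, x + s) \<Longrightarrow> \<bar>\<phi> p\<bar> \<le> b" using compact_imp_bounded bounded_iff by (metis imageI real_norm_def)
      have b: "\<bar>\<phi> p\<bar> \<le> \<bar>b\<bar> + 1" for p
      proof (cases "p \<in> light_cone x s")
        case True
        then show ?thesis using bb[OF subsetD[OF sub True]] by linarith
      qed (simp add: that(2))
      have "L2_st (\<lambda>p. \<phi> p / (\<bar>b\<bar> + 1))"
        by (rule L2_st_bounded_cone[of _ x s]) (use m b that(2) in \<open>auto simp: field_simps\<close>)
      from L2_st_cmult[OF this, of "\<bar>b\<bar> + 1"] show ?thesis by (simp add: add_pos_nonneg add.commute less_imp_neq[symmetric])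
    qed
    have EM: "E \<subseteq> sets M" unfolding E_def using xi_measurable[OF sL] measurable_sets by fastforce
    define N where "N = sigma (space M) E"
    have EP: "E \<subseteq> Pow (space M)" using EM sets.sets_into_space by auto
    have Ns: "sets N = G0 M \<xi> s x" unfolding N_def G0_def E_def[symmetric] by (rule sets_measure_of[OF EP])
    have sp: "space N = space M" unfolding N_def by (rule space_measure_of[OF EP])
    have "sets N \<subseteq> sets M" unfolding N_def sets_measure_of[OF EP] by (rule sets.sigma_sets_subset[OF EM])
    then have sub: "subalgebra M N" by (simp add: subalgebra_def sp)
    have nl: "null_sets M \<subseteq> sets N" unfolding N_def sets_measure_of[OF EP] by (auto simp: E_def)
    have "\<xi> \<phi> \<in> borel_measurable N" if "smooth_fun \<phi>" "\<And>p. p \<notin> light_cone x s \<Longrightarrow> \<phi> p = 0" for \<phi>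
    proof (rule measurableI)
      fix B :: "real set" assume "B \<in> sets borel"
      then have "\<xi> \<phi> -` B \<inter> space M \<in> E" unfolding E_def using that by blast
      then show "\<xi> \<phi> -` B \<inter> space N \<in> sets N" unfolding sp unfolding N_def sets_measure_of[OF EP] by (rule sigma_sets.Basic)
    qed simp
    from smooth_cone_total[OF sub nl this _ _ s]
    have m: "\<xi> \<phi> \<in> borel_measurable N" if "L2_st \<phi>" "\<And>p. p \<notin> light_cone x t \<Longrightarrow> \<phi> p = 0" for \<phi> using that by blast
    have "noise_gen (light_cone x t) \<union> null_sets M \<subseteq> sets N"
      using nl measurable_sets[OF m] unfolding noise_gen_def sp by auto
    then show ?thesis unfolding Ns[symmetric] sets_noise using sets.sigma_sets_subset[of _ N] sp by auto
  qed
  then show ?thesis unfolding G_def by auto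
qed

end

section \<open>The limit law of the increments\<close>

text \<open>\<open>stoch_integral\<close> provides convergence in probability only. On the event of
  a large deviation the two exponentials differ by at most 2, elsewhere by at most
  \<open>\<bar>l\<bar> * e\<close>.\<close>

lemma (in prob_space) char_tendsto_prob:
  assumes X: "\<And>n. X n \<in> borel_measurable M" and Z: "Z \<in> borel_measurable M"
    and p: "\<And>e. e > 0 \<Longrightarrow> (\<lambda>n. prob {\<omega> \<in> space M. \<bar>X n \<omega> - Z \<omega>\<bar> > e}) \<longlonglongrightarrow> 0"
  shows "(\<lambda>n. CLINT \<omega>|M. iexp (l * X n \<omega>)) \<longlonglongrightarrow> (CLINT \<omega>|M. iexp (l * Z \<omega>))"
proof (rule LIMSEQ_I)
  fix r :: real assume r: "0 < r"
  note [measurable] = X Z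
  define e where "e = r / (4 * (\<bar>l\<bar> + 1))"
  have e: "e > 0" using r by (simp add: e_def)
  have le: "\<bar>l\<bar> * e \<le> r / 4"
  proof -
    have "\<bar>l\<bar> * e \<le> (\<bar>l\<bar> + 1) * e" using e by (intro mult_right_mono) auto
    also have "\<dots> = r / 4" by (simp add: e_def field_simps add_pos_nonneg less_imp_neq[symmetric])
    finally show ?thesis .
  qed
  have bound: "norm ((CLINT \<omega>|M. iexp (l * X n \<omega>)) - (CLINT \<omega>|M. iexp (l * Z \<omega>))) \<le> r / 4 + 2 * prob {\<omega> \<in> space M. \<bar>X n \<omega> - Z \<omega>\<bar> > e}" for n
  proof -
    have ix: "complex_integrable M (\<lambda>\<omega>. iexp (l * X n \<omega>))" "complex_integrable M (\<lambda>\<omega>. iexp (l * Z \<omega>))"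
      by (auto intro!: integrable_iexp)
    have ii: "integrable M (\<lambda>\<omega>. r / 4 + 2 * indicator {\<omega> \<in> space M. \<bar>X n \<omega> - Z \<omega>\<bar> > e} \<omega> :: real)"
      by (intro Bochner_Integration.integrable_add integrable_const Bochner_Integration.integrable_mult_right integrable_real_indicator) (auto simp: emeasure_eq_measure)
    have "norm ((CLINT \<omega>|M. iexp (l * X n \<omega>)) - (CLINT \<omega>|M. iexp (l * Z \<omega>))) = norm (CLINT \<omega>|M. iexp (l * X n \<omega>) - iexp (l * Z \<omega>))"
      using ix by simp
    also have "\<dots> \<le> (\<integral>\<omega>. norm (iexp (l * X n \<omega>) - iexp (l * Z \<omega>)) \<partial>M)" by (rule integral_norm_bound)
    also have "\<dots> \<le> (\<integral>\<omega>. r / 4 + 2 * indicator {\<omega> \<in> space M. \<bar>X n \<omega> - Z \<omega>\<bar> > e} \<omega> \<partial>M)"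
    proof (rule integral_mono[OF _ ii])
      show "integrable M (\<lambda>\<omega>. norm (iexp (l * X n \<omega>) - iexp (l * Z \<omega>)))" by (intro integrable_norm Bochner_Integration.integrable_diff ix)
      fix \<omega> assume \<omega>: "\<omega> \<in> space M"
      show "norm (iexp (l * X n \<omega>) - iexp (l * Z \<omega>)) \<le> r / 4 + 2 * indicator {\<omega> \<in> space M. \<bar>X n \<omega> - Z \<omega>\<bar> > e} \<omega>"
      proof (cases "\<bar>X n \<omega> - Z \<omega>\<bar> > e")
        case True
        have "norm (iexp (l * X n \<omega>) - iexp (l * Z \<omega>)) \<le> norm (iexp (l * X n \<omega>)) + norm (iexp (l * Z \<omega>))" by (rule norm_triangle_ineq4)
        also have "\<dots> = 2" by simp
        finally show ?thesis using True \<omega> r by simp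
      next
        case False
        have "norm (iexp (l * X n \<omega>) - iexp (l * Z \<omega>)) \<le> \<bar>l * X n \<omega> - l * Z \<omega>\<bar>" by (rule iexp_lipschitz)
        also have "\<dots> = \<bar>l\<bar> * \<bar>X n \<omega> - Z \<omega>\<bar>" by (simp add: abs_mult[symmetric] right_diff_distrib)
        also have "\<dots> \<le> \<bar>l\<bar> * e" using False by (intro mult_left_mono) auto
        finally show ?thesis using le False by simp
      qed
    qed
    also have "\<dots> = r / 4 + 2 * prob {\<omega> \<in> space M. \<bar>X n \<omega> - Z \<omega>\<bar> > e}"
    proof -
      have "{\<omega> \<in> space M. \<bar>X n \<omega> - Z \<omega>\<bar> > e} \<in> sets M" by measurable
      then have "integrable M (indicator {\<omega> \<in> space M. \<bar>X n \<omega> - Z \<omega>\<bar> > e} :: _ \<Rightarrow> real)" by (auto simp: emeasure_eq_measure)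
      then show ?thesis by (subst Bochner_Integration.integral_add) (auto simp: prob_space)
    qed
    finally show ?thesis .
  qed
  have "eventually (\<lambda>n. prob {\<omega> \<in> space M. \<bar>X n \<omega> - Z \<omega>\<bar> > e} < r / 4) sequentially" by (rule order_tendstoD(2)[OF p[OF e]]) (use r in simp)
  then obtain N where N: "\<And>n. n \<ge> N \<Longrightarrow> prob {\<omega> \<in> space M. \<bar>X n \<omega> - Z \<omega>\<bar> > e} < r / 4" by (auto simp: eventually_sequentially)
  show "\<exists>no. \<forall>n\<ge>no. norm ((CLINT \<omega>|M. iexp (l * X n \<omega>)) - (CLINT \<omega>|M. iexp (l * Z \<omega>))) < r"
  proof (intro exI[of _ N] allI impI)
    fix n assume "N \<le> n"
    then show "norm ((CLINT \<omega>|M. iexp (l * X n \<omega>)) - (CLINT \<omega>|M. iexp (l * Z \<omega>))) < r" using bound[of n] N[of n] r by linarith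
  qed
qed

section \<open>The law of the limiting stochastic integral\<close>

context mild_wave_at
begin

definition Vb :: "real \<Rightarrow> 'a \<Rightarrow> real" where "Vb y \<omega> = \<sigma> (u (t - \<bar>x - y\<bar>) y \<omega>)"

lemma Vb_measurable:
  assumes "\<bar>x - y\<bar> \<le> t" shows "Vb y \<in> borel_measurable (noise (light_cone x t))"
  unfolding Vb_def[abs_def]
  by (rule measurable_compose[OF u_light_cone_measurable sigma_measurable]) (use assms in \<open>auto simp: light_cone_def\<close>)

text \<open>The same mechanism as for the increments. Given the noise in the cone, a left-point sum
  is Gaussian with variance a Riemann sum of the squared integrand, so both characteristic functions
  tend to the same mixture. Equality of laws is thus obtained without a coupling.\<close>

lemma stoch_integral_char:
  assumes W: "two_sided_BM M W" and ind: "indep_set (sigma_of_process M W) (G M \<xi> t x)"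
    and Z: "stoch_integral M Vb W (x - t) (x + t) Z"
  shows "char (distr M borel Z) l = complex_of_real (\<integral>\<omega>. exp (- (l\<^sup>2 / 2 * S \<omega>)) \<partial>M)"
proof -
  have Wm[measurable]: "W y \<in> borel_measurable M" for y using W by (simp add: two_sided_BM_def)
  have Zm[measurable]: "Z \<in> borel_measurable M" using Z by (simp add: stoch_integral_def)
  define p where "p n k = x - t + real k * (x + t - (x - t)) / real n" for n k
  define X where "X n k \<omega> = W (p n (Suc k)) \<omega> - W (p n k) \<omega>" for n k \<omega>
  define h where "h n = 2 * t / real n" for n
  have pS: "p n (Suc k) = p n k + h n" for n k by (simp add: p_def h_def field_simps add_divide_distrib)
  have h0: "0 < n \<Longrightarrow> 0 < h n" for n using t0 by (simp add: h_def)
  have pb: "\<bar>x - p n k\<bar> \<le> t" if "k \<le> n" "0 < n" for n k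
  proof -
    have "0 \<le> real k * (2 * t) / real n" "real k * (2 * t) / real n \<le> 2 * t" using that t0 by (auto simp: field_simps)
    then show ?thesis by (auto simp: p_def abs_le_iff)
  qed
  have Xm[measurable]: "X n k \<in> borel_measurable M" for n k unfolding X_def[abs_def] by measurable
  have rs: "riemann_sum Vb W (x - t) (x + t) n \<omega> = (\<Sum>k<n. Vb (p n k) \<omega> * X n k \<omega>)" for n \<omega>
    by (simp add: riemann_sum_def p_def X_def)
  have rsm: "riemann_sum Vb W (x - t) (x + t) n \<in> borel_measurable M" for n
  proof (cases "n = 0")
    case False
    then have "Vb (p n k) \<in> borel_measurable M" if "k < n" for k using noise_measurable_M[OF Vb_measurable[OF pb]] that by auto
    then show ?thesis unfolding rs[abs_def] by (intro borel_measurable_sum borel_measurable_times Xm) auto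
  qed (simp add: riemann_sum_def[abs_def])
  \<comment> \<open>Without conditioning, the characteristic function factorises over the
    independent increments along the grid.\<close>
  have gauss0: "(CLINT \<omega>|M. iexp (\<Sum>k<n. \<alpha> k * X n k \<omega>)) = complex_of_real (exp (- (\<Sum>k<n. (\<alpha> k)\<^sup>2 * h n) / 2))" if n: "0 < n" for n \<alpha>
  proof -
    define ys where "ys = map (p n) [0..<Suc n]"
    have ysn: "ys ! i = p n i" if "i \<le> n" for i using that unfolding ys_def by (simp del: upt_Suc)
    have pm: "p n i \<le> p n j" if "i \<le> j" for i j
      using that t0 n unfolding p_def by (intro add_left_mono divide_right_mono mult_right_mono) auto
    have "sorted ys" unfolding sorted_iff_nth_mono using pm ysn by (auto simp: ys_def less_Suc_eq_le simp del: upt_Suc)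
    then have "indep_vars (\<lambda>_. borel) (\<lambda>i \<omega>. W (ys ! Suc i) \<omega> - W (ys ! i) \<omega>) {..<length ys - 1}"
      using W unfolding two_sided_BM_def by blast
    moreover have "length ys - 1 = n" by (simp add: ys_def)
    ultimately have "indep_vars (\<lambda>_. borel) (\<lambda>i \<omega>. W (ys ! Suc i) \<omega> - W (ys ! i) \<omega>) {..<n}" by simp
    also have "?this \<longleftrightarrow> indep_vars (\<lambda>_. borel) (X n) {..<n}"
      by (rule indep_vars_cong) (auto simp: X_def ysn fun_eq_iff)
    finally have "indep_vars (\<lambda>_. borel) (X n) {..<n}" .
    then have iv: "indep_vars (\<lambda>_. borel) (\<lambda>k \<omega>. \<alpha> k * X n k \<omega>) {..<n}"
      by (rule indep_vars_compose2[where Y="\<lambda>k y. \<alpha> k * y"]) simp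
    have "(CLINT \<omega>|M. iexp (\<Sum>k<n. \<alpha> k * X n k \<omega>)) = char (distr M borel (\<lambda>\<omega>. \<Sum>k<n. \<alpha> k * X n k \<omega>)) 1"
      unfolding char_def by (subst integral_distr) auto
    also have "\<dots> = (\<Prod>k<n. char (distr M borel (\<lambda>\<omega>. \<alpha> k * X n k \<omega>)) 1)" by (rule char_distr_sum[OF iv])
    also have "\<dots> = (\<Prod>k<n. complex_of_real (exp (- ((\<alpha> k)\<^sup>2 * h n) / 2)))"
    proof (rule prod.cong[OF refl])
      fix k
      have d: "distributed M lborel (X n k) (normal_density 0 (sqrt (h n)))"
      proof -
        have "\<forall>a b. a < b \<longrightarrow> distributed M lborel (\<lambda>\<omega>. W b \<omega> - W a \<omega>) (normal_density 0 (sqrt (b - a)))"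
          using W by (simp add: two_sided_BM_def)
        from this[rule_format, of "p n k" "p n (Suc k)"] h0[OF n] show ?thesis by (simp add: pS X_def[abs_def])
      qed
      have "char (distr M borel (\<lambda>\<omega>. \<alpha> k * X n k \<omega>)) 1 = (CLINT \<omega>|M. iexp (\<alpha> k * X n k \<omega>))"
        unfolding char_def by (subst integral_distr) auto
      also have "\<dots> = complex_of_real (exp (- ((\<alpha> k)\<^sup>2 * (sqrt (h n))\<^sup>2) / 2))" by (rule normal_iexp[OF d]) (use h0[OF n] in simp)
      finally show "char (distr M borel (\<lambda>\<omega>. \<alpha> k * X n k \<omega>)) 1 = complex_of_real (exp (- ((\<alpha> k)\<^sup>2 * h n) / 2))" using h0[OF n] by simp
    qed
    also have "\<dots> = complex_of_real (exp (\<Sum>k<n. - ((\<alpha> k)\<^sup>2 * h n) / 2))" by (simp add: exp_sum)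
    also have "(\<Sum>k<n. - ((\<alpha> k)\<^sup>2 * h n) / 2) = - (\<Sum>k<n. (\<alpha> k)\<^sup>2 * h n) / 2" by (simp add: sum_negf sum_divide_distrib)
    finally show ?thesis .
  qed
  define NW where "NW = sigma (space M) {W y -` B \<inter> space M | y B. B \<in> sets borel}"
  have NWP: "{W y -` B \<inter> space M | y B. B \<in> sets borel} \<subseteq> Pow (space M)" by auto
  have NWs: "sets NW = sigma_of_process M W" unfolding NW_def sigma_of_process_def by (rule sets_measure_of[OF NWP])
  have NWsp: "space NW = space M" unfolding NW_def by (rule space_measure_of[OF NWP])
  have WN[measurable]: "W y \<in> borel_measurable NW" for y
    by (rule measurableI) (auto simp: NWs NWsp sigma_of_process_def intro!: sigma_sets.Basic)
  have XN[measurable]: "X n k \<in> borel_measurable NW" for n k unfolding X_def[abs_def] by measurable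
  \<comment> \<open>Conditioning on the cone changes nothing: \<open>A\<close> belongs to
    \<open>G\<close> by \<open>noise_subset_G\<close>, and the sum is a function of the Brownian
    motion.\<close>
  have gauss: "(CLINT \<omega>|M. indicator A \<omega> *\<^sub>R iexp (\<Sum>k<n. \<alpha> k * X n k \<omega>)) = complex_of_real (prob A * exp (- (\<Sum>k<n. (\<alpha> k)\<^sup>2 * h n) / 2))"
    if n: "0 < n" and A: "A \<in> sets (noise (light_cone x t))" for n \<alpha> A
  proof -
    let ?U = "\<lambda>\<omega>. \<Sum>k<n. \<alpha> k * X n k \<omega>"
    have AM[measurable]: "A \<in> sets M" using subsetD[OF sets_noise_sub A] .
    have UN: "?U \<in> borel_measurable NW" by measurable
    have UM[measurable]: "?U \<in> borel_measurable M" by measurable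
    have iA: "(indicator A :: _ \<Rightarrow> real) \<in> borel_measurable (noise (light_cone x t))" using A by simp
    have "indep_set {indicator A -` B \<inter> space M | B. B \<in> sets (borel :: real measure)} {?U -` B \<inter> space M | B. B \<in> sets borel}"
    proof (rule indep_setI)
      fix a b assume "a \<in> {indicator A -` B \<inter> space M | B. B \<in> sets (borel :: real measure)}" "b \<in> {?U -` B \<inter> space M | B. B \<in> sets borel}"
      then have "a \<in> G M \<xi> t x" "b \<in> sigma_of_process M W"
        using measurable_sets[OF iA] subsetD[OF noise_subset_G] measurable_sets[OF UN] by (auto simp: NWs NWsp)
      then have "prob (b \<inter> a) = prob b * prob a" using indep_setD[OF ind] by simp
      then show "prob (a \<inter> b) = prob a * prob b" by (simp add: Int_commute mult.commute)
    qed auto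
    then have "indep_set (sigma_sets (space M) {indicator A -` B \<inter> space M | B. B \<in> sets (borel :: real measure)}) (sigma_sets (space M) {?U -` B \<inter> space M | B. B \<in> sets borel})"
      by (intro indep_set_sigma_sets Int_stable_vimages)
    then have iv: "indep_var borel (indicator A :: _ \<Rightarrow> real) borel ?U" unfolding indep_var_eq by auto
    have iv2: "indep_var borel (complex_of_real \<circ> (indicator A :: _ \<Rightarrow> real)) borel (iexp \<circ> ?U)"
      by (rule indep_var_compose[OF iv]) auto
    have i1: "complex_integrable M (complex_of_real \<circ> (indicator A :: _ \<Rightarrow> real))"
      by (rule integrable_const_bound[where B=1]) (auto simp: indicator_def comp_def)
    have i2: "complex_integrable M (iexp \<circ> ?U)" unfolding comp_def by (rule integrable_iexp) auto
    have "(CLINT \<omega>|M. indicator A \<omega> *\<^sub>R iexp (?U \<omega>)) = (CLINT \<omega>|M. (complex_of_real \<circ> indicator A) \<omega> * (iexp \<circ> ?U) \<omega>)"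
      by (simp add: scaleR_conv_of_real comp_def del: of_real_sum)
    also have "\<dots> = (CLINT \<omega>|M. (complex_of_real \<circ> indicator A) \<omega>) * (CLINT \<omega>|M. (iexp \<circ> ?U) \<omega>)"
      by (rule indep_var_lebesgue_integral[OF iv2 i1 i2])
    also have "(CLINT \<omega>|M. (complex_of_real \<circ> indicator A) \<omega>) = complex_of_real (prob A)"
      using sets.sets_into_space[OF AM] by (simp add: comp_def Int_absorb2)
    also have "(CLINT \<omega>|M. (iexp \<circ> ?U) \<omega>) = complex_of_real (exp (- (\<Sum>k<n. (\<alpha> k)\<^sup>2 * h n) / 2))"
      using gauss0[OF n, of \<alpha>] by (simp only: comp_def)
    finally show ?thesis by simp
  qed
  have rc: "(CLINT \<omega>|M. iexp (l * riemann_sum Vb W (x - t) (x + t) n \<omega>)) = complex_of_real (\<integral>\<omega>. exp (- (l\<^sup>2 / 2 * (\<Sum>k<n. (Vb (p n k) \<omega>)\<^sup>2 * h n))) \<partial>M)" if n: "0 < n" for n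
  proof -
    have sp: "space M \<in> sets (noise (light_cone x t))" using sets.top[of "noise (light_cone x t)"] by simp
    have "(CLINT \<omega>|M. iexp (l * riemann_sum Vb W (x - t) (x + t) n \<omega>)) = (CLINT \<omega>|M. indicator (space M) \<omega> *\<^sub>R iexp (\<Sum>k<n. (l * Vb (p n k) \<omega>) * X n k \<omega>))"
      by (rule Bochner_Integration.integral_cong) (simp_all add: rs sum_distrib_left mult.assoc del: of_real_sum)
    also have "\<dots> = complex_of_real (\<integral>\<omega>. indicator (space M) \<omega> * exp (- (\<Sum>k<n. (l * Vb (p n k) \<omega>)\<^sup>2 * h n) / 2) \<partial>M)"
    proof (rule conditional_gaussian[OF subalgebra_noise Xm _ gauss[OF n] _ sp])
      show "(\<lambda>\<omega>. l * Vb (p n k) \<omega>) \<in> borel_measurable (noise (light_cone x t))" if "k < n" for k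
        using Vb_measurable[OF pb[of k n]] that n by simp
    qed (use h0[OF n] in auto)
    also have "(\<integral>\<omega>. indicator (space M) \<omega> * exp (- (\<Sum>k<n. (l * Vb (p n k) \<omega>)\<^sup>2 * h n) / 2) \<partial>M) = (\<integral>\<omega>. exp (- (l\<^sup>2 / 2 * (\<Sum>k<n. (Vb (p n k) \<omega>)\<^sup>2 * h n))) \<partial>M)"
    proof (rule Bochner_Integration.integral_cong[OF refl])
      fix \<omega> assume \<omega>: "\<omega> \<in> space M"
      have "(\<Sum>k<n. (l * Vb (p n k) \<omega>)\<^sup>2 * h n) = l\<^sup>2 * (\<Sum>k<n. (Vb (p n k) \<omega>)\<^sup>2 * h n)" by (simp add: sum_distrib_left power_mult_distrib mult.assoc)
      then show "indicator (space M) \<omega> * exp (- (\<Sum>k<n. (l * Vb (p n k) \<omega>)\<^sup>2 * h n) / 2) = exp (- (l\<^sup>2 / 2 * (\<Sum>k<n. (Vb (p n k) \<omega>)\<^sup>2 * h n)))" using \<omega> by simp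
    qed
    finally show ?thesis .
  qed
  have Tlim: "(\<lambda>n. \<Sum>k<n. (Vb (p n k) \<omega>)\<^sup>2 * h n) \<longlonglongrightarrow> S \<omega>" if \<omega>: "\<omega> \<in> space M" for \<omega>
  proof -
    have tt: "x - t < x + t" using t0 by simp
    have "x - t + real j * (x + t - (x - t)) / real m \<le> p m j \<and> p m j \<le> x - t + real (Suc j) * (x + t - (x - t)) / real m" if "0 < m" for m j
      using that t0 by (auto simp: p_def intro!: divide_right_mono mult_right_mono)
    from tagged_riemann_sums_limit[OF boundary_sq_continuous[OF \<omega>] tt this]
    show ?thesis by (simp add: Vb_def h_def S_def)
  qed
  have "(\<lambda>n. \<integral>\<omega>. exp (- (l\<^sup>2 / 2 * (\<Sum>k<Suc n. (Vb (p (Suc n) k) \<omega>)\<^sup>2 * h (Suc n)))) \<partial>M) \<longlonglongrightarrow> (\<integral>\<omega>. exp (- (l\<^sup>2 / 2 * S \<omega>)) \<partial>M)"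
  proof (rule integral_dominated_convergence[where w="\<lambda>_. 1"])
    note [measurable] = S_measurable
    show "(\<lambda>\<omega>. exp (- (l\<^sup>2 / 2 * S \<omega>))) \<in> borel_measurable M" by measurable
    have [measurable]: "(\<lambda>\<omega>. \<Sum>k<Suc n. (Vb (p (Suc n) k) \<omega>)\<^sup>2 * h (Suc n)) \<in> borel_measurable M" for n
      using noise_measurable_M[OF Vb_measurable[OF pb]] by (intro borel_measurable_sum borel_measurable_times borel_measurable_power borel_measurable_const) auto
    show "(\<lambda>\<omega>. exp (- (l\<^sup>2 / 2 * (\<Sum>k<Suc n. (Vb (p (Suc n) k) \<omega>)\<^sup>2 * h (Suc n))))) \<in> borel_measurable M" for n by measurable
    show "AE \<omega> in M. (\<lambda>n. exp (- (l\<^sup>2 / 2 * (\<Sum>k<Suc n. (Vb (p (Suc n) k) \<omega>)\<^sup>2 * h (Suc n))))) \<longlonglongrightarrow> exp (- (l\<^sup>2 / 2 * S \<omega>))"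
      by (rule AE_I2) (intro tendsto_intros LIMSEQ_Suc[OF Tlim])
    have "0 \<le> l\<^sup>2 / 2 * (\<Sum>k<Suc n. (Vb (p (Suc n) k) \<omega>)\<^sup>2 * h (Suc n))" for n \<omega>
      using h0[of "Suc n"] by (intro mult_nonneg_nonneg sum_nonneg) auto
    then show "AE \<omega> in M. norm (exp (- (l\<^sup>2 / 2 * (\<Sum>k<Suc n. (Vb (p (Suc n) k) \<omega>)\<^sup>2 * h (Suc n))))) \<le> 1" for n by auto
  qed simp
  then have "(\<lambda>n. CLINT \<omega>|M. iexp (l * riemann_sum Vb W (x - t) (x + t) (Suc n) \<omega>)) \<longlonglongrightarrow> complex_of_real (\<integral>\<omega>. exp (- (l\<^sup>2 / 2 * S \<omega>)) \<partial>M)"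
    unfolding rc[OF zero_less_Suc] by (rule tendsto_of_real)
  moreover have "(\<lambda>n. CLINT \<omega>|M. iexp (l * riemann_sum Vb W (x - t) (x + t) (Suc n) \<omega>)) \<longlonglongrightarrow> (CLINT \<omega>|M. iexp (l * Z \<omega>))"
    by (rule char_tendsto_prob[OF rsm Zm]) (use Z in \<open>auto simp: stoch_integral_def intro!: LIMSEQ_Suc[where f="\<lambda>n. prob {\<omega> \<in> space M. e < \<bar>riemann_sum Vb W (x - t) (x + t) n \<omega> - Z \<omega>\<bar>}" for e]\<close>)
  ultimately have "(CLINT \<omega>|M. iexp (l * Z \<omega>)) = complex_of_real (\<integral>\<omega>. exp (- (l\<^sup>2 / 2 * S \<omega>)) \<partial>M)" by (rule LIMSEQ_unique[symmetric])
  then show ?thesis unfolding char_def by (subst integral_distr) auto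
qed

lemma increments_weak_convergence:
  assumes W: "two_sided_BM M W" and ind: "indep_set (sigma_of_process M W) (G M \<xi> t x)"
    and Z: "stoch_integral M Vb W (x - t) (x + t) Z" and e: "\<And>n. 0 < e n" "e \<longlonglongrightarrow> 0"
  shows "weak_conv_m (\<lambda>n. distr M borel (\<lambda>\<omega>. (u (t + e n) x \<omega> - u t x \<omega>) / sqrt (e n))) (distr M borel Z)"
proof (rule levy_continuity)
  have [measurable]: "u (t + e n) x \<in> borel_measurable M" "u t x \<in> borel_measurable M" for n
    using t0 e(1)[of n] by (intro u_measurable; simp)+
  show "real_distribution (distr M borel (\<lambda>\<omega>. (u (t + e n) x \<omega> - u t x \<omega>) / sqrt (e n)))" for n
    by (rule real_distribution_distr) simp
  show "real_distribution (distr M borel Z)" by (rule real_distribution_distr) (use Z in \<open>simp add: stoch_integral_def\<close>)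
  show "(\<lambda>n. char (distr M borel (\<lambda>\<omega>. (u (t + e n) x \<omega> - u t x \<omega>) / sqrt (e n))) l) \<longlonglongrightarrow> char (distr M borel Z) l" for l
    unfolding stoch_integral_char[OF W ind Z] by (rule increment_char_limit[OF e])
qed

end

section \<open>The law of the iterated logarithm\<close>

context prob_space
begin

lemma first_passage:
  fixes X :: "nat \<Rightarrow> 'a \<Rightarrow> real" and l :: real
  defines "A \<equiv> \<lambda>i. {\<omega> \<in> space M. X i \<omega> > l \<and> (\<forall>j<i. X j \<omega> \<le> l)}"
  assumes X: "\<And>i. i \<le> m \<Longrightarrow> X i \<in> borel_measurable M"
  shows "prob {\<omega> \<in> space M. \<exists>i\<le>m. X i \<omega> > l} = (\<Sum>i\<le>m. prob (A i))"
    "\<And>i. i \<le> m \<Longrightarrow> A i \<in> events" "disjoint_family A"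
proof -
  show Am: "A i \<in> events" if "i \<le> m" for i
  proof -
    have "{\<omega> \<in> space M. X i \<omega> > l} \<in> events" using X[OF that] by measurable
    moreover have "{\<omega> \<in> space M. \<forall>j<i. X j \<omega> \<le> l} \<in> events"
    proof -
      have "{\<omega> \<in> space M. \<forall>j\<in>{..<i}. X j \<omega> \<le> l} \<in> events"
        by (rule sets.sets_Collect_finite_All) (use X that in \<open>auto intro: borel_measurable_le\<close>)
      then show ?thesis by (simp only: Ball_def lessThan_iff)
    qed
    ultimately have "{\<omega> \<in> space M. X i \<omega> > l} \<inter> {\<omega> \<in> space M. \<forall>j<i. X j \<omega> \<le> l} \<in> events" by (rule sets.Int)
    also have "{\<omega> \<in> space M. X i \<omega> > l} \<inter> {\<omega> \<in> space M. \<forall>j<i. X j \<omega> \<le> l} = A i" by (auto simp: A_def)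
    finally show ?thesis .
  qed
  show dj: "disjoint_family A" unfolding disjoint_family_on_def
  proof (intro ballI impI)
    fix i j :: nat assume "i \<noteq> j"
    then consider "i < j" | "j < i" by linarith
    then show "A i \<inter> A j = {}" by cases (fastforce simp: A_def)+
  qed
  have "{\<omega> \<in> space M. \<exists>i\<le>m. X i \<omega> > l} = (\<Union>i\<in>{..m}. A i)"
  proof (rule set_eqI, rule iffI)
    fix \<omega> assume "\<omega> \<in> {\<omega> \<in> space M. \<exists>i\<le>m. X i \<omega> > l}"
    then obtain i where i: "\<omega> \<in> space M" "i \<le> m" "X i \<omega> > l" by auto
    define k where "k = (LEAST i. X i \<omega> > l)"
    have "X k \<omega> > l" unfolding k_def by (rule LeastI[of "\<lambda>i. X i \<omega> > l", OF i(3)])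
    moreover have "k \<le> i" unfolding k_def by (rule Least_le[of "\<lambda>i. X i \<omega> > l", OF i(3)])
    moreover have "X j \<omega> \<le> l" if "j < k" for j using not_less_Least[of j "\<lambda>i. X i \<omega> > l"] that by (auto simp: k_def)
    ultimately show "\<omega> \<in> (\<Union>i\<in>{..m}. A i)" using i by (auto simp: A_def intro!: bexI[of _ k])
  qed (auto simp: A_def)
  then show "prob {\<omega> \<in> space M. \<exists>i\<le>m. X i \<omega> > l} = (\<Sum>i\<le>m. prob (A i))"
    using Am disjoint_family_on_mono[OF _ dj, of "{..m}"] by (simp add: finite_measure_finite_Union image_subset_iff)
qed

text \<open>The martingale property enters in the form that \<open>R_orthogonal\<close> supplies,
  orthogonality of \<open>X m - X i\<close> to the square integrable variables of
  \<open>H i\<close>. On the event of first passage at \<open>i\<close>, the square of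
  \<open>X m\<close> then has at least the mean of the square of \<open>X i\<close>, which exceeds
  \<open>l\<^sup>2\<close>.\<close>

lemma Kolmogorov_maximal:
  fixes X :: "nat \<Rightarrow> 'a \<Rightarrow> real"
  assumes X: "\<And>i. i \<le> m \<Longrightarrow> sqint M (X i)" and H: "\<And>i. i \<le> m \<Longrightarrow> subalgebra M (H i)"
    and ad: "\<And>i j. i \<le> m \<Longrightarrow> j \<le> i \<Longrightarrow> X j \<in> borel_measurable (H i)"
    and orth: "\<And>i Y. i \<le> m \<Longrightarrow> Y \<in> borel_measurable (H i) \<Longrightarrow> sqint M Y \<Longrightarrow> (\<integral>\<omega>. (X m \<omega> - X i \<omega>) * Y \<omega> \<partial>M) = 0"
    and l: "0 \<le> l"
  shows "l\<^sup>2 * prob {\<omega> \<in> space M. \<exists>i\<le>m. \<bar>X i \<omega>\<bar> > l} \<le> (\<integral>\<omega>. (X m \<omega>)\<^sup>2 \<partial>M)"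
proof -
  define A where "A i = {\<omega> \<in> space M. \<bar>X i \<omega>\<bar> > l \<and> (\<forall>j<i. \<bar>X j \<omega>\<bar> \<le> l)}" for i
  have Xm: "X i \<in> borel_measurable M" if "i \<le> m" for i using X[OF that] by (simp add: sqint_def)
  note fp = first_passage[where X="\<lambda>i \<omega>. \<bar>X i \<omega>\<bar>" and m=m and l=l, folded A_def]
  have P: "prob {\<omega> \<in> space M. \<exists>i\<le>m. \<bar>X i \<omega>\<bar> > l} = (\<Sum>i\<le>m. prob (A i))" by (rule fp(1)) (use Xm in auto)
  have Am: "A i \<in> events" if "i \<le> m" for i by (rule fp(2)) (use Xm that in auto)
  have dj: "disjoint_family A" by (rule fp(3)) (use Xm in auto)
  have AH: "A i \<in> sets (H i)" if "i \<le> m" for i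
  proof -
    have sp: "space (H i) = space M" using H[OF that] by (simp add: subalgebra_def)
    have 1: "{\<omega> \<in> space (H i). \<bar>X i \<omega>\<bar> > l} \<in> sets (H i)" using ad[OF that order_refl] by measurable
    have 2: "{\<omega> \<in> space (H i). \<forall>j\<in>{..<i}. \<bar>X j \<omega>\<bar> \<le> l} \<in> sets (H i)"
      by (rule sets.sets_Collect_finite_All) (use ad[OF that] in \<open>auto intro!: borel_measurable_le borel_measurable_abs\<close>)
    have "{\<omega> \<in> space (H i). \<bar>X i \<omega>\<bar> > l} \<inter> {\<omega> \<in> space (H i). \<forall>j\<in>{..<i}. \<bar>X j \<omega>\<bar> \<le> l} = A i"
      unfolding sp A_def by auto
    then show ?thesis using sets.Int[OF 1 2] by simp
  qed
  have trm: "l\<^sup>2 * prob (A i) \<le> (\<integral>\<omega>. indicator (A i) \<omega> * (X m \<omega>)\<^sup>2 \<partial>M)" if i: "i \<le> m" for i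
  proof -
    let ?Y = "\<lambda>\<omega>. indicator (A i) \<omega> * X i \<omega>"
    have Ys: "sqint M ?Y" by (rule sqint_indicator_mult[OF X[OF i] Am[OF i]])
    have YH: "?Y \<in> borel_measurable (H i)" using AH[OF i] ad[OF i order_refl] by measurable
    have d: "sqint M (\<lambda>\<omega>. X m \<omega> - X i \<omega>)" by (intro sqint_diff X i order_refl)
    have i1: "integrable M (\<lambda>\<omega>. (?Y \<omega>)\<^sup>2)" using Ys by (simp add: sqint_def)
    have i2: "integrable M (\<lambda>\<omega>. (X m \<omega> - X i \<omega>) * ?Y \<omega>)" by (rule sqint_mult_integrable[OF d Ys])
    have i3: "integrable M (\<lambda>\<omega>. indicator (A i) \<omega> * (X m \<omega>)\<^sup>2)"
      using X[of m] integrable_mult_indicator[OF Am[OF i], of "\<lambda>\<omega>. (X m \<omega>)\<^sup>2"] by (simp add: sqint_def)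
    have i4: "integrable M (\<lambda>\<omega>. l\<^sup>2 * indicator (A i) \<omega>)" using Am[OF i] by (auto simp: emeasure_eq_measure)
    have "l\<^sup>2 * prob (A i) = (\<integral>\<omega>. l\<^sup>2 * indicator (A i) \<omega> \<partial>M)"
      using sets.sets_into_space[OF Am[OF i]] by (simp add: Int_absorb2)
    also have "\<dots> \<le> (\<integral>\<omega>. (?Y \<omega>)\<^sup>2 \<partial>M)"
    proof (rule integral_mono[OF i4 i1])
      fix \<omega>
      have "l\<^sup>2 \<le> (X i \<omega>)\<^sup>2" if "\<omega> \<in> A i"
      proof -
        have "l \<le> \<bar>X i \<omega>\<bar>" using that by (auto simp: A_def)
        then have "l\<^sup>2 \<le> \<bar>X i \<omega>\<bar>\<^sup>2" using l by (intro power_mono)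
        then show ?thesis by simp
      qed
      then show "l\<^sup>2 * indicator (A i) \<omega> \<le> (?Y \<omega>)\<^sup>2" by (auto simp: indicator_def)
    qed
    \<comment> \<open>The inserted cross term has mean zero. With it the integrand is, on
      \<open>A i\<close>, the square of \<open>X m\<close> minus the square of
      \<open>X m - X i\<close>.\<close>
    also have "\<dots> = (\<integral>\<omega>. (?Y \<omega>)\<^sup>2 + 2 * ((X m \<omega> - X i \<omega>) * ?Y \<omega>) \<partial>M)" using i1 i2 orth[OF i YH Ys] by simp
    also have "\<dots> \<le> (\<integral>\<omega>. indicator (A i) \<omega> * (X m \<omega>)\<^sup>2 \<partial>M)"
    proof (rule integral_mono[OF _ i3])
      show "integrable M (\<lambda>\<omega>. (?Y \<omega>)\<^sup>2 + 2 * ((X m \<omega> - X i \<omega>) * ?Y \<omega>))" by (rule Bochner_Integration.integrable_add[OF i1 integrable_mult_right[OF i2]])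
      fix \<omega>
      have "(X m \<omega>)\<^sup>2 = (X i \<omega>)\<^sup>2 + 2 * ((X m \<omega> - X i \<omega>) * X i \<omega>) + (X m \<omega> - X i \<omega>)\<^sup>2" by (simp add: power2_eq_square algebra_simps)
      then show "(?Y \<omega>)\<^sup>2 + 2 * ((X m \<omega> - X i \<omega>) * ?Y \<omega>) \<le> indicator (A i) \<omega> * (X m \<omega>)\<^sup>2" by (simp add: indicator_def)
    qed
    finally show ?thesis .
  qed
  have I3: "integrable M (\<lambda>\<omega>. indicator (A i) \<omega> * (X m \<omega>)\<^sup>2)" if "i \<le> m" for i
    using X[of m] integrable_mult_indicator[OF Am[OF that], of "\<lambda>\<omega>. (X m \<omega>)\<^sup>2"] by (simp add: sqint_def)
  have "l\<^sup>2 * prob {\<omega> \<in> space M. \<exists>i\<le>m. \<bar>X i \<omega>\<bar> > l} \<le> (\<Sum>i\<le>m. \<integral>\<omega>. indicator (A i) \<omega> * (X m \<omega>)\<^sup>2 \<partial>M)"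
    unfolding P sum_distrib_left by (rule sum_mono) (use trm in auto)
  also have "\<dots> = (\<integral>\<omega>. (\<Sum>i\<le>m. indicator (A i) \<omega> * (X m \<omega>)\<^sup>2) \<partial>M)"
    using I3 by (subst Bochner_Integration.integral_sum) auto
  also have "\<dots> \<le> (\<integral>\<omega>. (X m \<omega>)\<^sup>2 \<partial>M)"
  proof (rule integral_mono)
    show "integrable M (\<lambda>\<omega>. \<Sum>i\<le>m. indicator (A i) \<omega> * (X m \<omega>)\<^sup>2)"
      using I3 by (intro Bochner_Integration.integrable_sum) auto
    show "integrable M (\<lambda>\<omega>. (X m \<omega>)\<^sup>2)" using X[of m] by (simp add: sqint_def)
    fix \<omega>
    have "(\<Sum>i\<le>m. indicator (A i) \<omega>) = (indicator (\<Union>i\<le>m. A i) \<omega> :: real)"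
      by (rule indicator_UN_disjoint[symmetric]) (use disjoint_family_on_mono[OF _ dj] in auto)
    then have "(\<Sum>i\<le>m. indicator (A i) \<omega>) \<le> (1::real)" by (simp add: indicator_def)
    then show "(\<Sum>i\<le>m. indicator (A i) \<omega> * (X m \<omega>)\<^sup>2) \<le> (X m \<omega>)\<^sup>2"
      unfolding sum_distrib_right[symmetric] by (rule mult_left_le_one_le[OF zero_le_power2 sum_nonneg, rotated]) auto
  qed
  finally show ?thesis .
qed

text \<open>Hypothesis \<open>sym\<close> says that, given \<open>H i\<close>, the rest
  \<open>X m - X i\<close> is nonnegative with probability at least one half. Then a path that has
  passed \<open>l\<close> at \<open>i\<close> ends above \<open>l\<close>; as the first passage
  events are disjoint, the factor 2 is paid only once.\<close>

lemma Levy_maximal: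
  fixes X :: "nat \<Rightarrow> 'a \<Rightarrow> real"
  assumes H: "\<And>i. i \<le> m \<Longrightarrow> subalgebra M (H i)"
    and ad: "\<And>i j. i \<le> m \<Longrightarrow> j \<le> i \<Longrightarrow> X j \<in> borel_measurable (H i)"
    and sym: "\<And>i A. i \<le> m \<Longrightarrow> A \<in> sets (H i) \<Longrightarrow> prob A \<le> 2 * prob (A \<inter> {\<omega> \<in> space M. X m \<omega> - X i \<omega> \<ge> 0})"
  shows "prob {\<omega> \<in> space M. \<exists>i\<le>m. X i \<omega> > l} \<le> 2 * prob {\<omega> \<in> space M. X m \<omega> > l}"
proof -
  define A where "A i = {\<omega> \<in> space M. X i \<omega> > l \<and> (\<forall>j<i. X j \<omega> \<le> l)}" for i
  have Xm: "X i \<in> borel_measurable M" if "i \<le> m" for i using measurable_from_subalg[OF H ad] that by blast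
  note fp = first_passage[where X=X and m=m and l=l, folded A_def]
  have P: "prob {\<omega> \<in> space M. \<exists>i\<le>m. X i \<omega> > l} = (\<Sum>i\<le>m. prob (A i))" by (rule fp(1)) (use Xm in auto)
  have Am: "A i \<in> events" if "i \<le> m" for i by (rule fp(2)) (use Xm that in auto)
  have dj: "disjoint_family A" by (rule fp(3)) (use Xm in auto)
  have AH: "A i \<in> sets (H i)" if "i \<le> m" for i
  proof -
    have sp: "space (H i) = space M" using H[OF that] by (simp add: subalgebra_def)
    have 1: "{\<omega> \<in> space (H i). X i \<omega> > l} \<in> sets (H i)" using ad[OF that order_refl] by measurable
    have 2: "{\<omega> \<in> space (H i). \<forall>j\<in>{..<i}. X j \<omega> \<le> l} \<in> sets (H i)"
      by (rule sets.sets_Collect_finite_All) (use ad[OF that] in \<open>auto intro!: borel_measurable_le\<close>)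
    have "{\<omega> \<in> space (H i). X i \<omega> > l} \<inter> {\<omega> \<in> space (H i). \<forall>j\<in>{..<i}. X j \<omega> \<le> l} = A i"
      unfolding sp A_def by auto
    then show ?thesis using sets.Int[OF 1 2] by simp
  qed
  let ?D = "\<lambda>i. {\<omega> \<in> space M. X m \<omega> - X i \<omega> \<ge> 0}"
  have Dm: "?D i \<in> events" if "i \<le> m" for i using Xm[OF that] Xm[OF order_refl] by measurable
  have Em: "{\<omega> \<in> space M. X m \<omega> > l} \<in> events" using Xm[OF order_refl] by measurable
  have "(\<Sum>i\<le>m. prob (A i)) \<le> (\<Sum>i\<le>m. 2 * prob (A i \<inter> ?D i))" by (rule sum_mono) (use sym AH in auto)
  also have "\<dots> = 2 * (\<Sum>i\<le>m. prob (A i \<inter> ?D i))" by (simp add: sum_distrib_left)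
  also have "(\<Sum>i\<le>m. prob (A i \<inter> ?D i)) = prob (\<Union>i\<in>{..m}. A i \<inter> ?D i)"
  proof (rule finite_measure_finite_Union[symmetric])
    show "disjoint_family_on (\<lambda>i. A i \<inter> ?D i) {..m}" using dj by (auto simp: disjoint_family_on_def)
    show "(\<lambda>i. A i \<inter> ?D i) ` {..m} \<subseteq> events" using Am Dm by auto
  qed simp
  also have "\<dots> \<le> prob {\<omega> \<in> space M. X m \<omega> > l}" by (rule finite_measure_mono[OF _ Em]) (auto simp: A_def)
  finally show ?thesis unfolding P by simp
qed

lemma char_indep_event:
  assumes [measurable]: "X \<in> borel_measurable M" "A \<in> events" "B \<in> sets borel"
    and eq: "\<And>l. (CLINT \<omega>|M. indicator A \<omega> *\<^sub>R iexp (l * X \<omega>)) = complex_of_real (prob A) * (CLINT \<omega>|M. iexp (l * X \<omega>))"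
  shows "prob (A \<inter> (X -` B \<inter> space M)) = prob A * prob (X -` B \<inter> space M)"
proof -
  have "(\<integral>\<omega>. (indicator A \<omega> - prob A) * indicator B (X \<omega>) \<partial>M) = 0"
  proof (rule weighted_cos_sin_zero[where c=1])
    show "\<bar>indicator A \<omega> - prob A\<bar> \<le> 1" for \<omega> by (auto simp: indicator_def)
    fix l :: real
    have i1: "complex_integrable M (\<lambda>\<omega>. iexp (l * X \<omega>))" by (rule integrable_iexp) auto
    have i0: "complex_integrable M (\<lambda>\<omega>. indicator A \<omega> *\<^sub>R iexp (l * X \<omega>))" by (rule integrable_mult_indicator[OF _ i1]) simp
    have i2: "complex_integrable M (\<lambda>\<omega>. (indicator A \<omega> - prob A) *\<^sub>R iexp (l * X \<omega>))"
      unfolding scaleR_diff_left by (intro Bochner_Integration.integrable_diff i0 integrable_scaleR_right i1)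
    have z: "(CLINT \<omega>|M. (indicator A \<omega> - prob A) *\<^sub>R iexp (l * X \<omega>)) = 0"
      unfolding scaleR_diff_left using i0 i1 eq[of l] by (subst Bochner_Integration.integral_diff) (auto simp: scaleR_conv_of_real)
    have "(\<integral>\<omega>. Re ((indicator A \<omega> - prob A) *\<^sub>R iexp (l * X \<omega>)) \<partial>M) = 0" "(\<integral>\<omega>. Im ((indicator A \<omega> - prob A) *\<^sub>R iexp (l * X \<omega>)) \<partial>M) = 0"
      using z by (simp_all only: integral_Re[OF i2] integral_Im[OF i2], simp_all)
    then show "(\<integral>\<omega>. (indicator A \<omega> - prob A) * cos (l * X \<omega>) \<partial>M) = 0" "(\<integral>\<omega>. (indicator A \<omega> - prob A) * sin (l * X \<omega>) \<partial>M) = 0"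
      by (simp_all add: Re_exp Im_exp)
  qed measurable
  moreover have "(\<integral>\<omega>. (indicator A \<omega> - prob A) * indicator B (X \<omega>) \<partial>M) =
    (\<integral>\<omega>. indicator (A \<inter> (X -` B \<inter> space M)) \<omega> - prob A * indicator (X -` B \<inter> space M) \<omega> \<partial>M)"
    by (rule Bochner_Integration.integral_cong) (auto simp: indicator_def)
  moreover have "\<dots> = prob (A \<inter> (X -` B \<inter> space M)) - prob A * prob (X -` B \<inter> space M)"
    by (subst Bochner_Integration.integral_diff) (auto simp: Int_assoc emeasure_eq_measure)
  ultimately show ?thesis by simp
qed

text \<open>The characteristic function is even, so \<open>X\<close> and \<open>- X\<close> have the
  same law, and the two half lines cover the space.\<close>

lemma char_symmetric:
  assumes [measurable]: "X \<in> borel_measurable M" and c: "\<And>l. (CLINT \<omega>|M. iexp (l * X \<omega>)) = complex_of_real (exp (- (l\<^sup>2 * v) / 2))"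
  shows "1 / 2 \<le> prob {\<omega> \<in> space M. X \<omega> \<ge> 0}"
proof -
  have "char (distr M borel X) = char (distr M borel (\<lambda>\<omega>. - X \<omega>))"
  proof
    fix l
    have "char (distr M borel X) l = (CLINT \<omega>|M. iexp (l * X \<omega>))" unfolding char_def by (subst integral_distr) auto
    also have "\<dots> = (CLINT \<omega>|M. iexp ((- l) * X \<omega>))" unfolding c by simp
    also have "\<dots> = char (distr M borel (\<lambda>\<omega>. - X \<omega>)) l" unfolding char_def by (subst integral_distr) auto
    finally show "char (distr M borel X) l = char (distr M borel (\<lambda>\<omega>. - X \<omega>)) l" .
  qed
  then have e: "distr M borel X = distr M borel (\<lambda>\<omega>. - X \<omega>)" by (intro Levy_uniqueness real_distribution_distr) auto
  have "prob {\<omega> \<in> space M. X \<omega> \<ge> 0} = measure (distr M borel X) {0..}" by (subst measure_distr) (auto intro!: arg_cong[where f=prob])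
  also have "\<dots> = prob {\<omega> \<in> space M. X \<omega> \<le> 0}" unfolding e by (subst measure_distr) (auto intro!: arg_cong[where f=prob])
  finally have 1: "prob {\<omega> \<in> space M. X \<omega> \<ge> 0} = prob {\<omega> \<in> space M. X \<omega> \<le> 0}" .
  have "1 = prob ({\<omega> \<in> space M. X \<omega> \<ge> 0} \<union> {\<omega> \<in> space M. X \<omega> \<le> 0})" using prob_space by (auto intro!: arg_cong[where f=prob] simp: prob_space[symmetric] simp del: prob_space)
  also have "\<dots> \<le> prob {\<omega> \<in> space M. X \<omega> \<ge> 0} + prob {\<omega> \<in> space M. X \<omega> \<le> 0}" by (rule measure_Un_le) auto
  finally show ?thesis using 1 by simp
qed

text \<open>For \<open>z > l \<ge> 0\<close> one has
  \<open>z\<^sup>2 \<ge> l\<^sup>2 + (z - l)\<^sup>2\<close>, which bounds the density by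
  \<open>exp (- l\<^sup>2 / 2)\<close> times a normal density centred at \<open>l\<close>. The lower
  bound keeps only the interval from \<open>l\<close> to \<open>l + 1\<close>, on which the density
  is at least its value at the right end.\<close>

lemma gaussian_tails:
  assumes [measurable]: "X \<in> borel_measurable M" and v: "v > 0" and c: "\<And>l. (CLINT \<omega>|M. iexp (l * X \<omega>)) = complex_of_real (exp (- (l\<^sup>2 * v) / 2))"
    and l: "0 \<le> l"
  shows "prob {\<omega> \<in> space M. X \<omega> > l * sqrt v} \<le> exp (- l\<^sup>2 / 2)"
    "exp (- (l + 1)\<^sup>2 / 2) / sqrt (2 * pi) \<le> prob {\<omega> \<in> space M. X \<omega> > l * sqrt v}"
proof -
  let ?Y = "\<lambda>\<omega>. X \<omega> / sqrt v"
  interpret N: real_distribution std_normal_distribution by (rule real_dist_normal_dist)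
  have "char (distr M borel ?Y) s = char std_normal_distribution s" for s
  proof -
    have "char (distr M borel ?Y) s = (CLINT \<omega>|M. iexp ((s / sqrt v) * X \<omega>))" unfolding char_def by (subst integral_distr) auto
    then show ?thesis unfolding c char_std_normal_distribution using v by (simp add: power_divide)
  qed
  then have e: "distr M borel ?Y = std_normal_distribution" by (intro Levy_uniqueness real_distribution_distr real_dist_normal_dist ext) auto
  have "prob {\<omega> \<in> space M. X \<omega> > l * sqrt v} = measure (distr M borel ?Y) {l<..}"
    using v by (subst measure_distr) (auto intro!: arg_cong[where f=prob] simp: field_simps)
  then have p: "ennreal (prob {\<omega> \<in> space M. X \<omega> > l * sqrt v}) = emeasure std_normal_distribution {l<..}"
    unfolding e by (simp add: N.emeasure_eq_measure)
  have d: "emeasure std_normal_distribution {l<..} = (\<integral>\<^sup>+z. ennreal (std_normal_density z) * indicator {l<..} z \<partial>lborel)"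
    by (rule emeasure_density) auto
  have "\<dots> \<le> (\<integral>\<^sup>+z. ennreal (exp (- l\<^sup>2 / 2)) * ennreal (normal_density l 1 z) \<partial>lborel)"
  proof (rule nn_integral_mono)
    fix z
    show "ennreal (std_normal_density z) * indicator {l<..} z \<le> ennreal (exp (- l\<^sup>2 / 2)) * ennreal (normal_density l 1 z)"
    proof (cases "z > l")
      case True
      have "l * l \<le> l * z" using True l by (intro mult_left_mono) auto
      then have "- z\<^sup>2 / 2 \<le> - l\<^sup>2 / 2 + - (z - l)\<^sup>2 / 2" by (simp add: power2_eq_square algebra_simps)
      then have "exp (- z\<^sup>2 / 2) \<le> exp (- l\<^sup>2 / 2) * exp (- (z - l)\<^sup>2 / 2)" unfolding exp_add[symmetric] by simp
      then have "(1 / sqrt (2 * pi)) * exp (- z\<^sup>2 / 2) \<le> (1 / sqrt (2 * pi)) * (exp (- l\<^sup>2 / 2) * exp (- (z - l)\<^sup>2 / 2))" by (intro mult_left_mono) auto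
      then have "std_normal_density z \<le> exp (- l\<^sup>2 / 2) * normal_density l 1 z"
        by (simp add: std_normal_density_def normal_density_def)
      then show ?thesis using True by (simp add: ennreal_mult'[symmetric] ennreal_leI)
    qed simp
  qed
  also have "\<dots> = ennreal (exp (- l\<^sup>2 / 2)) * (\<integral>\<^sup>+z. ennreal (normal_density l 1 z) \<partial>lborel)" by (rule nn_integral_cmult) simp
  also have "(\<integral>\<^sup>+z. ennreal (normal_density l 1 z) \<partial>lborel) = 1"
    by (subst nn_integral_eq_integral) auto
  finally have "ennreal (prob {\<omega> \<in> space M. X \<omega> > l * sqrt v}) \<le> ennreal (exp (- l\<^sup>2 / 2))" unfolding p d by simp
  then show "prob {\<omega> \<in> space M. X \<omega> > l * sqrt v} \<le> exp (- l\<^sup>2 / 2)" by simp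
  have "ennreal (exp (- (l + 1)\<^sup>2 / 2) / sqrt (2 * pi)) = (\<integral>\<^sup>+z. ennreal (exp (- (l + 1)\<^sup>2 / 2) / sqrt (2 * pi)) * indicator {l<..l + 1} z \<partial>lborel)"
    by (subst nn_integral_cmult_indicator) auto
  also have "\<dots> \<le> (\<integral>\<^sup>+z. ennreal (std_normal_density z) * indicator {l<..} z \<partial>lborel)"
  proof (rule nn_integral_mono)
    fix z
    show "ennreal (exp (- (l + 1)\<^sup>2 / 2) / sqrt (2 * pi)) * indicator {l<..l + 1} z \<le> ennreal (std_normal_density z) * indicator {l<..} z"
    proof (cases "l < z \<and> z \<le> l + 1")
      case True
      have "z\<^sup>2 \<le> (l + 1)\<^sup>2" using True l by (intro power_mono) auto
      then have "exp (- (l + 1)\<^sup>2 / 2) / sqrt (2 * pi) \<le> std_normal_density z" by (simp add: std_normal_density_def divide_right_mono)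
      then show ?thesis using True by (simp add: ennreal_leI)
    qed (auto simp: indicator_def)
  qed
  finally have "ennreal (exp (- (l + 1)\<^sup>2 / 2) / sqrt (2 * pi)) \<le> ennreal (prob {\<omega> \<in> space M. X \<omega> > l * sqrt v})" unfolding p d .
  then show "exp (- (l + 1)\<^sup>2 / 2) / sqrt (2 * pi) \<le> prob {\<omega> \<in> space M. X \<omega> > l * sqrt v}" by simp
qed

end

section \<open>Frozen sums with normalised coefficients\<close>

context mild_wave_at
begin

text \<open>The frozen coefficients, normalised so that the corresponding noise sums are Brownian in
  \<open>r\<close> and independent of the noise in the cone of height \<open>t\<close>.\<close>

definition a :: "nat \<Rightarrow> nat \<Rightarrow> 'a \<Rightarrow> real" where
  "a n j \<omega> = (if Sn n \<omega> > 0 then V n j \<omega> / sqrt (Sn n \<omega>) else 1 / sqrt (2 * t))"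

definition Bn :: "nat \<Rightarrow> real \<Rightarrow> real \<Rightarrow> 'a \<Rightarrow> real" where
  "Bn n r r' \<omega> = (\<Sum>j<2 * n. a n j \<omega> * Xi n j r r' \<omega>)"

text \<open>The default \<open>1 / sqrt (2 * t)\<close> in \<open>a\<close> is the constant for
  which the \<open>2 * n\<close> summands still add up to 1 when \<open>Sn\<close> vanishes.\<close>

lemma a_normalised: "0 < n \<Longrightarrow> (\<Sum>j<2 * n. (a n j \<omega>)\<^sup>2 * (t / real n)) = 1"
proof (cases "Sn n \<omega> > 0")
  case True
  have "(\<Sum>j<2 * n. (a n j \<omega>)\<^sup>2 * (t / real n)) = (\<Sum>j<2 * n. (V n j \<omega>)\<^sup>2 * (t / real n)) / Sn n \<omega>"
    unfolding sum_divide_distrib using True by (intro sum.cong) (auto simp: a_def power_divide)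
  then show ?thesis using True by (simp add: Sn_def)
next
  case False
  assume "0 < n"
  then show ?thesis using False t0 by (simp add: a_def power_divide field_simps)
qed

lemma sint_Bn: "0 < n \<Longrightarrow> sint (vl n r r') \<omega> = sqrt (Sn n \<omega>) * Bn n r r' \<omega>"
proof (cases "Sn n \<omega> > 0")
  case True
  then show ?thesis unfolding sint_vl Bn_def sum_distrib_left by (intro sum.cong) (auto simp: a_def)
next
  \<comment> \<open>If \<open>Sn\<close> vanishes then so does every frozen coefficient, and both
    sides are 0 whatever the default value in \<open>a\<close>.\<close>
  case False
  assume n: "0 < n"
  have "Sn n \<omega> = 0" using False Sn_nonneg[of n \<omega>] by simp
  then have "\<forall>j\<in>{..<2 * n}. (V n j \<omega>)\<^sup>2 * (t / real n) = 0"
    unfolding Sn_def using t0 by (subst (asm) sum_nonneg_eq_0_iff) auto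
  then have "V n j \<omega> = 0" if "j < 2 * n" for j using that n t0 by auto
  then show ?thesis using \<open>Sn n \<omega> = 0\<close> by (simp add: sint_vl)
qed

lemma a_measurable:
  assumes "0 < n" "j < 2 * n" shows "a n j \<in> borel_measurable (noise (light_cone x t))"
proof -
  note [measurable] = V_measurable(3)[OF assms] Sn_measurable[OF assms(1)]
  show ?thesis unfolding a_def[abs_def] by measurable
qed

lemma Bn_measurable:
  assumes "0 < n" "0 \<le> r" "r \<le> r'"
  shows "Bn n r r' \<in> borel_measurable (noise (light_cone x (t + r')))" "Bn n r r' \<in> borel_measurable M"
proof -
  have c: "light_cone x t \<subseteq> light_cone x (t + r')" using assms by (intro light_cone_mono') auto
  show "Bn n r r' \<in> borel_measurable (noise (light_cone x (t + r')))" unfolding Bn_def[abs_def]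
    by (intro borel_measurable_sum borel_measurable_times noise_measurable_mono[OF a_measurable c] Xi_measurable(1)) (use assms in auto)
  then show "Bn n r r' \<in> borel_measurable M" by (rule noise_measurable_M)
qed

lemma Bn_add:
  assumes "0 < n" "0 \<le> r" "r \<le> r'" "r' \<le> r''"
  shows "AE \<omega> in M. Bn n r r'' \<omega> = Bn n r r' \<omega> + Bn n r' r'' \<omega>"
  using Xi_add_all[OF assms] by eventually_elim (simp add: Bn_def sum.distrib[symmetric] distrib_left)

text \<open>Although the coefficients are random, their normalisation makes the conditional variance
  the constant \<open>r' - r\<close>. A conditional law that does not depend on the condition
  amounts to independence from the cone of height \<open>t + r\<close>.\<close>

lemma Bn_char:
  assumes n: "0 < n" and r: "0 \<le> r" "r \<le> r'" and A: "A \<in> sets (noise (light_cone x (t + r)))"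
  shows "(CLINT \<omega>|M. indicator A \<omega> *\<^sub>R iexp (l * Bn n r r' \<omega>)) = complex_of_real (prob A * exp (- (l\<^sup>2 * (r' - r)) / 2))"
proof -
  have AM: "A \<in> sets M" using subsetD[OF sets_noise_sub A] .
  have c: "light_cone x t \<subseteq> light_cone x (t + r)" using r by (intro light_cone_mono') auto
  have am: "(\<lambda>\<omega>. l * a n j \<omega>) \<in> borel_measurable (noise (light_cone x (t + r)))" if "j < 2 * n" for j
    using noise_measurable_mono[OF a_measurable[OF n that] c] by simp
  have e: "(\<Sum>j<2 * n. (l * a n j \<omega>)\<^sup>2 * (t / real n * (r' - r))) = l\<^sup>2 * (r' - r)" for \<omega>
  proof -
    have "(\<Sum>j<2 * n. (l * a n j \<omega>)\<^sup>2 * (t / real n * (r' - r))) = (l\<^sup>2 * (r' - r)) * (\<Sum>j<2 * n. (a n j \<omega>)\<^sup>2 * (t / real n))"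
      unfolding sum_distrib_left by (intro sum.cong) (auto simp: power_mult_distrib)
    then show ?thesis by (simp only: a_normalised[OF n] mult_1_right)
  qed
  have "(CLINT \<omega>|M. indicator A \<omega> *\<^sub>R iexp (l * Bn n r r' \<omega>)) = (CLINT \<omega>|M. indicator A \<omega> *\<^sub>R iexp (\<Sum>j<2 * n. (l * a n j \<omega>) * Xi n j r r' \<omega>))"
    by (simp add: Bn_def sum_distrib_left mult.assoc del: of_real_sum)
  also have "\<dots> = complex_of_real (\<integral>\<omega>. indicator A \<omega> * exp (- (\<Sum>j<2 * n. (l * a n j \<omega>)\<^sup>2 * (t / real n * (r' - r))) / 2) \<partial>M)"
    by (rule frozen_char[OF n r am A])
  also have "\<dots> = complex_of_real (prob A * exp (- (l\<^sup>2 * (r' - r)) / 2))"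
    unfolding e using sets.sets_into_space[OF AM] by (simp add: Int_absorb2)
  finally show ?thesis .
qed

lemma Bn_char0:
  assumes "0 < n" "0 \<le> r" "r \<le> r'"
  shows "(CLINT \<omega>|M. iexp (l * Bn n r r' \<omega>)) = complex_of_real (exp (- (l\<^sup>2 * (r' - r)) / 2))"
proof -
  have "space M \<in> sets (noise (light_cone x (t + r)))" using sets.top[of "noise (light_cone x (t + r))"] by simp
  from Bn_char[OF assms this, of l] have "(CLINT \<omega>|M. indicator (space M) \<omega> *\<^sub>R iexp (l * Bn n r r' \<omega>)) = complex_of_real (exp (- (l\<^sup>2 * (r' - r)) / 2))"
    by (simp add: prob_space)
  moreover have "(CLINT \<omega>|M. indicator (space M) \<omega> *\<^sub>R iexp (l * Bn n r r' \<omega>)) = (CLINT \<omega>|M. iexp (l * Bn n r r' \<omega>))"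
    by (rule Bochner_Integration.integral_cong) auto
  ultimately show ?thesis by simp
qed

lemma Bn_indep:
  assumes "0 < n" "0 \<le> r" "r \<le> r'" and A: "A \<in> sets (noise (light_cone x (t + r)))" and B: "B \<in> sets borel"
  shows "prob (A \<inter> (Bn n r r' -` B \<inter> space M)) = prob A * prob (Bn n r r' -` B \<inter> space M)"
  by (rule char_indep_event[OF Bn_measurable(2)[OF assms(1-3)] subsetD[OF sets_noise_sub A] B])
    (unfold Bn_char[OF assms(1-3) A] Bn_char0[OF assms(1-3)], rule of_real_mult)

lemma Bn_half:
  assumes n: "0 < n" "0 \<le> r" "r \<le> r'" and A: "A \<in> sets (noise (light_cone x (t + r)))"
  shows "prob A \<le> 2 * prob (A \<inter> {\<omega> \<in> space M. 0 \<le> Bn n r r' \<omega>})" "prob A \<le> 2 * prob (A \<inter> {\<omega> \<in> space M. 0 \<le> - Bn n r r' \<omega>})"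
proof -
  note [measurable] = Bn_measurable(2)[OF n]
  have c: "(CLINT \<omega>|M. iexp (l * Bn n r r' \<omega>)) = complex_of_real (exp (- (l\<^sup>2 * (r' - r)) / 2))"
     "(CLINT \<omega>|M. iexp (l * - Bn n r r' \<omega>)) = complex_of_real (exp (- (l\<^sup>2 * (r' - r)) / 2))" for l
    using Bn_char0[OF n, of l] Bn_char0[OF n, of "-l"] by simp_all
  have 1: "1 / 2 \<le> prob {\<omega> \<in> space M. Bn n r r' \<omega> \<ge> 0}" by (rule char_symmetric[OF _ c(1)]) measurable
  have 2: "1 / 2 \<le> prob {\<omega> \<in> space M. - Bn n r r' \<omega> \<ge> 0}" by (rule char_symmetric[OF _ c(2)]) measurable
  have e: "{\<omega> \<in> space M. 0 \<le> Bn n r r' \<omega>} = Bn n r r' -` {0..} \<inter> space M" "{\<omega> \<in> space M. 0 \<le> - Bn n r r' \<omega>} = Bn n r r' -` {..0} \<inter> space M" by auto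
  show "prob A \<le> 2 * prob (A \<inter> {\<omega> \<in> space M. 0 \<le> Bn n r r' \<omega>})"
    using 1 mult_left_mono[OF 1, of "prob A"] unfolding e by (subst Bn_indep[OF n A]) auto
  show "prob A \<le> 2 * prob (A \<inter> {\<omega> \<in> space M. 0 \<le> - Bn n r r' \<omega>})"
    using 2 mult_left_mono[OF 2, of "prob A"] unfolding e by (subst Bn_indep[OF n A]) auto
qed

text \<open>Levy's inequality for \<open>Bn\<close> and for \<open>- Bn\<close>; the 4 is 2 from the
  inequality times 2 from the signs.\<close>

lemma Bn_maximal:
  fixes r :: "nat \<Rightarrow> real"
  assumes n: "0 < n" and r: "\<And>i j. i \<le> j \<Longrightarrow> r i \<le> r j" "0 \<le> r 0" "r m > 0" and l: "0 \<le> l"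
  shows "prob {\<omega> \<in> space M. \<exists>i\<le>m. \<bar>Bn n 0 (r i) \<omega>\<bar> > l * sqrt (r m)} \<le> 4 * exp (- l\<^sup>2 / 2)"
proof -
  have r0: "0 \<le> r i" for i using r(1)[of 0 i] r(2) by auto
  have Bm[measurable]: "Bn n 0 (r i) \<in> borel_measurable M" for i by (rule Bn_measurable(2)[OF n order_refl r0])
  have Bm'[measurable]: "i \<le> j \<Longrightarrow> Bn n (r i) (r j) \<in> borel_measurable M" for i j by (rule Bn_measurable(2)[OF n r0 r(1)])
  have ad: "Bn n 0 (r j) \<in> borel_measurable (noise (light_cone x (t + r i)))" if "j \<le> i" for i j
    by (rule noise_measurable_mono[OF Bn_measurable(1)[OF n order_refl r0] light_cone_mono']) (use r(1)[OF that] in simp)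
  \<comment> \<open>Additivity of \<open>Bn\<close> in its interval holds only almost surely, so
    events are compared up to null sets.\<close>
  have ev: "prob A = prob B" if "AE \<omega> in M. \<omega> \<in> A \<longleftrightarrow> \<omega> \<in> B" "A \<in> events" "B \<in> events" for A B
    by (rule finite_measure_eq_AE[OF that])
  have half: "prob A \<le> 2 * prob (A \<inter> {\<omega> \<in> space M. Bn n 0 (r m) \<omega> - Bn n 0 (r i) \<omega> \<ge> 0}) \<and>
      prob A \<le> 2 * prob (A \<inter> {\<omega> \<in> space M. - Bn n 0 (r m) \<omega> - - Bn n 0 (r i) \<omega> \<ge> 0})"
    if i: "i \<le> m" and A: "A \<in> sets (noise (light_cone x (t + r i)))" for i A
  proof -
    note [measurable] = Bm'[OF i]
    have AM[measurable]: "A \<in> events" using subsetD[OF sets_noise_sub A] .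
    have ae: "AE \<omega> in M. Bn n 0 (r m) \<omega> = Bn n 0 (r i) \<omega> + Bn n (r i) (r m) \<omega>" by (rule Bn_add[OF n order_refl r0 r(1)[OF i]])
    have "prob (A \<inter> {\<omega> \<in> space M. Bn n 0 (r m) \<omega> - Bn n 0 (r i) \<omega> \<ge> 0}) = prob (A \<inter> {\<omega> \<in> space M. 0 \<le> Bn n (r i) (r m) \<omega>})"
      by (rule ev) (use ae in \<open>auto elim!: eventually_mono\<close>)
    moreover have "prob (A \<inter> {\<omega> \<in> space M. - Bn n 0 (r m) \<omega> - - Bn n 0 (r i) \<omega> \<ge> 0}) = prob (A \<inter> {\<omega> \<in> space M. 0 \<le> - Bn n (r i) (r m) \<omega>})"
      by (rule ev) (use ae in \<open>auto elim!: eventually_mono\<close>)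
    ultimately show ?thesis using Bn_half[OF n r0 r(1)[OF i] A] by simp
  qed
  have c: "(CLINT \<omega>|M. iexp (s * Bn n 0 (r m) \<omega>)) = complex_of_real (exp (- (s\<^sup>2 * r m) / 2))"
     "(CLINT \<omega>|M. iexp (s * - Bn n 0 (r m) \<omega>)) = complex_of_real (exp (- (s\<^sup>2 * r m) / 2))" for s
    using Bn_char0[OF n order_refl r0, of s m] Bn_char0[OF n order_refl r0, of "-s" m] by simp_all
  have "prob {\<omega> \<in> space M. \<exists>i\<le>m. Bn n 0 (r i) \<omega> > l * sqrt (r m)} \<le> 2 * prob {\<omega> \<in> space M. Bn n 0 (r m) \<omega> > l * sqrt (r m)}"
    by (rule Levy_maximal[where H="\<lambda>i. noise (light_cone x (t + r i))"]) (use subalgebra_noise ad half in auto)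
  also have "\<dots> \<le> 2 * exp (- l\<^sup>2 / 2)" using gaussian_tails(1)[OF Bm r(3) c(1) l] by simp
  finally have p1: "prob {\<omega> \<in> space M. \<exists>i\<le>m. Bn n 0 (r i) \<omega> > l * sqrt (r m)} \<le> 2 * exp (- l\<^sup>2 / 2)" .
  have "prob {\<omega> \<in> space M. \<exists>i\<le>m. - Bn n 0 (r i) \<omega> > l * sqrt (r m)} \<le> 2 * prob {\<omega> \<in> space M. - Bn n 0 (r m) \<omega> > l * sqrt (r m)}"
    by (rule Levy_maximal[where H="\<lambda>i. noise (light_cone x (t + r i))" and X="\<lambda>i \<omega>. - Bn n 0 (r i) \<omega>"]) (use subalgebra_noise ad half in auto)
  also have "\<dots> \<le> 2 * exp (- l\<^sup>2 / 2)" using gaussian_tails(1)[OF _ r(3) c(2) l] by simp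
  finally have p2: "prob {\<omega> \<in> space M. \<exists>i\<le>m. - Bn n 0 (r i) \<omega> > l * sqrt (r m)} \<le> 2 * exp (- l\<^sup>2 / 2)" .
  have "prob {\<omega> \<in> space M. \<exists>i\<le>m. \<bar>Bn n 0 (r i) \<omega>\<bar> > l * sqrt (r m)} \<le>
    prob ({\<omega> \<in> space M. \<exists>i\<le>m. Bn n 0 (r i) \<omega> > l * sqrt (r m)} \<union> {\<omega> \<in> space M. \<exists>i\<le>m. - Bn n 0 (r i) \<omega> > l * sqrt (r m)})"
    by (rule finite_measure_mono) (auto simp: abs_real_def split: if_splits)
  also have "\<dots> \<le> prob {\<omega> \<in> space M. \<exists>i\<le>m. Bn n 0 (r i) \<omega> > l * sqrt (r m)} + prob {\<omega> \<in> space M. \<exists>i\<le>m. - Bn n 0 (r i) \<omega> > l * sqrt (r m)}"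
    by (rule measure_Un_le) measurable
  finally show ?thesis using p1 p2 by simp
qed

lemma R_maximal:
  fixes r :: "nat \<Rightarrow> real"
  assumes n: "0 < n" and r: "\<And>i j. i \<le> j \<Longrightarrow> r i \<le> r j" "0 \<le> r 0" and l: "0 \<le> l"
  shows "l\<^sup>2 * prob {\<omega> \<in> space M. \<exists>i\<le>m. \<bar>R n (r i) \<omega>\<bar> > l} \<le> (\<integral>\<omega>. (R n (r m) \<omega>)\<^sup>2 \<partial>M)"
proof -
  have r0: "0 \<le> r i" for i using r(1)[of 0 i] r(2) by auto
  show ?thesis
  proof (rule Kolmogorov_maximal[where H="\<lambda>i. noise (light_cone x (t + r i))"])
    show "sqint M (R n (r i))" for i by (rule R_measurable(2)[OF n r0])
    show "subalgebra M (noise (light_cone x (t + r i)))" for i by (rule subalgebra_noise)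
    show "R n (r j) \<in> borel_measurable (noise (light_cone x (t + r i)))" if "j \<le> i" for i j
      by (rule noise_measurable_mono[OF R_measurable(1)[OF n r0] light_cone_mono']) (use r(1)[OF that] in simp)
    show "(\<integral>\<omega>. (R n (r m) \<omega> - R n (r i) \<omega>) * Y \<omega> \<partial>M) = 0" if "i \<le> m" "Y \<in> borel_measurable (noise (light_cone x (t + r i)))" "sqint M Y" for i Y
      by (rule R_orthogonal[OF n r0 r(1)[OF that(1)] that(2,3)])
  qed (fact l)
qed

end

text \<open>Applied to the increment of \<open>u\<close> only. Frozen sums and remainders are
  indexed by uncountably many times without known continuity; they are estimated at dyadic points,
  and the bound on their sum extends by continuity of \<open>u\<close>.\<close>

lemma dyadic_closure:
  fixes f :: "real \<Rightarrow> real"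
  assumes c: "continuous_on {0..e} f" and e: "0 < e" and b: "\<And>m i. i \<le> 2 ^ m \<Longrightarrow> \<bar>f (e * real i / 2 ^ m)\<bar> \<le> b" and r: "r \<in> {0..e}"
  shows "\<bar>f r\<bar> \<le> b"
proof -
  define i where "i m = nat \<lfloor>2 ^ m * r / e\<rfloor>" for m :: nat
  have i: "real (i m) \<le> 2 ^ m * r / e" "2 ^ m * r / e < real (i m) + 1" for m
  proof -
    have "0 \<le> 2 ^ m * r / e" using r e by simp
    then show "real (i m) \<le> 2 ^ m * r / e" "2 ^ m * r / e < real (i m) + 1" unfolding i_def by linarith+
  qed
  have im: "i m \<le> 2 ^ m" for m
  proof -
    have "2 ^ m * r / e \<le> 2 ^ m" using r e by (simp add: field_simps)
    from order_trans[OF i(1)[of m] this] show ?thesis by simp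
  qed
  define s where "s m = e * real (i m) / 2 ^ m" for m
  have s1: "s m \<le> r" "r - e / 2 ^ m \<le> s m" for m
  proof -
    show "s m \<le> r" using i(1)[of m] e unfolding s_def by (simp add: field_simps)
    have "r \<le> e * (real (i m) + 1) / 2 ^ m" using i(2)[of m] e by (simp add: field_simps)
    also have "\<dots> = s m + e / 2 ^ m" by (simp add: s_def add_divide_distrib distrib_left)
    finally show "r - e / 2 ^ m \<le> s m" by simp
  qed
  have s0: "0 \<le> s m" for m using e by (simp add: s_def)
  have s2: "s m \<le> e" for m using s1(1)[of m] r by auto
  have "(\<lambda>m. r - e / 2 ^ m) \<longlonglongrightarrow> r - 0"
    by (intro tendsto_diff tendsto_const LIMSEQ_divide_realpow_zero) simp
  then have lo: "(\<lambda>m. r - e / 2 ^ m) \<longlonglongrightarrow> r" by simp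
  have "s \<longlonglongrightarrow> r" by (rule tendsto_sandwich[OF _ _ lo tendsto_const]) (use s1 in auto)
  then have "(\<lambda>m. f (s m)) \<longlonglongrightarrow> f r"
    by (rule continuous_on_tendsto_compose[OF c]) (use r s0 s2 in auto)
  then have "(\<lambda>m. \<bar>f (s m)\<bar>) \<longlonglongrightarrow> \<bar>f r\<bar>" by (rule tendsto_rabs)
  then show ?thesis by (rule LIMSEQ_le_const2) (use b im in \<open>auto simp: s_def\<close>)
qed

text \<open>The dyadic grids are nested, so the events increase with \<open>m\<close> and a bound
  uniform in \<open>m\<close> survives the union.\<close>

lemma (in prob_space) dyadic_sup_prob:
  fixes f :: "real \<Rightarrow> 'a \<Rightarrow> real"
  assumes e: "0 < e" and f: "\<And>r. 0 \<le> r \<Longrightarrow> r \<le> e \<Longrightarrow> f r \<in> borel_measurable M"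
    and p: "\<And>m. prob {\<omega> \<in> space M. \<exists>i\<le>2 ^ m. \<bar>f (e * real i / 2 ^ m) \<omega>\<bar> > l} \<le> c"
  shows "{\<omega> \<in> space M. \<exists>m. \<exists>i\<le>2 ^ m. \<bar>f (e * real i / 2 ^ m) \<omega>\<bar> > l} \<in> events"
    "prob {\<omega> \<in> space M. \<exists>m. \<exists>i\<le>2 ^ m. \<bar>f (e * real i / 2 ^ m) \<omega>\<bar> > l} \<le> c"
proof -
  define E where "E m = {\<omega> \<in> space M. \<exists>i\<le>2 ^ m. \<bar>f (e * real i / 2 ^ m) \<omega>\<bar> > l}" for m :: nat
  have pt: "0 \<le> e * real i / 2 ^ m \<and> e * real i / 2 ^ m \<le> e" if "i \<le> 2 ^ m" for i m :: nat
  proof -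
    have "real i \<le> real (2 ^ m)" using that by (simp only: of_nat_le_iff)
    then show ?thesis using e by (simp add: field_simps)
  qed
  have Em: "E m \<in> events" for m
  proof -
    have "{\<omega> \<in> space M. \<exists>i\<in>{..2 ^ m}. \<bar>f (e * real i / 2 ^ m) \<omega>\<bar> > l} \<in> events"
      by (rule sets.sets_Collect_finite_Ex) (use f pt in \<open>auto intro!: borel_measurable_less borel_measurable_abs\<close>)
    then show ?thesis unfolding E_def by (simp only: Bex_def atMost_iff)
  qed
  have "E m \<subseteq> E (Suc m)" for m
  proof
    fix \<omega> assume "\<omega> \<in> E m"
    then obtain i where i: "\<omega> \<in> space M" "i \<le> 2 ^ m" "\<bar>f (e * real i / 2 ^ m) \<omega>\<bar> > l" by (auto simp: E_def)
    have "e * real (2 * i) / 2 ^ Suc m = e * real i / 2 ^ m" by simp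
    then show "\<omega> \<in> E (Suc m)" unfolding E_def using i by (intro CollectI conjI exI[of _ "2 * i"]) auto
  qed
  then have inc: "incseq E" by (rule incseq_SucI)
  have U: "{\<omega> \<in> space M. \<exists>m. \<exists>i\<le>2 ^ m. \<bar>f (e * real i / 2 ^ m) \<omega>\<bar> > l} = (\<Union>m. E m)" by (auto simp: E_def)
  show "{\<omega> \<in> space M. \<exists>m. \<exists>i\<le>2 ^ m. \<bar>f (e * real i / 2 ^ m) \<omega>\<bar> > l} \<in> events" unfolding U using Em by auto
  have "(\<lambda>m. prob (E m)) \<longlonglongrightarrow> prob (\<Union>m. E m)" by (rule finite_Lim_measure_incseq) (use Em inc in auto)
  then show "prob {\<omega> \<in> space M. \<exists>m. \<exists>i\<le>2 ^ m. \<bar>f (e * real i / 2 ^ m) \<omega>\<bar> > l} \<le> c"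
    unfolding U by (rule LIMSEQ_le_const2) (use p in \<open>auto simp: E_def\<close>)
qed

lemma (in prob_space) Borel_Cantelli_eventually:
  assumes A: "\<And>n. A n \<in> events" and le: "eventually (\<lambda>n. prob (A n) \<le> g n) sequentially" and g: "summable g"
  shows "AE \<omega> in M. eventually (\<lambda>n. \<omega> \<notin> A n) sequentially"
proof -
  have "summable (\<lambda>n. prob (A n))" by (rule summable_comparison_test_ev[OF _ g]) (use le in simp)
  then have "AE \<omega> in M. eventually (\<lambda>n. \<omega> \<in> space M - A n) sequentially"
    by (intro borel_cantelli_AE1 A) (simp_all add: emeasure_eq_measure)
  then show ?thesis by (auto elim!: eventually_mono)
qed

text \<open>The slack \<open>1 - d\<close> absorbs both the shift by 1 and the factor
  \<open>1 / sqrt (2 * pi)\<close> in the lower tail bound, leaving \<open>exp (- l)\<close>, whose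
  values along the blocks are a harmonic sequence.\<close>

lemma gaussian_tail_comparison:
  assumes d: "0 < d" "d \<le> 1"
  shows "\<exists>l0\<ge>0. \<forall>l\<ge>l0. exp (- l) \<le> exp (- ((1 - d) * sqrt (2 * l) + 1)\<^sup>2 / 2) / sqrt (2 * pi)"
proof -
  define c where "c = ln (sqrt (2 * pi))"
  \<comment> \<open>The first bound gives \<open>1 \<le> (d / 2) * y\<close> for
    \<open>y = sqrt (2 * l)\<close>, which handles the shift; the second gives
    \<open>\<bar>c\<bar> \<le> d / 2 * l\<close>, which handles the prefactor.\<close>
  define l0 where "l0 = max (2 / d\<^sup>2) (2 * \<bar>c\<bar> / d)"
  have "exp (- l) \<le> exp (- ((1 - d) * sqrt (2 * l) + 1)\<^sup>2 / 2) / sqrt (2 * pi)" if l: "l \<ge> l0" for l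
  proof -
    have l1: "2 / d\<^sup>2 \<le> l" "2 * \<bar>c\<bar> / d \<le> l" using l by (auto simp: l0_def)
    have lp: "0 \<le> l" using order_trans[OF _ l1(1)] by simp
    define y where "y = sqrt (2 * l)"
    have y2: "y\<^sup>2 = 2 * l" using lp by (simp add: y_def)
    have "2 / d \<le> y" unfolding y_def
      by (rule real_le_rsqrt) (use l1(1) d in \<open>simp add: power_divide field_simps\<close>)
    then have "1 \<le> (d / 2) * y" using d by (simp add: field_simps)
    then have 1: "(1 - d) * y + 1 \<le> (1 - d / 2) * y" by (simp add: algebra_simps)
    have "0 \<le> (1 - d) * y + 1" using d lp by (simp add: y_def)
    then have "((1 - d) * y + 1)\<^sup>2 \<le> ((1 - d / 2) * y)\<^sup>2" using 1 by (intro power_mono)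
    also have "\<dots> = (1 - d / 2)\<^sup>2 * (2 * l)" by (simp add: power_mult_distrib y2)
    also have "\<dots> \<le> (1 - d / 2) * (2 * l)"
    proof (rule mult_right_mono)
      show "(1 - d / 2)\<^sup>2 \<le> 1 - d / 2" using d mult_right_mono[of "1 - d / 2" 1 "1 - d / 2"] by (simp add: power2_eq_square)
    qed (use lp in simp)
    finally have "((1 - d) * y + 1)\<^sup>2 / 2 \<le> l - d / 2 * l" by (simp add: algebra_simps)
    moreover have "\<bar>c\<bar> \<le> d / 2 * l" using l1(2) d by (simp add: field_simps)
    ultimately have "- l \<le> - ((1 - d) * y + 1)\<^sup>2 / 2 - c" by linarith
    then have "exp (- l) \<le> exp (- ((1 - d) * y + 1)\<^sup>2 / 2 - c)" by simp
    also have "\<dots> = exp (- ((1 - d) * y + 1)\<^sup>2 / 2) / sqrt (2 * pi)" by (simp add: exp_diff c_def)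
    finally show ?thesis by (simp add: y_def)
  qed
  then show ?thesis by (intro exI[of _ l0]) (use d in \<open>auto simp: l0_def le_max_iff_disj\<close>)
qed

definition psi :: "real \<Rightarrow> real" where "psi r = sqrt (2 * r * ln (ln (1 / r)))"

section \<open>Estimates along geometric blocks\<close>

locale wave_blocks = mild_wave_at M \<xi> \<sigma> u L t x for M :: "'a measure" and \<xi> \<sigma> u L t x +
  fixes w :: real
  assumes w: "0 < w" "w < 1"
begin

text \<open>The blocks end at \<open>ek k = w\<^sup>4\<^sup>k\<close>, and the mesh \<open>1 / nk k \<le> ek k\<close> makes the remainder \<open>R\<close> on the
  \<open>k\<close>-th block of order \<open>ek k\<close>. In the end \<open>w \<rightarrow> 1\<close> yields the upper and \<open>w \<rightarrow> 0\<close> the lower bound.\<close>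

definition ek :: "nat \<Rightarrow> real" where "ek k = w ^ (4 * k)"
definition nk :: "nat \<Rightarrow> nat" where "nk k = Suc (nat \<lceil>1 / ek k\<rceil>)"
text \<open>Chosen so that \<open>ln (1 / ek k) = real k * cc\<close>; thus \<open>lk k\<close>
  below is the iterated logarithm at the block end \<open>ek k\<close>.\<close>

definition cc :: real where "cc = 4 * ln (1 / w)"
definition lk :: "nat \<Rightarrow> real" where "lk k = ln (real k * cc)"
definition Nr :: "real \<Rightarrow> 'a \<Rightarrow> real" where "Nr r \<omega> = u (t + r) x \<omega> - u t x \<omega>"

lemma ek_bounds: "0 < ek k" "ek k \<le> 1" "ek (Suc k) = w ^ 4 * ek k" "ek (Suc k) < ek k"
proof -
  show 1: "0 < ek k" and "ek k \<le> 1" using w by (auto simp: ek_def power_le_one)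
  show 2: "ek (Suc k) = w ^ 4 * ek k" by (simp add: ek_def power_add)
  have "w ^ 4 < 1" using w by (simp add: power_less_one_iff)
  then show "ek (Suc k) < ek k" unfolding 2 using 1 by simp
qed

lemma ek_mono: "i \<le> j \<Longrightarrow> ek j \<le> ek i" using w by (simp add: ek_def power_decreasing)

lemma ek_lim: "ek \<longlonglongrightarrow> 0"
proof -
  have "(\<lambda>k. (w ^ 4) ^ k) \<longlonglongrightarrow> 0" using w by (intro LIMSEQ_realpow_zero) (auto simp: power_less_one_iff)
  then show ?thesis by (simp add: ek_def[abs_def] power_mult)
qed

lemma nk_pos: "0 < nk k" by (simp add: nk_def)

lemma nk_inv: "1 / real (nk k) \<le> ek k"
proof -
  have "1 / ek k \<le> real (nk k)" unfolding nk_def using ek_bounds(1)[of k] by (simp add: le_nat_iff) linarith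
  then show ?thesis using ek_bounds(1)[of k] nk_pos[of k] by (simp add: field_simps)
qed

lemma nk_lim: "filterlim nk at_top sequentially"
proof -
  have "(\<lambda>k. 1 / real (nk k)) \<longlonglongrightarrow> 0"
    by (rule tendsto_sandwich[OF _ _ tendsto_const ek_lim]) (use nk_inv in auto)
  then have "filterlim (\<lambda>k. inverse (1 / real (nk k))) at_top sequentially"
    by (rule filterlim_inverse_at_top) (use nk_pos in auto)
  then have "filterlim (\<lambda>k. real (nk k)) at_top sequentially" by simp
  then show ?thesis by (simp add: filterlim_real_sequentially filterlim_sequentially_iff_filterlim_real)
qed

lemma cc_pos: "0 < cc" using w by (simp add: cc_def)

lemma ln_ek: "ln (1 / ek k) = real k * cc"
  using w by (simp add: ek_def cc_def ln_div ln_realpow)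

lemma psi_ek: "psi (ek k) = sqrt (ek k) * sqrt (2 * lk k)"
  by (simp add: psi_def ln_ek lk_def real_sqrt_mult[symmetric] mult_ac)

lemma sqrt_ek: "sqrt (ek k) = w ^ (2 * k)"
proof -
  have "ek k = (w ^ (2 * k))\<^sup>2" by (simp add: ek_def power_mult[symmetric] mult.commute)
  then show ?thesis using w by simp
qed

lemma lk_lim: "filterlim lk at_top sequentially"
  unfolding lk_def[abs_def] using cc_pos
  by (intro filterlim_compose[OF ln_at_top] filterlim_at_top_mult_tendsto_pos[OF tendsto_const] filterlim_real_sequentially)

lemma lk_large: "eventually (\<lambda>k. lk k \<ge> 1 \<and> real k * cc \<ge> 2 \<and> 0 < k) sequentially"
proof -
  have "filterlim (\<lambda>k. real k * cc) at_top sequentially"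
    using cc_pos by (intro filterlim_at_top_mult_tendsto_pos[OF tendsto_const] filterlim_real_sequentially)
  then have "eventually (\<lambda>k. real k * cc \<ge> 2) sequentially" by (simp add: filterlim_at_top)
  moreover have "eventually (\<lambda>k. lk k \<ge> 1) sequentially" using lk_lim by (simp add: filterlim_at_top)
  ultimately show ?thesis using eventually_gt_at_top[of 0] by eventually_elim auto
qed

text \<open>The second fact makes the threshold for the remainder negligible. The third rests on the
  crude \<open>lk (Suc k) \<le> 4 * lk k\<close>, good enough for small \<open>w\<close>. The fourth
  loses the factor \<open>w\<^sup>2\<close> over a block, which is harmless for \<open>w\<close>
  near 1.\<close>

lemma psi_facts:
  assumes "lk k \<ge> 1" "real k * cc \<ge> 2"
  shows "0 < psi (ek k)" "w ^ (3 * k) \<le> w ^ k * psi (ek k)" "psi (ek (Suc k)) \<le> 2 * w\<^sup>2 * psi (ek k)"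
    "\<And>r. ek (Suc k) < r \<Longrightarrow> r \<le> ek k \<Longrightarrow> w\<^sup>2 * psi (ek k) \<le> psi r"
proof -
  show p: "0 < psi (ek k)" using assms ek_bounds(1)[of k] by (simp add: psi_ek)
  have s2: "1 \<le> sqrt (2 * lk k)" using assms by simp
  have "w ^ (3 * k) = w ^ k * w ^ (2 * k)" by (simp add: power_add[symmetric])
  also have "\<dots> \<le> w ^ k * (w ^ (2 * k) * sqrt (2 * lk k))" using w s2 by (intro mult_left_mono) auto
  finally show "w ^ (3 * k) \<le> w ^ k * psi (ek k)" by (simp add: psi_ek sqrt_ek)
  have "lk (Suc k) \<le> 4 * lk k"
  proof -
    have k: "real k \<ge> 1" using assms(2) by (cases k) auto
    have pos: "0 < real k * cc" using assms by linarith
    have "real (Suc k) * cc \<le> (real k * cc) * (real k * cc)"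
    proof -
      have "real (Suc k) * cc \<le> 2 * (real k * cc)" using k cc_pos by (simp add: algebra_simps)
      also have "\<dots> \<le> (real k * cc) * (real k * cc)" using assms pos by (intro mult_right_mono) auto
      finally show ?thesis .
    qed
    then have "lk (Suc k) \<le> ln ((real k * cc) * (real k * cc))" unfolding lk_def using cc_pos pos k by (subst ln_le_cancel_iff) auto
    also have "\<dots> = 2 * lk k" unfolding lk_def using pos k by (subst ln_mult) auto
    finally show ?thesis using assms by linarith
  qed
  then have "sqrt (2 * lk (Suc k)) \<le> sqrt (4 * (2 * lk k))" by (intro real_sqrt_le_mono) simp
  also have "\<dots> = 2 * sqrt (2 * lk k)" unfolding real_sqrt_mult[of 4] by simp
  finally have "sqrt (2 * lk (Suc k)) \<le> 2 * sqrt (2 * lk k)" .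
  then have "w ^ (2 * Suc k) * sqrt (2 * lk (Suc k)) \<le> w ^ (2 * Suc k) * (2 * sqrt (2 * lk k))" using w by (intro mult_left_mono) auto
  then show "psi (ek (Suc k)) \<le> 2 * w\<^sup>2 * psi (ek k)" by (simp add: psi_ek sqrt_ek power2_eq_square mult_ac)
  fix r assume r: "ek (Suc k) < r" "r \<le> ek k"
  have r0: "0 < r" using r(1) ek_bounds(1)[of "Suc k"] by linarith
  have "1 / ek k \<le> 1 / r" using r r0 by (intro divide_left_mono) auto
  then have "ln (1 / ek k) \<le> ln (1 / r)" using r0 ek_bounds(1)[of k] by (subst ln_le_cancel_iff) auto
  then have "real k * cc \<le> ln (1 / r)" by (simp only: ln_ek)
  then have "lk k \<le> ln (ln (1 / r))" unfolding lk_def using assms by (subst ln_le_cancel_iff) auto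
  moreover have "w ^ 4 * ek k \<le> r" using r(1) by (simp add: ek_bounds(3))
  ultimately have "(w ^ 4 * ek k) * lk k \<le> r * ln (ln (1 / r))" using assms r0 ek_bounds(1)[of k] w by (intro mult_mono) auto
  then have "(w\<^sup>2 * psi (ek k))\<^sup>2 \<le> 2 * r * ln (ln (1 / r))"
    using assms ek_bounds(1)[of k] by (simp add: psi_ek power_mult_distrib power_mult[symmetric] algebra_simps)
  then show "w\<^sup>2 * psi (ek k) \<le> psi r" unfolding psi_def[of r] by (rule real_le_rsqrt)
qed

lemma Nr_decomp: "Nr r \<omega> = sqrt (Sn (nk k) \<omega>) * Bn (nk k) 0 r \<omega> + R (nk k) r \<omega>"
  by (simp add: Nr_def R_def sint_Bn[OF nk_pos])

lemma Nr_continuous: "\<omega> \<in> space M \<Longrightarrow> continuous_on {0..} (\<lambda>r. Nr r \<omega>)"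
proof -
  assume \<omega>: "\<omega> \<in> space M"
  have "continuous_on {0..} (\<lambda>r. (\<lambda>(s, y). u s y \<omega>) (t + r, x))"
    by (rule continuous_on_compose2[OF cont[OF \<omega>]]) (use t0 in \<open>auto intro!: continuous_intros\<close>)
  then show ?thesis unfolding Nr_def by (auto intro!: continuous_intros)
qed

lemma dyadic_points:
  shows "\<And>i j :: nat. i \<le> j \<Longrightarrow> ek k * real i / 2 ^ m \<le> ek k * real j / 2 ^ m" "ek k * real (2 ^ m) / 2 ^ m = ek k"
  using ek_bounds(1)[of k] by (auto intro!: divide_right_mono mult_left_mono)

text \<open>At the level \<open>(1 + d) * psi (ek k)\<close> the maximal inequality gives a bound of
  order \<open>k powr (- (1 + d)\<^sup>2)\<close>, summable because the exponent exceeds 1 in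
  modulus.\<close>

lemma Bn_block:
  assumes d: "0 < d"
  shows "AE \<omega> in M. eventually (\<lambda>k. \<forall>m. \<forall>i\<le>2 ^ m. \<bar>Bn (nk k) 0 (ek k * real i / 2 ^ m) \<omega>\<bar> \<le> (1 + d) * psi (ek k)) sequentially"
proof -
  define E where "E k = {\<omega> \<in> space M. \<exists>m. \<exists>i\<le>2 ^ m. \<bar>Bn (nk k) 0 (ek k * real i / 2 ^ m) \<omega>\<bar> > (1 + d) * psi (ek k)}" for k
  \<comment> \<open>For small \<open>k\<close> the iterated logarithm may be undefined or negative;
    replacing the event by the empty set keeps measurability and the bound valid for every
    \<open>k\<close>.\<close>
  define A where "A k = (if lk k \<ge> 1 \<and> real k * cc \<ge> 2 \<and> 0 < k then E k else {})" for k
  have main: "E k \<in> events \<and> prob (E k) \<le> (4 * cc powr (- (1 + d)\<^sup>2)) * (real k powr (- (1 + d)\<^sup>2))"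
    if k: "lk k \<ge> 1" "real k * cc \<ge> 2" "0 < k" for k
  proof -
    have "prob {\<omega> \<in> space M. \<exists>i\<le>2 ^ m. \<bar>Bn (nk k) 0 (ek k * real i / 2 ^ m) \<omega>\<bar> > (1 + d) * psi (ek k)} \<le> (4 * cc powr (- (1 + d)\<^sup>2)) * (real k powr (- (1 + d)\<^sup>2))" for m
    proof -
      define l where "l = (1 + d) * sqrt (2 * lk k)"
      have l0: "0 \<le> l" using d k by (simp add: l_def)
      have ls: "l * sqrt (ek k * real (2 ^ m) / 2 ^ m) = (1 + d) * psi (ek k)" unfolding dyadic_points(2) by (simp add: l_def psi_ek)
      have "prob {\<omega> \<in> space M. \<exists>i\<le>2 ^ m. \<bar>Bn (nk k) 0 (ek k * real i / 2 ^ m) \<omega>\<bar> > l * sqrt (ek k * real (2 ^ m) / 2 ^ m)} \<le> 4 * exp (- l\<^sup>2 / 2)"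
        by (rule Bn_maximal[OF nk_pos dyadic_points(1) _ _ l0]) (use ek_bounds(1)[of k] in auto)
      also have "- l\<^sup>2 / 2 = - ((1 + d)\<^sup>2) * lk k" using k by (simp add: l_def power_mult_distrib)
      also have "exp (- ((1 + d)\<^sup>2) * lk k) = (real k * cc) powr (- (1 + d)\<^sup>2)" using k cc_pos by (simp add: powr_def lk_def)
      also have "\<dots> = real k powr (- (1 + d)\<^sup>2) * cc powr (- (1 + d)\<^sup>2)" using cc_pos by (simp add: powr_mult)
      finally show ?thesis unfolding ls by (simp add: mult_ac)
    qed
    from dyadic_sup_prob[OF ek_bounds(1) Bn_measurable(2)[OF nk_pos order_refl] this] show ?thesis unfolding E_def by blast
  qed
  have Am: "A k \<in> events" for k using main[of k] by (simp add: A_def)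
  have sm: "summable (\<lambda>k. (4 * cc powr (- (1 + d)\<^sup>2)) * (real k powr (- (1 + d)\<^sup>2)))"
  proof (rule summable_mult)
    have "1 < (1 + d)\<^sup>2" using d by (simp add: one_less_power)
    then show "summable (\<lambda>k. real k powr (- (1 + d)\<^sup>2))" by (simp add: summable_real_powr_iff)
  qed
  have "AE \<omega> in M. eventually (\<lambda>k. \<omega> \<notin> A k) sequentially"
    by (rule Borel_Cantelli_eventually[OF Am _ sm]) (use main cc_pos in \<open>auto simp: A_def intro!: always_eventually\<close>)
  with AE_space show ?thesis
  proof eventually_elim
    case (elim \<omega>)
    from elim(2) lk_large show ?case
      by eventually_elim (use elim(1) in \<open>auto simp: A_def E_def not_less\<close>)
  qed
qed

text \<open>The choice of mesh gives mean square at most \<open>2 * C * (ek k)\<^sup>2\<close>, of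
  order \<open>w ^ (8 * k)\<close>. Dividing by the squared threshold \<open>w ^ (6 * k)\<close>
  leaves \<open>w ^ (2 * k)\<close>, a summable bound, while the threshold itself is still small
  against \<open>psi (ek k)\<close>.\<close>

lemma R_block:
  "AE \<omega> in M. eventually (\<lambda>k. (\<forall>m. \<forall>i\<le>2 ^ m. \<bar>R (nk k) (ek k * real i / 2 ^ m) \<omega>\<bar> \<le> w ^ (3 * k)) \<and> \<bar>R (nk k) (ek (Suc k)) \<omega>\<bar> \<le> w ^ (3 * k)) sequentially"
proof -
  obtain C where C: "C \<ge> 0" "\<And>n r. n > 0 \<Longrightarrow> 0 \<le> r \<Longrightarrow> r \<le> 1 \<Longrightarrow> (\<integral>\<omega>. (R n r \<omega>)\<^sup>2 \<partial>M) \<le> C * r * (r + 1 / real n)"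
    using R_bound by blast
  define A where "A k = {\<omega> \<in> space M. \<exists>m. \<exists>i\<le>2 ^ m. \<bar>R (nk k) (ek k * real i / 2 ^ m) \<omega>\<bar> > w ^ (3 * k)}" for k
  \<comment> \<open>The point \<open>ek (Suc k)\<close> need not be a dyadic fraction of
    \<open>ek k\<close>, so the remainder with the mesh of block \<open>k\<close> is controlled
    there separately.\<close>
  define B where "B k = {\<omega> \<in> space M. \<bar>R (nk k) (ek (Suc k)) \<omega>\<bar> > w ^ (3 * k)}" for k
  have Rm: "R n r \<in> borel_measurable M" if "0 < n" "0 \<le> r" for n r using R_measurable(2)[OF that] by (simp add: sqint_def)
  have bd: "p \<le> (2 * C) * (w\<^sup>2) ^ k" if p: "(w ^ (3 * k))\<^sup>2 * p \<le> (\<integral>\<omega>. (R (nk k) r \<omega>)\<^sup>2 \<partial>M)" and r: "0 \<le> r" "r \<le> ek k" for p k r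
  proof -
    have "(w ^ (3 * k))\<^sup>2 * p \<le> C * r * (r + 1 / real (nk k))" using order_trans[OF p C(2)[OF nk_pos]] r ek_bounds(2)[of k] by simp
    also have "\<dots> \<le> C * ek k * (ek k + ek k)" using r C(1) nk_inv[of k] nk_pos[of k] ek_bounds(1)[of k] by (intro mult_mono add_mono) auto
    also have "\<dots> = (2 * C) * (ek k)\<^sup>2" by (simp add: power2_eq_square)
    also have "(ek k)\<^sup>2 = (w ^ (3 * k))\<^sup>2 * (w\<^sup>2) ^ k" by (simp add: ek_def power_mult[symmetric] power_add[symmetric])
    finally have "(w ^ (3 * k))\<^sup>2 * p \<le> (w ^ (3 * k))\<^sup>2 * ((2 * C) * (w\<^sup>2) ^ k)" by (simp add: mult_ac)
    then show ?thesis using w by (simp add: mult_le_cancel_left_pos)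
  qed
  have A: "A k \<in> events \<and> prob (A k) \<le> (2 * C) * (w\<^sup>2) ^ k" for k
  proof -
    have "prob {\<omega> \<in> space M. \<exists>i\<le>2 ^ m. \<bar>R (nk k) (ek k * real i / 2 ^ m) \<omega>\<bar> > w ^ (3 * k)} \<le> (2 * C) * (w\<^sup>2) ^ k" for m
    proof (rule bd)
      show "(w ^ (3 * k))\<^sup>2 * prob {\<omega> \<in> space M. \<exists>i\<le>2 ^ m. \<bar>R (nk k) (ek k * real i / 2 ^ m) \<omega>\<bar> > w ^ (3 * k)} \<le> (\<integral>\<omega>. (R (nk k) (ek k * real (2 ^ m) / 2 ^ m) \<omega>)\<^sup>2 \<partial>M)"
        by (rule R_maximal[OF nk_pos dyadic_points(1)]) (use w ek_bounds(1)[of k] in auto)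
    qed (use dyadic_points(2)[of k m] ek_bounds(1)[of k] in auto)
    from dyadic_sup_prob[OF ek_bounds(1) Rm[OF nk_pos] this] show ?thesis unfolding A_def by blast
  qed
  have B: "B k \<in> events \<and> prob (B k) \<le> (2 * C) * (w\<^sup>2) ^ k" for k
  proof
    have [measurable]: "R (nk k) (ek (Suc k)) \<in> borel_measurable M" using ek_bounds(1)[of "Suc k"] by (intro Rm nk_pos) simp
    show "B k \<in> events" unfolding B_def by measurable
    \<comment> \<open>The maximal inequality for a single time is Chebyshev's inequality.\<close>
    have "(w ^ (3 * k))\<^sup>2 * prob {\<omega> \<in> space M. \<exists>i\<le>(0::nat). \<bar>R (nk k) (ek (Suc k)) \<omega>\<bar> > w ^ (3 * k)} \<le> (\<integral>\<omega>. (R (nk k) (ek (Suc k)) \<omega>)\<^sup>2 \<partial>M)"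
      by (rule R_maximal[OF nk_pos, where r="\<lambda>_. ek (Suc k)"]) (use w ek_bounds(1)[of "Suc k"] in auto)
    then have "(w ^ (3 * k))\<^sup>2 * prob (B k) \<le> (\<integral>\<omega>. (R (nk k) (ek (Suc k)) \<omega>)\<^sup>2 \<partial>M)" by (simp add: B_def)
    then show "prob (B k) \<le> (2 * C) * (w\<^sup>2) ^ k" by (rule bd) (use ek_bounds(1)[of "Suc k"] ek_bounds(4)[of k] in auto)
  qed
  have sm: "summable (\<lambda>k. (2 * C) * (w\<^sup>2) ^ k)" using w by (intro summable_mult summable_geometric) (simp add: power_less_one_iff abs_square_less_1)
  have "AE \<omega> in M. eventually (\<lambda>k. \<omega> \<notin> A k) sequentially" "AE \<omega> in M. eventually (\<lambda>k. \<omega> \<notin> B k) sequentially"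
    by (rule Borel_Cantelli_eventually[OF _ _ sm]; use A B in simp)+
  with AE_space show ?thesis
  proof eventually_elim
    case (elim \<omega>)
    from elim(2,3) show ?case
      by eventually_elim (use elim(1) in \<open>auto simp: A_def B_def not_less\<close>)
  qed
qed

lemma Nr_block:
  assumes d: "0 < d"
  shows "AE \<omega> in M. eventually (\<lambda>k. \<forall>r\<in>{0..ek k}. \<bar>Nr r \<omega>\<bar> \<le> (sqrt (Sn (nk k) \<omega>) * (1 + d) + w ^ k) * psi (ek k)) sequentially"
  using AE_space Bn_block[OF d] R_block
proof eventually_elim
  case (elim \<omega>)
  from elim(2,3) lk_large show ?case
  proof eventually_elim
    case (elim k)
    note el = this
    show ?case
    proof
      fix r assume r: "r \<in> {0..ek k}"
      show "\<bar>Nr r \<omega>\<bar> \<le> (sqrt (Sn (nk k) \<omega>) * (1 + d) + w ^ k) * psi (ek k)"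
      proof (rule dyadic_closure[OF continuous_on_subset[OF Nr_continuous[OF \<open>\<omega> \<in> space M\<close>]] ek_bounds(1) _ r])
        fix m i :: nat assume i: "i \<le> 2 ^ m"
        let ?r = "ek k * real i / 2 ^ m"
        have "\<bar>Nr ?r \<omega>\<bar> \<le> \<bar>sqrt (Sn (nk k) \<omega>) * Bn (nk k) 0 ?r \<omega>\<bar> + \<bar>R (nk k) ?r \<omega>\<bar>"
          unfolding Nr_decomp[of _ _ k] by (rule abs_triangle_ineq)
        also have "\<dots> \<le> sqrt (Sn (nk k) \<omega>) * ((1 + d) * psi (ek k)) + w ^ k * psi (ek k)"
        proof (rule add_mono)
          show "\<bar>sqrt (Sn (nk k) \<omega>) * Bn (nk k) 0 ?r \<omega>\<bar> \<le> sqrt (Sn (nk k) \<omega>) * ((1 + d) * psi (ek k))"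
            using el(1) i Sn_nonneg[of "nk k" \<omega>] by (simp add: abs_mult mult_left_mono)
          show "\<bar>R (nk k) ?r \<omega>\<bar> \<le> w ^ k * psi (ek k)"
            using el i psi_facts(2)[of k] by (meson order_trans)
        qed
        finally show "\<bar>Nr ?r \<omega>\<bar> \<le> (sqrt (Sn (nk k) \<omega>) * (1 + d) + w ^ k) * psi (ek k)" by (simp add: distrib_right mult.assoc)
      qed auto
    qed
  qed
qed

lemma wk_lim: "(\<lambda>k. w ^ k) \<longlonglongrightarrow> 0" using w by (intro LIMSEQ_realpow_zero) auto

lemma sqrt_Sn_lim: "\<omega> \<in> space M \<Longrightarrow> (\<lambda>k. sqrt (Sn (nk k) \<omega>)) \<longlonglongrightarrow> sqrt (S \<omega>)"
  by (intro tendsto_real_sqrt filterlim_compose[OF Sn_limit nk_lim])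

lemma upper_bound:
  assumes d: "0 < d"
  shows "AE \<omega> in M. \<forall>h>0. eventually (\<lambda>r. \<bar>Nr r \<omega>\<bar> \<le> (sqrt (S \<omega>) * (1 + d) + h) / w\<^sup>2 * psi r) (at_right 0)"
  using AE_space Nr_block[OF d]
proof eventually_elim
  case (elim \<omega>)
  show ?case
  proof (intro allI impI)
    fix h :: real assume h: "0 < h"
    have "(\<lambda>k. sqrt (Sn (nk k) \<omega>) * (1 + d) + w ^ k) \<longlonglongrightarrow> sqrt (S \<omega>) * (1 + d) + 0"
      by (intro tendsto_intros sqrt_Sn_lim elim(1) wk_lim)
    then have "eventually (\<lambda>k. sqrt (Sn (nk k) \<omega>) * (1 + d) + w ^ k < sqrt (S \<omega>) * (1 + d) + h) sequentially"
      by (rule order_tendstoD(2)) (use h in simp)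
    with elim(2) lk_large
    have "eventually (\<lambda>k. (\<forall>r\<in>{0..ek k}. \<bar>Nr r \<omega>\<bar> \<le> (sqrt (S \<omega>) * (1 + d) + h) * psi (ek k)) \<and> lk k \<ge> 1 \<and> real k * cc \<ge> 2) sequentially"
    proof eventually_elim
      case (elim k)
      have "(sqrt (Sn (nk k) \<omega>) * (1 + d) + w ^ k) * psi (ek k) \<le> (sqrt (S \<omega>) * (1 + d) + h) * psi (ek k)"
        using elim psi_facts(1)[of k] by (intro mult_right_mono) auto
      then show ?case using elim by (meson order_trans)
    qed
    then obtain K where K: "\<And>k r. k \<ge> K \<Longrightarrow> r \<in> {0..ek k} \<Longrightarrow> \<bar>Nr r \<omega>\<bar> \<le> (sqrt (S \<omega>) * (1 + d) + h) * psi (ek k)" "\<And>k. k \<ge> K \<Longrightarrow> lk k \<ge> 1 \<and> real k * cc \<ge> 2"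
      unfolding eventually_sequentially by blast
    show "eventually (\<lambda>r. \<bar>Nr r \<omega>\<bar> \<le> (sqrt (S \<omega>) * (1 + d) + h) / w\<^sup>2 * psi r) (at_right 0)"
      unfolding eventually_at_right_field
    proof (intro exI[of _ "ek K"] conjI ek_bounds(1) allI impI)
      fix r assume r: "0 < r" "r < ek K"
      have "eventually (\<lambda>k. ek k < r) sequentially" by (rule order_tendstoD(2)[OF ek_lim r(1)])
      then have ex: "\<exists>k. ek k < r" by (auto simp: eventually_sequentially)
      \<comment> \<open>The first block end below \<open>r\<close>. It comes after \<open>K\<close>,
        so it has a predecessor \<open>k\<close>, and \<open>r\<close> lies between
        \<open>ek (Suc k)\<close> and \<open>ek k\<close>.\<close>
      define k' where "k' = (LEAST k. ek k < r)"
      have k': "ek k' < r" unfolding k'_def by (rule LeastI_ex[OF ex])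
      have "K < k'"
      proof (rule ccontr)
        assume "\<not> K < k'"
        then have "ek K \<le> ek k'" by (intro ek_mono) simp
        then show False using k' r by simp
      qed
      then obtain k where k: "k' = Suc k" "K \<le> k" by (metis Suc_le_eq less_imp_Suc_add le_add1)
      have "\<not> ek k < r" using not_less_Least[of k "\<lambda>k. ek k < r"] k by (simp add: k'_def[symmetric])
      then have rk: "ek (Suc k) < r" "r \<le> ek k" using k' k by auto
      have "0 \<le> sqrt (S \<omega>)" using S_nonneg[OF elim(1)] by simp
      then have c0: "0 \<le> sqrt (S \<omega>) * (1 + d) + h" using d h by auto
      have "\<bar>Nr r \<omega>\<bar> \<le> (sqrt (S \<omega>) * (1 + d) + h) * psi (ek k)" using K(1)[OF k(2), of r] r rk by simp
      also have "\<dots> = (sqrt (S \<omega>) * (1 + d) + h) / w\<^sup>2 * (w\<^sup>2 * psi (ek k))" using w by simp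
      also have "\<dots> \<le> (sqrt (S \<omega>) * (1 + d) + h) / w\<^sup>2 * psi r"
        using psi_facts(4)[OF _ _ rk] K(2)[OF k(2)] c0 by (intro mult_left_mono) auto
      finally show "\<bar>Nr r \<omega>\<bar> \<le> (sqrt (S \<omega>) * (1 + d) + h) / w\<^sup>2 * psi r" .
    qed
  qed
qed

text \<open>The fresh part of block \<open>k\<close>: known in the cone of height
  \<open>t + ek k\<close>, independent of the cone of height \<open>t + ek (Suc k)\<close>.\<close>

definition g :: "nat \<Rightarrow> 'a \<Rightarrow> real" where "g k = Bn (nk k) (ek (Suc k)) (ek k)"

text \<open>The divergence half of Borel-Cantelli. The cones shrink as \<open>k\<close> grows, so
  \<open>g a\<close> is independent of all later \<open>g k\<close>, although each has its own mesh.
  The product bound for missing every threshold vanishes because the harmonic series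
  diverges.\<close>

lemma g_io:
  assumes d: "0 < d" "d \<le> 1"
  shows "AE \<omega> in M. \<forall>K. \<exists>k\<ge>K. g k \<omega> > (1 - d) * sqrt (1 - w ^ 4) * psi (ek k)"
proof -
  define b where "b k = (1 - d) * sqrt (1 - w ^ 4) * psi (ek k)" for k
  define F where "F k = {\<omega> \<in> space M. g k \<omega> \<le> b k}" for k
  have r: "0 \<le> ek (Suc k)" "ek (Suc k) \<le> ek k" for k using ek_bounds(1)[of "Suc k"] ek_bounds(4)[of k] by auto
  have gm[measurable]: "g k \<in> borel_measurable M" for k unfolding g_def by (rule Bn_measurable(2)[OF nk_pos r])
  have gH: "g k \<in> borel_measurable (noise (light_cone x (t + ek k)))" for k unfolding g_def by (rule Bn_measurable(1)[OF nk_pos r])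
  have Fm: "F k \<in> events" for k unfolding F_def by measurable
  have FH: "F k \<in> sets (noise (light_cone x (t + ek j)))" if "j \<le> k" for j k
  proof -
    have "{\<omega> \<in> space (noise (light_cone x (t + ek k))). g k \<omega> \<le> b k} \<in> sets (noise (light_cone x (t + ek k)))" using gH[of k] by measurable
    then have "F k \<in> sets (noise (light_cone x (t + ek k)))" by (simp add: F_def)
    then show ?thesis using noise_mono[OF light_cone_mono'[of "t + ek k" "t + ek j" x]] ek_mono[OF that] by auto
  qed
  obtain l0 where l0: "\<And>l. l \<ge> l0 \<Longrightarrow> exp (- l) \<le> exp (- ((1 - d) * sqrt (2 * l) + 1)\<^sup>2 / 2) / sqrt (2 * pi)"
    using gaussian_tail_comparison[OF d] by blast
  have "eventually (\<lambda>k. lk k \<ge> l0) sequentially" using lk_lim by (simp add: filterlim_at_top)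
  with lk_large have "eventually (\<lambda>k. lk k \<ge> l0 \<and> lk k \<ge> 1 \<and> real k * cc \<ge> 2 \<and> 0 < k) sequentially" by eventually_elim auto
  then obtain K0 where K0: "\<And>k. k \<ge> K0 \<Longrightarrow> lk k \<ge> l0 \<and> lk k \<ge> 1 \<and> real k * cc \<ge> 2 \<and> 0 < k" unfolding eventually_sequentially by blast
  have Fp: "prob (F k) \<le> exp (- (1 / (real k * cc)))" if k: "k \<ge> K0" for k
  proof -
    have v: "ek k - ek (Suc k) = (1 - w ^ 4) * ek k" by (simp add: ek_bounds(3) left_diff_distrib)
    have v0: "0 < ek k - ek (Suc k)" using ek_bounds(4)[of k] by simp
    define l where "l = (1 - d) * sqrt (2 * lk k)"
    have l: "0 \<le> l" using d K0[OF k] by (simp add: l_def)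
    have bl: "b k = l * sqrt (ek k - ek (Suc k))" unfolding v by (simp add: b_def l_def psi_ek real_sqrt_mult)
    have "exp (- lk k) \<le> exp (- (l + 1)\<^sup>2 / 2) / sqrt (2 * pi)" unfolding l_def using l0 K0[OF k] by blast
    also have "\<dots> \<le> prob {\<omega> \<in> space M. g k \<omega> > l * sqrt (ek k - ek (Suc k))}"
      by (rule gaussian_tails(2)[OF gm v0 _ l]) (simp only: g_def Bn_char0[OF nk_pos r])
    also have "\<dots> = 1 - prob (F k)"
    proof -
      have "{\<omega> \<in> space M. g k \<omega> > b k} = space M - F k" by (auto simp: F_def)
      then show ?thesis unfolding bl[symmetric] using prob_compl[OF Fm[of k]] by simp
    qed
    also have "exp (- lk k) = 1 / (real k * cc)" using K0[OF k] cc_pos by (simp add: lk_def exp_minus inverse_eq_divide)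
    finally have "prob (F k) \<le> 1 + (- (1 / (real k * cc)))" by simp
    also have "\<dots> \<le> exp (- (1 / (real k * cc)))" by (rule exp_ge_add_one_self)
    finally show ?thesis .
  qed
  define J where "J a n = {\<omega> \<in> space M. \<forall>k\<in>{a..<a + n}. \<omega> \<in> F k}" for a n
  have JH: "J (Suc a) n \<in> sets (noise (light_cone x (t + ek (Suc a))))" for a n
  proof -
    have "{\<omega> \<in> space (noise (light_cone x (t + ek (Suc a)))). \<forall>k\<in>{Suc a..<Suc a + n}. \<omega> \<in> F k} \<in> sets (noise (light_cone x (t + ek (Suc a))))"
    proof (rule sets.sets_Collect_finite_All)
      fix k assume k: "k \<in> {Suc a..<Suc a + n}"
      then have "F k \<in> sets (noise (light_cone x (t + ek (Suc a))))" by (intro FH) auto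
      moreover have "{\<omega> \<in> space (noise (light_cone x (t + ek (Suc a)))). \<omega> \<in> F k} = F k" by (auto simp: F_def)
      ultimately show "{\<omega> \<in> space (noise (light_cone x (t + ek (Suc a)))). \<omega> \<in> F k} \<in> sets (noise (light_cone x (t + ek (Suc a))))" by simp
    qed simp
    then show ?thesis by (simp add: J_def)
  qed
  \<comment> \<open>The smallest index is peeled off: \<open>J (Suc a) n\<close> is an event of the
    cone from which block \<open>a\<close> starts, hence independent of \<open>F a\<close>.\<close>
  have Jp: "K0 \<le> a \<Longrightarrow> prob (J a n) \<le> exp (- (\<Sum>k\<in>{a..<a + n}. 1 / (real k * cc)))" for a n
  proof (induction n arbitrary: a)
    case 0 then show ?case by simp
  next
    case (Suc n)
    have "J a (Suc n) = J (Suc a) n \<inter> (g a -` {..b a} \<inter> space M)"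
    proof -
      have "{a..<a + Suc n} = insert a {Suc a..<Suc a + n}" by auto
      then show ?thesis unfolding J_def by (auto simp: F_def)
    qed
    then have "prob (J a (Suc n)) = prob (J (Suc a) n) * prob (g a -` {..b a} \<inter> space M)"
      using Bn_indep[OF nk_pos r JH, of "{..b a}" a n] unfolding g_def by simp
    also have "g a -` {..b a} \<inter> space M = F a" by (auto simp: F_def)
    also have "prob (J (Suc a) n) * prob (F a) \<le> exp (- (\<Sum>k\<in>{Suc a..<Suc a + n}. 1 / (real k * cc))) * exp (- (1 / (real a * cc)))"
      by (intro mult_mono Suc.IH Fp) (use Suc.prems in auto)
    also have "\<dots> = exp (- (\<Sum>k\<in>insert a {Suc a..<Suc a + n}. 1 / (real k * cc)))" by (simp add: exp_add[symmetric])
    also have "insert a {Suc a..<Suc a + n} = {a..<a + Suc n}" by auto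
    finally show ?case .
  qed
  have null: "AE \<omega> in M. \<exists>k\<ge>a. \<omega> \<notin> F k" if a: "K0 \<le> a" for a
  proof -
    define Z where "Z = {\<omega> \<in> space M. \<forall>k\<in>{a..}. \<omega> \<in> F k}"
    have Zm: "Z \<in> events"
    proof -
      have "Z = (\<Inter>k\<in>{a..}. F k)" by (auto simp: Z_def F_def)
      moreover have "(\<Inter>k\<in>{a..}. F k) \<in> events" by (rule sets.countable_INT') (use Fm in auto)
      ultimately show ?thesis by simp
    qed
    \<comment> \<open>Partial sums of the tail of the harmonic series exceed every \<open>y\<close>,
      so the bound on \<open>J\<close> can be made as small as desired.\<close>
    have "prob Z \<le> exp (- y)" for y
    proof -
      have "\<not> summable (\<lambda>k. 1 / (real (k + a) * cc))"
      proof
        assume "summable (\<lambda>k. 1 / (real (k + a) * cc))"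
        then have "summable (\<lambda>k. cc * (1 / (real (k + a) * cc)))" by (rule summable_mult)
        moreover have "cc * (1 / (real (k + a) * cc)) = inverse (real (k + a))" for k using cc_pos by (simp add: inverse_eq_divide)
        ultimately have "summable (\<lambda>k. inverse (real (k + a)))" by simp
        then have "summable (\<lambda>k. inverse (real k))" by (subst (asm) summable_iff_shift)
        then show False using not_summable_harmonic[where 'a=real] by simp
      qed
      moreover have "0 \<le> 1 / (real (k + a) * cc)" for k using cc_pos by simp
      ultimately have "\<not> (\<forall>n. (\<Sum>k<n. 1 / (real (k + a) * cc)) \<le> y)"
        using summableI_nonneg_bounded[of "\<lambda>k. 1 / (real (k + a) * cc)" y] by blast
      then obtain n where n: "y < (\<Sum>k<n. 1 / (real (k + a) * cc))" unfolding not_all not_le by (rule exE)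
      have "(\<Sum>k\<in>{a..<a + n}. 1 / (real k * cc)) = (\<Sum>k<n. 1 / (real (k + a) * cc))"
        using sum.shift_bounds_nat_ivl[of "\<lambda>k. 1 / (real k * cc)" 0 a n] by (simp only: add_0 lessThan_atLeast0 add.commute[of n a])
      then have "exp (- (\<Sum>k\<in>{a..<a + n}. 1 / (real k * cc))) \<le> exp (- y)" using n by simp
      then have "prob (J a n) \<le> exp (- y)" by (rule order_trans[OF Jp[OF a]])
      moreover have "prob Z \<le> prob (J a n)"
      proof (rule finite_measure_mono)
        show "Z \<subseteq> J a n" by (auto simp: Z_def J_def)
        have "{\<omega> \<in> space M. \<omega> \<in> F k} = F k" for k by (auto simp: F_def)
        then show "J a n \<in> events" unfolding J_def
          by (intro sets.sets_Collect_finite_All) (simp_all add: Fm)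
      qed
      ultimately show ?thesis by simp
    qed
    note bound = this
    have "prob Z \<le> e" if "0 < e" for e using bound[of "- ln e"] that by simp
    then have "prob Z \<le> 0 + e" if "0 < e" for e using that by simp
    then have "prob Z \<le> 0" by (rule field_le_epsilon)
    then have "prob Z = 0" using measure_nonneg[of M Z] by simp
    then have "Z \<in> null_sets M" using Zm by (simp add: null_sets_def emeasure_eq_measure)
    then have "AE \<omega> in M. \<omega> \<notin> Z" by (rule AE_not_in)
    with AE_space show ?thesis by eventually_elim (auto simp: Z_def)
  qed
  have "AE \<omega> in M. \<forall>a. \<exists>k\<ge>max K0 a. \<omega> \<notin> F k" unfolding AE_all_countable by (intro allI null max.cobounded1)
  with AE_space show ?thesis
  proof eventually_elim
    case (elim \<omega>)
    show ?case
    proof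
      fix K
      obtain k where "k \<ge> max K0 K" "\<omega> \<notin> F k" using elim(2) by blast
      then show "\<exists>k\<ge>K. g k \<omega> > (1 - d) * sqrt (1 - w ^ 4) * psi (ek k)" using elim(1) by (auto simp: F_def b_def not_le intro!: exI[of _ k])
    qed
  qed
qed

text \<open>At \<open>ek k\<close> the increment is its value at \<open>ek (Suc k)\<close> plus the
  fresh part and two remainders. The earlier value is bounded by \<open>Nr_block\<close> with slack
  1; its factor 2 and the \<open>2 * w\<^sup>2\<close> of \<open>psi_facts\<close> give
  \<open>4 * w\<^sup>2\<close>, which disappears as \<open>w\<close> tends to 0, while
  \<open>sqrt (1 - w ^ 4)\<close> tends to 1.\<close>

lemma lower_bound:
  assumes d: "0 < d" "d \<le> 1"
  shows "AE \<omega> in M. \<forall>h>0. frequently (\<lambda>r. (sqrt (S \<omega>) * ((1 - d) * sqrt (1 - w ^ 4) - 4 * w\<^sup>2) - h) * psi r \<le> Nr r \<omega>) (at_right 0)"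
proof -
  have r: "0 \<le> ek (Suc k)" "ek (Suc k) \<le> ek k" for k using ek_bounds(1)[of "Suc k"] ek_bounds(4)[of k] by auto
  have "AE \<omega> in M. \<forall>k. Bn (nk k) 0 (ek k) \<omega> = Bn (nk k) 0 (ek (Suc k)) \<omega> + Bn (nk k) (ek (Suc k)) (ek k) \<omega>"
    unfolding AE_all_countable using Bn_add[OF nk_pos order_refl r] by blast
  with AE_space g_io[OF d] R_block Nr_block[OF zero_less_one] show ?thesis
  proof eventually_elim
    case (elim \<omega>)
    show ?case
    proof (intro allI impI)
      fix h :: real assume h: "0 < h"
      let ?c = "(1 - d) * sqrt (1 - w ^ 4)"
      \<comment> \<open>Two terms \<open>w ^ k\<close> pay for the remainders at both ends of the
        block, taken with the mesh \<open>nk k\<close>. The last term carries the mesh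
        \<open>nk (Suc k)\<close>, because the value at \<open>ek (Suc k)\<close> is estimated as
        the end of the next block.\<close>
      define co where "co k = sqrt (Sn (nk k) \<omega>) * ?c - 2 * w ^ k - (sqrt (Sn (nk (Suc k)) \<omega>) * (1 + 1) + w ^ Suc k) * (2 * w\<^sup>2)" for k
      have "co \<longlonglongrightarrow> sqrt (S \<omega>) * ?c - 2 * 0 - (sqrt (S \<omega>) * (1 + 1) + 0) * (2 * w\<^sup>2)"
        unfolding co_def by (intro tendsto_intros sqrt_Sn_lim elim(1) wk_lim LIMSEQ_Suc[OF wk_lim] LIMSEQ_Suc[OF sqrt_Sn_lim[OF elim(1)]])
      also have "sqrt (S \<omega>) * ?c - 2 * 0 - (sqrt (S \<omega>) * (1 + 1) + 0) * (2 * w\<^sup>2) = sqrt (S \<omega>) * (?c - 4 * w\<^sup>2)" by (simp add: algebra_simps)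
      finally have "eventually (\<lambda>k. sqrt (S \<omega>) * (?c - 4 * w\<^sup>2) - h < co k) sequentially" by (rule order_tendstoD(1)) (use h in simp)
      moreover have "eventually (\<lambda>k. \<forall>r\<in>{0..ek (Suc k)}. \<bar>Nr r \<omega>\<bar> \<le> (sqrt (Sn (nk (Suc k)) \<omega>) * (1 + 1) + w ^ Suc k) * psi (ek (Suc k))) sequentially"
        using elim(4) by (subst eventually_sequentially_Suc)
      ultimately have "eventually (\<lambda>k. g k \<omega> > ?c * psi (ek k) \<longrightarrow> (sqrt (S \<omega>) * (?c - 4 * w\<^sup>2) - h) * psi (ek k) \<le> Nr (ek k) \<omega>) sequentially"
        using elim(3) lk_large
      proof eventually_elim
        case (elim k)
        show ?case
        proof
          assume gk: "g k \<omega> > ?c * psi (ek k)"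
          note pf = psi_facts[of k]
          have p0: "0 < psi (ek k)" using pf elim by auto
          have R1: "\<bar>R (nk k) (ek k) \<omega>\<bar> \<le> w ^ k * psi (ek k)"
          proof -
            have "\<bar>R (nk k) (ek k * real 1 / 2 ^ 0) \<omega>\<bar> \<le> w ^ (3 * k)" using elim(3) by (metis one_le_numeral one_le_power)
            then show ?thesis using pf(2) elim by auto
          qed
          have R2: "\<bar>R (nk k) (ek (Suc k)) \<omega>\<bar> \<le> w ^ k * psi (ek k)" using elim pf(2) by auto
          have N1: "\<bar>Nr (ek (Suc k)) \<omega>\<bar> \<le> (sqrt (Sn (nk (Suc k)) \<omega>) * (1 + 1) + w ^ Suc k) * (2 * w\<^sup>2 * psi (ek k))"
          proof -
            have "\<bar>Nr (ek (Suc k)) \<omega>\<bar> \<le> (sqrt (Sn (nk (Suc k)) \<omega>) * (1 + 1) + w ^ Suc k) * psi (ek (Suc k))" using elim(2) r(1)[of k] by auto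
            also have "\<dots> \<le> (sqrt (Sn (nk (Suc k)) \<omega>) * (1 + 1) + w ^ Suc k) * (2 * w\<^sup>2 * psi (ek k))"
              using pf(3) elim w Sn_nonneg[of "nk (Suc k)" \<omega>] by (intro mult_left_mono) auto
            finally show ?thesis .
          qed
          have G1: "sqrt (Sn (nk k) \<omega>) * (?c * psi (ek k)) \<le> sqrt (Sn (nk k) \<omega>) * g k \<omega>"
            using gk Sn_nonneg[of "nk k" \<omega>] by (intro mult_left_mono) auto
          have "Nr (ek k) \<omega> = Nr (ek (Suc k)) \<omega> + sqrt (Sn (nk k) \<omega>) * g k \<omega> + R (nk k) (ek k) \<omega> - R (nk k) (ek (Suc k)) \<omega>"
            unfolding Nr_decomp[of "ek k" \<omega> k] Nr_decomp[of "ek (Suc k)" \<omega> k] g_def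
            using \<open>\<forall>k. Bn (nk k) 0 (ek k) \<omega> = Bn (nk k) 0 (ek (Suc k)) \<omega> + Bn (nk k) (ek (Suc k)) (ek k) \<omega>\<close> by (simp add: distrib_left)
          moreover have "co k * psi (ek k) = sqrt (Sn (nk k) \<omega>) * (?c * psi (ek k)) - 2 * (w ^ k * psi (ek k)) - (sqrt (Sn (nk (Suc k)) \<omega>) * (1 + 1) + w ^ Suc k) * (2 * w\<^sup>2 * psi (ek k))"
            unfolding co_def by (simp add: left_diff_distrib mult.assoc)
          ultimately have "co k * psi (ek k) \<le> Nr (ek k) \<omega>" using G1 N1 R1 R2 unfolding abs_le_iff by linarith
          moreover have "(sqrt (S \<omega>) * (?c - 4 * w\<^sup>2) - h) * psi (ek k) \<le> co k * psi (ek k)" using elim(1) p0 by (intro mult_right_mono) auto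
          ultimately show "(sqrt (S \<omega>) * (?c - 4 * w\<^sup>2) - h) * psi (ek k) \<le> Nr (ek k) \<omega>" by linarith
        qed
      qed
      then obtain K1 where K1: "\<And>k. k \<ge> K1 \<Longrightarrow> g k \<omega> > ?c * psi (ek k) \<Longrightarrow> (sqrt (S \<omega>) * (?c - 4 * w\<^sup>2) - h) * psi (ek k) \<le> Nr (ek k) \<omega>"
        unfolding eventually_sequentially by blast
      show "frequently (\<lambda>r. (sqrt (S \<omega>) * (?c - 4 * w\<^sup>2) - h) * psi r \<le> Nr r \<omega>) (at_right 0)"
        unfolding frequently_def eventually_at_right_field
      proof (rule notI, elim exE conjE)
        fix b :: real assume b: "0 < b" "\<forall>y>0. y < b \<longrightarrow> \<not> (sqrt (S \<omega>) * (?c - 4 * w\<^sup>2) - h) * psi y \<le> Nr y \<omega>"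
        have "eventually (\<lambda>k. ek k < b) sequentially" by (rule order_tendstoD(2)[OF ek_lim b(1)])
        then obtain K2 where K2: "\<And>k. k \<ge> K2 \<Longrightarrow> ek k < b" unfolding eventually_sequentially by blast
        obtain k where "k \<ge> max K1 K2" "g k \<omega> > ?c * psi (ek k)" using elim(2) by blast
        then show False using K1[of k] K2[of k] b(2) ek_bounds(1)[of k] by auto
      qed
    qed
  qed
qed

end

section \<open>Varying the block ratio\<close>

context mild_wave_at
begin

lemma psi_pos: "eventually (\<lambda>r. 0 < psi r) (at_right 0)"
  unfolding eventually_at_right_field
proof (intro exI[of _ "exp (-1)"] conjI allI impI)
  fix r :: real assume r: "0 < r" "r < exp (-1)"
  have "ln r < ln (exp (-1 :: real))" using r by (subst ln_less_cancel_iff) auto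
  then have "1 < ln (1 / r)" using r by (simp add: ln_div)
  then have "0 < ln (ln (1 / r))" by simp
  then have "0 < r * ln (ln (1 / r))" using r(1) by (rule mult_pos_pos[rotated])
  then show "0 < psi r" by (simp add: psi_def)
qed simp

text \<open>One null sequence serves as every small parameter, so the exceptional sets are countably
  many: the block ratio is \<open>1 - d i\<close> for the upper bound and \<open>d i\<close> for the
  lower bound, and the slacks are \<open>d i\<close> as well.\<close>

lemma law_of_iterated_logarithm:
  "AE \<omega> in M. Limsup (at_right 0) (\<lambda>r. ereal ((u (t + r) x \<omega> - u t x \<omega>) / psi r)) = ereal (sqrt (S \<omega>))"
proof -
  let ?N = "\<lambda>r \<omega>. u (t + r) x \<omega> - u t x \<omega>"
  \<comment> \<open>The offset 2 keeps \<open>d i\<close> strictly between 0 and 1, so both block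
    ratios are admissible.\<close>
  define d where "d i = 1 / real (i + 2)" for i
  have d: "0 < d i" "d i \<le> 1" "d i < 1" for i by (auto simp: d_def)
  have dl: "d \<longlonglongrightarrow> 0" unfolding d_def[abs_def] using LIMSEQ_ignore_initial_segment[OF lim_1_over_n, of 2] by simp
  have U: "AE \<omega> in M. \<forall>i. \<forall>h>0. eventually (\<lambda>r. \<bar>?N r \<omega>\<bar> \<le> (sqrt (S \<omega>) * (1 + d i) + h) / (1 - d i)\<^sup>2 * psi r) (at_right 0)"
    unfolding AE_all_countable
  proof
    fix i
    interpret B: wave_blocks M \<xi> \<sigma> u L t x "1 - d i" by unfold_locales (use d[of i] in auto)
    show "AE \<omega> in M. \<forall>h>0. eventually (\<lambda>r. \<bar>?N r \<omega>\<bar> \<le> (sqrt (S \<omega>) * (1 + d i) + h) / (1 - d i)\<^sup>2 * psi r) (at_right 0)"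
      using B.upper_bound[OF d(1)] unfolding B.Nr_def .
  qed
  have Lo: "AE \<omega> in M. \<forall>i. \<forall>h>0. frequently (\<lambda>r. (sqrt (S \<omega>) * ((1 - d i) * sqrt (1 - d i ^ 4) - 4 * (d i)\<^sup>2) - h) * psi r \<le> ?N r \<omega>) (at_right 0)"
    unfolding AE_all_countable
  proof
    fix i
    interpret B: wave_blocks M \<xi> \<sigma> u L t x "d i" by unfold_locales (use d[of i] in auto)
    show "AE \<omega> in M. \<forall>h>0. frequently (\<lambda>r. (sqrt (S \<omega>) * ((1 - d i) * sqrt (1 - d i ^ 4) - 4 * (d i)\<^sup>2) - h) * psi r \<le> ?N r \<omega>) (at_right 0)"
      using B.lower_bound[OF d(1,2)] unfolding B.Nr_def .
  qed
  from U Lo show ?thesis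
  proof eventually_elim
    case (elim \<omega>)
    show ?case
    proof (rule antisym)
      have le: "Limsup (at_right 0) (\<lambda>r. ereal (?N r \<omega> / psi r)) \<le> ereal ((sqrt (S \<omega>) * (1 + d i) + d i) / (1 - d i)\<^sup>2)" for i
      proof (rule Limsup_bounded)
        have "eventually (\<lambda>r. \<bar>?N r \<omega>\<bar> \<le> (sqrt (S \<omega>) * (1 + d i) + d i) / (1 - d i)\<^sup>2 * psi r) (at_right 0)" using elim(1) d(1) by blast
        with psi_pos show "eventually (\<lambda>r. ereal (?N r \<omega> / psi r) \<le> ereal ((sqrt (S \<omega>) * (1 + d i) + d i) / (1 - d i)\<^sup>2)) (at_right 0)"
        proof eventually_elim
          case (elim r)
          then have "?N r \<omega> \<le> (sqrt (S \<omega>) * (1 + d i) + d i) / (1 - d i)\<^sup>2 * psi r" by (simp only: abs_le_iff)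
          then have "?N r \<omega> / psi r \<le> (sqrt (S \<omega>) * (1 + d i) + d i) / (1 - d i)\<^sup>2" using elim(1) by (subst pos_divide_le_eq)
          then show ?case by simp
        qed
      qed
      have "(\<lambda>i. (sqrt (S \<omega>) * (1 + d i) + d i) / (1 - d i)\<^sup>2) \<longlonglongrightarrow> (sqrt (S \<omega>) * (1 + 0) + 0) / (1 - 0)\<^sup>2"
        by (intro tendsto_intros dl) simp
      then have "(\<lambda>i. ereal ((sqrt (S \<omega>) * (1 + d i) + d i) / (1 - d i)\<^sup>2)) \<longlonglongrightarrow> ereal (sqrt (S \<omega>))" by simp
      then show "Limsup (at_right 0) (\<lambda>r. ereal (?N r \<omega> / psi r)) \<le> ereal (sqrt (S \<omega>))"
        by (rule LIMSEQ_le_const) (use le in blast)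
      have ge: "ereal (sqrt (S \<omega>) * ((1 - d i) * sqrt (1 - d i ^ 4) - 4 * (d i)\<^sup>2) - d i) \<le> Limsup (at_right 0) (\<lambda>r. ereal (?N r \<omega> / psi r))" for i
      proof (rule ccontr)
        let ?c = "sqrt (S \<omega>) * ((1 - d i) * sqrt (1 - d i ^ 4) - 4 * (d i)\<^sup>2) - d i"
        assume "\<not> ereal ?c \<le> Limsup (at_right 0) (\<lambda>r. ereal (?N r \<omega> / psi r))"
        then have "Limsup (at_right 0) (\<lambda>r. ereal (?N r \<omega> / psi r)) < ereal ?c" by simp
        then have "eventually (\<lambda>r. ereal (?N r \<omega> / psi r) < ereal ?c) (at_right 0)" by (rule Limsup_lessD)
        with psi_pos have "eventually (\<lambda>r. \<not> ?c * psi r \<le> ?N r \<omega>) (at_right 0)"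
        proof eventually_elim
          case (elim r)
          then have "?N r \<omega> / psi r < ?c" by simp
          then have "?N r \<omega> < ?c * psi r" using elim(1) by (subst (asm) pos_divide_less_eq)
          then show ?case by simp
        qed
        moreover have "frequently (\<lambda>r. ?c * psi r \<le> ?N r \<omega>) (at_right 0)" using elim(2) d(1) by blast
        ultimately show False by (simp add: frequently_def)
      qed
      have "(\<lambda>i. sqrt (S \<omega>) * ((1 - d i) * sqrt (1 - d i ^ 4) - 4 * (d i)\<^sup>2) - d i) \<longlonglongrightarrow> sqrt (S \<omega>) * ((1 - 0) * sqrt (1 - 0 ^ 4) - 4 * 0\<^sup>2) - 0"
        by (intro tendsto_intros dl)
      then have "(\<lambda>i. ereal (sqrt (S \<omega>) * ((1 - d i) * sqrt (1 - d i ^ 4) - 4 * (d i)\<^sup>2) - d i)) \<longlonglongrightarrow> ereal (sqrt (S \<omega>))" by simp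
      then show "ereal (sqrt (S \<omega>)) \<le> Limsup (at_right 0) (\<lambda>r. ereal (?N r \<omega> / psi r))"
        by (rule LIMSEQ_le_const2) (use ge in blast)
    qed
  qed
qed

end

theorem theorem2:
  fixes M :: "'a measure" and \<xi> :: "(real \<times> real \<Rightarrow> real) \<Rightarrow> 'a \<Rightarrow> real"
    and \<sigma> :: "real \<Rightarrow> real" and u :: "real \<Rightarrow> real \<Rightarrow> 'a \<Rightarrow> real" and t x :: real
  assumes wn: "white_noise M \<xi>"
    and lip: "\<exists>C. C-lipschitz_on UNIV \<sigma>"
    and sol: "mild_solution M \<xi> \<sigma> u"
    and cont: "\<forall>\<omega>\<in>space M. continuous_on ({0..} \<times> UNIV) (\<lambda>(s, y). u s y \<omega>)"
    and t: "t > 0"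
  shows "(\<forall>W Z. two_sided_BM M W \<and> prob_space.indep_set M (sigma_of_process M W) (G M \<xi> t x)
            \<and> stoch_integral M (\<lambda>y \<omega>. \<sigma> (u (t - \<bar>x - y\<bar>) y \<omega>)) W (x - t) (x + t) Z \<longrightarrow>
          (\<forall>\<epsilon> :: nat \<Rightarrow> real. (\<forall>n. \<epsilon> n > 0) \<and> \<epsilon> \<longlonglongrightarrow> 0 \<longrightarrow>
             weak_conv_m (\<lambda>n. distr M borel (\<lambda>\<omega>. (u (t + \<epsilon> n) x \<omega> - u t x \<omega>) / sqrt (\<epsilon> n)))
               (distr M borel Z)))
      \<and> (AE \<omega> in M. Limsup (at_right 0)
            (\<lambda>\<epsilon>. ereal ((u (t + \<epsilon>) x \<omega> - u t x \<omega>) / sqrt (2 * \<epsilon> * ln (ln (1 / \<epsilon>)))))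
          = ereal (sqrt (integral {x - t..x + t} (\<lambda>y. (\<sigma> (u (t - \<bar>x - y\<bar>) y \<omega>))^2))))"
proof -
  from wn interpret prob_space M by (simp add: white_noise_def)
  interpret white_noise_space M \<xi> by unfold_locales (rule wn)
  obtain C where C: "C-lipschitz_on UNIV \<sigma>" using lip by blast
  have "\<bar>\<sigma> a - \<sigma> b\<bar> \<le> C * \<bar>a - b\<bar>" for a b using lipschitz_onD[OF C, of a b] by (simp add: dist_real_def)
  then interpret mild_wave_at M \<xi> \<sigma> u C t x
    using lipschitz_on_nonneg[OF C] sol t cont by unfold_locales auto
  have Vb: "(\<lambda>y \<omega>. \<sigma> (u (t - \<bar>x - y\<bar>) y \<omega>)) = Vb" by (simp add: fun_eq_iff Vb_def)
  show ?thesis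
    using increments_weak_convergence law_of_iterated_logarithm unfolding Vb psi_def S_def by blast
qed

end
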